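(* Let $(\sigma,u)\in\Sigma\times V$ be the exact solution of: $(A\sigma,\tau)+(\operatorname{div}\tau,u)=0$ for all $\tau\in\Sigma$ and $(\operatorname{div}\sigma,v)=(f,v)$ for all $v\in V$, and suppose $\sigma\in H^2(\Omega,\mathbb S)$ and $u\in H^2(\Omega,\mathbb R^2)$. Let $(\sigma_h,u_h)\in\Sigma_h\times V_h$ be the finite element solution, i.e. $$(A\sigma_h,\tau)+(\operatorname{div}_h\tau,u_h)=0\quad\forall\tau\in\Sigma_h,\qquad (\operatorname{div}_h\sigma_h,v)=(f,v)\quad\forall v\in V_h .$$ Then, with a constant $C>0$ independent of $h$ (and of $\sigma,u$), $$\|\sigma-\sigma_h\|_0\le Ch(\|u\|_2+\|\sigma\|_2),$$ $$\|\operatorname{div}_h(\sigma-\sigma_h)\|_0\le Ch(\|u\|_2+\|\sigma\|_2),$$ $$\|u-u_h\|_0\le Ch(\|u\|_2+\|\sigma\|_2).$$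
   Context: Let $\Omega\subset\mathbb R^2$ be a rectangle with sides parallel to the coordinate axes, and $f\in L^2(\Omega,\mathbb R^2)$. $\mathbb S$ denotes the symmetric $2\times2$ real matrices; $(\cdot,\cdot)$ and $\|\cdot\|_0$ are the $L^2(\Omega)$ inner product and norm for scalar, vector (Euclidean product) or matrix (Frobenius product) valued functions; $\|\cdot\|_2$ is the $H^2(\Omega)$ norm. $\Sigma=H(\operatorname{div},\Omega,\mathbb S)$ (symmetric matrix-valued $L^2$ functions with row-wise divergence in $L^2$), $V=L^2(\Omega,\mathbb R^2)$. $A$ is the (bounded) symmetric and (uniformly) positive definite operator acting on $\mathbb S$-valued functions on $\Omega$ (compliance tensor). The mixed problem corresponds to the pure displacement problem $\operatorname{div}(A^{-1}\epsilon(u))=f$ in $\Omega$, $u=0$ on $\partial\Omega$, with $\epsilon(u)=\frac12(\nabla u+\nabla u^T)$. $\{\mathcal T_h\}$ is a family of rectangular grids of $\Omega$: each $\mathcal T_h$ is a conforming partition of $\Omega$ into rectangles $K$ with sides parallel to the axes, and $h$ is the mesh size (maximal side length). Edges are horizontal or vertical; an edge is interior if it is not contained in $\partial\Omega$. On each $K$ let $V_K=P_0(K)^2$ (constant vectors), and let $\Sigma_K$ be the set of symmetric matrix functions $\begin{pmatrix}\sigma_{11}&\sigma_{12}\\ \sigma_{12}&\sigma_{22}\end{pmatrix}$ on $K$ with $\sigma_{11}\in\operatorname{span}\{1,x\}$, $\sigma_{22}\in\operatorname{span}\{1,y\}$, $\sigma_{12}\in\operatorname{span}\{1,x,y\}$.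 Define - $\Sigma_h$: the set of $\sigma\in L^2(\Omega,\mathbb S)$ with $\sigma|_K\in\Sigma_K$ for all $K\in\mathcal T_h$, such that $\sigma_{11}$ is continuous across all vertical interior edges, $\sigma_{22}$ is continuous across all horizontal interior edges, and $\sigma_{12}$ is continuous at the midpoints of all interior edges; - $V_h=\{v\in L^2(\Omega,\mathbb R^2): v|_K\in V_K\ \forall K\in\mathcal T_h\}$. $\operatorname{div}_h$ is the elementwise (row-wise) divergence, $(\operatorname{div}_h\tau)|_K=\operatorname{div}(\tau|_K)$. *)

theory Defs
  imports "HOL-Analysis.Analysis"
begin

section \<open>Square-integrable functions\<close>

text \<open>Elements of \<open>L\<^sup>2\<close> are represented by functions on the whole plane; only the values on the
  domain, up to null sets, matter. For matrices \<open>norm\<close> and \<open>inner\<close> are the Frobenius ones.\<close>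

type_synonym plane = "real^2"

definition L2 :: "plane set \<Rightarrow> (plane \<Rightarrow> 'b::euclidean_space) set" where
  "L2 U = {f. f \<in> borel_measurable (lebesgue_on U) \<and>
              integrable (lebesgue_on U) (\<lambda>x. (norm (f x))\<^sup>2)}"

definition L2_inner :: "plane set \<Rightarrow> (plane \<Rightarrow> 'b) \<Rightarrow> (plane \<Rightarrow> 'b::euclidean_space) \<Rightarrow> real" where
  "L2_inner U f g = (LINT x|lebesgue_on U. f x \<bullet> g x)"

definition L2_norm :: "plane set \<Rightarrow> (plane \<Rightarrow> 'b::euclidean_space) \<Rightarrow> real" where
  "L2_norm U f = sqrt (LINT x|lebesgue_on U. (norm (f x))\<^sup>2)"

definition L2_sym :: "plane set \<Rightarrow> (plane \<Rightarrow> real^2^2) set" where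
  "L2_sym U = {\<tau> \<in> L2 U. AE x in lebesgue_on U. transpose (\<tau> x) = \<tau> x}"


section \<open>Weak derivatives, Sobolev spaces, weak divergence\<close>

definition partial :: "2 \<Rightarrow> (plane \<Rightarrow> real) \<Rightarrow> plane \<Rightarrow> real" where
  "partial i f x = frechet_derivative f (at x) (axis i 1)"

primrec Ck :: "nat \<Rightarrow> (plane \<Rightarrow> real) \<Rightarrow> bool" where
  "Ck 0 f \<longleftrightarrow> continuous_on UNIV f"
| "Ck (Suc k) f \<longleftrightarrow> (\<forall>x. f differentiable (at x)) \<and> (\<forall>i. Ck k (partial i f))"

text \<open>Smooth functions with compact support in \<open>U\<close>.\<close>

definition test_functions :: "plane set \<Rightarrow> (plane \<Rightarrow> real) set" where
  "test_functions U = {\<phi>. (\<forall>k. Ck k \<phi>) \<and> compact (closure {x. \<phi> x \<noteq> 0}) \<and>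
                          closure {x. \<phi> x \<noteq> 0} \<subseteq> U}"

definition multi_partial :: "nat \<times> nat \<Rightarrow> (plane \<Rightarrow> real) \<Rightarrow> plane \<Rightarrow> real" where
  "multi_partial \<alpha> \<phi> = (partial 1 ^^ fst \<alpha>) ((partial 2 ^^ snd \<alpha>) \<phi>)"

definition has_weak_deriv ::
    "plane set \<Rightarrow> nat \<times> nat \<Rightarrow> (plane \<Rightarrow> 'b) \<Rightarrow> (plane \<Rightarrow> 'b::euclidean_space) \<Rightarrow> bool" where
  "has_weak_deriv U \<alpha> f g \<longleftrightarrow> (\<forall>\<phi>\<in>test_functions U.
     (LINT x|lebesgue_on U. multi_partial \<alpha> \<phi> x *\<^sub>R f x) =
     (-1) ^ (fst \<alpha> + snd \<alpha>) *\<^sub>R (LINT x|lebesgue_on U. \<phi> x *\<^sub>R g x))"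

text \<open>The chosen weak derivative (and likewise the weak divergence below) is determined only up to
  a null set; it is used only inside integrals and for functions for which it exists.\<close>

definition weak_deriv ::
    "plane set \<Rightarrow> nat \<times> nat \<Rightarrow> (plane \<Rightarrow> 'b) \<Rightarrow> plane \<Rightarrow> 'b::euclidean_space" where
  "weak_deriv U \<alpha> f = (SOME g. g \<in> L2 U \<and> has_weak_deriv U \<alpha> f g)"

definition sobolev :: "nat \<Rightarrow> plane set \<Rightarrow> (plane \<Rightarrow> 'b::euclidean_space) set" where
  "sobolev m U = {f \<in> L2 U. \<forall>\<alpha>. fst \<alpha> + snd \<alpha> \<le> m \<longrightarrow> (\<exists>g\<in>L2 U. has_weak_deriv U \<alpha> f g)}"

definition sobolev_norm :: "nat \<Rightarrow> plane set \<Rightarrow> (plane \<Rightarrow> 'b::euclidean_space) \<Rightarrow> real" where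
  "sobolev_norm m U f =
     sqrt (\<Sum>\<alpha> | fst \<alpha> + snd \<alpha> \<le> m. (L2_norm U (weak_deriv U \<alpha> f))\<^sup>2)"

text \<open>Row-wise divergence: the \<open>i\<close>-th component of \<open>\<tau> x *v \<nabla>\<phi> x\<close> is the product of the
  \<open>i\<close>-th row of \<open>\<tau> x\<close> with \<open>\<nabla>\<phi> x\<close>.\<close>

definition has_weak_div :: "plane set \<Rightarrow> (plane \<Rightarrow> real^2^2) \<Rightarrow> (plane \<Rightarrow> real^2) \<Rightarrow> bool" where
  "has_weak_div U \<tau> d \<longleftrightarrow> (\<forall>\<phi>\<in>test_functions U.
     (LINT x|lebesgue_on U. \<tau> x *v (\<chi> j. partial j \<phi> x)) =
     - (LINT x|lebesgue_on U. \<phi> x *\<^sub>R d x))"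

definition weak_div :: "plane set \<Rightarrow> (plane \<Rightarrow> real^2^2) \<Rightarrow> plane \<Rightarrow> real^2" where
  "weak_div U \<tau> = (SOME d. d \<in> L2 U \<and> has_weak_div U \<tau> d)"

definition Hdiv_sym :: "plane set \<Rightarrow> (plane \<Rightarrow> real^2^2) set" where
  "Hdiv_sym U = {\<tau> \<in> L2_sym U. \<exists>d\<in>L2 U. has_weak_div U \<tau> d}"


section \<open>The compliance tensor and the continuous problem\<close>

text \<open>Equations between functions hold almost everywhere. Multiplication by a bounded measurable
  field of symmetric, uniformly positive definite linear maps on symmetric matrices is an
  instance.\<close>

definition compliance ::
    "plane set \<Rightarrow> ((plane \<Rightarrow> real^2^2) \<Rightarrow> (plane \<Rightarrow> real^2^2)) \<Rightarrow> bool" where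
  "compliance U A \<longleftrightarrow>
     (\<forall>\<tau>\<in>L2_sym U. A \<tau> \<in> L2_sym U) \<and>
     (\<forall>\<sigma>\<in>L2_sym U. \<forall>\<tau>\<in>L2_sym U. \<forall>r s::real.
        AE x in lebesgue_on U.
          A (\<lambda>y. r *\<^sub>R \<sigma> y + s *\<^sub>R \<tau> y) x = r *\<^sub>R A \<sigma> x + s *\<^sub>R A \<tau> x) \<and>
     (\<exists>M. \<forall>\<tau>\<in>L2_sym U. L2_norm U (A \<tau>) \<le> M * L2_norm U \<tau>) \<and>
     (\<forall>\<sigma>\<in>L2_sym U. \<forall>\<tau>\<in>L2_sym U. L2_inner U (A \<sigma>) \<tau> = L2_inner U \<sigma> (A \<tau>)) \<and>
     (\<exists>c>0. \<forall>\<tau>\<in>L2_sym U. L2_inner U (A \<tau>) \<tau> \<ge> c * (L2_norm U \<tau>)\<^sup>2)"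

definition exact_solution ::
    "plane set \<Rightarrow> ((plane \<Rightarrow> real^2^2) \<Rightarrow> (plane \<Rightarrow> real^2^2)) \<Rightarrow> (plane \<Rightarrow> real^2) \<Rightarrow>
     (plane \<Rightarrow> real^2^2) \<Rightarrow> (plane \<Rightarrow> real^2) \<Rightarrow> bool" where
  "exact_solution U A f \<sigma> u \<longleftrightarrow> \<sigma> \<in> Hdiv_sym U \<and> u \<in> L2 U \<and>
     (\<forall>\<tau>\<in>Hdiv_sym U. L2_inner U (A \<sigma>) \<tau> + L2_inner U (weak_div U \<tau>) u = 0) \<and>
     (\<forall>v\<in>L2 U. L2_inner U (weak_div U \<sigma>) v = L2_inner U f v)"


section \<open>Rectangular grids\<close>

text \<open>A grid is a set of closed rectangles. \<open>edges i K\<close> are the two edges of \<open>K\<close> orthogonal to the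
  \<open>i\<close>-th coordinate axis: the vertical ones for \<open>i = 1\<close>, the horizontal ones for \<open>i = 2\<close>.\<close>

definition edges :: "2 \<Rightarrow> plane set \<Rightarrow> plane set set" where
  "edges i K = {{x\<in>K. x $ i = interval_lowerbound K $ i}, {x\<in>K. x $ i = interval_upperbound K $ i}}"

definition interior_edges :: "plane set \<Rightarrow> plane set set \<Rightarrow> 2 \<Rightarrow> plane set set" where
  "interior_edges U T i = {e. (\<exists>K\<in>T. e \<in> edges i K) \<and> \<not> e \<subseteq> frontier U}"

definition edge_midpoint :: "plane set \<Rightarrow> plane" where
  "edge_midpoint e = midpoint (interval_lowerbound e) (interval_upperbound e)"

text \<open>Conformity (no hanging nodes): the faces of a rectangle are the empty set, its vertices, its
  edges and itself.\<close>

definition rect_grid :: "plane set \<Rightarrow> plane set set \<Rightarrow> bool" where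
  "rect_grid U T \<longleftrightarrow> T division_of (closure U) \<and> (\<forall>K\<in>T. interior K \<noteq> {}) \<and>
     (\<forall>K\<in>T. \<forall>L\<in>T. (K \<inter> L) face_of K \<and> (K \<inter> L) face_of L)"

definition mesh_size :: "plane set set \<Rightarrow> real" where
  "mesh_size T = Max {interval_upperbound K $ i - interval_lowerbound K $ i | K i. K \<in> T}"


section \<open>The finite element spaces and the discrete problem\<close>

text \<open>Polynomials are taken on the whole plane, so that the value on an edge of the restriction to
  either adjacent element makes sense.\<close>

definition Sigma_poly :: "(plane \<Rightarrow> real^2^2) set" where
  "Sigma_poly = {p. \<exists>a0 a1 b0 b1 c0 c1 c2. \<forall>x.
     p x $ 1 $ 1 = a0 + a1 * x $ 1 \<and>
     p x $ 2 $ 2 = b0 + b1 * x $ 2 \<and>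
     p x $ 1 $ 2 = c0 + c1 * x $ 1 + c2 * x $ 2 \<and>
     p x $ 2 $ 1 = p x $ 1 $ 2}"

definition Sigma_h :: "plane set \<Rightarrow> plane set set \<Rightarrow> (plane \<Rightarrow> real^2^2) set" where
  "Sigma_h U T = {\<tau> \<in> L2_sym U. \<exists>p.
     (\<forall>K\<in>T. p K \<in> Sigma_poly \<and> (AE x in lebesgue_on K. \<tau> x = p K x)) \<and>
     (\<forall>i. \<forall>e\<in>interior_edges U T i. \<forall>K\<in>T. \<forall>L\<in>T. e \<in> edges i K \<and> e \<in> edges i L \<longrightarrow>
        (\<forall>x\<in>e. p K x $ i $ i = p L x $ i $ i) \<and>
        p K (edge_midpoint e) $ 1 $ 2 = p L (edge_midpoint e) $ 1 $ 2)}"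

definition V_h :: "plane set \<Rightarrow> plane set set \<Rightarrow> (plane \<Rightarrow> real^2) set" where
  "V_h U T = {v \<in> L2 U. \<forall>K\<in>T. \<exists>c. AE x in lebesgue_on K. v x = c}"

definition div_h :: "plane set set \<Rightarrow> (plane \<Rightarrow> real^2^2) \<Rightarrow> plane \<Rightarrow> real^2" where
  "div_h T \<tau> x = (\<Sum>K\<in>T. indicator (interior K) x *\<^sub>R weak_div (interior K) \<tau> x)"

definition fem_solution ::
    "plane set \<Rightarrow> plane set set \<Rightarrow> ((plane \<Rightarrow> real^2^2) \<Rightarrow> (plane \<Rightarrow> real^2^2)) \<Rightarrow>
     (plane \<Rightarrow> real^2) \<Rightarrow> (plane \<Rightarrow> real^2^2) \<Rightarrow> (plane \<Rightarrow> real^2) \<Rightarrow> bool" where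
  "fem_solution U T A f \<sigma>h uh \<longleftrightarrow> \<sigma>h \<in> Sigma_h U T \<and> uh \<in> V_h U T \<and>
     (\<forall>\<tau>\<in>Sigma_h U T. L2_inner U (A \<sigma>h) \<tau> + L2_inner U (div_h T \<tau>) uh = 0) \<and>
     (\<forall>v\<in>V_h U T. L2_inner U (div_h T \<sigma>h) v = L2_inner U f v)"

end

theory Submission
  imports Defs
begin

text \<open>
  The method is nonconforming only in the shear entry of the stress. The diagonal entries of a
  discrete stress \<open>\<tau>\<close> are continuous in the direction in which the divergence differentiates them, so
  that the diagonal part of \<open>\<tau>\<close> lies in \<open>H(div)\<close> (\<open>diag_part_Hdiv\<close>), while the shear entry is only
  continuous at the midpoints of edges. The estimate is the standard one for saddle point problems
  with a consistency term. All constants are independent of the shape of the elements.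

  \<^item> Interpolation (\<open>interpolation\<close>). Averages of the normal stresses over edges and vertex values of
    the shear define a discrete stress \<open>\<pi>\<close> close to \<open>\<sigma>\<close>. An average of two vertex values is attained
    at each edge midpoint, so the interpolant is continuous there. Its divergence differs from the
    elementwise mean of \<open>div \<sigma>\<close> only by first moments of the mixed derivative of \<open>\<sigma>\<^sub>1\<^sub>2\<close>.

  \<^item> Stability (\<open>right_inverse\<close>). A piecewise constant \<open>v\<close> is the divergence of a discrete stress
    without shear: each diagonal entry is the integral of a component of \<open>v\<close> along the row of elements.

  \<^item> Consistency (\<open>consistency\<close>). For the exact solution, \<open>(A\<sigma>,\<tau>) + (div\<^sub>h \<tau>,u)\<close> involves only the
    shear. Testing the exact problem with pure shear fields shows that the off-diagonal part of \<open>A\<sigma>\<close>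
    is the symmetric gradient of \<open>u\<close> and that the tangential component of \<open>u\<close> vanishes on the boundary.
    On an element, \<open>\<tau>\<^sub>1\<^sub>2\<close> is its restriction to the centre line plus a part linear in the transverse
    coordinate with mean zero. By the midpoint continuity the first part sums to zero by parts. The
    second part sees only the variation of the gradient of \<open>u\<close>; together with an inverse estimate for
    its slope this leaves a factor \<open>h\<close>.

  \<^item> Conclusion (\<open>error_estimate\<close>). The discrete divergence is the projection of the exact one. The
    difference of \<open>\<sigma>\<^sub>h\<close> and an interpolant with repaired divergence is divergence free, and coercivity
    bounds it; the displacement error follows by testing with a right inverse of its divergence.

  Derivatives are given in the weak sense only, and the argument needs values on grid lines and at
  vertices. Instead of trace theorems it uses the identity \<open>(b - a) w(t) = \<integral>w + \<integral>k w'\<close> with an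
  explicit kernel \<open>k\<close> as a definition of the value at \<open>t\<close>, integrated against a weight in the other
  variable (\<open>line_trace\<close>). Weak derivative identities extend from products of test functions to
  piecewise smooth weights (\<open>weak_partial_extended\<close>), and this yields integration by parts on
  subrectangles with these traces as boundary values (\<open>line_trace_by_parts\<close>). The Poincare
  inequality is obtained from the same kernel, line by line.
\<close>

section \<open>Calculus of square-integrable functions\<close>
lemma L2_measurable: "f \<in> L2 U \<Longrightarrow> f \<in> borel_measurable (lebesgue_on U)"
  by (simp add: L2_def)

lemma L2_norm_integrable: "f \<in> L2 U \<Longrightarrow> integrable (lebesgue_on U) (\<lambda>x. (norm (f x))\<^sup>2)"
  by (simp add: L2_def)

lemma L2_dominated:
  assumes "g \<in> borel_measurable (lebesgue_on U)" "integrable (lebesgue_on U) k"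
    and "\<And>x. x \<in> U \<Longrightarrow> (norm (g x))\<^sup>2 \<le> k x"
  shows "g \<in> L2 U"
proof -
  have "AE x in lebesgue_on U. norm ((norm (g x))\<^sup>2) \<le> norm (k x)"
    by (rule AE_I2) (use assms(3) order_trans in \<open>fastforce\<close>)
  moreover have "(\<lambda>x. (norm (g x))\<^sup>2) \<in> borel_measurable (lebesgue_on U)"
    using assms(1) by measurable
  ultimately have "integrable (lebesgue_on U) (\<lambda>x. (norm (g x))\<^sup>2)"
    using Bochner_Integration.integrable_bound[OF assms(2)] by blast
  then show ?thesis using assms(1) by (simp add: L2_def)
qed

lemma norm_add_sq_le: "(norm (a + b))\<^sup>2 \<le> 2 * (norm a)\<^sup>2 + 2 * (norm (b::'a::real_normed_vector))\<^sup>2"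
proof -
  have "(norm (a + b))\<^sup>2 \<le> (norm a + norm b)\<^sup>2"
    by (simp add: norm_triangle_ineq power_mono)
  also have "\<dots> \<le> 2 * (norm a)\<^sup>2 + 2 * (norm b)\<^sup>2"
    using sum_squares_bound[of "norm a" "norm b"] by (simp add: power2_sum)
  finally show ?thesis .
qed

lemma L2_add: "f \<in> L2 U \<Longrightarrow> g \<in> L2 U \<Longrightarrow> (\<lambda>x. f x + g x) \<in> L2 U"
  by (rule L2_dominated[where k = "\<lambda>x. 2 * (norm (f x))\<^sup>2 + 2 * (norm (g x))\<^sup>2"])
     (auto simp: L2_def norm_add_sq_le)

lemma L2_scaleR: "f \<in> L2 U \<Longrightarrow> (\<lambda>x. c *\<^sub>R f x) \<in> L2 U"
  by (auto simp: L2_def power_mult_distrib)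

lemma L2_bounded_scaleR:
  assumes f: "f \<in> L2 U" and k: "k \<in> borel_measurable (lebesgue_on U)"
    and B: "\<And>x. x \<in> U \<Longrightarrow> \<bar>k x\<bar> \<le> B"
  shows "(\<lambda>x. k x *\<^sub>R f x) \<in> L2 U"
proof (rule L2_dominated)
  show "(\<lambda>x. k x *\<^sub>R f x) \<in> borel_measurable (lebesgue_on U)"
    using L2_measurable[OF f] k by measurable
  show "integrable (lebesgue_on U) (\<lambda>x. B\<^sup>2 * (norm (f x))\<^sup>2)"
    using L2_norm_integrable[OF f] by simp
  show "(norm (k x *\<^sub>R f x))\<^sup>2 \<le> B\<^sup>2 * (norm (f x))\<^sup>2" if "x \<in> U" for x
    using B[OF that] by (simp add: power_mult_distrib mult_right_mono abs_le_square_iff[symmetric])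
qed

lemma L2_bounded_mult:
  fixes f :: "plane \<Rightarrow> real"
  assumes "f \<in> L2 U" "k \<in> borel_measurable (lebesgue_on U)" "\<And>x. x \<in> U \<Longrightarrow> \<bar>k x\<bar> \<le> B"
  shows "(\<lambda>x. k x * f x) \<in> L2 U"
  using L2_bounded_scaleR[OF assms] by simp

lemma L2_diff: "f \<in> L2 U \<Longrightarrow> g \<in> L2 U \<Longrightarrow> (\<lambda>x. f x - g x) \<in> L2 U"
  using L2_add[OF _ L2_scaleR[of g U "-1"]] by fastforce

lemma L2_zero: "(\<lambda>x. 0) \<in> L2 U"
  by (simp add: L2_def)

lemma L2_sum: "(\<And>i. i \<in> I \<Longrightarrow> f i \<in> L2 U) \<Longrightarrow> (\<lambda>x. \<Sum>i\<in>I. f i x) \<in> L2 U"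
  by (induction I rule: infinite_finite_induct) (auto simp: L2_zero L2_add)

lemma L2_linear:
  assumes f: "f \<in> L2 U" and h: "bounded_linear h"
  shows "(\<lambda>x. h (f x)) \<in> L2 U"
proof -
  obtain K where K: "\<And>x. norm (h x) \<le> norm x * K" using h bounded_linear.bounded by blast
  have *: "(norm (h (f x)))\<^sup>2 \<le> K\<^sup>2 * (norm (f x))\<^sup>2" for x
    using power_mono[OF K[of "f x"], of 2] by (simp add: power_mult_distrib mult.commute)
  have "h \<in> borel_measurable borel"
    using h by (simp add: borel_measurable_continuous_onI linear_continuous_on)
  then have "(\<lambda>x. h (f x)) \<in> borel_measurable (lebesgue_on U)"
    using L2_measurable[OF f] by (rule measurable_compose[rotated])
  then show ?thesis
    by (rule L2_dominated[OF _ integrable_mult_right[OF L2_norm_integrable[OF f], where c = "K\<^sup>2"]]) (simp add: *)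
qed

lemma L2_nth: "f \<in> L2 U \<Longrightarrow> (\<lambda>x. f x $ i) \<in> L2 U"
  by (rule L2_linear) (auto intro: bounded_linear_vec_nth)

lemma L2_nth_nth: "f \<in> L2 U \<Longrightarrow> (\<lambda>x. f x $ i $ j) \<in> L2 U"
  using L2_nth[OF L2_nth] by blast

lemma L2_euclideanI:
  assumes "\<And>b. b \<in> Basis \<Longrightarrow> (\<lambda>x. f x \<bullet> b) \<in> L2 U"
  shows "f \<in> L2 U"
proof -
  have "(\<lambda>x. \<Sum>b\<in>Basis. (f x \<bullet> b) *\<^sub>R b) \<in> L2 U"
    by (rule L2_sum, rule L2_linear[OF assms]) (auto intro: bounded_linear_scaleR_left)
  then show ?thesis by (simp add: euclidean_representation)
qed

lemma L2_vec2I: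
  fixes f :: "plane \<Rightarrow> real^2"
  assumes "\<And>i. (\<lambda>x. f x $ i) \<in> L2 U" shows "f \<in> L2 U"
  by (rule L2_euclideanI) (auto simp: Basis_vec_def inner_axis assms)

lemma L2_mat2I:
  fixes f :: "plane \<Rightarrow> real^2^2"
  assumes "\<And>i j. (\<lambda>x. f x $ i $ j) \<in> L2 U" shows "f \<in> L2 U"
  by (rule L2_euclideanI) (auto simp: Basis_vec_def inner_axis assms)

lemma L2_inner_integrable:
  assumes "f \<in> L2 U" "g \<in> L2 U"
  shows "integrable (lebesgue_on U) (\<lambda>x. f x \<bullet> g x)"
proof (rule Bochner_Integration.integrable_bound)
  show "integrable (lebesgue_on U) (\<lambda>x. (norm (f x))\<^sup>2 + (norm (g x))\<^sup>2)"
    using assms by (simp add: L2_def)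
  show "(\<lambda>x. f x \<bullet> g x) \<in> borel_measurable (lebesgue_on U)"
    using assms[THEN L2_measurable] by measurable
  have "norm (f x \<bullet> g x) \<le> norm ((norm (f x))\<^sup>2 + (norm (g x))\<^sup>2)" for x
    using Cauchy_Schwarz_ineq2[of "f x" "g x"] sum_squares_bound[of "norm (f x)" "norm (g x)"]
      mult_nonneg_nonneg[of "norm (f x)" "norm (g x)"]
    by auto
  then show "AE x in lebesgue_on U. norm (f x \<bullet> g x) \<le> norm ((norm (f x))\<^sup>2 + (norm (g x))\<^sup>2)"
    by simp
qed

lemma L2_bounded:
  assumes U: "U \<in> lmeasurable" and f: "f \<in> borel_measurable (lebesgue_on U)"
    and B: "\<And>x. x \<in> U \<Longrightarrow> norm (f x) \<le> B"
  shows "f \<in> L2 U"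
proof (rule L2_dominated[OF f])
  show "integrable (lebesgue_on U) (\<lambda>x. B\<^sup>2)"
    using U by (intro finite_measure.integrable_const) (simp add: finite_measure_lebesgue_on)
  show "(norm (f x))\<^sup>2 \<le> B\<^sup>2" if "x \<in> U" for x
    using B[OF that] by (simp add: power_mono)
qed

lemma L2_const: "U \<in> lmeasurable \<Longrightarrow> (\<lambda>x. c) \<in> L2 U"
  by (rule L2_bounded[where B = "norm c"]) auto

lemma L2_integrable:
  assumes U: "U \<in> lmeasurable" and f: "f \<in> L2 U"
  shows "integrable (lebesgue_on U) f"
proof (rule Bochner_Integration.integrable_bound)
  show "integrable (lebesgue_on U) (\<lambda>x. 1 + (norm (f x))\<^sup>2)"
    using L2_norm_integrable[OF f] U
    by (intro Bochner_Integration.integrable_add finite_measure.integrable_const)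
       (simp_all add: finite_measure_lebesgue_on)
  show "f \<in> borel_measurable (lebesgue_on U)" using f by (rule L2_measurable)
  have "norm (f x) \<le> 1 + (norm (f x))\<^sup>2" for x
    using sum_squares_bound[of "norm (f x)" 1] norm_ge_zero[of "f x"] by (simp, linarith)
  then show "AE x in lebesgue_on U. norm (f x) \<le> norm (1 + (norm (f x))\<^sup>2)" by simp
qed

lemma L2_subset:
  assumes f: "f \<in> L2 U" and "S \<subseteq> U" "S \<in> sets lebesgue" "U \<in> sets lebesgue"
  shows "f \<in> L2 S"
proof -
  have "f \<in> borel_measurable (lebesgue_on S)"
    using L2_measurable[OF f] assms(2) by (rule measurable_restrict_mono)
  moreover have "integrable (lebesgue_on S) (\<lambda>x. (norm (f x))\<^sup>2)"
  proof -
    have "set_integrable lebesgue U (\<lambda>x. (norm (f x))\<^sup>2)"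
      using L2_norm_integrable[OF f] assms(4) by (simp add: set_integrable_def integrable_restrict_space)
    then have "set_integrable lebesgue S (\<lambda>x. (norm (f x))\<^sup>2)"
      by (rule set_integrable_subset) (use assms(2,3) in auto)
    then show ?thesis using assms(3) by (simp add: set_integrable_def integrable_restrict_space)
  qed
  ultimately show ?thesis by (simp add: L2_def)
qed

lemma L2_norm_nonneg: "0 \<le> L2_norm U f"
  by (simp add: L2_norm_def)

lemma L2_norm_sq: "(L2_norm U f)\<^sup>2 = (LINT x|lebesgue_on U. (norm (f x))\<^sup>2)"
  by (simp add: L2_norm_def)

lemma L2_inner_self: "L2_inner U f f = (L2_norm U f)\<^sup>2"
  by (simp add: L2_norm_sq L2_inner_def power2_norm_eq_inner)

lemma L2_inner_add_left:
  "f \<in> L2 U \<Longrightarrow> g \<in> L2 U \<Longrightarrow> k \<in> L2 U \<Longrightarrow> L2_inner U (\<lambda>x. f x + g x) k = L2_inner U f k + L2_inner U g k"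
  by (simp add: L2_inner_def inner_add_left L2_inner_integrable)

lemma L2_inner_diff_left:
  "f \<in> L2 U \<Longrightarrow> g \<in> L2 U \<Longrightarrow> k \<in> L2 U \<Longrightarrow> L2_inner U (\<lambda>x. f x - g x) k = L2_inner U f k - L2_inner U g k"
  by (simp add: L2_inner_def inner_diff_left L2_inner_integrable)

lemma L2_inner_scaleR_left: "L2_inner U (\<lambda>x. c *\<^sub>R f x) k = c * L2_inner U f k"
  by (simp add: L2_inner_def)

lemma L2_inner_commute: "L2_inner U f g = L2_inner U g f"
  by (simp add: L2_inner_def inner_commute)

lemma L2_inner_cong_AE:
  assumes "AE x in lebesgue_on U. f x = f' x" "f \<in> L2 U" "f' \<in> L2 U" "g \<in> L2 U"
  shows "L2_inner U f g = L2_inner U f' g"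
  unfolding L2_inner_def
  by (rule integral_cong_AE) (use assms(1) assms(2-4)[THEN L2_measurable] in \<open>auto\<close>)

lemma L2_norm_cong_AE:
  assumes "AE x in lebesgue_on U. f x = f' x"
    "f \<in> borel_measurable (lebesgue_on U)" "f' \<in> borel_measurable (lebesgue_on U)"
  shows "L2_norm U f = L2_norm U f'"
  unfolding L2_norm_def using assms
  by (intro arg_cong[where f = sqrt] integral_cong_AE) auto

lemma L2_norm_scaleR: "L2_norm U (\<lambda>x. c *\<^sub>R f x) = \<bar>c\<bar> * L2_norm U f"
  by (simp add: L2_norm_def power_mult_distrib real_sqrt_mult)

text \<open>A quadratic without sign change has nonpositive discriminant; applied to the squared
  norm of \<open>f + t g\<close> it gives the Cauchy--Schwarz inequality.\<close>
lemma quadratic_nonneg_discriminant: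
  fixes F G I :: real
  assumes "\<And>t. 0 \<le> F + 2 * t * I + t\<^sup>2 * G" "0 \<le> G"
  shows "I\<^sup>2 \<le> F * G"
proof (cases "G = 0")
  case True
  have "I = 0"
  proof (rule ccontr)
    assume "I \<noteq> 0"
    with assms(1)[of "- (F + 1) / (2 * I)"] True show False by (simp add: field_simps)
  qed
  then show ?thesis using True by simp
next
  case False
  then have G: "0 < G" using assms(2) by simp
  have "(- I / G)\<^sup>2 * G = I\<^sup>2 / G" "2 * (- I / G) * I = - 2 * (I\<^sup>2 / G)"
    using G by (simp_all add: power2_eq_square)
  with assms(1)[of "- I / G"] have "I\<^sup>2 / G \<le> F" by linarith
  then show ?thesis using G by (simp add: field_simps)
qed

lemma L2_Cauchy_Schwarz:
  assumes f: "f \<in> L2 U" and g: "g \<in> L2 U"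
  shows "\<bar>L2_inner U f g\<bar> \<le> L2_norm U f * L2_norm U g"
proof -
  let ?F = "(L2_norm U f)\<^sup>2" and ?G = "(L2_norm U g)\<^sup>2" and ?I = "L2_inner U f g"
  have quad: "0 \<le> ?F + 2 * t * ?I + t\<^sup>2 * ?G" for t
  proof -
    let ?w = "\<lambda>x. f x + t *\<^sub>R g x"
    have w: "?w \<in> L2 U" by (intro L2_add L2_scaleR f g)
    have "L2_inner U ?w ?w = L2_inner U f ?w + t * L2_inner U g ?w"
      by (simp only: L2_inner_add_left[OF f L2_scaleR[OF g] w] L2_inner_scaleR_left)
    also have "L2_inner U f ?w = ?F + t * ?I"
      by (simp only: L2_inner_commute[of U f ?w] L2_inner_add_left[OF f L2_scaleR[OF g] f]
          L2_inner_scaleR_left L2_inner_self L2_inner_commute[of U g f])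
    also have "L2_inner U g ?w = ?I + t * ?G"
      by (simp only: L2_inner_commute[of U g ?w] L2_inner_add_left[OF f L2_scaleR[OF g] g]
          L2_inner_scaleR_left L2_inner_self)
    finally have "(L2_norm U ?w)\<^sup>2 = ?F + 2 * t * ?I + t\<^sup>2 * ?G"
      by (simp add: L2_inner_self power2_eq_square algebra_simps)
    then show ?thesis by (metis zero_le_power2)
  qed
  have "?I\<^sup>2 \<le> ?F * ?G"
    by (rule quadratic_nonneg_discriminant) (simp_all add: quad)
  then have "\<bar>?I\<bar>\<^sup>2 \<le> (L2_norm U f * L2_norm U g)\<^sup>2" by (simp add: power_mult_distrib)
  then show ?thesis
    by (rule power2_le_imp_le) (simp add: L2_norm_nonneg)
qed

lemma L2_norm_triangle:
  assumes f: "f \<in> L2 U" and g: "g \<in> L2 U"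
  shows "L2_norm U (\<lambda>x. f x + g x) \<le> L2_norm U f + L2_norm U g"
proof -
  let ?w = "\<lambda>x. f x + g x"
  have w: "?w \<in> L2 U" by (intro L2_add f g)
  have "(L2_norm U ?w)\<^sup>2 = L2_inner U f ?w + L2_inner U g ?w"
    by (simp only: L2_inner_self[symmetric] L2_inner_add_left[OF f g w])
  also have "\<dots> = (L2_norm U f)\<^sup>2 + 2 * L2_inner U f g + (L2_norm U g)\<^sup>2"
    by (simp add: L2_inner_commute[of U f ?w] L2_inner_commute[of U g ?w] L2_inner_add_left[OF f g f]
        L2_inner_add_left[OF f g g] L2_inner_self L2_inner_commute[of U g f])
  also have "\<dots> \<le> (L2_norm U f + L2_norm U g)\<^sup>2"
    using L2_Cauchy_Schwarz[OF f g] by (simp add: power2_sum)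
  finally show ?thesis by (rule power2_le_imp_le) (simp add: L2_norm_nonneg)
qed

lemma L2_norm_diff_triangle:
  assumes "f \<in> L2 U" and "g \<in> L2 U"
  shows "L2_norm U (\<lambda>x. f x - g x) \<le> L2_norm U f + L2_norm U g"
  using L2_norm_triangle[OF assms(1) L2_scaleR[OF assms(2), of "-1"]] L2_norm_scaleR[of U "-1" g] by simp

lemma L2_norm_mono:
  assumes "f \<in> borel_measurable (lebesgue_on U)" "g \<in> L2 U" "AE x in lebesgue_on U. norm (f x) \<le> norm (g x)"
  shows "L2_norm U f \<le> L2_norm U g"
  unfolding L2_norm_def
proof (rule real_sqrt_le_mono, rule integral_mono_AE')
  show "integrable (lebesgue_on U) (\<lambda>x. (norm (g x))\<^sup>2)" by (rule L2_norm_integrable[OF assms(2)])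
  show "AE x in lebesgue_on U. (norm (f x))\<^sup>2 \<le> (norm (g x))\<^sup>2"
    using assms(3) by eventually_elim (simp add: power_mono)
qed simp

lemma L2_norm_nth_le:
  fixes f :: "plane \<Rightarrow> 'a::euclidean_space^2"
  assumes "f \<in> L2 U" shows "L2_norm U (\<lambda>x. f x $ i) \<le> L2_norm U f"
  by (rule L2_norm_mono[OF L2_measurable[OF L2_nth[OF assms]] assms]) (simp add: Finite_Cartesian_Product.norm_nth_le)

lemma L2_norm_nth_nth_le:
  fixes f :: "plane \<Rightarrow> real^2^2"
  assumes "f \<in> L2 U" shows "L2_norm U (\<lambda>x. f x $ i $ j) \<le> L2_norm U f"
  using L2_norm_nth_le[OF assms, of i] L2_norm_nth_le[OF L2_nth[OF assms, of i], of j] by linarith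

text \<open>Vector and matrix fields are estimated one component at a time throughout; the loss is
  only in the constant.\<close>
lemma L2_norm_vec_le:
  fixes f :: "plane \<Rightarrow> 'a::euclidean_space^2"
  assumes "f \<in> L2 U" "\<And>i. L2_norm U (\<lambda>x. f x $ i) \<le> c i"
  shows "L2_norm U f \<le> c 1 + c 2"
proof -
  have "(L2_norm U f)\<^sup>2 = (L2_norm U (\<lambda>x. f x $ 1))\<^sup>2 + (L2_norm U (\<lambda>x. f x $ 2))\<^sup>2"
    using L2_norm_integrable[OF L2_nth[OF assms(1)]]
    by (simp add: L2_norm_sq norm_vec_def L2_set_def UNIV_2)
  also have "\<dots> \<le> (L2_norm U (\<lambda>x. f x $ 1) + L2_norm U (\<lambda>x. f x $ 2))\<^sup>2"
    by (simp add: power2_sum L2_norm_nonneg)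
  finally have "L2_norm U f \<le> L2_norm U (\<lambda>x. f x $ 1) + L2_norm U (\<lambda>x. f x $ 2)"
    by (rule power2_le_imp_le) (simp add: L2_norm_nonneg)
  then show ?thesis using assms(2)[of 1] assms(2)[of 2] by linarith
qed

section \<open>Smooth functions and test functions\<close>

text \<open>Differentiability of order \<open>k\<close> in one variable. Recursion through an
  existentially quantified derivative makes sums and products follow by a plain induction on
  \<open>k\<close>.\<close>
primrec ndiff :: "nat \<Rightarrow> (real \<Rightarrow> real) \<Rightarrow> bool" where
  "ndiff 0 f \<longleftrightarrow> True"
| "ndiff (Suc k) f \<longleftrightarrow> (\<exists>f'. (\<forall>t. (f has_real_derivative f' t) (at t)) \<and> ndiff k f')"

definition smooth :: "(real \<Rightarrow> real) \<Rightarrow> bool" where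
  "smooth f \<longleftrightarrow> (\<forall>k. ndiff k f)"

lemma ndiff_pred: "ndiff (Suc k) f \<Longrightarrow> ndiff k f"
  by (induction k arbitrary: f) auto

lemma ndiff_const: "ndiff k (\<lambda>t. c)"
proof (induction k arbitrary: c)
  case (Suc k)
  show ?case unfolding ndiff.simps by (rule exI[of _ "\<lambda>t. 0"]) (auto intro!: Suc derivative_eq_intros)
qed simp

lemma ndiff_add: "ndiff k f \<Longrightarrow> ndiff k g \<Longrightarrow> ndiff k (\<lambda>t. f t + g t)"
proof (induction k arbitrary: f g)
  case (Suc k)
  then obtain f' g' where "\<forall>t. (f has_real_derivative f' t) (at t)" "ndiff k f'"
    "\<forall>t. (g has_real_derivative g' t) (at t)" "ndiff k g'" by auto
  then show ?case unfolding ndiff.simps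
    by (intro exI[of _ "\<lambda>t. f' t + g' t"]) (auto intro!: Suc.IH derivative_eq_intros)
qed simp

lemma ndiff_mult: "ndiff k f \<Longrightarrow> ndiff k g \<Longrightarrow> ndiff k (\<lambda>t. f t * g t)"
proof (induction k arbitrary: f g)
  case (Suc k)
  then obtain f' g' where *: "\<forall>t. (f has_real_derivative f' t) (at t)" "ndiff k f'"
    "\<forall>t. (g has_real_derivative g' t) (at t)" "ndiff k g'" by auto
  have "ndiff k f" "ndiff k g" using Suc.prems by (auto intro!: ndiff_pred simp del: ndiff.simps)
  then show ?case unfolding ndiff.simps using *
    by (intro exI[of _ "\<lambda>t. f' t * g t + g' t * f t"]) (auto intro!: ndiff_add Suc.IH derivative_eq_intros)
qed simp

lemma ndiff_affine: "ndiff k f \<Longrightarrow> ndiff k (\<lambda>t. f (c * t + d))"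
proof (induction k arbitrary: f)
  case (Suc k)
  then obtain f' where *: "\<forall>t. (f has_real_derivative f' t) (at t)" "ndiff k f'" by auto
  have "((\<lambda>t. f (c * t + d)) has_real_derivative c * f' (c * t + d)) (at t)" for t
  proof -
    have "((\<lambda>t. c * t + d) has_real_derivative c) (at t)" by (auto intro!: derivative_eq_intros)
    from DERIV_chain2[OF _ this, of f "f' (c * t + d)"] *(1) show ?thesis by (simp add: mult.commute)
  qed
  then show ?case unfolding ndiff.simps using *(2) Suc.IH
    by (intro exI[of _ "\<lambda>t. c * f' (c * t + d)"]) (auto intro!: ndiff_mult ndiff_const)
qed simp

lemma smooth_const: "smooth (\<lambda>t. c)" by (simp add: smooth_def ndiff_const)
lemma smooth_add: "smooth f \<Longrightarrow> smooth g \<Longrightarrow> smooth (\<lambda>t. f t + g t)" by (simp add: smooth_def ndiff_add)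
lemma smooth_mult: "smooth f \<Longrightarrow> smooth g \<Longrightarrow> smooth (\<lambda>t. f t * g t)" by (simp add: smooth_def ndiff_mult)
lemma smooth_affine: "smooth f \<Longrightarrow> smooth (\<lambda>t. f (c * t + d))" by (simp add: smooth_def ndiff_affine)

text \<open>Primitives of smooth functions are smooth, so primitives of test functions can again
  serve as test functions.\<close>
lemma smooth_antiderivative: "(\<And>t. (f has_real_derivative f' t) (at t)) \<Longrightarrow> smooth f' \<Longrightarrow> smooth f"
  unfolding smooth_def
proof
  fix k assume "\<And>t. (f has_real_derivative f' t) (at t)" "\<forall>k. ndiff k f'"
  then show "ndiff k f" by (cases k) auto
qed

lemma smooth_ident: "smooth (\<lambda>t. t)"
  by (rule smooth_antiderivative[OF _ smooth_const[of 1]]) (auto intro!: derivative_eq_intros)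

lemma smooth_diff: "smooth f \<Longrightarrow> smooth g \<Longrightarrow> smooth (\<lambda>t. f t - g t)"
  using smooth_add[OF _ smooth_mult[OF smooth_const[of "-1"]], of f g] by simp

lemma smooth_has_deriv: "smooth f \<Longrightarrow> (f has_real_derivative deriv f t) (at t)"
  using DERIV_imp_deriv unfolding smooth_def by (metis ndiff.simps(2))

lemma smooth_deriv: "smooth f \<Longrightarrow> smooth (deriv f)"
proof -
  assume f: "smooth f"
  have "ndiff k (deriv f)" for k
  proof -
    obtain f' where f': "\<forall>t. (f has_real_derivative f' t) (at t)" "ndiff k f'"
      using f unfolding smooth_def by (metis ndiff.simps(2))
    then have "deriv f = f'" by (auto intro: DERIV_imp_deriv)
    then show ?thesis using f' by simp
  qed
  then show ?thesis by (simp add: smooth_def)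
qed

lemma smooth_continuous: "smooth f \<Longrightarrow> continuous_on S f"
  by (meson DERIV_isCont continuous_at_imp_continuous_on smooth_has_deriv)

text \<open>The family \<open>exp (-1/t) / t^m\<close>, extended by zero, is closed under
  differentiation up to linear combinations. This makes the flat function \<open>exp
  (-1/t)\<close>, the case \<open>m = 0\<close>, smooth at the origin.\<close>
definition flat_quot :: "nat \<Rightarrow> real \<Rightarrow> real" where
  "flat_quot m t = (if t \<le> 0 then 0 else exp (- 1 / t) / t ^ m)"

lemma flat_quot_deriv:
  "(flat_quot m has_real_derivative flat_quot (m + 2) t - real m * flat_quot (m + 1) t) (at t)"
proof -
  consider "t < 0" | "t = 0" | "t > 0" by linarith
  then show ?thesis
  proof cases
    case 1
    have "((\<lambda>t. 0) has_real_derivative 0) (at t)" by simp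
    moreover have "\<forall>\<^sub>F s in nhds t. flat_quot m s = 0"
      using eventually_nhds_in_open[of "{..<0}" t] 1 by (auto elim!: eventually_mono simp: flat_quot_def)
    ultimately have "(flat_quot m has_real_derivative 0) (at t)"
      by (subst DERIV_cong_ev[OF refl _ refl]) auto
    then show ?thesis using 1 by (simp add: flat_quot_def)
  next
    case 3
    have "((\<lambda>t. exp (- 1 / t) / t ^ m) has_real_derivative
        flat_quot (m + 2) t - real m * flat_quot (m + 1) t) (at t)"
      using 3
      by (auto intro!: derivative_eq_intros simp: flat_quot_def field_simps power2_eq_square)
         (cases m; simp add: field_simps power2_eq_square)
    moreover have "\<forall>\<^sub>F s in nhds t. flat_quot m s = exp (- 1 / s) / s ^ m"
      using eventually_nhds_in_open[of "{0<..}" t] 3 by (auto elim!: eventually_mono simp: flat_quot_def)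
    ultimately show ?thesis
      by (subst DERIV_cong_ev[OF refl _ refl]) auto
  next
    case 2
    have lim: "((\<lambda>x::real. x ^ (m + 1) / exp x) \<longlongrightarrow> 0) at_top" by (rule tendsto_power_div_exp_0)
    have "((\<lambda>s::real. inverse s ^ (m + 1) / exp (inverse s)) \<longlongrightarrow> 0) (at_right 0)"
      using filterlim_compose[OF lim filterlim_inverse_at_top_right] by simp
    then have "((\<lambda>s. flat_quot m s / s) \<longlongrightarrow> 0) (at_right 0)"
      by (rule Lim_transform_eventually)
         (auto simp: eventually_at_right_field flat_quot_def exp_minus field_simps intro!: exI[of _ 1])
    moreover have "((\<lambda>s. flat_quot m s / s) \<longlongrightarrow> 0) (at_left 0)"
      by (rule Lim_transform_eventually[OF tendsto_const])
         (auto simp: eventually_at_left_field flat_quot_def intro!: exI[of _ "-1"])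
    ultimately have "((\<lambda>s. flat_quot m s / s) \<longlongrightarrow> 0) (at 0)"
      by (simp add: filterlim_split_at)
    then show ?thesis using 2 by (simp add: has_field_derivative_iff flat_quot_def)
  qed
qed

lemma ndiff_flat_quot: "ndiff k (flat_quot m)"
proof (induction k arbitrary: m)
  case (Suc k)
  have "ndiff k (\<lambda>t. flat_quot (m + 2) t + (- real m) * flat_quot (m + 1) t)"
    by (intro ndiff_add ndiff_mult ndiff_const Suc)
  then show ?case unfolding ndiff.simps using flat_quot_deriv[of m]
    by (intro exI[of _ "\<lambda>t. flat_quot (m + 2) t - real m * flat_quot (m + 1) t"]) auto
qed simp

definition flat :: "real \<Rightarrow> real" where "flat = flat_quot 0"

lemma smooth_flat: "smooth flat" by (simp add: smooth_def flat_def ndiff_flat_quot)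
lemma flat_nonpos: "t \<le> 0 \<Longrightarrow> flat t = 0" by (simp add: flat_def flat_quot_def)
lemma flat_nonneg: "0 \<le> flat t" by (simp add: flat_def flat_quot_def)
lemma flat_le_1: "flat t \<le> 1" by (simp add: flat_def flat_quot_def)
lemma flat_at_top: "(flat \<longlongrightarrow> 1) at_top"
proof -
  have "((\<lambda>t::real. exp (- 1 / t)) \<longlongrightarrow> exp 0) at_top"
    by (intro tendsto_exp real_tendsto_divide_at_top[OF tendsto_const filterlim_ident])
  moreover have "\<forall>\<^sub>F t in at_top. exp (- 1 / t) = flat t"
    by (auto simp: flat_def flat_quot_def eventually_at_top_linorder intro!: exI[of _ 1])
  ultimately show ?thesis using Lim_transform_eventually by fastforce
qed

lemma flat_scaled_limit:
  assumes "s > 0" shows "(\<lambda>n. flat (real n * s - c)) \<longlonglongrightarrow> 1"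
proof -
  have "filterlim (\<lambda>n. real n * s + (- c)) at_top sequentially"
    using filterlim_tendsto_add_at_top[OF tendsto_const
        filterlim_tendsto_pos_mult_at_top[OF tendsto_const assms filterlim_real_sequentially], of "- c"]
    by (simp add: mult.commute add.commute)
  then show ?thesis using filterlim_compose[OF flat_at_top] by fastforce
qed

text \<open>One-dimensional test functions on the open interval. Products of two of
  them serve as test functions on the plane.\<close>
definition test1 :: "real \<Rightarrow> real \<Rightarrow> (real \<Rightarrow> real) \<Rightarrow> bool" where
  "test1 a b f \<longleftrightarrow> smooth f \<and> (\<exists>c d. a < c \<and> d < b \<and> (\<forall>t. f t \<noteq> 0 \<longrightarrow> c \<le> t \<and> t \<le> d))"

lemma test1_smooth: "test1 a b f \<Longrightarrow> smooth f" by (simp add: test1_def)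

lemma test1_mult_smooth: "test1 a b f \<Longrightarrow> smooth g \<Longrightarrow> test1 a b (\<lambda>t. f t * g t)"
  unfolding test1_def by (auto intro!: smooth_mult)

lemma test1_add:
  assumes "test1 a b f" "test1 a b g" shows "test1 a b (\<lambda>t. f t + g t)"
proof -
  obtain c d c' d' where *: "a < c" "d < b" "\<And>t. f t \<noteq> 0 \<longrightarrow> c \<le> t \<and> t \<le> d"
    "a < c'" "d' < b" "\<And>t. g t \<noteq> 0 \<longrightarrow> c' \<le> t \<and> t \<le> d'"
    using assms unfolding test1_def by metis
  have "\<forall>t. f t + g t \<noteq> 0 \<longrightarrow> min c c' \<le> t \<and> t \<le> max d d'"
    using *(3,6) by (metis add.right_neutral add_0 le_max_iff_disj min_le_iff_disj)
  moreover have "a < min c c'" "max d d' < b" using * by auto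
  ultimately show ?thesis using assms unfolding test1_def by (blast intro: smooth_add)
qed

lemma test1_deriv:
  assumes "test1 a b f" shows "test1 a b (deriv f)"
proof -
  obtain c d where *: "a < c" "d < b" "\<And>t. f t \<noteq> 0 \<longrightarrow> c \<le> t \<and> t \<le> d" and f: "smooth f"
    using assms unfolding test1_def by metis
  have "deriv f t = 0" if "t \<notin> {c..d}" for t
  proof -
    have "\<forall>\<^sub>F s in nhds t. s \<in> - {c..d}" by (rule eventually_nhds_in_open) (use that in auto)
    then have "\<forall>\<^sub>F s in nhds t. f s = 0" by (rule eventually_mono) (use *(3) in force)
    then have "(f has_real_derivative 0) (at t)" by (subst DERIV_cong_ev[OF refl _ refl]) auto
    then show ?thesis by (rule DERIV_imp_deriv)
  qed
  then show ?thesis using *(1,2) f unfolding test1_def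
    by (intro conjI smooth_deriv exI[of _ c] exI[of _ d]) auto
qed

text \<open>The shift by one makes the support compact in the interval for every \<open>n\<close>;
  the factor \<open>n\<close> makes the sequence tend to one on the interval.\<close>
definition cutoff :: "real \<Rightarrow> real \<Rightarrow> nat \<Rightarrow> real \<Rightarrow> real" where
  "cutoff a b n t = flat (real n * (t - a) - 1) * flat (real n * (b - t) - 1)"

lemma cutoff_test1: "test1 a b (cutoff a b n)"
proof -
  have "smooth (\<lambda>t. flat (real n * t + (- real n * a - 1)) * flat (- real n * t + (real n * b - 1)))"
    by (intro smooth_mult smooth_affine smooth_flat)
  then have "smooth (cutoff a b n)"
    unfolding cutoff_def by (simp add: algebra_simps)
  moreover have "\<exists>c d. a < c \<and> d < b \<and> (\<forall>t. cutoff a b n t \<noteq> 0 \<longrightarrow> c \<le> t \<and> t \<le> d)"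
  proof (cases "n = 0")
    case True
    then show ?thesis by (intro exI[of _ "a + 1"] exI[of _ "b - 1"]) (simp add: cutoff_def flat_nonpos)
  next
    case False
    have "a + 1 / real n \<le> t \<and> t \<le> b - 1 / real n" if "cutoff a b n t \<noteq> 0" for t
    proof -
      have "flat (real n * (t - a) - 1) \<noteq> 0" "flat (real n * (b - t) - 1) \<noteq> 0"
        using that unfolding cutoff_def by auto
      then have "real n * (t - a) - 1 > 0" "real n * (b - t) - 1 > 0"
        using flat_nonpos not_le by blast+
      then show ?thesis using False by (simp add: field_simps)
    qed
    then show ?thesis using False
      by (intro exI[of _ "a + 1 / real n"] exI[of _ "b - 1 / real n"]) simp
  qed
  ultimately show ?thesis by (simp add: test1_def)
qed

lemma cutoff_bounds: "0 \<le> cutoff a b n t" "cutoff a b n t \<le> 1"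
  unfolding cutoff_def by (auto intro!: mult_le_one mult_nonneg_nonneg flat_nonneg flat_le_1)

lemma cutoff_zero: "t \<notin> {a<..<b} \<Longrightarrow> cutoff a b n t = 0"
proof -
  assume "t \<notin> {a<..<b}"
  then have "real n * (t - a) - 1 \<le> 0 \<or> real n * (b - t) - 1 \<le> 0"
    by (smt (verit) greaterThanLessThan_iff mult_nonneg_nonpos of_nat_0_le_iff)
  then show ?thesis by (auto simp: cutoff_def flat_nonpos)
qed

lemma cutoff_limit: "t \<in> {a<..<b} \<Longrightarrow> (\<lambda>n. cutoff a b n t) \<longlonglongrightarrow> 1"
  unfolding cutoff_def using tendsto_mult[OF flat_scaled_limit[of "t - a" 1] flat_scaled_limit[of "b - t" 1]]
  by simp

text \<open>Bounded pointwise limits of test functions. An integral identity that holds for test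
  functions passes to them by dominated convergence. The class contains smooth functions without
  boundary condition, step functions and their products, and these are the weights from which
  traces and element integrals are built.\<close>
definition test_limit :: "real \<Rightarrow> real \<Rightarrow> (real \<Rightarrow> real) \<Rightarrow> bool" where
  "test_limit a b q \<longleftrightarrow> (\<exists>Q M. (\<forall>n. test1 a b (Q n)) \<and> (\<forall>n t. \<bar>Q n t\<bar> \<le> M) \<and>
     (\<forall>t\<in>{a<..<b}. (\<lambda>n. Q n t) \<longlonglongrightarrow> q t))"

lemma test_limit_smooth:
  assumes "smooth f" shows "test_limit a b f"
proof -
  have "bounded (f ` {a..b})"
    by (intro compact_imp_bounded compact_continuous_image smooth_continuous assms) simp
  then obtain M where M: "M > 0" "\<And>t. t \<in> {a..b} \<Longrightarrow> \<bar>f t\<bar> \<le> M"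
    unfolding bounded_pos by auto
  have "test1 a b (\<lambda>t. cutoff a b n t * f t)" for n
    by (intro test1_mult_smooth cutoff_test1 assms)
  moreover have "\<bar>cutoff a b n t * f t\<bar> \<le> M" for n t
  proof (cases "t \<in> {a<..<b}")
    case True
    then show ?thesis using mult_mono[of "cutoff a b n t" 1 "\<bar>f t\<bar>" M] cutoff_bounds M
      by (simp add: abs_mult)
  qed (use M cutoff_zero in auto)
  moreover have "(\<lambda>n. cutoff a b n t * f t) \<longlonglongrightarrow> f t" if "t \<in> {a<..<b}" for t
    using tendsto_mult[OF cutoff_limit[OF that] tendsto_const[of "f t"]] by simp
  ultimately show ?thesis unfolding test_limit_def
    by (intro exI[of _ "\<lambda>n t. cutoff a b n t * f t"] exI[of _ M]) blast
qed

lemma test_limit_mult: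
  assumes "test_limit a b f" "test_limit a b g" shows "test_limit a b (\<lambda>t. f t * g t)"
proof -
  obtain F M G N where F: "\<And>n. test1 a b (F n)" "\<And>n t. \<bar>F n t\<bar> \<le> M" "\<And>t. t\<in>{a<..<b} \<Longrightarrow> (\<lambda>n. F n t) \<longlonglongrightarrow> f t"
    and G: "\<And>n. test1 a b (G n)" "\<And>n t. \<bar>G n t\<bar> \<le> N" "\<And>t. t\<in>{a<..<b} \<Longrightarrow> (\<lambda>n. G n t) \<longlonglongrightarrow> g t"
    using assms unfolding test_limit_def by metis
  have "\<bar>F n t * G n t\<bar> \<le> M * N" for n t
    unfolding abs_mult using F(2)[of n t] G(2)[of n t] by (intro mult_mono) auto
  then show ?thesis unfolding test_limit_def
    by (intro exI[of _ "\<lambda>n t. F n t * G n t"] exI[of _ "M * N"])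
       (auto intro!: test1_mult_smooth F G tendsto_mult test1_smooth[OF G(1)])
qed

lemma test_limit_add:
  assumes "test_limit a b f" "test_limit a b g" shows "test_limit a b (\<lambda>t. f t + g t)"
proof -
  obtain F M G N where F: "\<And>n. test1 a b (F n)" "\<And>n t. \<bar>F n t\<bar> \<le> M" "\<And>t. t\<in>{a<..<b} \<Longrightarrow> (\<lambda>n. F n t) \<longlonglongrightarrow> f t"
    and G: "\<And>n. test1 a b (G n)" "\<And>n t. \<bar>G n t\<bar> \<le> N" "\<And>t. t\<in>{a<..<b} \<Longrightarrow> (\<lambda>n. G n t) \<longlonglongrightarrow> g t"
    using assms unfolding test_limit_def by metis
  have "\<bar>F n t + G n t\<bar> \<le> M + N" for n t
    using F(2)[of n t] G(2)[of n t] by linarith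
  then show ?thesis unfolding test_limit_def
    by (intro exI[of _ "\<lambda>n t. F n t + G n t"] exI[of _ "M + N"])
       (auto intro!: test1_add F G tendsto_add)
qed

lemma test_limit_const: "test_limit a b (\<lambda>t. c)" by (intro test_limit_smooth smooth_const)
lemma test_limit_ident: "test_limit a b (\<lambda>t. t)" by (intro test_limit_smooth smooth_ident)

lemma test_limit_cmult: "test_limit a b f \<Longrightarrow> test_limit a b (\<lambda>t. c * f t)"
  by (intro test_limit_mult test_limit_const)

lemma test_limit_diff: "test_limit a b f \<Longrightarrow> test_limit a b g \<Longrightarrow> test_limit a b (\<lambda>t. f t - g t)"
  using test_limit_add[OF _ test_limit_cmult[of a b g "-1"], of f] by simp

text \<open>Step functions are limits of rescaled flat functions, with the value zero at the jump.\<close>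
lemma test_limit_step: "test_limit a b (\<lambda>t. if 0 < s * t + d then 1 else 0)"
proof -
  let ?F = "\<lambda>n t. cutoff a b n t * flat (real n * (s * t + d))"
  have "smooth (\<lambda>t. flat (real n * s * t + real n * d))" for n
    by (intro smooth_affine smooth_flat)
  then have "test1 a b (?F n)" for n
    by (intro test1_mult_smooth cutoff_test1) (simp add: distrib_left mult.assoc)
  moreover have "\<bar>?F n t\<bar> \<le> 1" for n t
    using cutoff_bounds[of a b n t] flat_nonneg flat_le_1 by (simp add: abs_mult mult_le_one)
  moreover have "(\<lambda>n. ?F n t) \<longlonglongrightarrow> (if 0 < s * t + d then 1 else 0)" if "t \<in> {a<..<b}" for t
  proof (cases "0 < s * t + d")
    case True
    then show ?thesis using tendsto_mult[OF cutoff_limit[OF that] flat_scaled_limit[of "s * t + d" 0]] by simp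
  next
    case False
    then have "?F n t = 0" for n by (simp add: flat_nonpos mult_nonneg_nonpos)
    then have "(\<lambda>n. ?F n t) = (\<lambda>n. 0)" by blast
    then show ?thesis using False by (simp only: if_False tendsto_const)
  qed
  ultimately show ?thesis unfolding test_limit_def
    by (intro exI[of _ "?F"] exI[of _ 1]) blast
qed

lemma test_limit_less: "test_limit a b (\<lambda>t. if t < c then 1 else 0)"
  using test_limit_step[of a b "-1" c] by simp

lemma test_limit_indicator: "test_limit a b (indicator {l<..<r})"
proof -
  have "(\<lambda>t. (if l < t then 1 else 0) * (if t < r then 1 else 0)) = (indicator {l<..<r} :: real \<Rightarrow> real)"
    by (auto simp: indicator_def)
  then show ?thesis using test_limit_mult[OF test_limit_step[of a b 1 "- l"] test_limit_less[of a b r]] by simp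
qed

section \<open>Test functions on the plane\<close>

text \<open>The other coordinate direction. The problem is invariant under exchange of the axes,
  and with \<open>co\<close> both directions are treated by one proof.\<close>
definition co :: "2 \<Rightarrow> 2" where "co i = (if i = 1 then 2 else 1)"

lemma co_simps [simp]: "co 1 = 2" "co 2 = 1" by (simp_all add: co_def)
lemma co_neq [simp]: "co i \<noteq> i" "i \<noteq> co i" by (auto simp: co_def)
lemma co_co [simp]: "co (co i) = i" using exhaust_2[of i] by (auto simp: co_def)
lemma index_cases: "k = i \<or> k = co i" using exhaust_2[of i] exhaust_2[of k] by (auto simp: co_def)

lemma partial_eq: "(f has_derivative D) (at x) \<Longrightarrow> partial i f x = D (axis i 1)"
  unfolding partial_def by (metis frechet_derivative_at)

lemma differentiable_has_partial:
  "f differentiable (at x) \<Longrightarrow> (f has_derivative frechet_derivative f (at x)) (at x)"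
  by (simp add: frechet_derivative_works)

lemma partial_add:
  "f differentiable (at x) \<Longrightarrow> g differentiable (at x) \<Longrightarrow>
    partial i (\<lambda>x. f x + g x) x = partial i f x + partial i g x"
  by (subst partial_eq[OF has_derivative_add[OF differentiable_has_partial differentiable_has_partial]])
     (auto simp: partial_def)

lemma partial_mult:
  "f differentiable (at x) \<Longrightarrow> g differentiable (at x) \<Longrightarrow>
    partial i (\<lambda>x. f x * g x) x = f x * partial i g x + partial i f x * g x"
  by (subst partial_eq[OF has_derivative_mult[OF differentiable_has_partial differentiable_has_partial]])
     (auto simp: partial_def)

lemma Ck_continuous: "Ck k f \<Longrightarrow> continuous_on S f"
proof (cases k)
  case (Suc m)
  assume "Ck k f"
  then have "\<forall>x. f differentiable (at x)" using Suc by simp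
  then show ?thesis
    by (simp add: continuous_at_imp_continuous_on differentiable_imp_continuous_within)
qed (auto intro: continuous_on_subset)

lemma Ck_pred: "Ck (Suc k) f \<Longrightarrow> Ck k f"
proof (induction k arbitrary: f)
  case 0
  then show ?case using Ck_continuous[of "Suc 0" f UNIV] by simp
next
  case (Suc k)
  then show ?case by (auto simp del: Ck.simps(2) simp: Ck.simps(2)[of "Suc k"] Ck.simps(2)[of k])
qed

lemma Ck_add: "Ck k f \<Longrightarrow> Ck k g \<Longrightarrow> Ck k (\<lambda>x. f x + g x)"
proof (induction k arbitrary: f g)
  case (Suc k)
  then have "partial i (\<lambda>x. f x + g x) = (\<lambda>x. partial i f x + partial i g x)" for i
    by (auto simp: partial_add)
  then show ?case using Suc by (auto intro!: differentiable_add)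
qed (auto intro: continuous_on_add)

lemma Ck_mult: "Ck k f \<Longrightarrow> Ck k g \<Longrightarrow> Ck k (\<lambda>x. f x * g x)"
proof (induction k arbitrary: f g)
  case (Suc k)
  then have "partial i (\<lambda>x. f x * g x) = (\<lambda>x. f x * partial i g x + partial i f x * g x)" for i
    by (auto simp: partial_mult)
  moreover have "Ck k f" "Ck k g" using Suc.prems Ck_pred by blast+
  ultimately show ?case using Suc by (auto intro!: differentiable_mult Ck_add Suc.IH)
qed (auto intro: continuous_on_mult)

lemma has_derivative_coord:
  assumes "smooth f"
  shows "((\<lambda>x::plane. f (x $ i)) has_derivative (\<lambda>h. deriv f (x $ i) * h $ i)) (at x)"
proof -
  have "((\<lambda>x::plane. x $ i) has_derivative (\<lambda>h. h $ i)) (at x)"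
    by (rule bounded_linear_imp_has_derivative[OF bounded_linear_vec_nth])
  moreover have "(f has_derivative (*) (deriv f (x $ i))) (at (x $ i))"
    using smooth_has_deriv[OF assms] by (simp add: has_field_derivative_def)
  ultimately show ?thesis by (rule has_derivative_compose)
qed

lemma partial_coord:
  "smooth f \<Longrightarrow> partial k (\<lambda>x. f (x $ i)) x = (if k = i then deriv f (x $ i) else 0)"
  by (subst partial_eq[OF has_derivative_coord]) (auto simp: axis_def)

lemma Ck_const: "Ck k (\<lambda>x. c)"
proof (induction k arbitrary: c)
  case (Suc k)
  have "partial i (\<lambda>x. c) = (\<lambda>x. 0)" for i by (rule ext) (simp add: partial_eq[OF has_derivative_const])
  then show ?case using Suc by simp
qed simp

lemma Ck_coord: "smooth f \<Longrightarrow> Ck k (\<lambda>x. f (x $ i))"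
proof (induction k arbitrary: f)
  case 0
  then show ?case
    by (auto intro!: continuous_on_compose2[OF smooth_continuous[of f UNIV]] continuous_intros)
next
  case (Suc k)
  have "partial j (\<lambda>x. f (x $ i)) = (if j = i then (\<lambda>x. deriv f (x $ i)) else (\<lambda>x. 0))" for j
    by (auto simp: partial_coord[OF Suc.prems])
  then have "Ck k (partial j (\<lambda>x. f (x $ i)))" for j
    using Suc.IH[OF smooth_deriv[OF Suc.prems]] Ck_const[of k 0] by (cases "j = i") simp_all
  moreover have "(\<lambda>x. f (x $ i)) differentiable (at x)" for x
    using has_derivative_coord[OF Suc.prems] by (rule differentiableI)
  ultimately show ?case by simp
qed

lemma Ck_differentiable: "\<forall>k. Ck k f \<Longrightarrow> f differentiable (at x)"
  using Ck.simps(2) by blast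

lemma Ck_partial: "\<forall>k. Ck k f \<Longrightarrow> \<forall>k. Ck k (partial i f)"
  using Ck.simps(2) by blast

text \<open>Differentiation does not enlarge the support.\<close>
lemma partial_outside_support:
  assumes "x \<notin> closure {x. f x \<noteq> 0}" shows "partial i f x = 0"
proof -
  have "open (- closure {x. f x \<noteq> 0})" by (simp add: open_Compl)
  moreover have "0 = f y" if "y \<in> - closure {x. f x \<noteq> 0}" for y
    using that closure_subset[of "{x. f x \<noteq> 0}"] by (metis (mono_tags) ComplD mem_Collect_eq subsetD)
  moreover have "x \<in> - closure {x. f x \<noteq> 0}" using assms by simp
  ultimately have "(f has_derivative (\<lambda>h. 0)) (at x)"
    using has_derivative_transform_within_open[OF has_derivative_const[of 0 "at x"]] by blast
  then show ?thesis by (simp add: partial_eq)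
qed

lemma compact_closure_subset: "compact T \<Longrightarrow> closure S \<subseteq> T \<Longrightarrow> compact (closure S)"
  using compact_Int_closed[of T "closure S"] by (simp add: inf.absorb2)

lemma test_functions_mono: "U \<subseteq> W \<Longrightarrow> test_functions U \<subseteq> test_functions W"
  by (auto simp: test_functions_def)

lemma test_function_zero: "\<phi> \<in> test_functions U \<Longrightarrow> x \<notin> U \<Longrightarrow> \<phi> x = 0"
  using closure_subset[of "{x. \<phi> x \<noteq> 0}"] by (auto simp: test_functions_def)

lemma test_function_partial_zero: "\<phi> \<in> test_functions U \<Longrightarrow> x \<notin> U \<Longrightarrow> partial i \<phi> x = 0"
  unfolding test_functions_def using partial_outside_support by blast

lemma test_function_times_smooth:
  assumes "\<phi> \<in> test_functions U" "\<forall>k. Ck k s"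
  shows "(\<lambda>x. s x * \<phi> x) \<in> test_functions U"
proof -
  have sub: "closure {x. s x * \<phi> x \<noteq> 0} \<subseteq> closure {x. \<phi> x \<noteq> 0}" by (rule closure_mono) auto
  then have "compact (closure {x. s x * \<phi> x \<noteq> 0})"
    using assms(1) compact_closure_subset[OF _ sub] unfolding test_functions_def by blast
  moreover have "\<forall>k. Ck k (\<lambda>x. s x * \<phi> x)" "closure {x. \<phi> x \<noteq> 0} \<subseteq> U"
    using assms by (simp_all add: test_functions_def Ck_mult)
  ultimately show ?thesis using sub unfolding test_functions_def by blast
qed

lemma partial_test_function:
  assumes "\<phi> \<in> test_functions U" shows "partial i \<phi> \<in> test_functions U"
proof -
  have sub: "closure {x. partial i \<phi> x \<noteq> 0} \<subseteq> closure {x. \<phi> x \<noteq> 0}"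
    using partial_outside_support by (intro closure_minimal) auto
  then have "compact (closure {x. partial i \<phi> x \<noteq> 0})"
    using assms(1) compact_closure_subset[OF _ sub] unfolding test_functions_def by blast
  moreover have "\<forall>k. Ck k (partial i \<phi>)" "closure {x. \<phi> x \<noteq> 0} \<subseteq> U"
    using assms Ck_partial by (simp_all add: test_functions_def)
  ultimately show ?thesis using sub unfolding test_functions_def by blast
qed

lemma test_function_bounded:
  assumes "\<phi> \<in> test_functions U"
  obtains M where "\<And>x. \<bar>\<phi> x\<bar> \<le> M"
proof -
  let ?S = "closure {x. \<phi> x \<noteq> 0}"
  have "continuous_on ?S \<phi>" "compact ?S"
    using assms Ck_continuous by (auto simp: test_functions_def)
  then have "bounded (\<phi> ` ?S)" by (intro compact_imp_bounded compact_continuous_image)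
  then obtain M where "\<forall>y\<in>\<phi> ` ?S. norm y \<le> M" using bounded_iff by blast
  then have M: "\<bar>\<phi> x\<bar> \<le> M" if "x \<in> ?S" for x using that by (simp only: real_norm_def ball_simps)
  have "\<bar>\<phi> x\<bar> \<le> max M 0" for x
  proof (cases "\<phi> x = 0")
    case False
    then have "x \<in> ?S" using closure_subset[of "{x. \<phi> x \<noteq> 0}"] by blast
    then show ?thesis using M by fastforce
  qed simp
  then show ?thesis by (rule that)
qed

lemma continuous_measurable_lebesgue_on:
  fixes s :: "plane \<Rightarrow> real"
  assumes "continuous_on UNIV s" shows "s \<in> borel_measurable (lebesgue_on W)"
proof -
  have "s \<in> borel_measurable lebesgue"
    using borel_measurable_continuous_onI[OF assms] by (simp add: measurable_completion)
  then show ?thesis by (rule measurable_restrict_space1)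
qed

lemma test_function_measurable: "\<phi> \<in> test_functions U \<Longrightarrow> \<phi> \<in> borel_measurable (lebesgue_on W)"
  by (rule continuous_measurable_lebesgue_on) (auto simp: test_functions_def intro: Ck_continuous)

lemma product_test_function:
  assumes p: "test1 (a $ 1) (b $ 1) p" and q: "test1 (a $ 2) (b $ 2) q"
  shows "(\<lambda>x. p (x $ 1) * q (x $ 2)) \<in> test_functions (box a b)"
proof -
  obtain c d where *: "a$1 < c" "d < b$1" "\<And>t. p t \<noteq> 0 \<longrightarrow> c \<le> t \<and> t \<le> d"
    using p unfolding test1_def by metis
  obtain e f where **: "a$2 < e" "f < b$2" "\<And>t. q t \<noteq> 0 \<longrightarrow> e \<le> t \<and> t \<le> f"
    using q unfolding test1_def by metis
  let ?l = "\<chi> i. if i = 1 then c else e" and ?r = "\<chi> i. if i = 1 then d else f"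
  have sub: "closure {x::plane. p (x $ 1) * q (x $ 2) \<noteq> 0} \<subseteq> cbox ?l ?r"
  proof (rule closure_minimal)
    show "{x::plane. p (x $ 1) * q (x $ 2) \<noteq> 0} \<subseteq> cbox ?l ?r"
    proof
      fix x :: plane assume "x \<in> {x. p (x $ 1) * q (x $ 2) \<noteq> 0}"
      then have "p (x $ 1) \<noteq> 0" "q (x $ 2) \<noteq> 0" by auto
      then show "x \<in> cbox ?l ?r" using *(3)[of "x $ 1"] **(3)[of "x $ 2"] by (simp add: mem_box_cart forall_2)
    qed
  qed (rule closed_cbox)
  then have "compact (closure {x::plane. p (x $ 1) * q (x $ 2) \<noteq> 0})"
    using compact_closure_subset[OF compact_cbox] by blast
  moreover have "cbox ?l ?r \<subseteq> box a b"
    using *(1,2) **(1,2) by (auto simp: mem_box_cart forall_2)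
  moreover have "\<forall>k. Ck k (\<lambda>x::plane. p (x $ 1) * q (x $ 2))"
    using p q by (intro allI Ck_mult Ck_coord test1_smooth)
  ultimately show ?thesis using sub unfolding test_functions_def by blast
qed

lemma product_test_function':
  assumes "test1 (a $ i) (b $ i) q" and "test1 (a $ co i) (b $ co i) p"
  shows "(\<lambda>x. q (x $ i) * p (x $ co i)) \<in> test_functions (box a b)"
proof (cases "i = 1")
  case True
  then show ?thesis using product_test_function[of a b q p] assms by simp
next
  case False
  then have "i = 2" using exhaust_2 by blast
  then show ?thesis using product_test_function[of a b p q] assms by (simp add: mult.commute)
qed

lemma partial_product:
  assumes "smooth q" "smooth p"
  shows "partial i (\<lambda>x. q (x $ i) * p (x $ co i)) x = deriv q (x $ i) * p (x $ co i)"
  using has_derivative_coord[OF assms(1), of i x] has_derivative_coord[OF assms(2), of "co i" x]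
  by (subst partial_mult) (auto simp: partial_coord assms differentiable_def)

section \<open>Integration by parts\<close>
lemma box_mem_iff:
  fixes x :: plane
  shows "x \<in> box l u \<longleftrightarrow> x $ i \<in> {l $ i<..<u $ i} \<and> x $ co i \<in> {l $ co i<..<u $ co i}"
proof -
  have "(\<forall>k. P k) \<longleftrightarrow> P i \<and> P (co i)" for P :: "2 \<Rightarrow> bool" by (metis index_cases)
  then show ?thesis by (simp add: mem_box_cart)
qed

definition emb :: "2 \<Rightarrow> real \<Rightarrow> real \<Rightarrow> plane" where
  "emb i s t = (\<chi> k. if k = i then s else t)"

lemma emb_nth [simp]: "emb i s t $ i = s" "emb i s t $ co i = t"
  by (simp_all add: emb_def)

lemma emb_collapse: "emb i (x $ i) (x $ co i) = x"
proof (rule vec_eq_iff[THEN iffD2], rule allI)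
  fix k show "emb i (x $ i) (x $ co i) $ k = x $ k" using index_cases[of k i] by auto
qed

lemma UNIV_index: "(UNIV :: 2 set) = {i, co i}"
  using index_cases by auto

lemma prod_index: "(\<Prod>k\<in>(UNIV::2 set). f k) = f i * f (co i)"
  by (subst UNIV_index[of i]) simp

lemma emb_measurable [measurable]: "(\<lambda>(s, t). emb i s t) \<in> borel_measurable (borel \<Otimes>\<^sub>M borel)"
proof -
  have "continuous_on UNIV (\<lambda>p. (\<chi> k. if k = i then fst p else snd p) :: plane)"
  proof (intro continuous_on_vec_lambda)
    fix k show "continuous_on UNIV (\<lambda>p. if k = i then fst p else snd p :: real)"
      by (cases "k = i") (auto intro: continuous_intros)
  qed
  then have "(\<lambda>p. (\<chi> k. if k = i then fst p else snd p) :: plane) \<in> borel_measurable borel"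
    by (rule borel_measurable_continuous_onI)
  then show ?thesis by (simp add: emb_def case_prod_beta borel_prod)
qed

lemma prod_Basis_plane: "(\<Prod>b\<in>(Basis :: plane set). f b) = (\<Prod>k\<in>UNIV. f (axis k 1))"
proof -
  have B: "(Basis :: plane set) = (\<lambda>k. axis k 1) ` UNIV" by (auto simp: Basis_vec_def)
  have "inj (\<lambda>k. axis k (1::real) :: plane)" by (auto simp: inj_def axis_eq_axis)
  then show ?thesis unfolding B by (simp add: prod.reindex)
qed

text \<open>The coordinate map carries the product measure to planar Lebesgue measure, as both give
  every box its area. Fubini on the plane, in either order, is a consequence.\<close>
lemma lborel_emb: "distr (lborel \<Otimes>\<^sub>M lborel) borel (\<lambda>(s, t). emb i s t) = lborel"
proof (rule lborel_eqI[symmetric])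
  fix l u :: plane assume lu: "\<And>b. b \<in> Basis \<Longrightarrow> l \<bullet> b \<le> u \<bullet> b"
  have le: "l $ k \<le> u $ k" for k
    using lu[of "axis k 1"] by (auto simp: Basis_vec_def inner_axis)
  have pre: "(\<lambda>(s, t). emb i s t) -` box l u \<inter> space (lborel \<Otimes>\<^sub>M lborel) =
      {l $ i<..<u $ i} \<times> {l $ co i<..<u $ co i}"
    by (auto simp: box_mem_iff[of _ l u i] space_pair_measure)
  have "emeasure (distr (lborel \<Otimes>\<^sub>M lborel) borel (\<lambda>(s, t). emb i s t)) (box l u) =
      emeasure (lborel \<Otimes>\<^sub>M lborel) ({l $ i<..<u $ i} \<times> {l $ co i<..<u $ co i})"
    unfolding pre[symmetric] by (rule emeasure_distr) simp_all
  also have "\<dots> = emeasure lborel {l $ i<..<u $ i} * emeasure lborel {l $ co i<..<u $ co i}"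
    by (rule lborel.emeasure_pair_measure_Times) auto
  also have "\<dots> = ennreal ((u $ i - l $ i) * (u $ co i - l $ co i))"
    using le by (simp add: ennreal_mult)
  also have "(u $ i - l $ i) * (u $ co i - l $ co i) = (\<Prod>b\<in>Basis. (u - l) \<bullet> b)"
    unfolding prod_Basis_plane by (simp add: prod_index[of _ i] inner_axis)
  finally show "emeasure (distr (lborel \<Otimes>\<^sub>M lborel) borel (\<lambda>(s, t). emb i s t)) (box l u) =
      ennreal (\<Prod>b\<in>Basis. (u - l) \<bullet> b)" .
qed simp

lemma plane_nn_integral:
  assumes [measurable]: "F \<in> borel_measurable borel"
  shows "(\<integral>\<^sup>+x. F x \<partial>lborel) = (\<integral>\<^sup>+t. (\<integral>\<^sup>+s. F (emb i s t) \<partial>lborel) \<partial>lborel)"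
proof -
  have "(\<integral>\<^sup>+x. F x \<partial>lborel) = (\<integral>\<^sup>+p. F (case p of (s, t) \<Rightarrow> emb i s t) \<partial>(lborel \<Otimes>\<^sub>M lborel))"
    by (subst lborel_emb[of i, symmetric], subst nn_integral_distr) simp_all
  also have "\<dots> = (\<integral>\<^sup>+t. (\<integral>\<^sup>+s. F (emb i s t) \<partial>lborel) \<partial>lborel)"
    by (subst lborel_pair.nn_integral_snd[symmetric]) (simp_all add: case_prod_beta)
  finally show ?thesis .
qed

lemma plane_integral:
  fixes F :: "plane \<Rightarrow> real"
  assumes F: "integrable lborel F"
  shows "(LINT x|lborel. F x) = (LINT t|lborel. (LINT s|lborel. F (emb i s t)))"
    and "AE t in lborel. integrable lborel (\<lambda>s. F (emb i s t))"
proof -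
  have [measurable]: "F \<in> borel_measurable borel" using borel_measurable_integrable[OF F] by simp
  have "integrable (distr (lborel \<Otimes>\<^sub>M lborel) borel (\<lambda>(s, t). emb i s t)) F"
    using F by (simp add: lborel_emb)
  then have int: "integrable (lborel \<Otimes>\<^sub>M lborel) (\<lambda>(s, t). F (emb i s t))"
    by (subst (asm) integrable_distr_eq) (simp_all add: case_prod_beta')
  show "AE t in lborel. integrable lborel (\<lambda>s. F (emb i s t))"
    by (rule lborel_pair.AE_integrable_snd[OF int])
  have "(LINT x|lborel. F x) = (LINT p|(lborel \<Otimes>\<^sub>M lborel). F (case p of (s, t) \<Rightarrow> emb i s t))"
    by (subst lborel_emb[of i, symmetric], subst integral_distr) simp_all
  also have "\<dots> = (LINT t|lborel. (LINT s|lborel. F (emb i s t)))"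
    using lborel_pair.integral_snd[OF int] by (simp add: case_prod_beta')
  finally show "(LINT x|lborel. F x) = (LINT t|lborel. (LINT s|lborel. F (emb i s t)))" .
qed

lemma integral_lebesgue_on_UNIV:
  fixes f :: "plane \<Rightarrow> real"
  assumes "U \<in> sets lebesgue" "\<And>x. x \<notin> U \<Longrightarrow> f x = 0"
  shows "(LINT x|lebesgue_on U. f x) = (LINT x|lebesgue. f x)"
proof -
  have "(\<lambda>x. indicator U x *\<^sub>R f x) = f"
  proof
    show "indicator U x *\<^sub>R f x = f x" for x using assms(2)[of x] by (cases "x \<in> U") auto
  qed
  then show ?thesis using assms(1) by (simp add: integral_restrict_space)
qed

text \<open>By Fubini the integral is taken first along lines in direction \<open>i\<close>; there
  the fundamental theorem of calculus gives zero, because the support is bounded.\<close>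
lemma integral_partial_test_function:
  assumes U: "U \<in> sets lebesgue" and phi: "\<phi> \<in> test_functions U"
  shows "(LINT x|lebesgue_on U. partial i \<phi> x) = 0"
proof -
  let ?F = "partial i \<phi>"
  have cont: "continuous_on UNIV ?F" using phi Ck_continuous Ck_partial by (auto simp: test_functions_def)
  have bor: "?F \<in> borel_measurable borel" by (rule borel_measurable_continuous_onI[OF cont])
  obtain M where M: "\<And>x. \<bar>?F x\<bar> \<le> M"
    using test_function_bounded[OF partial_test_function[OF phi]] by blast
  have "bounded (closure {x. \<phi> x \<noteq> 0})" using phi compact_imp_bounded by (auto simp: test_functions_def)
  then obtain R where R: "\<forall>x\<in>closure {x. \<phi> x \<noteq> 0}. norm x \<le> R" using bounded_iff by blast
  have far: "\<phi> x = 0 \<and> ?F x = 0" if "R < norm x" for x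
  proof -
    have "x \<notin> closure {x. \<phi> x \<noteq> 0}" using R that by force
    then show ?thesis using partial_outside_support[of x \<phi> i] closure_subset[of "{x. \<phi> x \<noteq> 0}"] by blast
  qed
  have int: "integrable lborel ?F"
  proof (rule Bochner_Integration.integrable_bound)
    show "integrable lborel (\<lambda>x. M * indicat_real (cball 0 R) x)"
      using emeasure_lborel_cball_finite by (intro integrable_mult_right integrable_real_indicator) auto
    show "AE x in lborel. norm (?F x) \<le> norm (M * indicat_real (cball 0 R) x)"
    proof (rule AE_I2)
      fix x show "norm (?F x) \<le> norm (M * indicat_real (cball 0 R) x)"
        using M[of x] far[of x] by (cases "norm x \<le> R") auto
    qed
  qed (use bor in simp)
  have inner: "(LINT s|lborel. ?F (emb i s t)) = 0" for t
  proof -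
    let ?r = "\<bar>R\<bar> + 1"
    define z where "z = emb i 0 t"
    have emb: "emb i s t = z + s *\<^sub>R axis i 1" for s by (simp add: z_def vec_eq_iff emb_def axis_def)
    have far': "\<phi> (emb i s t) = 0 \<and> ?F (emb i s t) = 0" if "R < \<bar>s\<bar>" for s
      using far[of "emb i s t"] component_le_norm_cart[of "emb i s t" i] that by simp
    have line: "((\<lambda>s. \<phi> (emb i s t)) has_real_derivative ?F (emb i s t)) (at s)" for s
    proof -
      have d: "(\<phi> has_derivative frechet_derivative \<phi> (at (emb i s t))) (at (emb i s t))"
        using phi Ck_differentiable differentiable_has_partial by (auto simp: test_functions_def)
      have "((\<lambda>s. emb i s t) has_derivative (\<lambda>h. h *\<^sub>R axis i 1)) (at s)"
        unfolding emb by (auto intro!: derivative_eq_intros)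
      from has_derivative_compose[OF this d]
      have "((\<lambda>s. \<phi> (emb i s t)) has_derivative (\<lambda>h. frechet_derivative \<phi> (at (emb i s t)) (h *\<^sub>R axis i 1))) (at s)" .
      moreover have "frechet_derivative \<phi> (at (emb i s t)) (h *\<^sub>R axis i 1) = ?F (emb i s t) * h" for h
        using linear_scale[OF has_derivative_linear[OF d], of h "axis i 1"] by (simp add: partial_def mult.commute)
      ultimately show ?thesis by (simp add: has_field_derivative_def)
    qed
    have "(LINT s|lborel. ?F (emb i s t) * indicator {- ?r..?r} s) = \<phi> (emb i ?r t) - \<phi> (emb i (- ?r) t)"
    proof (rule integral_FTC_Icc_real)
      fix s
      show "isCont (\<lambda>s. ?F (emb i s t)) s"
        unfolding emb by (rule isCont_o2) (use cont in \<open>auto simp: continuous_on_eq_continuous_at intro!: continuous_intros\<close>)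
    qed (use line in auto)
    also have "\<dots> = 0" using far' by simp
    also have "(LINT s|lborel. ?F (emb i s t) * indicator {- ?r..?r} s) = (LINT s|lborel. ?F (emb i s t))"
    proof (rule Bochner_Integration.integral_cong[OF refl])
      fix s show "?F (emb i s t) * indicator {- ?r..?r} s = ?F (emb i s t)"
        using far'[of s] by (cases "R < \<bar>s\<bar>") (auto simp: indicator_def)
    qed
    finally show ?thesis .
  qed
  have "(LINT x|lborel. ?F x) = 0" unfolding plane_integral(1)[OF int, of i] inner by simp
  then have "(LINT x|lebesgue. ?F x) = 0" using bor by (simp add: integral_completion)
  then show ?thesis
    using integral_lebesgue_on_UNIV[OF U] test_function_partial_zero[OF phi] by metis
qed

lemma test_function_L2: "\<phi> \<in> test_functions U \<Longrightarrow> W \<in> lmeasurable \<Longrightarrow> \<phi> \<in> L2 W"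
  using test_function_bounded[of \<phi> U] test_function_measurable[of \<phi> U W]
  by (metis L2_bounded real_norm_def)

lemma integrable_smooth_test:
  assumes "\<phi> \<in> test_functions U" "\<forall>k. Ck k s" "W \<in> lmeasurable"
  shows "integrable (lebesgue_on W) (\<lambda>x. s x * \<phi> x)"
  by (rule L2_integrable[OF assms(3) test_function_L2[OF test_function_times_smooth[OF assms(1,2)] assms(3)]])

text \<open>The derivative of \<open>s \<phi>\<close> is that of a test function and integrates to
  zero.\<close>
lemma integration_by_parts_test:
  assumes U: "U \<in> lmeasurable" and phi: "\<phi> \<in> test_functions U" and s: "\<forall>k. Ck k s"
  shows "(LINT x|lebesgue_on U. s x * partial i \<phi> x) = - (LINT x|lebesgue_on U. partial i s x * \<phi> x)"
proof -
  have "partial i (\<lambda>x. s x * \<phi> x) x = s x * partial i \<phi> x + partial i s x * \<phi> x" for x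
    using s phi by (intro partial_mult Ck_differentiable) (auto simp: test_functions_def)
  then have "0 = (LINT x|lebesgue_on U. s x * partial i \<phi> x + partial i s x * \<phi> x)"
    using integral_partial_test_function[OF _ test_function_times_smooth[OF phi s], of i] U by simp
  also have "\<dots> = (LINT x|lebesgue_on U. s x * partial i \<phi> x) + (LINT x|lebesgue_on U. partial i s x * \<phi> x)"
    using integrable_smooth_test[OF partial_test_function[OF phi] s U]
      integrable_smooth_test[OF phi Ck_partial[OF s] U]
    by (intro Bochner_Integration.integral_add)
  finally show ?thesis by simp
qed

section \<open>Limits of test functions as weights\<close>
lemma lmeasurable_box [simp]: "box a b \<in> lmeasurable" by simp

lemma test1_measurable: "test1 c d q \<Longrightarrow> (\<lambda>x::plane. q (x $ i)) \<in> borel_measurable (lebesgue_on W)"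
  by (rule continuous_measurable_lebesgue_on, rule Ck_continuous[of 0])
     (rule Ck_coord, erule test1_smooth)

lemma box_nthD: "x \<in> box a b \<Longrightarrow> x $ i \<in> {a $ i<..<b $ i}" for x :: plane
  by (simp add: mem_box_cart)

lemma test_limit_measurable:
  fixes a b :: plane
  assumes "test_limit (a $ i) (b $ i) q"
  shows "(\<lambda>x. q (x $ i)) \<in> borel_measurable (lebesgue_on (box a b))"
proof -
  obtain Q M where Q: "\<And>n. test1 (a $ i) (b $ i) (Q n)" "\<And>n t. \<bar>Q n t\<bar> \<le> M"
      "\<And>t. t \<in> {a $ i<..<b $ i} \<Longrightarrow> (\<lambda>n. Q n t) \<longlonglongrightarrow> q t"
    using assms unfolding test_limit_def by metis
  show ?thesis
  proof (rule borel_measurable_LIMSEQ_real)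
    show "(\<lambda>n. Q n (x $ i)) \<longlonglongrightarrow> q (x $ i)" if "x \<in> space (lebesgue_on (box a b))" for x
      by (rule Q(3), rule box_nthD) (use that in simp)
    show "(\<lambda>x. Q n (x $ i)) \<in> borel_measurable (lebesgue_on (box a b))" for n
      by (rule test1_measurable[OF Q(1)])
  qed
qed

lemma test_limit_bounded:
  assumes "test_limit a b q"
  obtains M where "0 \<le> M" "\<And>t. t \<in> {a<..<b} \<Longrightarrow> \<bar>q t\<bar> \<le> M"
proof -
  obtain Q M where Q: "\<And>n. test1 a b (Q n)" "\<And>n t. \<bar>Q n t\<bar> \<le> M"
      "\<And>t. t \<in> {a<..<b} \<Longrightarrow> (\<lambda>n. Q n t) \<longlonglongrightarrow> q t"
    using assms unfolding test_limit_def by metis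
  have "\<bar>q t\<bar> \<le> M" if "t \<in> {a<..<b}" for t
    using tendsto_rabs[OF Q(3)[OF that]] by (rule LIMSEQ_le_const2) (use Q(2) in blast)
  moreover have "0 \<le> M" using Q(2)[of 0 0] by linarith
  ultimately show ?thesis using that by blast
qed

lemma bounded_dominated_convergence:
  fixes k :: "nat \<Rightarrow> plane \<Rightarrow> real"
  assumes z: "integrable (lebesgue_on U) z"
    and k: "\<And>n. k n \<in> borel_measurable (lebesgue_on U)" "\<And>n x. x \<in> U \<Longrightarrow> \<bar>k n x\<bar> \<le> M"
    and lim: "\<And>x. x \<in> U \<Longrightarrow> (\<lambda>n. k n x) \<longlonglongrightarrow> k' x"
  shows "(\<lambda>n. LINT x|lebesgue_on U. k n x * z x) \<longlonglongrightarrow> (LINT x|lebesgue_on U. k' x * z x)"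
proof (rule integral_dominated_convergence)
  have zm: "z \<in> borel_measurable (lebesgue_on U)" using z by (rule borel_measurable_integrable)
  show "(\<lambda>x. k n x * z x) \<in> borel_measurable (lebesgue_on U)" for n using k(1) zm by measurable
  have "k' \<in> borel_measurable (lebesgue_on U)"
    by (rule borel_measurable_LIMSEQ_real[where u = k]) (use k lim in auto)
  then show "(\<lambda>x. k' x * z x) \<in> borel_measurable (lebesgue_on U)" using zm by measurable
  show "integrable (lebesgue_on U) (\<lambda>x. M * \<bar>z x\<bar>)"
    by (rule integrable_mult_right[OF integrable_abs[OF z]])
  show "AE x in lebesgue_on U. (\<lambda>n. k n x * z x) \<longlonglongrightarrow> k' x * z x"
    by (rule AE_I2) (use lim in \<open>auto intro!: tendsto_mult\<close>)
  show "AE x in lebesgue_on U. norm (k n x * z x) \<le> M * \<bar>z x\<bar>" for n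
    by (rule AE_I2) (use k(2) in \<open>auto simp: abs_mult intro!: mult_right_mono\<close>)
qed

text \<open>The positive and negative parts of \<open>z\<close> are densities of finite measures
  that agree on boxes. Boxes generate the Borel sets and are closed under intersection, so the
  measures agree, and so do their densities.\<close>
lemma AE_zero_of_box_integrals:
  fixes z :: "plane \<Rightarrow> real"
  assumes z: "integrable lebesgue z"
    and box: "\<And>l u. (LINT x|lebesgue. indicator (box l u) x * z x) = 0"
    and all: "(LINT x|lebesgue. z x) = 0"
  shows "AE x in lebesgue. z x = 0"
proof -
  obtain y where y: "y \<in> borel_measurable lborel" "AE x in lborel. z x = y x"
    using completion_ex_borel_measurable_real[OF borel_measurable_integrable[OF z]] by blast
  have yb [measurable]: "y \<in> borel_measurable borel" using y(1) by simp
  have yc: "y \<in> borel_measurable lebesgue" using yb by (simp add: measurable_completion)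
  have zy: "AE x in lebesgue. z x = y x" using y(2) by (rule AE_completion)
  have int_y: "integrable lebesgue y"
    using z by (rule Bochner_Integration.integrable_cong_AE_imp) (use zy yc in auto)
  then have int: "integrable lborel y" using yb by (simp add: integrable_completion)
  have ind: "(LINT x|lborel. indicator A x * y x) = (LINT x|lebesgue. indicator A x * z x)"
    if "A \<in> sets borel" for A
  proof -
    have [measurable]: "A \<in> sets borel" by fact
    have A': "indicat_real A \<in> borel_measurable lebesgue"
      using measurable_completion[of "indicat_real A" lborel borel] by simp
    have "(LINT x|lborel. indicator A x * y x) = (LINT x|lebesgue. indicator A x * y x)"
      by (rule integral_completion[symmetric]) simp
    also have "\<dots> = (LINT x|lebesgue. indicator A x * z x)"
      using yc borel_measurable_integrable[OF z] A' zy
      by (intro integral_cong_AE) auto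
    finally show ?thesis .
  qed
  have zero: "(LINT x|lborel. indicator A x * y x) = 0" if "A \<in> sets borel" for A
  proof -
    have "Int_stable (range (\<lambda>(a, b). box a b :: plane set))"
      by (auto simp: Int_stable_def box_Int_box)
    moreover have "(range (\<lambda>(a, b). box a b)) \<subseteq> Pow (UNIV :: plane set)" by auto
    moreover have "A \<in> sigma_sets UNIV (range (\<lambda>(a, b). box a b :: plane set))"
      using that unfolding borel_eq_box by simp
    ultimately show ?thesis
    proof (induction rule: sigma_sets_induct_disjoint)
      case (basic A)
      then obtain l u where "A = box l u" by auto
      then show ?case using ind[of A] box by simp
    next
      case empty
      then show ?case by simp
    next
      case (compl A)
      then have A [measurable]: "A \<in> sets borel" by (simp add: borel_eq_box)
      have "indicat_real (UNIV - A) x * y x = y x - indicator A x * y x" for x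
        by (auto simp: indicator_def)
      moreover have "(LINT x|lborel. y x) = 0"
        using ind[of UNIV] all by simp
      moreover have "integrable lborel (\<lambda>x. indicat_real A x * y x)"
        using int by (auto intro: integrable_real_mult_indicator simp: mult.commute)
      ultimately show ?case using compl int by simp
    next
      case (union F)
      then have F: "\<And>i. F i \<in> sets lborel" by (simp add: borel_eq_box subset_eq)
      then have UF: "(\<Union>i. F i) \<in> sets lborel" by auto
      have "set_integrable lborel (\<Union>i. F i) y"
        unfolding set_integrable_def using int UF by (intro integrable_mult_indicator) auto
      then have "(LINT x:(\<Union>i. F i)|lborel. y x) = (\<Sum>i. (LINT x:(F i)|lborel. y x))"
        using union(1) F by (intro lebesgue_integral_countable_add) (auto simp: disjoint_family_on_def)
      then show ?case using union by (simp add: set_lebesgue_integral_def)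
    qed
  qed
  let ?P = "{x. 0 < y x}" and ?N = "{x. y x < 0}"
  have P: "?P \<in> sets borel" and N: "?N \<in> sets borel" by measurable
  have "AE x in lborel. indicator ?P x * y x = 0"
  proof (rule integral_nonneg_eq_0_iff_AE[THEN iffD1])
    show "integrable lborel (\<lambda>x. indicator ?P x * y x)"
      using integrable_mult_indicator[of ?P lborel y] int P by simp
  qed (use zero[OF P] in \<open>auto simp: indicator_def\<close>)
  moreover have "AE x in lborel. - (indicator ?N x * y x) = 0"
  proof (rule integral_nonneg_eq_0_iff_AE[THEN iffD1])
    show "integrable lborel (\<lambda>x. - (indicator ?N x * y x))"
      using integrable_mult_indicator[of ?N lborel y] int N by simp
  qed (use zero[OF N] in \<open>auto simp: indicator_def\<close>)
  ultimately have "AE x in lborel. y x = 0"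
    by eventually_elim (auto simp: indicator_def split: if_splits)
  then have "AE x in lebesgue. y x = 0" by (rule AE_completion)
  with zy show ?thesis by eventually_elim simp
qed

text \<open>Integration against a weight of product form, \<open>q\<close> in direction
  \<open>i\<close> and \<open>p\<close> across it. Keeping the two factors separate lets
  one-dimensional arguments act on either of them.\<close>
definition pairing :: "plane \<Rightarrow> plane \<Rightarrow> 2 \<Rightarrow> (plane \<Rightarrow> real) \<Rightarrow> (real \<Rightarrow> real) \<Rightarrow> (real \<Rightarrow> real) \<Rightarrow> real" where
  "pairing a b i w q p = (LINT x|lebesgue_on (box a b). q (x $ i) * p (x $ co i) * w x)"

lemma pairing_swap: "pairing a b (co i) w p q = pairing a b i w q p"
  by (simp add: pairing_def mult_ac)

lemma pairing_limit:
  assumes w: "w \<in> L2 (box a b)"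
    and Q: "\<And>n. test1 (a $ i) (b $ i) (Q n)" "\<And>n t. \<bar>Q n t\<bar> \<le> M"
      "\<And>t. t \<in> {a $ i<..<b $ i} \<Longrightarrow> (\<lambda>n. Q n t) \<longlonglongrightarrow> q t"
    and P: "\<And>n. test1 (a $ co i) (b $ co i) (P n)" "\<And>n t. \<bar>P n t\<bar> \<le> N"
      "\<And>t. t \<in> {a $ co i<..<b $ co i} \<Longrightarrow> (\<lambda>n. P n t) \<longlonglongrightarrow> p t"
  shows "(\<lambda>n. pairing a b i w (Q n) (P n)) \<longlonglongrightarrow> pairing a b i w q p"
  unfolding pairing_def
proof (rule bounded_dominated_convergence[where M = "M * N"])
  show "integrable (lebesgue_on (box a b)) w" using w by (rule L2_integrable[rotated]) simp
  show "(\<lambda>x. Q n (x $ i) * P n (x $ co i)) \<in> borel_measurable (lebesgue_on (box a b))" for n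
    using test1_measurable[OF Q(1)] test1_measurable[OF P(1)] by (intro borel_measurable_times)
  show "\<bar>Q n (x $ i) * P n (x $ co i)\<bar> \<le> M * N" for n x
  proof -
    have "0 \<le> M" using Q(2)[of n 0] by linarith
    then show ?thesis unfolding abs_mult using Q(2) P(2) by (intro mult_mono) auto
  qed
  show "(\<lambda>n. Q n (x $ i) * P n (x $ co i)) \<longlonglongrightarrow> q (x $ i) * p (x $ co i)" if "x \<in> box a b" for x
    by (intro tendsto_mult Q(3) P(3) box_nthD[OF that])
qed

lemma pairing_test_limit_zero:
  assumes w: "w \<in> L2 (box a b)"
    and zero: "\<And>q p. test1 (a $ i) (b $ i) q \<Longrightarrow> test1 (a $ co i) (b $ co i) p \<Longrightarrow> pairing a b i w q p = 0"
    and q: "test_limit (a $ i) (b $ i) q" and p: "test_limit (a $ co i) (b $ co i) p"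
  shows "pairing a b i w q p = 0"
proof -
  obtain Q M where Q: "\<And>n. test1 (a $ i) (b $ i) (Q n)" "\<And>n t. \<bar>Q n t\<bar> \<le> M"
      "\<And>t. t \<in> {a $ i<..<b $ i} \<Longrightarrow> (\<lambda>n. Q n t) \<longlonglongrightarrow> q t"
    using q unfolding test_limit_def by metis
  obtain P N where P: "\<And>n. test1 (a $ co i) (b $ co i) (P n)" "\<And>n t. \<bar>P n t\<bar> \<le> N"
      "\<And>t. t \<in> {a $ co i<..<b $ co i} \<Longrightarrow> (\<lambda>n. P n t) \<longlonglongrightarrow> p t"
    using p unfolding test_limit_def by metis
  have "(\<lambda>n. pairing a b i w (Q n) (P n)) = (\<lambda>n. 0)" using zero Q(1) P(1) by blast
  then show ?thesis using pairing_limit[OF w Q P] LIMSEQ_unique[OF _ tendsto_const] by fastforce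
qed

text \<open>Products of test functions suffice: their bounded limits include the indicators of
  boxes.\<close>
lemma fundamental_lemma:
  assumes w: "w \<in> L2 (box a b)"
    and zero: "\<And>q p. test1 (a $ i) (b $ i) q \<Longrightarrow> test1 (a $ co i) (b $ co i) p \<Longrightarrow> pairing a b i w q p = 0"
  shows "AE x in lebesgue_on (box a b). w x = 0"
proof -
  define z where "z x = indicator (box a b) x * w x" for x
  have int: "integrable (lebesgue_on (box a b)) w" using w by (rule L2_integrable[rotated]) simp
  then have z: "integrable lebesgue z"
    unfolding z_def by (simp add: integrable_restrict_space)
  have lim: "pairing a b i w q p = 0" if "test_limit (a $ i) (b $ i) q" "test_limit (a $ co i) (b $ co i) p" for q p
    by (rule pairing_test_limit_zero[OF w zero that])
  have "(LINT x|lebesgue. indicator (box l u) x * z x) = 0" for l u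
  proof -
    have *: "indicat_real {l $ i<..<u $ i} (x $ i) * indicat_real {l $ co i<..<u $ co i} (x $ co i) = indicator (box l u) x" for x
      by (simp add: box_mem_iff[of x l u i] indicator_def)
    have "(LINT x|lebesgue. indicator (box l u) x * z x) = (LINT x|lebesgue. indicator (box a b) x *\<^sub>R (indicator (box l u) x * w x))"
      by (simp add: z_def mult_ac)
    also have "\<dots> = (LINT x|lebesgue_on (box a b). indicator (box l u) x * w x)"
      by (simp add: integral_restrict_space)
    also have "\<dots> = pairing a b i w (indicator {l $ i<..<u $ i}) (indicator {l $ co i<..<u $ co i})"
      unfolding pairing_def * ..
    also have "\<dots> = 0" by (intro lim test_limit_indicator)
    finally show ?thesis .
  qed
  moreover have "(LINT x|lebesgue. z x) = 0"
  proof -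
    have "(LINT x|lebesgue. z x) = (LINT x|lebesgue_on (box a b). w x)"
      by (simp add: integral_restrict_space z_def)
    also have "\<dots> = pairing a b i w (\<lambda>t. 1) (\<lambda>t. 1)" by (simp add: pairing_def)
    also have "\<dots> = 0" by (intro lim test_limit_const)
    finally show ?thesis .
  qed
  ultimately have "AE x in lebesgue. z x = 0" using AE_zero_of_box_integrals[OF z] by blast
  then have "AE x in lebesgue. x \<in> box a b \<longrightarrow> w x = 0"
  proof eventually_elim
    case (elim x)
    then show ?case unfolding z_def by (cases "x \<in> box a b") simp_all
  qed
  then show ?thesis by (simp add: AE_restrict_space_iff)
qed

section \<open>Weak partial derivatives against piecewise smooth weights\<close>

text \<open>Weak differentiability tested with products only. It follows from the distributional
  definition, and its one-dimensional structure in direction \<open>i\<close> is what the trace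
  calculus uses.\<close>
definition weak_partial :: "plane \<Rightarrow> plane \<Rightarrow> 2 \<Rightarrow> (plane \<Rightarrow> real) \<Rightarrow> (plane \<Rightarrow> real) \<Rightarrow> bool" where
  "weak_partial a b i w g \<longleftrightarrow> w \<in> L2 (box a b) \<and> g \<in> L2 (box a b) \<and>
     (\<forall>q p. test1 (a $ i) (b $ i) q \<and> test1 (a $ co i) (b $ co i) p \<longrightarrow>
        pairing a b i w (deriv q) p = - pairing a b i g q p)"

lemma test1_zero_outside: "test1 a b f \<Longrightarrow> t \<notin> {a<..<b} \<Longrightarrow> f t = 0"
  unfolding test1_def by force

lemma test1_integral_limit:
  assumes Q: "\<And>n. test1 a b (Q n)" "\<And>n t. \<bar>Q n t\<bar> \<le> M"
      "\<And>t. t \<in> {a<..<b} \<Longrightarrow> (\<lambda>n. Q n t) \<longlonglongrightarrow> q t"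
    and q: "(q has_integral I) {a..t}" and t: "t \<in> {a..b}"
  shows "(\<lambda>n. integral {a..t} (Q n)) \<longlonglongrightarrow> I"
proof -
  let ?g = "\<lambda>s. if s \<in> {a<..<b} then q s else 0"
  have g: "(?g has_integral I) {a..t}"
    by (rule has_integral_spike_finite[OF _ _ q, of "{a, b}"]) (use t in auto)
  have "(\<lambda>n. integral {a..t} (Q n)) \<longlonglongrightarrow> integral {a..t} ?g"
  proof (rule dominated_convergence(2))
    show "Q n integrable_on {a..t}" for n
      by (rule integrable_continuous_real[OF smooth_continuous[OF test1_smooth[OF Q(1)]]])
    show "(\<lambda>s. M) integrable_on {a..t}" by (rule integrable_const_ivl)
    show "norm (Q n s) \<le> M" for n s using Q(2) by simp
    show "(\<lambda>n. Q n s) \<longlonglongrightarrow> ?g s" for s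
      using Q(3)[of s] test1_zero_outside[OF Q(1), of s] by (cases "s \<in> {a<..<b}") simp_all
  qed
  then show ?thesis using g by (simp add: integral_unique)
qed

lemma continuous_antiderivative:
  fixes f :: "real \<Rightarrow> real"
  assumes "continuous_on UNIV f"
  obtains F where "\<And>t. (F has_real_derivative f t) (at t)"
proof -
  have "\<exists>F. \<forall>x :: real. -\<infinity> < ereal x \<longrightarrow> ereal x < \<infinity> \<longrightarrow> (F has_vector_derivative f x) (at x)"
    by (rule einterval_antiderivative) (use assms in \<open>auto simp: continuous_on_eq_continuous_at\<close>)
  then show ?thesis using that by (auto simp: has_real_derivative_iff_has_vector_derivative)
qed

text \<open>The condition on the mean makes the primitive vanish near both ends.\<close>
lemma test1_primitive:
  assumes q: "test1 a b q" and zero: "integral {a..b} q = 0" and ab: "a < b"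
  obtains R where "test1 a b R" "deriv R = q" "\<And>t. t \<in> {a..b} \<Longrightarrow> R t = integral {a..t} q"
proof -
  obtain F where F: "\<And>t. (F has_real_derivative q t) (at t)"
    using continuous_antiderivative[OF smooth_continuous[OF test1_smooth[OF q]]] by blast
  define R where "R t = F t - F a" for t
  have R: "(R has_real_derivative q t) (at t)" for t
    unfolding R_def using F[of t] by (auto intro!: derivative_eq_intros)
  have eq: "R t = integral {a..t} q" if "t \<in> {a..b}" for t
  proof -
    have "(q has_integral R t - R a) {a..t}"
      using that R by (intro fundamental_theorem_of_calculus)
        (auto simp: has_real_derivative_iff_has_vector_derivative[symmetric] intro: has_field_derivative_at_within)
    then show ?thesis by (simp add: R_def integral_unique)
  qed
  obtain c d where cd: "a < c" "d < b" "\<And>t. q t \<noteq> 0 \<longrightarrow> c \<le> t \<and> t \<le> d"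
    using q unfolding test1_def by metis
  have const: "R t = R s" if "\<And>x. x \<in> {min s t<..<max s t} \<Longrightarrow> q x = 0" for s t
  proof (cases "s = t")
    case False
    then have "min s t < max s t" by auto
    moreover have "continuous_on {min s t..max s t} R"
      using R by (meson DERIV_isCont continuous_at_imp_continuous_on)
    moreover have "\<And>x. min s t < x \<Longrightarrow> x < max s t \<Longrightarrow> (R has_real_derivative 0) (at x)"
      using that R by (metis greaterThanLessThan_iff)
    ultimately have "R (max s t) = R (min s t)" using DERIV_isconst_end by blast
    then show ?thesis by (auto simp: max_def min_def split: if_splits)
  qed simp
  have Ra: "R a = 0" by (simp add: R_def)
  have Rb: "R b = 0" using eq[of b] zero ab by simp
  have low: "R t = 0" if "t < c" for t
    using const[of t a] that cd Ra by fastforce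
  have high: "R t = 0" if "t > d" for t
    using const[of t b] that cd Rb by fastforce
  have "test1 a b R"
    unfolding test1_def using smooth_antiderivative[OF R test1_smooth[OF q]] cd(1,2) low high not_le by blast
  moreover have "deriv R = q" using R by (auto intro: DERIV_imp_deriv)
  ultimately show ?thesis using that eq by blast
qed

text \<open>A weight \<open>q\<close> of mean zero is approximated by test functions that need not
  have mean zero themselves. A multiple of a fixed bump, tending to zero, corrects the mean, and
  then the primitives are test functions as well.\<close>
lemma test_limit_primitive:
  assumes ab: "a < b" and q: "test_limit a b q"
    and Q: "\<And>t. t \<in> {a<..<b} \<Longrightarrow> (q has_integral Q t) {a..t}"
    and Q0: "(q has_integral 0) {a..b}"
  obtains R M where "\<And>n. test1 a b (R n)" "\<And>n t. \<bar>R n t\<bar> \<le> M" "\<And>n t. \<bar>deriv (R n) t\<bar> \<le> M"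
    "\<And>t. t \<in> {a<..<b} \<Longrightarrow> (\<lambda>n. R n t) \<longlonglongrightarrow> Q t"
    "\<And>t. t \<in> {a<..<b} \<Longrightarrow> (\<lambda>n. deriv (R n) t) \<longlonglongrightarrow> q t"
proof -
  obtain P M where P: "\<And>n. test1 a b (P n)" "\<And>n t. \<bar>P n t\<bar> \<le> M"
      "\<And>t. t \<in> {a<..<b} \<Longrightarrow> (\<lambda>n. P n t) \<longlonglongrightarrow> q t"
    using q unfolding test_limit_def by metis
  have cutoff_abs: "\<bar>cutoff a b n t\<bar> \<le> 1" for n t
    using cutoff_bounds[of a b n t] by simp
  have "((\<lambda>t. 1::real) has_integral b - a) {a..b}"
    using has_integral_const_real[of "1::real" a b] ab by simp
  then have "(\<lambda>n. integral {a..b} (cutoff a b n)) \<longlonglongrightarrow> b - a"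
    using ab by (intro test1_integral_limit[OF cutoff_test1 cutoff_abs cutoff_limit]) auto
  then have "\<forall>\<^sub>F n in sequentially. integral {a..b} (cutoff a b n) > 0"
    using ab by (intro order_tendstoD(1)) auto
  then obtain N where N: "integral {a..b} (cutoff a b N) > 0"
    using eventually_happens by fastforce
  \<comment> \<open>The fixed bump that corrects the means of the approximations.\<close>
  define th where "th = cutoff a b N"
  define c where "c = integral {a..b} th"
  have c: "c > 0" using N by (simp add: c_def th_def)
  have th: "test1 a b th" "\<And>t. \<bar>th t\<bar> \<le> 1"
    using cutoff_test1 cutoff_abs by (simp_all add: th_def)
  define I where "I n = integral {a..b} (P n)" for n
  have I: "I \<longlonglongrightarrow> 0"
    unfolding I_def by (rule test1_integral_limit[OF P Q0]) (use ab in auto)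
  then obtain L where L: "\<And>n. \<bar>I n\<bar> \<le> L"
    using convergent_imp_Bseq[of I] unfolding convergent_def Bseq_def by (metis real_norm_def)
  define r where "r n t = P n t + (- I n / c) * th t" for n t
  have intble: "f integrable_on {s..t}" if "test1 a b f" for f s t
    by (rule integrable_continuous_real[OF smooth_continuous[OF test1_smooth[OF that]]])
  have r: "test1 a b (r n)" for n
    unfolding r_def
    using test1_add[OF P(1)[of n] test1_mult_smooth[OF th(1) smooth_const[of "- I n / c"]]]
    by (simp add: mult.commute)
  have "integral {a..b} (r n) = 0" for n
  proof -
    have "(r n has_integral I n + (- I n / c) * c) {a..b}"
      unfolding r_def I_def c_def
      by (intro has_integral_add has_integral_mult_right integrable_integral intble P th(1))
    then show ?thesis using c by (simp add: integral_unique)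
  qed
  then have "\<exists>R. test1 a b R \<and> deriv R = r n \<and> (\<forall>t\<in>{a..b}. R t = integral {a..t} (r n))" for n
    using test1_primitive[OF r _ ab] by metis
  then obtain R where R: "\<And>n. test1 a b (R n)" "\<And>n. deriv (R n) = r n"
      "\<And>n t. t \<in> {a..b} \<Longrightarrow> R n t = integral {a..t} (r n)" by metis
  define K where "K = M + L / c"
  have K: "\<bar>r n t\<bar> \<le> K" for n t
  proof -
    have "\<bar>r n t\<bar> \<le> \<bar>P n t\<bar> + \<bar>(- I n / c) * th t\<bar>" unfolding r_def by (rule abs_triangle_ineq)
    also have "\<bar>(- I n / c) * th t\<bar> \<le> (L / c) * 1"
      unfolding abs_mult using L[of n] c th(2) order_trans[OF abs_ge_zero L[of n]] by (intro mult_mono) (auto simp: divide_right_mono)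
    finally show ?thesis using P(2)[of n t] by (simp add: K_def)
  qed
  have K0: "0 \<le> K" using K[of 0 0] by linarith
  have lim_r: "(\<lambda>n. r n t) \<longlonglongrightarrow> q t" if "t \<in> {a<..<b}" for t
  proof -
    have "(\<lambda>n. P n t + (- I n / c) * th t) \<longlonglongrightarrow> q t + (- 0 / c) * th t"
      by (intro tendsto_intros P(3) that I) (use c in auto)
    then show ?thesis by (simp add: r_def)
  qed
  have lim_R: "(\<lambda>n. R n t) \<longlonglongrightarrow> Q t" if "t \<in> {a<..<b}" for t
    using test1_integral_limit[OF r K lim_r Q[OF that]] that R(3) by simp
  have RK: "\<bar>R n t\<bar> \<le> K * (b - a)" for n t
  proof (cases "t \<in> {a<..<b}")
    case True
    have "norm (integral {a..t} (r n)) \<le> K * (t - a)"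
      by (rule integral_bound) (use True K in \<open>auto intro!: smooth_continuous test1_smooth[OF r]\<close>)
    also have "\<dots> \<le> K * (b - a)" using True K0 by (intro mult_left_mono) auto
    finally show ?thesis using R(3)[of t n] True by simp
  qed (use test1_zero_outside[OF R(1)] K0 ab in simp)
  show ?thesis
    by (rule that[of R "max K (K * (b - a))"]) (use R(1,2) RK K lim_R lim_r in \<open>auto simp: le_max_iff_disj\<close>)
qed

text \<open>Since the primitive \<open>Q\<close> vanishes at both ends of the interval, no boundary
  terms appear, and the weights may be discontinuous. The traces below
  and their integration by parts formula rest on this identity.\<close>
lemma weak_partial_extended:
  assumes wp: "weak_partial a b i w g" and ab: "a $ i < b $ i"
    and q: "test_limit (a $ i) (b $ i) q"
    and Q: "\<And>t. t \<in> {a $ i<..<b $ i} \<Longrightarrow> (q has_integral Q t) {a $ i..t}"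
    and Q0: "(q has_integral 0) {a $ i..b $ i}"
    and p: "test_limit (a $ co i) (b $ co i) p"
  shows "pairing a b i w q p = - pairing a b i g Q p"
proof -
  have w: "w \<in> L2 (box a b)" "g \<in> L2 (box a b)" using wp by (auto simp: weak_partial_def)
  obtain R M where R: "\<And>n. test1 (a $ i) (b $ i) (R n)" "\<And>n t. \<bar>R n t\<bar> \<le> M" "\<And>n t. \<bar>deriv (R n) t\<bar> \<le> M"
    "\<And>t. t \<in> {a $ i<..<b $ i} \<Longrightarrow> (\<lambda>n. R n t) \<longlonglongrightarrow> Q t"
    "\<And>t. t \<in> {a $ i<..<b $ i} \<Longrightarrow> (\<lambda>n. deriv (R n) t) \<longlonglongrightarrow> q t"
    using test_limit_primitive[OF ab q Q Q0] by metis
  obtain P N where P: "\<And>n. test1 (a $ co i) (b $ co i) (P n)" "\<And>n t. \<bar>P n t\<bar> \<le> N"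
      "\<And>t. t \<in> {a $ co i<..<b $ co i} \<Longrightarrow> (\<lambda>n. P n t) \<longlonglongrightarrow> p t"
    using p unfolding test_limit_def by metis
  have l1: "(\<lambda>n. pairing a b i w (deriv (R n)) (P n)) \<longlonglongrightarrow> pairing a b i w q p"
    by (rule pairing_limit[OF w(1) test1_deriv[OF R(1)] R(3,5) P])
  have l2: "(\<lambda>n. - pairing a b i g (R n) (P n)) \<longlonglongrightarrow> - pairing a b i g Q p"
    by (rule tendsto_minus[OF pairing_limit[OF w(2) R(1,2,4) P]])
  have "(\<lambda>n. pairing a b i w (deriv (R n)) (P n)) = (\<lambda>n. - pairing a b i g (R n) (P n))"
    using wp R(1) P(1) unfolding weak_partial_def by blast
  then show ?thesis using l1 l2 LIMSEQ_unique by metis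
qed

section \<open>Traces\<close>

text \<open>Functionals on one-dimensional weights that ignore finitely many points, such as an
  integral of a fixed function against the weight. The abstraction is used twice: for integrals
  over the domain and, to reach vertex values, for traces on lines.\<close>
definition weight_linear :: "real \<Rightarrow> real \<Rightarrow> ((real \<Rightarrow> real) \<Rightarrow> real) \<Rightarrow> bool" where
  "weight_linear a b L \<longleftrightarrow>
     (\<forall>f g. test_limit a b f \<and> test_limit a b g \<longrightarrow> L (\<lambda>t. f t + g t) = L f + L g) \<and>
     (\<forall>c f. test_limit a b f \<longrightarrow> L (\<lambda>t. c * f t) = c * L f) \<and>
     (\<forall>f g. test_limit a b f \<and> test_limit a b g \<and> finite {t \<in> {a<..<b}. f t \<noteq> g t} \<longrightarrow> L f = L g)"

lemma weight_linearD:
  assumes "weight_linear a b L"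
  shows "test_limit a b f \<Longrightarrow> test_limit a b g \<Longrightarrow> L (\<lambda>t. f t + g t) = L f + L g"
    and "test_limit a b f \<Longrightarrow> L (\<lambda>t. c * f t) = c * L f"
    and "test_limit a b f \<Longrightarrow> test_limit a b g \<Longrightarrow> finite {t \<in> {a<..<b}. f t \<noteq> g t} \<Longrightarrow> L f = L g"
  using assms unfolding weight_linear_def by blast+

text \<open>\<open>L\<close> and \<open>L'\<close> behave like integration of a function and of its
  derivative against a weight.\<close>
definition weak_pair :: "real \<Rightarrow> real \<Rightarrow> ((real \<Rightarrow> real) \<Rightarrow> real) \<Rightarrow> ((real \<Rightarrow> real) \<Rightarrow> real) \<Rightarrow> bool" where
  "weak_pair a b L L' \<longleftrightarrow> weight_linear a b L \<and> weight_linear a b L' \<and>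
     (\<forall>q Q. test_limit a b q \<and> test_limit a b Q \<and>
        (\<forall>t\<in>{a<..<b}. (q has_integral Q t) {a..t}) \<and> (q has_integral 0) {a..b} \<longrightarrow> L q = - L' Q)"

text \<open>The kernel of the representation \<open>(b - a) w(t) = \<integral>w + \<integral>k
  w'\<close> with \<open>k(s) = s - a\<close> for \<open>s < t\<close> and \<open>k(s) = s -
  b\<close> otherwise. The right-hand side makes sense for a weakly differentiable \<open>w\<close>
  and is taken as the definition of its value at \<open>t\<close>.\<close>
definition trace_kernel :: "real \<Rightarrow> real \<Rightarrow> real \<Rightarrow> real \<Rightarrow> real" where
  "trace_kernel a b t s = (if s < t then s - a else s - b)"

definition weak_trace :: "real \<Rightarrow> real \<Rightarrow> ((real \<Rightarrow> real) \<Rightarrow> real) \<Rightarrow> ((real \<Rightarrow> real) \<Rightarrow> real) \<Rightarrow> real \<Rightarrow> real" where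
  "weak_trace a b L L' t = (L (\<lambda>s. 1) + L' (trace_kernel a b t)) / (b - a)"

lemma test_limit_trace_kernel: "test_limit a b (trace_kernel a b t)"
proof -
  have "(\<lambda>s. (s - b) + (b - a) * (if s < t then 1 else 0)) = trace_kernel a b t"
    by (auto simp: trace_kernel_def)
  then show ?thesis
    using test_limit_add[OF test_limit_diff[OF test_limit_ident test_limit_const[of a b b]]
        test_limit_cmult[OF test_limit_less[of a b t], of "b - a"]] by simp
qed

lemma has_integral_indicator_deriv:
  assumes P: "\<And>s. (P has_real_derivative P' s) (at s)" and lr: "a \<le> l" "l \<le> r" "a \<le> t"
  shows "((\<lambda>s. indicator {l<..<r} s * P' s) has_integral
    (if t \<le> l then 0 else P (min r t) - P l)) {a..t}"
proof (cases "t \<le> l")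
  case True
  have "((\<lambda>s. 0) has_integral 0) {a..t}" by simp
  then have "((\<lambda>s. indicator {l<..<r} s * P' s) has_integral 0) {a..t}"
    by (rule has_integral_eq[rotated]) (use True in auto)
  then show ?thesis using True by simp
next
  case False
  define u where "u = min r t"
  have u: "l \<le> u" using False lr by (simp add: u_def)
  have "(P' has_integral P u - P l) {l..u}"
    using u P by (intro fundamental_theorem_of_calculus)
      (auto simp: has_real_derivative_iff_has_vector_derivative[symmetric] intro: has_field_derivative_at_within)
  then have "((\<lambda>s. indicator {l<..<u} s * P' s) has_integral P u - P l) {l..u}"
    by (rule has_integral_spike_finite[of "{l, u}", rotated 2]) auto
  then have "((\<lambda>s. indicator {l<..<u} s * P' s) has_integral P u - P l) {a..t}"
    by (rule has_integral_on_superset) (use lr in \<open>auto simp: u_def\<close>)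
  then have "((\<lambda>s. indicator {l<..<r} s * P' s) has_integral P u - P l) {a..t}"
    by (rule has_integral_spike_finite[of "{t}", rotated 2]) (auto simp: u_def indicator_def)
  then show ?thesis using False by (simp add: u_def)
qed

text \<open>On a subinterval, integration by parts holds with the trace as boundary value. To see
  this, subtract from the weight \<open>1_(l,r) P'\<close> its mean \<open>c\<close>: the primitive
  of the difference is a combination of the indicator and of the trace kernel at \<open>r\<close>,
  so the weak derivative identity applies, and the kernels at \<open>l\<close> and \<open>r\<close>
  differ by a multiple of the indicator.\<close>
lemma trace_by_parts:
  assumes wp: "weak_pair a b L L'" and lr: "a \<le> l" "l < r" "r \<le> b"
    and P: "smooth P"
  shows "L' (\<lambda>s. indicator {l<..<r} s * P s) + L (\<lambda>s. indicator {l<..<r} s * deriv P s)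
    = P r * weak_trace a b L L' r - P l * weak_trace a b L L' l"
proof -
  let ?k = "trace_kernel a b" and ?I = "indicat_real {l<..<r}"
  define c where "c = (P r - P l) / (b - a)"
  have ab: "b - a > 0" using lr by simp
  have lin: "weight_linear a b L" "weight_linear a b L'" using wp by (auto simp: weak_pair_def)
  have tl: "test_limit a b ?I" "test_limit a b (\<lambda>s. ?I s * P s)" "test_limit a b (\<lambda>s. ?I s * deriv P s)"
    "test_limit a b (?k t)" for t
    by (intro test_limit_mult test_limit_indicator test_limit_smooth P smooth_deriv test_limit_trace_kernel)+
  have tlc: "test_limit a b (\<lambda>s. c * 1)" for c by (intro test_limit_const)
  \<comment> \<open>The primitive of \<open>q\<close> that vanishes at \<open>a\<close> is \<open>Q\<close>.\<close>
  define q where "q s = ?I s * deriv P s + (- c) * 1" for s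
  define Q where "Q s = ?I s * P s + ((- P l) * ?I s + (- c) * ?k r s)" for s
  have tq: "test_limit a b q" "test_limit a b Q"
    unfolding q_def Q_def by (intro test_limit_add tl test_limit_cmult test_limit_const)+
  have q_int: "(q has_integral (if t \<le> l then 0 else P (min r t) - P l) - c * (t - a)) {a..t}"
    if "a \<le> t" for t
  proof -
    have "((\<lambda>s. (- c) * 1) has_integral (- c * (t - a))) {a..t}"
      using has_integral_const_real[of "- c" a t] that by (simp add: mult.commute)
    from has_integral_add[OF has_integral_indicator_deriv[OF smooth_has_deriv[OF P] lr(1) less_imp_le[OF lr(2)] that] this]
    show ?thesis unfolding q_def by simp
  qed
  have "(q has_integral Q t) {a..t}" if "t \<in> {a<..<b}" for t
  proof -
    have "Q t = (if t \<le> l then 0 else P (min r t) - P l) - c * (t - a)"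
    proof -
      consider "t \<le> l" | "l < t" "t < r" | "r \<le> t" by linarith
      then show ?thesis
      proof cases
        case 3
        have "c * (b - a) = P r - P l" using ab by (simp add: c_def)
        then show ?thesis using 3 lr by (simp add: Q_def trace_kernel_def min_def algebra_simps)
      qed (use lr in \<open>auto simp: Q_def trace_kernel_def min_def algebra_simps\<close>)
    qed
    then show ?thesis using q_int[of t] that by simp
  qed
  moreover have "(q has_integral 0) {a..b}"
  proof -
    have "c * (b - a) = P r - P l" using ab by (simp add: c_def)
    then show ?thesis using q_int[of b] lr by (simp add: min_def)
  qed
  ultimately have "L q = - L' Q" using wp tq unfolding weak_pair_def by blast
  moreover have "L q = L (\<lambda>s. ?I s * deriv P s) + L (\<lambda>s. (- c) * 1)"
    unfolding q_def using lin(1) tl(3) tlc unfolding weight_linear_def by blast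
  moreover have "L (\<lambda>s. (- c) * 1) = (- c) * L (\<lambda>s. 1)"
    using lin(1) test_limit_const unfolding weight_linear_def by blast
  moreover have "L' Q = L' (\<lambda>s. ?I s * P s) + L' (\<lambda>s. (- P l) * ?I s + (- c) * ?k r s)"
    unfolding Q_def using lin(2) tl(2) test_limit_add[OF test_limit_cmult[OF tl(1)] test_limit_cmult[OF tl(4)]]
    unfolding weight_linear_def by blast
  moreover have "L' (\<lambda>s. (- P l) * ?I s + (- c) * ?k r s) = L' (\<lambda>s. (- P l) * ?I s) + L' (\<lambda>s. (- c) * ?k r s)"
    using lin(2) test_limit_cmult[OF tl(1)] test_limit_cmult[OF tl(4)] unfolding weight_linear_def by blast
  moreover have "L' (\<lambda>s. (- P l) * ?I s) = (- P l) * L' ?I" "L' (\<lambda>s. (- c) * ?k r s) = (- c) * L' (?k r)"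
    using lin(2) tl(1,4) unfolding weight_linear_def by blast+
  moreover have "(b - a) * L' ?I = L' (?k r) - L' (?k l)"
  proof -
    have "L' (?k r) = L' (\<lambda>s. ?k l s + (b - a) * ?I s)"
    proof -
      have "{t \<in> {a<..<b}. ?k r t \<noteq> ?k l t + (b - a) * ?I t} \<subseteq> {l}"
        using lr by (auto simp: trace_kernel_def indicator_def)
      then have "finite {t \<in> {a<..<b}. ?k r t \<noteq> ?k l t + (b - a) * ?I t}" by (rule finite_subset) simp
      then show ?thesis
        by (intro weight_linearD(3)[OF lin(2)] test_limit_add test_limit_cmult tl)
    qed
    also have "\<dots> = L' (?k l) + L' (\<lambda>s. (b - a) * ?I s)"
      using lin(2) tl(4) test_limit_cmult[OF tl(1)] unfolding weight_linear_def by blast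
    also have "L' (\<lambda>s. (b - a) * ?I s) = (b - a) * L' ?I"
      using lin(2) tl(1) unfolding weight_linear_def by blast
    finally show ?thesis by simp
  qed
  ultimately have main: "L' (\<lambda>s. ?I s * P s) + L (\<lambda>s. ?I s * deriv P s) = c * L (\<lambda>s. 1) + c * L' (?k r) + P l * L' ?I"
    and I: "L' ?I = (L' (?k r) - L' (?k l)) / (b - a)"
    using ab by (simp_all add: field_simps)
  have "(pr - pl) / D * x + (pr - pl) / D * y + pl * ((y - z) / D) = pr * ((x + y) / D) - pl * ((x + z) / D)"
    if "D > 0" for pr pl x y z D :: real using that by (simp add: field_simps)
  from this[OF ab] show ?thesis unfolding main unfolding weak_trace_def c_def I .
qed

lemma AE_coordinate_notin_finite:
  fixes U :: "plane set"
  assumes "finite N" "U \<in> sets lebesgue" shows "AE x in lebesgue_on U. x $ i \<notin> N"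
proof -
  have "negligible {x::plane. x $ i = c}" for c
    using negligible_hyperplane[of "axis i 1 :: plane" c] by (simp add: inner_axis' axis_eq_0_iff)
  then have "negligible (\<Union>c\<in>N. {x::plane. x $ i = c})" using assms by (intro negligible_Union) auto
  then have "AE x in lebesgue. x \<notin> (\<Union>c\<in>N. {x::plane. x $ i = c})"
    by (intro AE_not_in) (simp add: negligible_iff_null_sets)
  then have "AE x in lebesgue. x \<in> U \<longrightarrow> x $ i \<notin> N" by (rule AE_mp) auto
  then show ?thesis using assms(2) by (simp add: AE_restrict_space_iff)
qed

lemma pairing_weight_L2:
  assumes w: "w \<in> L2 (box a b)" and q: "test_limit (a $ i) (b $ i) q" and p: "test_limit (a $ co i) (b $ co i) p"
  shows "(\<lambda>x. q (x $ i) * p (x $ co i) * w x) \<in> L2 (box a b)"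
proof -
  obtain M where M: "0 \<le> M" "\<And>t. t \<in> {a $ i<..<b $ i} \<Longrightarrow> \<bar>q t\<bar> \<le> M" using test_limit_bounded[OF q] by blast
  obtain N where N: "0 \<le> N" "\<And>t. t \<in> {a $ co i<..<b $ co i} \<Longrightarrow> \<bar>p t\<bar> \<le> N" using test_limit_bounded[OF p] by blast
  show ?thesis
  proof (rule L2_bounded_mult[OF w])
    show "(\<lambda>x. q (x $ i) * p (x $ co i)) \<in> borel_measurable (lebesgue_on (box a b))"
      by (intro borel_measurable_times test_limit_measurable q p)
    show "\<bar>q (x $ i) * p (x $ co i)\<bar> \<le> M * N" if "x \<in> box a b" for x
      unfolding abs_mult by (intro mult_mono M N box_nthD[OF that]) auto
  qed
qed

lemma pairing_integrable:
  assumes "w \<in> L2 (box a b)" "test_limit (a $ i) (b $ i) q" "test_limit (a $ co i) (b $ co i) p"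
  shows "integrable (lebesgue_on (box a b)) (\<lambda>x. q (x $ i) * p (x $ co i) * w x)"
  by (rule L2_integrable[OF lmeasurable_box pairing_weight_L2[OF assms]])

lemma pairing_cong:
  assumes w: "w \<in> L2 (box a b)" and p: "test_limit (a $ co i) (b $ co i) p"
    and f: "test_limit (a $ i) (b $ i) f" and g: "test_limit (a $ i) (b $ i) g"
    and fin: "finite {t \<in> {a $ i<..<b $ i}. f t \<noteq> g t}"
  shows "pairing a b i w f p = pairing a b i w g p"
proof -
  let ?N = "{t \<in> {a $ i<..<b $ i}. f t \<noteq> g t}"
  have "AE x in lebesgue_on (box a b). f (x $ i) * p (x $ co i) * w x = g (x $ i) * p (x $ co i) * w x"
  proof (rule AE_mp[OF AE_coordinate_notin_finite[OF fin]])
    show "AE x in lebesgue_on (box a b). x $ i \<notin> ?N \<longrightarrow>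
        f (x $ i) * p (x $ co i) * w x = g (x $ i) * p (x $ co i) * w x"
      by (rule AE_I2) (use box_nthD[of _ a b i] in auto)
  qed simp
  then show ?thesis unfolding pairing_def
    by (rule integral_cong_AE[rotated 2])
       (intro borel_measurable_integrable pairing_integrable w f g p)+
qed

lemma weight_linear_pairing:
  assumes w: "w \<in> L2 (box a b)" and p: "test_limit (a $ co i) (b $ co i) p"
  shows "weight_linear (a $ i) (b $ i) (\<lambda>q. pairing a b i w q p)"
  unfolding weight_linear_def
proof (intro conjI allI impI)
  fix f g assume "test_limit (a $ i) (b $ i) f \<and> test_limit (a $ i) (b $ i) g"
  then show "pairing a b i w (\<lambda>t. f t + g t) p = pairing a b i w f p + pairing a b i w g p"
    using pairing_integrable[OF w _ p] by (simp add: pairing_def distrib_right)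
next
  fix c f
  show "pairing a b i w (\<lambda>t. c * f t) p = c * pairing a b i w f p"
    by (simp add: pairing_def mult.assoc)
next
  fix f g assume "test_limit (a $ i) (b $ i) f \<and> test_limit (a $ i) (b $ i) g \<and>
    finite {t \<in> {a $ i<..<b $ i}. f t \<noteq> g t}"
  then show "pairing a b i w f p = pairing a b i w g p"
    by (intro pairing_cong[OF w p]) auto
qed

lemma weak_partial_L2: "weak_partial a b i w g \<Longrightarrow> w \<in> L2 (box a b)" "weak_partial a b i w g \<Longrightarrow> g \<in> L2 (box a b)"
  by (simp_all add: weak_partial_def)

lemma weak_pair_pairing:
  assumes wp: "weak_partial a b i w g" and ab: "a $ i < b $ i" and p: "test_limit (a $ co i) (b $ co i) p"
  shows "weak_pair (a $ i) (b $ i) (\<lambda>q. pairing a b i w q p) (\<lambda>q. pairing a b i g q p)"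
  unfolding weak_pair_def
  using weight_linear_pairing[OF weak_partial_L2(1)[OF wp] p] weight_linear_pairing[OF weak_partial_L2(2)[OF wp] p]
    weak_partial_extended[OF wp ab _ _ _ p] by blast

text \<open>The integral of \<open>w p\<close> over the line on which coordinate \<open>i\<close>
  equals \<open>t\<close>, for weakly differentiable \<open>w\<close>.\<close>
definition line_trace :: "plane \<Rightarrow> plane \<Rightarrow> 2 \<Rightarrow> (plane \<Rightarrow> real) \<Rightarrow> (plane \<Rightarrow> real) \<Rightarrow> (real \<Rightarrow> real) \<Rightarrow> real \<Rightarrow> real" where
  "line_trace a b i w g p = weak_trace (a $ i) (b $ i) (\<lambda>q. pairing a b i w q p) (\<lambda>q. pairing a b i g q p)"

lemma weight_linear_add:
  "weight_linear a b L \<Longrightarrow> weight_linear a b L' \<Longrightarrow> weight_linear a b (\<lambda>f. (L f + L' f) / c)"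
  unfolding weight_linear_def
proof (intro conjI allI impI, goal_cases)
  case (1 f g)
  then show ?case by (simp add: add_divide_distrib)
next
  case (2 d f)
  then show ?case by (simp add: distrib_left)
next
  case (3 f g)
  then have "L f = L g" "L' f = L' g" by blast+
  then show ?case by simp
qed

text \<open>With both first derivatives and the mixed one, the restriction of \<open>w\<close> to a
  line is again weakly differentiable along the line. Traces of traces therefore exist; they are
  point values.\<close>
lemma weak_pair_line_trace:
  assumes w: "weak_partial a b i w wi" and wj: "weak_partial a b (co i) w wj"
    and wij: "weak_partial a b (co i) wi wij" and wji: "weak_partial a b i wj wij"
    and ab: "a $ co i < b $ co i"
  shows "weak_pair (a $ co i) (b $ co i) (\<lambda>p. line_trace a b i w wi p t) (\<lambda>p. line_trace a b i wj wij p t)"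
proof -
  have L2: "w \<in> L2 (box a b)" "wi \<in> L2 (box a b)" "wj \<in> L2 (box a b)" "wij \<in> L2 (box a b)"
    using w wj wij by (auto simp: weak_partial_def)
  have lin: "weight_linear (a $ co i) (b $ co i) (\<lambda>p. pairing a b i v q p)"
    if "v \<in> L2 (box a b)" "test_limit (a $ i) (b $ i) q" for v q
    using weight_linear_pairing[of v a b "co i" q] that by (simp add: pairing_swap)
  have k: "test_limit (a $ i) (b $ i) (trace_kernel (a $ i) (b $ i) t)" "test_limit (a $ i) (b $ i) (\<lambda>s. 1)"
    by (intro test_limit_trace_kernel test_limit_const)+
  have ext: "pairing a b i v q p = - pairing a b i v' q P"
    if "weak_partial a b (co i) v v'" "test_limit (a $ i) (b $ i) q" "test_limit (a $ co i) (b $ co i) p"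
      "\<forall>t\<in>{a $ co i<..<b $ co i}. (p has_integral P t) {a $ co i..t}" "(p has_integral 0) {a $ co i..b $ co i}"
    for v v' q p P
    using weak_partial_extended[OF that(1) ab that(3) _ that(5), of P q] that(2,4) by (simp add: pairing_swap)
  show ?thesis
    unfolding weak_pair_def line_trace_def weak_trace_def
  proof (intro conjI allI impI)
    show "weight_linear (a $ co i) (b $ co i) (\<lambda>p. (pairing a b i w (\<lambda>s. 1) p +
        pairing a b i wi (trace_kernel (a $ i) (b $ i) t) p) / (b $ i - a $ i))"
      by (intro weight_linear_add lin L2 k)
    show "weight_linear (a $ co i) (b $ co i) (\<lambda>p. (pairing a b i wj (\<lambda>s. 1) p +
        pairing a b i wij (trace_kernel (a $ i) (b $ i) t) p) / (b $ i - a $ i))"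
      by (intro weight_linear_add lin L2 k)
    fix q Q
    assume "test_limit (a $ co i) (b $ co i) q \<and> test_limit (a $ co i) (b $ co i) Q \<and>
       (\<forall>t\<in>{a $ co i<..<b $ co i}. (q has_integral Q t) {a $ co i..t}) \<and> (q has_integral 0) {a $ co i..b $ co i}"
    then have "pairing a b i w (\<lambda>s. 1) q = - pairing a b i wj (\<lambda>s. 1) Q"
      "pairing a b i wi (trace_kernel (a $ i) (b $ i) t) q = - pairing a b i wij (trace_kernel (a $ i) (b $ i) t) Q"
      using ext[OF wj k(2), of q Q] ext[OF wij k(1), of q Q] by blast+
    then show "(pairing a b i w (\<lambda>s. 1) q + pairing a b i wi (trace_kernel (a $ i) (b $ i) t) q) / (b $ i - a $ i) =
       - ((pairing a b i wj (\<lambda>s. 1) Q + pairing a b i wij (trace_kernel (a $ i) (b $ i) t) Q) / (b $ i - a $ i))"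
      by (simp only: minus_add_distrib[symmetric] minus_divide_left)
  qed
qed

lemma box_subset_box_cart_le:
  fixes a :: plane
  assumes "\<And>k. a $ k \<le> l $ k" "\<And>k. r $ k \<le> b $ k" shows "box l r \<subseteq> box a b"
proof
  fix x assume "x \<in> box l r"
  then have "l $ k < x $ k" "x $ k < r $ k" for k by (auto simp: mem_box_cart)
  then show "x \<in> box a b" using assms unfolding mem_box_cart by (meson le_less_trans less_le_trans)
qed

lemma pairing_element:
  assumes lr: "\<And>k. a $ k \<le> l $ k" "\<And>k. r $ k \<le> b $ k"
  shows "pairing a b i w (\<lambda>s. indicator {l $ i<..<r $ i} s * P s) (\<lambda>s. indicator {l $ co i<..<r $ co i} s * R s)
    = (LINT x|lebesgue_on (box l r). P (x $ i) * R (x $ co i) * w x)"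
proof -
  have sub: "box l r \<subseteq> box a b" using lr by (rule box_subset_box_cart_le)
  have eq: "indicator (box a b) x *\<^sub>R (indicator {l $ i<..<r $ i} (x $ i) * P (x $ i) *
      (indicator {l $ co i<..<r $ co i} (x $ co i) * R (x $ co i)) * w x)
    = indicator (box l r) x *\<^sub>R (P (x $ i) * R (x $ co i) * w x)" for x
  proof (cases "x \<in> box l r")
    case True
    then show ?thesis using sub box_mem_iff[of x l r i] by auto
  next
    case False
    then show ?thesis using box_mem_iff[of x l r i] by (auto simp: indicator_def)
  qed
  show ?thesis unfolding pairing_def
    by (subst (1 2) integral_restrict_space) (simp_all only: eq, simp_all)
qed

section \<open>The Poincare inequality on a rectangle\<close>

text \<open>Fubini is applied to a Borel representative, since slices of Lebesgue measurable
  functions need not be measurable.\<close>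
lemma L2_borel_version:
  fixes v :: "plane \<Rightarrow> real"
  assumes v: "v \<in> L2 (box l r)"
  obtains f where "f \<in> borel_measurable borel" "\<And>x. x \<notin> box l r \<Longrightarrow> f x = 0"
    "AE x in lebesgue_on (box l r). v x = f x"
proof -
  have "(\<lambda>x. indicator (box l r) x * v x) \<in> borel_measurable lebesgue"
    using L2_measurable[OF v] borel_measurable_restrict_space_iff[of "box l r" lebesgue v]
    by (simp add: mult.commute)
  then obtain u where u: "u \<in> borel_measurable lborel" "AE x in lborel. indicator (box l r) x * v x = u x"
    using completion_ex_borel_measurable_real by blast
  have [measurable]: "u \<in> borel_measurable borel" using u(1) by simp
  have "AE x in lebesgue. indicator (box l r) x * v x = u x" using u(2) by (rule AE_completion)
  then have "AE x in lebesgue. x \<in> box l r \<longrightarrow> v x = indicator (box l r) x * u x"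
    by eventually_elim (auto simp: indicator_def)
  then have "AE x in lebesgue_on (box l r). v x = indicator (box l r) x * u x"
    by (simp add: AE_restrict_space_iff)
  moreover have "(\<lambda>x. indicator (box l r) x * u x) \<in> borel_measurable borel" by measurable
  ultimately show ?thesis using that by fastforce
qed

lemma borel_measurable_lebesgue_on: "f \<in> borel_measurable borel \<Longrightarrow> f \<in> borel_measurable (lebesgue_on U)"
  by (rule measurable_restrict_space1) (simp add: measurable_completion)

lemma integral_box_lborel:
  fixes F :: "plane \<Rightarrow> real"
  assumes "F \<in> borel_measurable borel" "\<And>x. x \<notin> box l r \<Longrightarrow> F x = 0"
  shows "(LINT x|lebesgue_on (box l r). F x) = (LINT x|lborel. F x)"
    and "integrable (lebesgue_on (box l r)) F \<longleftrightarrow> integrable lborel F"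
proof -
  show "(LINT x|lebesgue_on (box l r). F x) = (LINT x|lborel. F x)"
    using integral_lebesgue_on_UNIV[of "box l r" F] assms by (simp add: integral_completion)
  have "(\<lambda>x. indicator (box l r) x *\<^sub>R F x) = F"
  proof
    show "indicator (box l r) x *\<^sub>R F x = F x" for x using assms(2)[of x] by (cases "x \<in> box l r") auto
  qed
  then show "integrable (lebesgue_on (box l r)) F \<longleftrightarrow> integrable lborel F"
    using assms(1) by (simp add: integrable_restrict_space integrable_completion)
qed

lemma ennreal_abs_integral_le:
  fixes f :: "'a \<Rightarrow> real"
  shows "ennreal \<bar>LINT x|M. f x\<bar> \<le> (\<integral>\<^sup>+x. ennreal \<bar>f x\<bar> \<partial>M)"
proof (cases "integrable M f")
  case True
  then show ?thesis using integral_norm_bound_ennreal[of M f] by simp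
qed (simp add: not_integrable_integral_eq)

lemma integrable_pair_mult:
  fixes g f :: "real \<Rightarrow> real"
  assumes g: "integrable lborel g" and f: "integrable lborel f"
  shows "integrable (lborel \<Otimes>\<^sub>M lborel) (\<lambda>(x, y). g x * f y)"
proof (rule lborel_pair.Fubini_integrable)
  have [measurable]: "g \<in> borel_measurable borel" "f \<in> borel_measurable borel"
    using f g borel_measurable_integrable by fastforce+
  show "(\<lambda>(x, y). g x * f y) \<in> borel_measurable (lborel \<Otimes>\<^sub>M lborel)" by measurable
  show "integrable lborel (\<lambda>x. LINT y|lborel. norm (case (x, y) of (x, y) \<Rightarrow> g x * f y))"
    using g f by (simp add: abs_mult)
  show "AE x in lborel. integrable lborel (\<lambda>y. case (x, y) of (x, y) \<Rightarrow> g x * f y)"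
    using f by simp
qed

lemma slice_measurable:
  assumes "f \<in> borel_measurable borel"
  shows "(\<lambda>(t, s). f (emb i s t)) \<in> borel_measurable (lborel \<Otimes>\<^sub>M lborel)"
proof -
  have "(\<lambda>z. case (snd z, fst z) of (s, t) \<Rightarrow> emb i s t) \<in> measurable (lborel \<Otimes>\<^sub>M lborel) borel"
    by (rule measurable_compose[OF _ emb_measurable]) simp
  from measurable_compose[OF this assms] show ?thesis by (simp add: case_prod_beta)
qed

text \<open>An integral operator acting along the lines in direction \<open>i\<close>, with a
  bounded kernel. Cauchy--Schwarz on each line gives the norm bound; Fubini moves the operator onto
  the weight. The operator is described only by its action on weights, which is the form in which
  weak derivatives are available.\<close>
lemma slice_operator:
  fixes k :: "real \<Rightarrow> real \<Rightarrow> real" and l r :: plane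
  assumes lr: "l $ i < r $ i"
    and k: "(\<lambda>(x, s). k x s) \<in> borel_measurable (borel \<Otimes>\<^sub>M borel)"
    and B: "\<And>x s. x \<in> {l $ i<..<r $ i} \<Longrightarrow> s \<in> {l $ i<..<r $ i} \<Longrightarrow> \<bar>k x s\<bar> \<le> B"
    and v: "v \<in> L2 (box l r)"
  obtains u where "u \<in> L2 (box l r)" "L2_norm (box l r) u \<le> B * (r $ i - l $ i) * L2_norm (box l r) v"
    "\<forall>q p M N. q \<in> borel_measurable borel \<longrightarrow> p \<in> borel_measurable borel \<longrightarrow>
      (\<forall>t. \<bar>q t\<bar> \<le> M) \<longrightarrow> (\<forall>t. \<bar>p t\<bar> \<le> N) \<longrightarrow>
      pairing l r i u q p =
        pairing l r i v (\<lambda>s. LINT x|lborel. indicator {l $ i<..<r $ i} x * (q x * k x s)) p"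
proof -
  let ?I = "{l $ i<..<r $ i}" and ?h = "r $ i - l $ i" and ?K = "box l r"
  obtain f where f [measurable]: "f \<in> borel_measurable borel" and f0: "\<And>x. x \<notin> ?K \<Longrightarrow> f x = 0"
    and vf: "AE x in lebesgue_on ?K. v x = f x" using L2_borel_version[OF v] by blast
  have fL: "f \<in> borel_measurable (lebesgue_on ?K)" by (rule borel_measurable_lebesgue_on) simp
  \<comment> \<open>The kernel is extended by zero, so that all line integrals run over the whole line.\<close>
  define kk where "kk x s = indicator ?I x * (indicator ?I s * k x s)" for x s
  have [measurable]: "(\<lambda>(x, s). k x s) \<in> borel_measurable (borel \<Otimes>\<^sub>M borel)" by (rule k)
  have kk [measurable]: "(\<lambda>(x, s). kk x s) \<in> borel_measurable (borel \<Otimes>\<^sub>M borel)"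
    unfolding kk_def by (use k in \<open>simp add: case_prod_beta\<close>)
  have B0: "0 \<le> B" using B[of "(l $ i + r $ i) / 2" "(l $ i + r $ i) / 2"] lr by fastforce
  have kkB: "\<bar>kk x s\<bar> \<le> B * (indicator ?I x * indicator ?I s)" for x s
    using B[of x s] by (simp add: kk_def indicator_def)
  have kkB': "\<bar>kk x s\<bar> \<le> B" for x s
    using kkB[of x s] B0 by (cases "x \<in> ?I"; cases "s \<in> ?I") simp_all
  define T where "T x t = (LINT s|lborel. kk x s * f (emb i s t))" for x t
  define u where "u x = T (x $ i) (x $ co i)" for x
  have u_emb: "u (emb i s t) = T s t" for s t by (simp add: u_def)
  have femb: "(\<lambda>s. f (emb i s t)) \<in> borel_measurable borel" for t
  proof -
    have "(\<lambda>s. (case (s, t) of (s, t) \<Rightarrow> emb i s t)) \<in> borel_measurable borel"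
      by (rule measurable_compose[OF _ emb_measurable]) simp
    then show ?thesis by (simp add: measurable_compose[OF _ f])
  qed
  have kkx: "(\<lambda>s. kk x s) \<in> borel_measurable borel" for x
    using measurable_compose[OF _ kk, of "\<lambda>s. (x, s)" borel] by simp
  have fKt: "kk x s * f (emb i s t) = 0" if "x \<notin> ?I \<or> t \<notin> {l $ co i<..<r $ co i}" for x s t
  proof -
    have "f (emb i s t) = 0" if "t \<notin> {l $ co i<..<r $ co i}"
      using f0[of "emb i s t"] that box_mem_iff[of "emb i s t" l r i] by simp
    then show ?thesis using that by (auto simp: kk_def)
  qed
  have u0: "u x = 0" if "x \<notin> ?K" for x
  proof -
    have "(\<lambda>s. kk (x $ i) s * f (emb i s (x $ co i))) = (\<lambda>s. 0)"
    proof
      fix s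
      show "kk (x $ i) s * f (emb i s (x $ co i)) = 0"
        using fKt[of "x $ i" "x $ co i" s] that unfolding box_mem_iff[of x l r i] by blast
    qed
    then show ?thesis by (simp add: u_def T_def)
  qed
  have u_meas [measurable]: "u \<in> borel_measurable borel"
  proof -
    have "(\<lambda>(x, s). kk (x $ i) s * f (emb i s (x $ co i))) \<in> borel_measurable ((borel :: plane measure) \<Otimes>\<^sub>M lborel)"
    proof -
      have c [measurable]: "(\<lambda>x::plane. x $ j) \<in> borel_measurable borel" for j
        by (intro borel_measurable_continuous_onI continuous_intros)
      have 1: "(\<lambda>z. kk (fst z $ i) (snd z)) \<in> borel_measurable ((borel :: plane measure) \<Otimes>\<^sub>M lborel)"
        using measurable_compose[OF _ kk, of "\<lambda>z. (fst z $ i, snd z)" "(borel :: plane measure) \<Otimes>\<^sub>M lborel"] by simp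
      have "(\<lambda>z. case (snd z, fst z $ co i) of (s, t) \<Rightarrow> emb i s t) \<in> measurable ((borel :: plane measure) \<Otimes>\<^sub>M lborel) borel"
        by (rule measurable_compose[OF _ emb_measurable]) simp
      then have 2: "(\<lambda>z. f (emb i (snd z) (fst z $ co i))) \<in> borel_measurable ((borel :: plane measure) \<Otimes>\<^sub>M lborel)"
        by (simp add: measurable_compose[OF _ f])
      show ?thesis using borel_measurable_times[OF 1 2] by (simp add: case_prod_beta)
    qed
    then show ?thesis unfolding u_def T_def
      by (rule lborel.borel_measurable_lebesgue_integral)
  qed
  have uL: "u \<in> borel_measurable (lebesgue_on ?K)" by (rule borel_measurable_lebesgue_on) simp
  have intf2: "integrable lborel (\<lambda>x. (f x)\<^sup>2)"
  proof -
    have "integrable (lebesgue_on ?K) (\<lambda>x. (v x)\<^sup>2)" using v by (simp add: L2_def)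
    then have "integrable (lebesgue_on ?K) (\<lambda>x. (f x)\<^sup>2)"
      by (rule Bochner_Integration.integrable_cong_AE_imp) (use vf fL in auto)
    then show ?thesis by (subst (asm) integral_box_lborel(2)) (use f0 in auto)
  qed
  have nf: "(\<integral>\<^sup>+x. ennreal ((f x)\<^sup>2) \<partial>lborel) = ennreal ((L2_norm ?K v)\<^sup>2)"
  proof -
    have "(\<integral>\<^sup>+x. ennreal ((f x)\<^sup>2) \<partial>lborel) = ennreal (LINT x|lborel. (f x)\<^sup>2)"
      by (rule nn_integral_eq_integral[OF intf2]) simp
    also have "(LINT x|lborel. (f x)\<^sup>2) = (LINT x|lebesgue_on ?K. (f x)\<^sup>2)"
      by (rule integral_box_lborel(1)[symmetric]) (use f0 in auto)
    also have "\<dots> = (LINT x|lebesgue_on ?K. (v x)\<^sup>2)"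
      by (rule integral_cong_AE) (use vf fL L2_measurable[OF v] in auto)
    finally show ?thesis by (simp add: L2_norm_sq)
  qed
  let ?G = "\<lambda>t. \<integral>\<^sup>+s. ennreal ((f (emb i s t))\<^sup>2) \<partial>lborel"
  have Tsq: "ennreal ((T x t)\<^sup>2) \<le> ennreal (B\<^sup>2 * ?h) * indicator ?I x * ?G t" for x t
  proof -
    have "ennreal \<bar>T x t\<bar> \<le> (\<integral>\<^sup>+s. ennreal \<bar>kk x s * f (emb i s t)\<bar> \<partial>lborel)"
      unfolding T_def by (rule ennreal_abs_integral_le)
    also have "\<dots> = (\<integral>\<^sup>+s. ennreal \<bar>kk x s\<bar> * ennreal \<bar>f (emb i s t)\<bar> \<partial>lborel)"
      by (simp add: abs_mult ennreal_mult)
    finally have "(ennreal \<bar>T x t\<bar>)\<^sup>2 \<le> (\<integral>\<^sup>+s. ennreal \<bar>kk x s\<bar> * ennreal \<bar>f (emb i s t)\<bar> \<partial>lborel)\<^sup>2"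
      by (simp add: power2_eq_square mult_mono)
    also have "\<dots> \<le> (\<integral>\<^sup>+s. (ennreal \<bar>kk x s\<bar>)\<^sup>2 \<partial>lborel) * (\<integral>\<^sup>+s. (ennreal \<bar>f (emb i s t)\<bar>)\<^sup>2 \<partial>lborel)"
      by (rule Cauchy_Schwarz_nn_integral) (use kkx[of x] femb[of t] in auto)
    also have "(\<integral>\<^sup>+s. (ennreal \<bar>kk x s\<bar>)\<^sup>2 \<partial>lborel) \<le> (\<integral>\<^sup>+s. ennreal (B\<^sup>2) * indicator ?I x * indicator ?I s \<partial>lborel)"
    proof (rule nn_integral_mono)
      fix s
      have "\<bar>kk x s\<bar>\<^sup>2 \<le> B\<^sup>2 * (indicator ?I x * indicator ?I s)"
        using power_mono[OF kkB[of x s], of 2] by (auto simp: indicator_def split: if_splits)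
      then have "ennreal (\<bar>kk x s\<bar>\<^sup>2) \<le> ennreal (B\<^sup>2 * (indicator ?I x * indicator ?I s))" by (rule ennreal_leI)
      then show "(ennreal \<bar>kk x s\<bar>)\<^sup>2 \<le> ennreal (B\<^sup>2) * indicator ?I x * indicator ?I s"
        by (auto simp: ennreal_power indicator_def split: if_splits)
    qed
    also have "\<dots> = ennreal (B\<^sup>2 * ?h) * indicator ?I x"
      using lr by (subst nn_integral_cmult) (auto simp: ennreal_mult indicator_def)
    finally show ?thesis by (simp add: ennreal_power mult_right_mono)
  qed
  have nu: "(\<integral>\<^sup>+x. ennreal ((u x)\<^sup>2) \<partial>lborel) \<le> ennreal (B\<^sup>2 * ?h\<^sup>2 * (L2_norm ?K v)\<^sup>2)"
  proof -
    have "(\<integral>\<^sup>+x. ennreal ((u x)\<^sup>2) \<partial>lborel) = (\<integral>\<^sup>+t. (\<integral>\<^sup>+x. ennreal ((T x t)\<^sup>2) \<partial>lborel) \<partial>lborel)"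
      by (subst plane_nn_integral[of _ i]) (simp_all add: u_emb)
    also have "\<dots> \<le> (\<integral>\<^sup>+t. (\<integral>\<^sup>+x. ennreal (B\<^sup>2 * ?h) * indicator ?I x * ?G t \<partial>lborel) \<partial>lborel)"
      by (intro nn_integral_mono Tsq)
    also have "\<dots> = (\<integral>\<^sup>+t. ennreal (B\<^sup>2 * ?h\<^sup>2) * ?G t \<partial>lborel)"
    proof (rule nn_integral_cong)
      fix t
      have "(\<integral>\<^sup>+x. ennreal (B\<^sup>2 * ?h) * indicator ?I x * ?G t \<partial>lborel)
        = ?G t * (\<integral>\<^sup>+x. ennreal (B\<^sup>2 * ?h) * indicator ?I x \<partial>lborel)"
        by (subst nn_integral_cmult[symmetric]) (auto simp: mult_ac)
      also have "(\<integral>\<^sup>+x. ennreal (B\<^sup>2 * ?h) * indicator ?I x \<partial>lborel) = ennreal (B\<^sup>2 * ?h\<^sup>2)"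
      proof -
        have "(\<integral>\<^sup>+x. ennreal (B\<^sup>2 * ?h) * indicator ?I x \<partial>lborel) = ennreal (B\<^sup>2 * ?h) * ennreal ?h"
          using lr by (subst nn_integral_cmult) auto
        also have "\<dots> = ennreal (B\<^sup>2 * ?h * ?h)" using lr by (subst ennreal_mult) auto
        finally show ?thesis by (simp add: power2_eq_square mult_ac)
      qed
      finally show "(\<integral>\<^sup>+x. ennreal (B\<^sup>2 * ?h) * indicator ?I x * ?G t \<partial>lborel)
        = ennreal (B\<^sup>2 * ?h\<^sup>2) * ?G t" by (simp add: mult.commute)
    qed
    also have "\<dots> = ennreal (B\<^sup>2 * ?h\<^sup>2) * (\<integral>\<^sup>+t. ?G t \<partial>lborel)"
    proof (rule nn_integral_cmult)
      have "(\<lambda>(t, s). ennreal ((f (emb i s t))\<^sup>2)) \<in> borel_measurable (lborel \<Otimes>\<^sub>M lborel)" using slice_measurable[of "\<lambda>x. ennreal ((f x)\<^sup>2)" i] by simp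
      then show "?G \<in> borel_measurable lborel"
        by (rule lborel.borel_measurable_nn_integral)
    qed
    also have "(\<integral>\<^sup>+t. ?G t \<partial>lborel) = ennreal ((L2_norm ?K v)\<^sup>2)"
      unfolding nf[symmetric] by (subst plane_nn_integral[of _ i]) simp_all
    finally show ?thesis by (simp add: ennreal_mult)
  qed
  then have intu2: "integrable lborel (\<lambda>x. (u x)\<^sup>2)"
    by (intro integrableI_bounded) (auto simp: top.not_eq_extremum intro: le_less_trans)
  have u2: "u \<in> L2 ?K"
    using intu2 integral_box_lborel(2)[of "\<lambda>x. (u x)\<^sup>2" l r] u0 uL by (simp add: L2_def)
  have unorm: "L2_norm ?K u \<le> B * ?h * L2_norm ?K v"
  proof -
    have "(L2_norm ?K u)\<^sup>2 = (LINT x|lborel. (u x)\<^sup>2)"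
      using integral_box_lborel(1)[of "\<lambda>x. (u x)\<^sup>2" l r] u0 by (simp add: L2_norm_sq)
    also have "ennreal \<dots> = (\<integral>\<^sup>+x. ennreal ((u x)\<^sup>2) \<partial>lborel)"
      by (rule nn_integral_eq_integral[symmetric, OF intu2]) simp
    finally have "ennreal ((L2_norm ?K u)\<^sup>2) \<le> ennreal (B\<^sup>2 * ?h\<^sup>2 * (L2_norm ?K v)\<^sup>2)" using nu by simp
    then have "(L2_norm ?K u)\<^sup>2 \<le> B\<^sup>2 * ?h\<^sup>2 * (L2_norm ?K v)\<^sup>2" by (subst (asm) ennreal_le_iff) auto
    then have "(L2_norm ?K u)\<^sup>2 \<le> (B * ?h * L2_norm ?K v)\<^sup>2" by (simp add: power_mult_distrib)
    then show ?thesis by (rule power2_le_imp_le) (use B0 lr in \<open>simp add: L2_norm_nonneg\<close>)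
  qed
  \<comment> \<open>Fubini in the two variables of the kernel, for almost every line.\<close>
  have pair: "pairing l r i u q p = pairing l r i v (\<lambda>s. LINT x|lborel. indicator ?I x * (q x * k x s)) p"
    if q [measurable]: "q \<in> borel_measurable borel" and p [measurable]: "p \<in> borel_measurable borel"
      and M: "\<And>t. \<bar>q t\<bar> \<le> M" and N: "\<And>t. \<bar>p t\<bar> \<le> N" for q p M N
  proof -
    have M0: "0 \<le> M" and N0: "0 \<le> N" using M[of 0] N[of 0] by linarith+
    have c [measurable]: "(\<lambda>x::plane. x $ j) \<in> borel_measurable borel" for j
      by (intro borel_measurable_continuous_onI continuous_intros)
    define Q where "Q s = (LINT x|lborel. q x * kk x s)" for s
    have Qm [measurable]: "Q \<in> borel_measurable borel"
    proof -
      have "(\<lambda>z. kk (snd z) (fst z)) \<in> borel_measurable (borel \<Otimes>\<^sub>M lborel)"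
        using measurable_compose[OF _ kk, of "\<lambda>z. (snd z, fst z)" "borel \<Otimes>\<^sub>M lborel"] by simp
      then have "(\<lambda>(s, x). q x * kk x s) \<in> borel_measurable (borel \<Otimes>\<^sub>M lborel)"
        by (simp add: case_prod_beta)
      then show ?thesis unfolding Q_def by (rule lborel.borel_measurable_lebesgue_integral)
    qed
    have intI: "integrable lborel (\<lambda>x. C * indicat_real ?I x)" for C
      using lr by (intro integrable_mult_right integrable_real_indicator) auto
    have qkkB: "\<bar>q x * kk x s\<bar> \<le> M * B * indicat_real ?I x" for x s
      using mult_mono[OF M[of x] kkB'[of x s]] M0 B0 by (cases "x \<in> ?I") (auto simp: abs_mult kk_def)
    have qkk: "integrable lborel (\<lambda>x. q x * kk x s)" for s
    proof (rule Bochner_Integration.integrable_bound[OF intI[of "M * B"]])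
      show "(\<lambda>x. q x * kk x s) \<in> borel_measurable lborel"
        using measurable_compose[OF _ kk, of "\<lambda>x. (x, s)" borel] by simp
      show "AE x in lborel. norm (q x * kk x s) \<le> norm (M * B * indicat_real ?I x)"
        using order_trans[OF qkkB abs_ge_self] by simp
    qed
    have QB: "\<bar>Q s\<bar> \<le> M * B * ?h" for s
    proof -
      have "\<bar>Q s\<bar> \<le> (LINT x|lborel. \<bar>q x * kk x s\<bar>)" unfolding Q_def by (rule integral_abs_bound)
      also have "\<dots> \<le> (LINT x|lborel. M * B * indicat_real ?I x)"
        by (rule integral_mono[OF integrable_abs[OF qkk] intI qkkB])
      also have "\<dots> = M * B * ?h" using lr by simp
      finally show ?thesis .
    qed
    have Qeq: "(LINT x|lborel. indicator ?I x * (q x * k x s)) = Q s" if "s \<in> ?I" for s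
      unfolding Q_def kk_def using that by (simp add: mult.left_commute)
    have int_gen: "integrable lborel (\<lambda>x. h (x $ i) * p (x $ co i) * g x)"
      if g: "g \<in> L2 ?K" "g \<in> borel_measurable borel" "\<And>x. x \<notin> ?K \<Longrightarrow> g x = 0"
        and h: "h \<in> borel_measurable borel" "\<And>t. \<bar>h t\<bar> \<le> L" for g h L
    proof -
      have [measurable]: "g \<in> borel_measurable borel" "h \<in> borel_measurable borel" by fact+
      have "(\<lambda>x. (h (x $ i) * p (x $ co i)) * g x) \<in> L2 ?K"
      proof (rule L2_bounded_mult[OF g(1)])
        show "(\<lambda>x. h (x $ i) * p (x $ co i)) \<in> borel_measurable (lebesgue_on ?K)"
          by (rule borel_measurable_lebesgue_on) measurable
        show "\<bar>h (x $ i) * p (x $ co i)\<bar> \<le> L * N" for x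
          unfolding abs_mult using h(2)[of 0] by (intro mult_mono h(2) N) linarith+
      qed
      then have "integrable (lebesgue_on ?K) (\<lambda>x. h (x $ i) * p (x $ co i) * g x)"
        by (rule L2_integrable[OF lmeasurable_box])
      then show ?thesis
        by (subst (asm) integral_box_lborel(2)) (simp_all add: g(3))
    qed
    have f2: "f \<in> L2 ?K"
      using intf2 integral_box_lborel(2)[of "\<lambda>x. (f x)\<^sup>2" l r] f0 fL by (simp add: L2_def)
    have "pairing l r i u q p = (LINT x|lborel. q (x $ i) * p (x $ co i) * u x)"
      unfolding pairing_def by (rule integral_box_lborel(1)) (simp_all add: u0)
    also have "\<dots> = (LINT t|lborel. (LINT s|lborel. q s * p t * T s t))"
      by (subst plane_integral(1)[OF int_gen[OF u2 u_meas u0 q M], of i]) (simp_all add: u_emb)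
    also have "\<dots> = (LINT t|lborel. (LINT s|lborel. Q s * p t * f (emb i s t)))"
    proof (rule integral_cong_AE)
      have "(\<lambda>(t, s). q s * p t * T s t) \<in> borel_measurable (lborel \<Otimes>\<^sub>M lborel)" using slice_measurable[OF u_meas, of i] by (simp add: case_prod_beta u_emb)
      then show "(\<lambda>t. LINT s|lborel. q s * p t * T s t) \<in> borel_measurable lborel"
        by (rule lborel.borel_measurable_lebesgue_integral)
      have "(\<lambda>(t, s). Q s * p t * f (emb i s t)) \<in> borel_measurable (lborel \<Otimes>\<^sub>M lborel)" using slice_measurable[OF f, of i] by (simp add: case_prod_beta)
      then show "(\<lambda>t. LINT s|lborel. Q s * p t * f (emb i s t)) \<in> borel_measurable lborel"
        by (rule lborel.borel_measurable_lebesgue_integral)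
      have intf: "integrable lborel f"
        using L2_integrable[OF lmeasurable_box f2] f0 by (subst (asm) integral_box_lborel(2)) auto
      show "AE t in lborel. (LINT s|lborel. q s * p t * T s t) = (LINT s|lborel. Q s * p t * f (emb i s t))"
        using plane_integral(2)[OF intf, of i]
      proof eventually_elim
        case (elim t)
        have int: "integrable (lborel \<Otimes>\<^sub>M lborel) (\<lambda>(x, s). q x * kk x s * f (emb i s t))"
        proof (rule Bochner_Integration.integrable_bound)
          show "integrable (lborel \<Otimes>\<^sub>M lborel) (\<lambda>(x, s). (M * B * indicat_real ?I x) * \<bar>f (emb i s t)\<bar>)"
            by (rule integrable_pair_mult[OF intI integrable_abs[OF elim]])
          have "(\<lambda>z. f (emb i (snd z) t)) \<in> borel_measurable (lborel \<Otimes>\<^sub>M lborel)"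
            using measurable_compose[OF _ femb[of t], of snd "lborel \<Otimes>\<^sub>M lborel"] by simp
          moreover have "(\<lambda>z. kk (fst z) (snd z)) \<in> borel_measurable (lborel \<Otimes>\<^sub>M lborel)"
            using kk by (simp add: case_prod_beta cong: measurable_cong_sets)
          ultimately show "(\<lambda>(x, s). q x * kk x s * f (emb i s t)) \<in> borel_measurable (lborel \<Otimes>\<^sub>M lborel)"
            by (simp add: case_prod_beta)
          show "AE z in lborel \<Otimes>\<^sub>M lborel. norm (case z of (x, s) \<Rightarrow> q x * kk x s * f (emb i s t))
            \<le> norm (case z of (x, s) \<Rightarrow> M * B * indicat_real ?I x * \<bar>f (emb i s t)\<bar>)"
          proof (rule AE_I2, clarify)
            fix x s
            show "norm (q x * kk x s * f (emb i s t)) \<le> norm (M * B * indicat_real ?I x * \<bar>f (emb i s t)\<bar>)"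
              using qkkB[of x s] M0 B0 by (simp add: abs_mult mult_right_mono)
          qed
        qed
        have "(LINT x|lborel. q x * p t * T x t) = (LINT x|lborel. p t * (LINT s|lborel. q x * kk x s * f (emb i s t)))"
          unfolding T_def by (simp add: mult_ac flip: integral_mult_right_zero)
        also have "\<dots> = p t * (LINT x|lborel. (LINT s|lborel. q x * kk x s * f (emb i s t)))" by simp
        also have "(LINT x|lborel. (LINT s|lborel. q x * kk x s * f (emb i s t))) =
            (LINT s|lborel. (LINT x|lborel. q x * kk x s * f (emb i s t)))"
          using lborel_pair.Fubini_integral[OF int] by simp
        also have "p t * \<dots> = (LINT s|lborel. Q s * p t * f (emb i s t))"
          unfolding Q_def by (simp add: mult_ac flip: integral_mult_right_zero integral_mult_left_zero)
        finally show ?case .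
      qed
    qed
    also have "\<dots> = (LINT x|lborel. Q (x $ i) * p (x $ co i) * f x)"
      by (subst plane_integral(1)[OF int_gen[OF f2 f f0 Qm QB], of i]) simp_all
    also have "\<dots> = (LINT x|lebesgue_on ?K. Q (x $ i) * p (x $ co i) * f x)"
      by (rule integral_box_lborel(1)[symmetric]) (simp_all add: f0)
    also have "\<dots> = (LINT x|lebesgue_on ?K. Q (x $ i) * p (x $ co i) * v x)"
    proof (rule integral_cong_AE)
      have "(\<lambda>x. Q (x $ i) * p (x $ co i)) \<in> borel_measurable (lebesgue_on ?K)"
        by (rule borel_measurable_lebesgue_on) measurable
      then show "(\<lambda>x. Q (x $ i) * p (x $ co i) * f x) \<in> borel_measurable (lebesgue_on ?K)"
        "(\<lambda>x. Q (x $ i) * p (x $ co i) * v x) \<in> borel_measurable (lebesgue_on ?K)"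
        using fL L2_measurable[OF v] by (auto intro: borel_measurable_times)
    qed (use vf in \<open>auto elim: eventually_mono\<close>)
    also have "\<dots> = pairing l r i v (\<lambda>s. LINT x|lborel. indicator ?I x * (q x * k x s)) p"
      unfolding pairing_def
      by (rule Bochner_Integration.integral_cong[OF refl])
         (use box_nthD[of _ l r i] Qeq in \<open>simp\<close>)
    finally show ?thesis .
  qed
  show ?thesis by (rule that[OF u2 unorm]) (intro allI impI pair; blast)
qed

lemma test1_measurable_borel: "test1 a b q \<Longrightarrow> q \<in> borel_measurable borel"
  by (intro borel_measurable_continuous_onI smooth_continuous test1_smooth)

lemma test1_bounded:
  assumes "test1 a b q" obtains M where "\<And>t. \<bar>q t\<bar> \<le> M"
proof -
  have "test_limit a b q" using assms by (intro test_limit_smooth test1_smooth)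
  then obtain M where M: "0 \<le> M" "\<And>t. t \<in> {a<..<b} \<Longrightarrow> \<bar>q t\<bar> \<le> M" using test_limit_bounded by blast
  have "\<bar>q t\<bar> \<le> M" for t using M test1_zero_outside[OF assms, of t] by (cases "t \<in> {a<..<b}") auto
  then show ?thesis by (rule that)
qed

lemma test1_lborel_integral:
  assumes q: "test1 a b q" and s: "a \<le> s"
  shows "(LINT x|lborel. indicator {a..s} x * q x) = integral {a..s} q"
    "integrable lborel (\<lambda>x. indicator {a..s} x * q x)"
proof -
  have "continuous_on {a..s} q" by (rule smooth_continuous[OF test1_smooth[OF q]])
  then have "set_integrable lborel {a..s} q" by (rule borel_integrable_atLeastAtMost')
  from set_borel_integral_eq_integral(2)[OF this] this
  show "(LINT x|lborel. indicator {a..s} x * q x) = integral {a..s} q"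
    "integrable lborel (\<lambda>x. indicator {a..s} x * q x)"
    by (simp_all add: set_lebesgue_integral_def set_integrable_def)
qed

text \<open>\<open>w\<close> is the sum of its average along lines in direction \<open>i\<close>
  and of \<open>N\<close>, expressed by pairings so that no pointwise meaning of the average is
  needed.\<close>
definition slice_split :: "plane \<Rightarrow> plane \<Rightarrow> 2 \<Rightarrow> (plane \<Rightarrow> real) \<Rightarrow> (plane \<Rightarrow> real) \<Rightarrow> bool" where
  "slice_split l r i w N \<longleftrightarrow> (\<forall>q p M. test1 (l $ i) (r $ i) q \<longrightarrow> test_limit (l $ co i) (r $ co i) p \<longrightarrow>
      p \<in> borel_measurable borel \<longrightarrow> (\<forall>t. \<bar>p t\<bar> \<le> M) \<longrightarrow>
      pairing l r i w q p =
        integral {l $ i..r $ i} q / (r $ i - l $ i) * pairing l r i w (\<lambda>t. 1) p + pairing l r i N q p)"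

text \<open>In one dimension, \<open>w(x)\<close> minus its mean is the integral of
  \<open>w'\<close> against the trace kernel divided by the length, a kernel bounded by one. The
  remainder is the corresponding slice operator applied to the weak derivative.\<close>
lemma mean_split:
  assumes wp: "weak_partial l r i w g" and lr: "l $ i < r $ i"
  obtains N where "N \<in> L2 (box l r)" "L2_norm (box l r) N \<le> (r $ i - l $ i) * L2_norm (box l r) g"
    "slice_split l r i w N"
proof -
  let ?h = "r $ i - l $ i" and ?I = "{l $ i<..<r $ i}"
  define k where "k x s = trace_kernel (l $ i) (r $ i) x s / ?h" for x s
  have w: "w \<in> L2 (box l r)" "g \<in> L2 (box l r)" using wp by (auto simp: weak_partial_def)
  have km: "(\<lambda>(x, s). k x s) \<in> borel_measurable (borel \<Otimes>\<^sub>M borel)"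
    unfolding k_def trace_kernel_def by measurable
  have k1: "\<bar>k x s\<bar> \<le> 1" if "x \<in> ?I" "s \<in> ?I" for x s
  proof -
    have "\<bar>trace_kernel (l $ i) (r $ i) x s\<bar> \<le> ?h"
      using that by (auto simp: trace_kernel_def abs_le_iff)
    then show ?thesis using lr by (simp add: k_def)
  qed
  obtain N where N: "N \<in> L2 (box l r)" "L2_norm (box l r) N \<le> 1 * ?h * L2_norm (box l r) g"
    "\<forall>q p M N'. q \<in> borel_measurable borel \<longrightarrow> p \<in> borel_measurable borel \<longrightarrow>
      (\<forall>t. \<bar>q t\<bar> \<le> M) \<longrightarrow> (\<forall>t. \<bar>p t\<bar> \<le> N') \<longrightarrow>
      pairing l r i N q p = pairing l r i g (\<lambda>s. LINT x|lborel. indicator ?I x * (q x * k x s)) p"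
    using slice_operator[OF lr km k1 w(2)] by blast
  have "pairing l r i w q p = integral {l $ i..r $ i} q / ?h * pairing l r i w (\<lambda>t. 1) p + pairing l r i N q p"
    if q: "test1 (l $ i) (r $ i) q" and p: "test_limit (l $ co i) (r $ co i) p" "p \<in> borel_measurable borel"
      and M: "\<And>t. \<bar>p t\<bar> \<le> M" for q p M
  proof -
    define c where "c = integral {l $ i..r $ i} q / ?h"
    define Q where "Q s = integral {l $ i..s} q - c * (s - l $ i)" for s
    have qint: "q integrable_on {l $ i..s}" for s
      by (rule integrable_continuous_real[OF smooth_continuous[OF test1_smooth[OF q]]])
    have tq: "test_limit (l $ i) (r $ i) q" by (rule test_limit_smooth[OF test1_smooth[OF q]])
    have has: "((\<lambda>s. q s + (- c) * 1) has_integral Q s) {l $ i..s}" if "l $ i \<le> s" for s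
    proof -
      have "((\<lambda>s. (- c) * 1) has_integral (- c * (s - l $ i))) {l $ i..s}"
        using has_integral_const_real[of "- c" "l $ i" s] that by (simp add: mult.commute)
      from has_integral_add[OF integrable_integral[OF qint] this] show ?thesis by (simp add: Q_def)
    qed
    have Q0: "Q (r $ i) = 0" using lr by (simp add: Q_def c_def)
    have "pairing l r i w (\<lambda>s. q s + (- c) * 1) p = - pairing l r i g Q p"
      using lr has has[of "r $ i"] Q0
      by (intro weak_partial_extended[OF wp lr _ _ _ p(1)] test_limit_add tq test_limit_cmult test_limit_const) auto
    moreover have "pairing l r i w (\<lambda>s. q s + (- c) * 1) p =
        pairing l r i w q p + (- c) * pairing l r i w (\<lambda>s. 1) p"
      using weight_linearD(1)[OF weight_linear_pairing[OF w(1) p(1)] tq test_limit_cmult[OF test_limit_const], of "- c" 1]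
        weight_linearD(2)[OF weight_linear_pairing[OF w(1) p(1)] test_limit_const, of "- c" 1] by simp
    moreover have "pairing l r i N q p = - pairing l r i g Q p"
    proof -
      obtain L where L: "\<And>t. \<bar>q t\<bar> \<le> L" using test1_bounded[OF q] by blast
      have Neq: "(LINT x|lborel. indicator ?I x * (q x * k x s)) = - Q s" if s: "s \<in> ?I" for s
      proof -
        have "indicator ?I x * (q x * k x s) =
            (s - l $ i) / ?h * (indicator {l $ i..r $ i} x * q x) - indicator {l $ i..s} x * q x" for x
        proof (cases "x \<in> ?I")
          case True
          then show ?thesis using s lr
            by (auto simp: k_def trace_kernel_def indicator_def field_simps)
        next
          case False
          then show ?thesis using test1_zero_outside[OF q False] by simp
        qed
        then have "(LINT x|lborel. indicator ?I x * (q x * k x s)) =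
            (s - l $ i) / ?h * integral {l $ i..r $ i} q - integral {l $ i..s} q"
          using s lr by (simp add: test1_lborel_integral[OF q] del: times_divide_eq_left)
        then show ?thesis by (simp add: Q_def c_def)
      qed
      have "pairing l r i N q p = pairing l r i g (\<lambda>s. LINT x|lborel. indicator ?I x * (q x * k x s)) p"
        by (rule N(3)[rule_format, OF test1_measurable_borel[OF q] p(2) L M])
      also have "\<dots> = pairing l r i g (\<lambda>s. - Q s) p"
        unfolding pairing_def
        by (rule Bochner_Integration.integral_cong[OF refl]) (use box_nthD[of _ l r i] Neq in simp)
      also have "\<dots> = - pairing l r i g Q p" by (simp add: pairing_def)
      finally show ?thesis .
    qed
    ultimately show ?thesis by (simp add: c_def)
  qed
  then have "slice_split l r i w N" unfolding slice_split_def by blast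
  then show ?thesis using that[of N] N(1,2) by simp
qed

lemma pairing_const_weight: "pairing a b i w (\<lambda>t. c) p = c * pairing a b i w (\<lambda>t. 1) p"
  by (simp add: pairing_def mult.assoc)

text \<open>Averaging along lines, as a slice operator with constant kernel; it does not increase
  the norm.\<close>
lemma slice_mean:
  assumes lr: "l $ i < r $ i" and v: "v \<in> L2 (box l r)"
  obtains M where "M \<in> L2 (box l r)" "L2_norm (box l r) M \<le> L2_norm (box l r) v"
    "\<forall>q p N. test1 (l $ i) (r $ i) q \<longrightarrow> p \<in> borel_measurable borel \<longrightarrow> (\<forall>t. \<bar>p t\<bar> \<le> N) \<longrightarrow>
      pairing l r i M q p = integral {l $ i..r $ i} q / (r $ i - l $ i) * pairing l r i v (\<lambda>t. 1) p"
proof -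
  let ?h = "r $ i - l $ i"
  define k where "k = (\<lambda>(x::real) (s::real). 1 / ?h)"
  have km: "(\<lambda>(x, s). k x s) \<in> borel_measurable (borel \<Otimes>\<^sub>M borel)" by (simp add: k_def)
  have kb: "\<bar>k x s\<bar> \<le> 1 / ?h" for x s using lr by (simp add: k_def)
  obtain M where M: "M \<in> L2 (box l r)" "L2_norm (box l r) M \<le> 1 / ?h * ?h * L2_norm (box l r) v"
    "\<forall>q p M' N. q \<in> borel_measurable borel \<longrightarrow> p \<in> borel_measurable borel \<longrightarrow>
      (\<forall>t. \<bar>q t\<bar> \<le> M') \<longrightarrow> (\<forall>t. \<bar>p t\<bar> \<le> N) \<longrightarrow>
      pairing l r i M q p =
        pairing l r i v (\<lambda>s. LINT x|lborel. indicator {l $ i<..<r $ i} x * (q x * k x s)) p"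
    using slice_operator[OF lr km kb v] by blast
  have "pairing l r i M q p = integral {l $ i..r $ i} q / ?h * pairing l r i v (\<lambda>t. 1) p"
    if q: "test1 (l $ i) (r $ i) q" and p: "p \<in> borel_measurable borel" and N: "\<And>t. \<bar>p t\<bar> \<le> N" for q p N
  proof -
    obtain B where B: "\<And>t. \<bar>q t\<bar> \<le> B" using test1_bounded[OF q] by blast
    have "indicator {l $ i<..<r $ i} x * (q x * k x s) = 1 / ?h * (indicator {l $ i..r $ i} x * q x)" for x s
      using test1_zero_outside[OF q, of x] by (cases "x \<in> {l $ i<..<r $ i}") (auto simp: k_def)
    then have "(LINT x|lborel. indicator {l $ i<..<r $ i} x * (q x * k x s)) =
        1 / ?h * (LINT x|lborel. indicator {l $ i..r $ i} x * q x)" for s by simp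
    then have "(LINT x|lborel. indicator {l $ i<..<r $ i} x * (q x * k x s)) = integral {l $ i..r $ i} q / ?h" for s
      using test1_lborel_integral(1)[OF q, of "r $ i"] lr by simp
    then show ?thesis
      using M(3)[rule_format, OF test1_measurable_borel[OF q] p B N]
        pairing_const_weight[of l r i v "integral {l $ i..r $ i} q / ?h" p] by simp
  qed
  then have "\<forall>q p N. test1 (l $ i) (r $ i) q \<longrightarrow> p \<in> borel_measurable borel \<longrightarrow> (\<forall>t. \<bar>p t\<bar> \<le> N) \<longrightarrow>
      pairing l r i M q p = integral {l $ i..r $ i} q / ?h * pairing l r i v (\<lambda>t. 1) p" by blast
  then show ?thesis using that[of M] M(1,2) lr by simp
qed

definition area :: "plane \<Rightarrow> plane \<Rightarrow> real" where
  "area l r = (r $ 1 - l $ 1) * (r $ 2 - l $ 2)"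

lemma area_index: "area l r = (r $ i - l $ i) * (r $ co i - l $ co i)"
  using exhaust_2[of i] by (auto simp: area_def)

definition mean :: "plane \<Rightarrow> plane \<Rightarrow> (plane \<Rightarrow> real) \<Rightarrow> real" where
  "mean l r w = (LINT x|lebesgue_on (box l r). w x) / area l r"

lemma measure_box_area:
  assumes "\<And>k. l $ k \<le> r $ k" shows "measure lebesgue (box l r) = area l r"
proof -
  have "l \<bullet> b \<le> r \<bullet> b" if "b \<in> Basis" for b
    using that assms by (auto simp: Basis_vec_def inner_axis)
  then have "measure lborel (box l r) = (\<Prod>b\<in>Basis. (r - l) \<bullet> b)" by (rule measure_lborel_box)
  also have "\<dots> = area l r"
    unfolding prod_Basis_plane by (simp add: prod_index[of _ 1] inner_axis area_def)
  finally show ?thesis by (simp add: measure_completion)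
qed

lemma integral_const_box:
  assumes "\<And>k. l $ k \<le> r $ k" shows "(LINT x|lebesgue_on (box l r). c) = c * area l r"
  using measure_box_area[OF assms] by (simp add: measure_restrict_space mult.commute)

lemma weak_partial_const: "weak_partial l r i (\<lambda>x. c) (\<lambda>x. 0)"
proof -
  have "pairing l r i (\<lambda>x. c) (deriv q) p = 0"
    if q: "test1 (l $ i) (r $ i) q" and p: "test1 (l $ co i) (r $ co i) p" for q p
  proof -
    have "(LINT x|lebesgue_on (box l r). deriv q (x $ i) * p (x $ co i)) = 0"
      using integral_partial_test_function[OF _ product_test_function'[OF q p], of i]
      by (simp add: partial_product[OF test1_smooth[OF q] test1_smooth[OF p]])
    then show ?thesis by (simp add: pairing_def)
  qed
  then show ?thesis by (simp add: weak_partial_def L2_zero L2_const pairing_def)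
qed

lemma pairing_add:
  assumes "v \<in> L2 (box a b)" "w \<in> L2 (box a b)" "test_limit (a $ i) (b $ i) q" "test_limit (a $ co i) (b $ co i) p"
  shows "pairing a b i (\<lambda>x. v x + w x) q p = pairing a b i v q p + pairing a b i w q p"
  using pairing_integrable[OF assms(1,3,4)] pairing_integrable[OF assms(2,3,4)]
  by (simp add: pairing_def distrib_left)

lemma pairing_diff:
  assumes "v \<in> L2 (box a b)" "w \<in> L2 (box a b)" "test_limit (a $ i) (b $ i) q" "test_limit (a $ co i) (b $ co i) p"
  shows "pairing a b i (\<lambda>x. v x - w x) q p = pairing a b i v q p - pairing a b i w q p"
  using pairing_integrable[OF assms(1,3,4)] pairing_integrable[OF assms(2,3,4)]
  by (simp add: pairing_def right_diff_distrib)

text \<open>For a constant function the remainder of the splitting has zero norm. This evaluates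
  pairings of constants as products of one-dimensional integrals.\<close>
lemma pairing_const_split:
  assumes lr: "l $ i < r $ i" and q: "test1 (l $ i) (r $ i) q"
    and p: "test_limit (l $ co i) (r $ co i) p" "p \<in> borel_measurable borel" "\<And>t. \<bar>p t\<bar> \<le> B"
  shows "pairing l r i (\<lambda>x. c) q p = integral {l $ i..r $ i} q / (r $ i - l $ i) * pairing l r i (\<lambda>x. c) (\<lambda>t. 1) p"
proof (rule mean_split[OF weak_partial_const[of l r i c] lr])
  let ?K = "box l r"
  fix N
  assume N: "N \<in> L2 ?K" "L2_norm ?K N \<le> (r $ i - l $ i) * L2_norm ?K (\<lambda>x. 0 :: real)"
    and split: "slice_split l r i (\<lambda>x. c) N"
  have "L2_norm ?K (\<lambda>x. 0 :: real) = 0" by (simp add: L2_norm_def)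
  then have "L2_norm ?K N = 0" using N(2) L2_norm_nonneg[of ?K N] by (simp only: mult_zero_right)
  moreover have "pairing l r i N q p = L2_inner ?K (\<lambda>x. q (x $ i) * p (x $ co i) * 1) N"
    by (simp add: pairing_def L2_inner_def)
  moreover have "(\<lambda>x. q (x $ i) * p (x $ co i) * 1) \<in> L2 ?K"
    by (rule pairing_weight_L2[OF L2_const[OF lmeasurable_box] test_limit_smooth[OF test1_smooth[OF q]] p(1)])
  ultimately have "pairing l r i N q p = 0"
    using L2_Cauchy_Schwarz[OF _ N(1), of "\<lambda>x. q (x $ i) * p (x $ co i) * 1"] by simp
  then show ?thesis using split[unfolded slice_split_def, rule_format, OF q p] by simp
qed

lemma pairing_const:
  assumes q: "test1 (l $ i) (r $ i) q" and p: "test1 (l $ co i) (r $ co i) p" and lr: "\<And>k. l $ k < r $ k"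
  shows "pairing l r i (\<lambda>x. c) q p = c * (integral {l $ i..r $ i} q * integral {l $ co i..r $ co i} p)"
proof -
  let ?one = "\<lambda>t::real. 1::real" and ?h = "r $ i - l $ i" and ?h' = "r $ co i - l $ co i"
  have h: "?h > 0" "?h' > 0" using lr by simp_all
  obtain B where B: "\<And>t. \<bar>p t\<bar> \<le> B" using test1_bounded[OF p] by blast
  have "pairing l r i (\<lambda>x. c) q p = integral {l $ i..r $ i} q / ?h * pairing l r i (\<lambda>x. c) ?one p"
    by (rule pairing_const_split[OF lr q test_limit_smooth[OF test1_smooth[OF p]] test1_measurable_borel[OF p] B])
  moreover have "pairing l r i (\<lambda>x. c) ?one p = integral {l $ co i..r $ co i} p / ?h' * pairing l r i (\<lambda>x. c) ?one ?one"
    using pairing_const_split[of l "co i" r p ?one 1 c] lr p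
    by (simp add: pairing_swap test_limit_const)
  moreover have "pairing l r i (\<lambda>x. c) ?one ?one = c * (?h * ?h')"
    using integral_const_box[of l r c] lr by (simp add: pairing_def less_imp_le area_index[of l r i])
  moreover have "x / d * (y / d' * (c * (d * d'))) = c * (x * y)" if "d > 0" "d' > 0" for x y d d' :: real
    using that by simp
  ultimately show ?thesis using h by (simp only:)
qed

text \<open>Averaging first in direction \<open>i\<close> and then across reaches the mean; each
  averaging costs one derivative and one side length. The second remainder is averaged in direction
  \<open>i\<close>, which does not increase its norm.\<close>
lemma Poincare_inequality:
  assumes wi: "weak_partial l r i w g" and wj: "weak_partial l r (co i) w g'"
    and lr: "\<And>k. l $ k < r $ k"
  shows "L2_norm (box l r) (\<lambda>x. w x - mean l r w) \<le>
    (r $ i - l $ i) * L2_norm (box l r) g + (r $ co i - l $ co i) * L2_norm (box l r) g'"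
proof -
  let ?K = "box l r" and ?h = "r $ i - l $ i" and ?h' = "r $ co i - l $ co i"
  let ?c = "mean l r w"
  have h: "?h > 0" "?h' > 0" using lr by simp_all
  have w: "w \<in> L2 ?K" using wi by (simp add: weak_partial_def)
  let ?one = "\<lambda>t::real. 1::real"
  have one: "test_limit a b ?one" "?one \<in> borel_measurable borel" "\<And>t. \<bar>?one t\<bar> \<le> 1" for a b
    by (simp_all add: test_limit_const)
  obtain N1 where N1: "N1 \<in> L2 ?K" "L2_norm ?K N1 \<le> ?h * L2_norm ?K g" "slice_split l r i w N1"
    using mean_split[OF wi lr[of i]] by blast
  obtain N2 where N2: "N2 \<in> L2 ?K" "L2_norm ?K N2 \<le> ?h' * L2_norm ?K g'" "slice_split l r (co i) w N2"
    using mean_split[OF wj lr[of "co i"]] by blast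
  note split1 = N1(3)[unfolded slice_split_def, rule_format]
    and split2 = N2(3)[unfolded slice_split_def co_co pairing_swap, rule_format]
  obtain M where M: "M \<in> L2 ?K" "L2_norm ?K M \<le> L2_norm ?K N2"
    "\<forall>q p N. test1 (l $ i) (r $ i) q \<longrightarrow> p \<in> borel_measurable borel \<longrightarrow> (\<forall>t. \<bar>p t\<bar> \<le> N) \<longrightarrow>
      pairing l r i M q p = integral {l $ i..r $ i} q / ?h * pairing l r i N2 ?one p"
    by (rule slice_mean[OF lr[of i] N2(1)]) (erule (2) that)
  have const: "pairing l r i (\<lambda>x. c) q p = c * (integral {l $ i..r $ i} q * integral {l $ co i..r $ co i} p)"
    if "test1 (l $ i) (r $ i) q" "test1 (l $ co i) (r $ co i) p" for q p c
    by (rule pairing_const[OF that lr])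
  define z where "z x = w x - ((N1 x + M x) + ?c)" for x
  have cL: "(\<lambda>x. ?c) \<in> L2 ?K" by (rule L2_const) simp
  have zL: "z \<in> L2 ?K" unfolding z_def by (intro L2_diff L2_add w N1 M cL)
  have "AE x in lebesgue_on ?K. z x = 0"
  proof (rule fundamental_lemma[OF zL])
    fix q p assume q: "test1 (l $ i) (r $ i) q" and p: "test1 (l $ co i) (r $ co i) p"
    obtain B where B: "\<And>t. \<bar>p t\<bar> \<le> B" using test1_bounded[OF p] by blast
    obtain B' where B': "\<And>t. \<bar>q t\<bar> \<le> B'" using test1_bounded[OF q] by blast
    have tq: "test_limit (l $ i) (r $ i) q" "test_limit (l $ co i) (r $ co i) p"
      by (intro test_limit_smooth test1_smooth[OF q] test1_smooth[OF p])+
    let ?Iq = "integral {l $ i..r $ i} q" and ?Ip = "integral {l $ co i..r $ co i} p"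
    have "pairing l r i w q p = ?Iq / ?h * pairing l r i w ?one p + pairing l r i N1 q p"
      by (rule split1[OF q tq(2) test1_measurable_borel[OF p] B])
    moreover have "pairing l r i w ?one p = ?Ip / ?h' * pairing l r i w ?one ?one + pairing l r i N2 ?one p"
      by (rule split2[OF p one])
    moreover have "pairing l r i w ?one ?one = ?c * (?h * ?h')"
      using h by (simp add: mean_def pairing_def area_index[of l r i])
    moreover have "pairing l r i M q p = ?Iq / ?h * pairing l r i N2 ?one p"
      by (rule M(3)[rule_format, OF q test1_measurable_borel[OF p] B])
    moreover have "pairing l r i z q p = pairing l r i w q p - (pairing l r i N1 q p + pairing l r i M q p + pairing l r i (\<lambda>x. ?c) q p)"
      unfolding z_def using tq w N1(1) M(1) cL by (simp add: pairing_diff pairing_add L2_add)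
    \<comment> \<open>The three contributions recombine; this is an identity between real numbers.\<close>
    moreover have "x / d * (y / d' * (c * (d * d')) + n) + m - (m + x / d * n + c * (x * y)) = 0"
      if "d > 0" "d' > 0" for x y c d d' m n :: real
      using that by (simp add: distrib_left)
    ultimately show "pairing l r i z q p = 0"
      using const[OF q p, of ?c] h by (simp only:)
  qed
  then have "AE x in lebesgue_on ?K. w x - ?c = N1 x + M x"
    by eventually_elim (simp add: z_def)
  then have "L2_norm ?K (\<lambda>x. w x - ?c) = L2_norm ?K (\<lambda>x. N1 x + M x)"
    by (rule L2_norm_cong_AE) (intro L2_measurable L2_diff L2_add w cL N1 M)+
  also have "\<dots> \<le> L2_norm ?K N1 + L2_norm ?K M" by (rule L2_norm_triangle[OF N1(1) M(1)])
  also have "L2_norm ?K M \<le> L2_norm ?K N2" using M(2) h by simp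
  finally show ?thesis using N1(2) N2(2) by linarith
qed

section \<open>Element identities and element estimates\<close>
lemma integral_subbox:
  fixes F :: "plane \<Rightarrow> real"
  assumes sub: "box l r \<subseteq> box a b" and zero: "\<And>x. x \<in> box a b \<Longrightarrow> x \<notin> box l r \<Longrightarrow> F x = 0"
  shows "(LINT x|lebesgue_on (box l r). F x) = (LINT x|lebesgue_on (box a b). F x)"
proof -
  have "(\<lambda>x. indicator (box l r) x *\<^sub>R F x) = (\<lambda>x. indicator (box a b) x *\<^sub>R F x)"
  proof
    show "indicator (box l r) x *\<^sub>R F x = indicator (box a b) x *\<^sub>R F x" for x
      using sub zero[of x] by (cases "x \<in> box l r"; cases "x \<in> box a b") auto
  qed
  moreover have "(LINT x|lebesgue_on (box u v). F x) = (LINT x|lebesgue. indicator (box u v) x *\<^sub>R F x)" for u v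
    by (rule integral_restrict_space) simp
  ultimately show ?thesis by (simp only:)
qed

lemma weak_partial_subbox:
  assumes wp: "weak_partial a b i w g" and lr: "\<And>k. a $ k \<le> l $ k" "\<And>k. r $ k \<le> b $ k"
  shows "weak_partial l r i w g"
proof -
  have sub: "box l r \<subseteq> box a b" by (rule box_subset_box_cart_le[OF lr])
  have t: "test1 (a $ k) (b $ k) q" if "test1 (l $ k) (r $ k) q" for k q
    using that lr[of k] unfolding test1_def by (meson le_less_trans less_le_trans)
  have eq: "pairing l r i v q p = pairing a b i v q p"
    if q: "test1 (l $ i) (r $ i) q" and p: "test1 (l $ co i) (r $ co i) p" for v q p
    unfolding pairing_def
  proof (rule integral_subbox[OF sub])
    fix x assume "x \<notin> box l r"
    then have "q (x $ i) = 0 \<or> p (x $ co i) = 0"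
      using test1_zero_outside[OF q] test1_zero_outside[OF p] unfolding box_mem_iff[of x l r i] by blast
    then show "q (x $ i) * p (x $ co i) * v x = 0" by auto
  qed
  have "w \<in> L2 (box l r)" "g \<in> L2 (box l r)"
    using wp L2_subset[OF _ sub] by (auto simp: weak_partial_def)
  then show ?thesis
    using wp t unfolding weak_partial_def by (simp add: eq test1_deriv)
qed

text \<open>Integration by parts on a rectangle, where only the two sides orthogonal to direction
  \<open>i\<close> contribute.\<close>
lemma line_trace_by_parts:
  assumes wp: "weak_partial a b i w g"
    and lr: "\<And>k. a $ k \<le> l $ k" "\<And>k. l $ k < r $ k" "\<And>k. r $ k \<le> b $ k"
    and P: "smooth P" and R: "smooth R"
  shows "(LINT x|lebesgue_on (box l r). P (x $ i) * R (x $ co i) * g x + deriv P (x $ i) * R (x $ co i) * w x) =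
    P (r $ i) * line_trace a b i w g (\<lambda>s. indicator {l $ co i<..<r $ co i} s * R s) (r $ i) -
    P (l $ i) * line_trace a b i w g (\<lambda>s. indicator {l $ co i<..<r $ co i} s * R s) (l $ i)"
proof -
  let ?p = "\<lambda>s. indicator {l $ co i<..<r $ co i} s * R s"
  have ab: "a $ i < b $ i" using lr(1-3)[of i] by linarith
  have p: "test_limit (a $ co i) (b $ co i) ?p"
    by (intro test_limit_mult test_limit_indicator test_limit_smooth R)
  have "pairing a b i g (\<lambda>s. indicator {l $ i<..<r $ i} s * P s) ?p +
      pairing a b i w (\<lambda>s. indicator {l $ i<..<r $ i} s * deriv P s) ?p =
    P (r $ i) * line_trace a b i w g ?p (r $ i) - P (l $ i) * line_trace a b i w g ?p (l $ i)"
    unfolding line_trace_def by (rule trace_by_parts[OF weak_pair_pairing[OF wp ab p] lr(1) lr(2) lr(3) P])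
  moreover have L2: "w \<in> L2 (box l r)" "g \<in> L2 (box l r)"
    using weak_partial_subbox[OF wp lr(1,3)] by (auto simp: weak_partial_def)
  have "integrable (lebesgue_on (box l r)) (\<lambda>x. P (x $ i) * R (x $ co i) * g x)"
    "integrable (lebesgue_on (box l r)) (\<lambda>x. deriv P (x $ i) * R (x $ co i) * w x)"
    using pairing_integrable L2 test_limit_smooth[OF P] test_limit_smooth[OF smooth_deriv[OF P]] test_limit_smooth[OF R]
    by blast+
  ultimately show ?thesis
    by (simp add: pairing_element[OF lr(1,3)])
qed

lemma smooth_affine_function: "smooth (\<lambda>t. t - c)"
  by (intro smooth_diff smooth_ident smooth_const)

lemma deriv_affine_function: "deriv (\<lambda>t::real. t - c) = (\<lambda>t. 1)"
  by (rule ext, rule DERIV_imp_deriv) (auto intro!: derivative_eq_intros)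

lemma deriv_const_function: "deriv (\<lambda>t::real. c::real) = (\<lambda>t. 0)"
  by (rule ext, rule DERIV_imp_deriv) simp

lemma L2_norm_const:
  assumes "\<And>k. l $ k \<le> r $ k" shows "L2_norm (box l r) (\<lambda>x. c :: real) = \<bar>c\<bar> * sqrt (area l r)"
proof -
  have "(LINT x|lebesgue_on (box l r). c\<^sup>2) = c\<^sup>2 * area l r" by (rule integral_const_box[OF assms])
  then show ?thesis by (simp add: L2_norm_def real_sqrt_mult)
qed

lemma area_pos: "(\<And>k. l $ k < r $ k) \<Longrightarrow> 0 < area l r"
  by (simp add: area_def)

text \<open>The factor \<open>sqrt (area l r)\<close> is the norm of a constant function on the
  rectangle, so this bounds the constant field given by a weighted mean by the norm of
  \<open>g\<close>.\<close>
lemma mean_diff_bound: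
  assumes g: "g \<in> L2 (box l r)" and lr: "\<And>k. l $ k < r $ k"
    and k: "k \<in> borel_measurable (lebesgue_on (box l r))" "\<And>x. x \<in> box l r \<Longrightarrow> \<bar>k x\<bar> \<le> B"
  shows "\<bar>mean l r (\<lambda>x. k x * g x)\<bar> * sqrt (area l r) \<le> B * L2_norm (box l r) g"
proof -
  let ?K = "box l r"
  have A: "0 < area l r" by (rule area_pos[OF lr])
  have B0: "0 \<le> B" using k(2)[of "(1/2) *\<^sub>R (l + r)"] lr by (fastforce simp: mem_box_cart)
  have kL: "k \<in> L2 ?K" by (rule L2_bounded[where B = B]) (use k in auto)
  have "L2_norm ?K k \<le> L2_norm ?K (\<lambda>x. B)"
    by (rule L2_norm_mono[OF k(1) L2_const]) (use k(2) B0 in \<open>auto intro!: AE_I2\<close>)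
  also have "\<dots> = B * sqrt (area l r)" using lr B0 by (subst L2_norm_const) (auto intro: less_imp_le)
  finally have kn: "L2_norm ?K k \<le> B * sqrt (area l r)" .
  have "\<bar>LINT x|lebesgue_on ?K. k x * g x\<bar> \<le> L2_norm ?K k * L2_norm ?K g"
    using L2_Cauchy_Schwarz[OF kL g] by (simp add: L2_inner_def)
  also have "\<dots> \<le> B * sqrt (area l r) * L2_norm ?K g"
    by (rule mult_right_mono[OF kn L2_norm_nonneg])
  finally have "\<bar>mean l r (\<lambda>x. k x * g x)\<bar> \<le> B * sqrt (area l r) * L2_norm ?K g / area l r"
    using A by (simp add: mean_def divide_right_mono)
  then have "\<bar>mean l r (\<lambda>x. k x * g x)\<bar> * sqrt (area l r) \<le> B * sqrt (area l r) * L2_norm ?K g / area l r * sqrt (area l r)"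
    using A by (intro mult_right_mono) auto
  also have "\<dots> = B * L2_norm ?K g * ((sqrt (area l r))\<^sup>2 / area l r)" by (simp add: power2_eq_square)
  also have "\<dots> = B * L2_norm ?K g" using A by simp
  finally show ?thesis .
qed

definition center :: "plane \<Rightarrow> plane \<Rightarrow> 2 \<Rightarrow> real" where
  "center l r k = (l $ k + r $ k) / 2"

lemma coordinate_measurable: "(\<lambda>x::plane. x $ k - c) \<in> borel_measurable (lebesgue_on U)"
  by (rule continuous_measurable_lebesgue_on) (intro continuous_intros)

lemma center_bound: "x \<in> box l r \<Longrightarrow> \<bar>x $ k - center l r k\<bar> \<le> (r $ k - l $ k) / 2"
  using box_nthD[of x l r k] by (auto simp: center_def abs_le_iff field_simps)

lemma affine_L2: "(\<lambda>x. c + s * (x $ 1 - m) + t * (x $ 2 - n)) \<in> L2 (box l r)"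
proof -
  have "(\<lambda>x. x $ k - d) \<in> L2 (box l r)" for k d
  proof (rule L2_bounded[OF lmeasurable_box coordinate_measurable])
    show "norm (x $ k - d) \<le> \<bar>l $ k\<bar> + \<bar>r $ k\<bar> + \<bar>d\<bar>" if "x \<in> box l r" for x
      using box_nthD[OF that, of k] by auto
  qed
  from L2_add[OF L2_add[OF L2_const[OF lmeasurable_box] L2_scaleR[OF this]] L2_scaleR[OF this],
      of c s 1 m t 2 n]
  show ?thesis by simp
qed

text \<open>The error of an affine approximation, split into the distance to the mean, for which
  the Poincare inequality is available, and the sizes of the remaining constant and of the slopes.\<close>
lemma affine_error:
  assumes w: "w \<in> L2 (box l r)" and lr: "\<And>k. l $ k < r $ k"
  shows "L2_norm (box l r) (\<lambda>x. w x - (c + s * (x $ 1 - center l r 1) + t * (x $ 2 - center l r 2))) \<le>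
    L2_norm (box l r) (\<lambda>x. w x - mean l r w) + \<bar>c - mean l r w\<bar> * sqrt (area l r)
    + (r $ 1 - l $ 1) / 2 * (\<bar>s\<bar> * sqrt (area l r)) + (r $ 2 - l $ 2) / 2 * (\<bar>t\<bar> * sqrt (area l r))"
proof -
  let ?K = "box l r" and ?h1 = "r $ 1 - l $ 1" and ?h2 = "r $ 2 - l $ 2"
  let ?B = "\<bar>c - mean l r w\<bar> + \<bar>s\<bar> * (?h1 / 2) + \<bar>t\<bar> * (?h2 / 2)"
  define d where "d x = (c - mean l r w) + s * (x $ 1 - center l r 1) + t * (x $ 2 - center l r 2)" for x :: plane
  have dL: "d \<in> L2 ?K" unfolding d_def by (rule affine_L2)
  have B0: "0 \<le> ?B" using lr[of 1] lr[of 2] by simp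
  have "\<bar>d x\<bar> \<le> ?B" if "x \<in> ?K" for x
  proof -
    have "\<bar>s * (x $ 1 - center l r 1)\<bar> \<le> \<bar>s\<bar> * (?h1 / 2)" "\<bar>t * (x $ 2 - center l r 2)\<bar> \<le> \<bar>t\<bar> * (?h2 / 2)"
      unfolding abs_mult by (intro mult_left_mono center_bound[OF that] abs_ge_zero)+
    then show ?thesis unfolding d_def by linarith
  qed
  then have "L2_norm ?K d \<le> L2_norm ?K (\<lambda>x. ?B)"
    using B0 by (intro L2_norm_mono[OF L2_measurable[OF dL] L2_const[OF lmeasurable_box]] AE_I2) auto
  also have "\<dots> = ?B * sqrt (area l r)" using lr B0 by (subst L2_norm_const) (auto intro: less_imp_le)
  finally have dn: "L2_norm ?K d \<le> ?B * sqrt (area l r)" .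
  have "L2_norm ?K (\<lambda>x. (w x - mean l r w) - d x) \<le> L2_norm ?K (\<lambda>x. w x - mean l r w) + L2_norm ?K d"
    by (intro L2_norm_diff_triangle L2_diff w L2_const dL lmeasurable_box)
  moreover have "(\<lambda>x. (w x - mean l r w) - d x) =
      (\<lambda>x. w x - (c + s * (x $ 1 - center l r 1) + t * (x $ 2 - center l r 2)))"
    by (auto simp: d_def)
  ultimately show ?thesis using dn by (simp add: algebra_simps)
qed

text \<open>The weight that restricts a line trace to one side of the rectangle. The factor
  \<open>1\<close> makes it an instance of the integration by parts formula.\<close>
definition strip_weight :: "plane \<Rightarrow> plane \<Rightarrow> 2 \<Rightarrow> real \<Rightarrow> real" where
  "strip_weight l r i = (\<lambda>s. indicator {l $ co i<..<r $ co i} s * 1)"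

text \<open>The difference of the integrals over opposite sides is the integral of the derivative.
  Their average differs from the integral over the element by a first moment of the derivative,
  which is of higher order.\<close>
lemma line_trace_element:
  assumes wp: "weak_partial a b i w g"
    and lr: "\<And>k. a $ k \<le> l $ k" "\<And>k. l $ k < r $ k" "\<And>k. r $ k \<le> b $ k"
  defines "T \<equiv> line_trace a b i w g (strip_weight l r i)"
  shows "T (r $ i) - T (l $ i) = area l r * mean l r g"
    and "(r $ i - l $ i) / 2 * (T (r $ i) + T (l $ i)) =
      area l r * (mean l r w + mean l r (\<lambda>x. (x $ i - center l r i) * g x))"
proof -
  have A: "0 < area l r" by (rule area_pos[OF lr(2)])
  have L2: "w \<in> L2 (box l r)" "g \<in> L2 (box l r)"
    using weak_partial_subbox[OF wp lr(1,3)] by (auto simp: weak_partial_def)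
  show "T (r $ i) - T (l $ i) = area l r * mean l r g"
    using line_trace_by_parts[OF wp lr smooth_const[of 1] smooth_const[of 1]] A
    by (simp add: T_def strip_weight_def mean_def deriv_const_function)
  have "(\<lambda>x. (x $ i - center l r i) * g x) \<in> L2 (box l r)"
  proof (rule L2_bounded_mult[OF L2(2)])
    show "(\<lambda>x. x $ i - center l r i) \<in> borel_measurable (lebesgue_on (box l r))" by (rule coordinate_measurable)
    show "\<bar>x $ i - center l r i\<bar> \<le> (r $ i - l $ i) / 2" if "x \<in> box l r" for x by (rule center_bound[OF that])
  qed
  then have int: "integrable (lebesgue_on (box l r)) (\<lambda>x. (x $ i - center l r i) * g x)"
    "integrable (lebesgue_on (box l r)) w" using L2 by (simp_all add: L2_integrable)
  have "(LINT x|lebesgue_on (box l r). (x $ i - center l r i) * g x + w x) =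
      (r $ i - center l r i) * T (r $ i) - (l $ i - center l r i) * T (l $ i)"
    using line_trace_by_parts[OF wp lr smooth_affine_function[of "center l r i"] smooth_const[of 1]]
    by (simp add: T_def strip_weight_def deriv_affine_function)
  also have "\<dots> = (r $ i - l $ i) / 2 * (T (r $ i) + T (l $ i))"
    by (simp add: center_def field_simps)
  finally have "(r $ i - l $ i) / 2 * (T (r $ i) + T (l $ i)) =
      (LINT x|lebesgue_on (box l r). (x $ i - center l r i) * g x) + (LINT x|lebesgue_on (box l r). w x)"
    using Bochner_Integration.integral_add[OF int] by simp
  moreover have "(LINT x|lebesgue_on (box l r). v x) = area l r * mean l r v" for v
    using A by (simp add: mean_def)
  ultimately show "(r $ i - l $ i) / 2 * (T (r $ i) + T (l $ i)) =
      area l r * (mean l r w + mean l r (\<lambda>x. (x $ i - center l r i) * g x))"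
    by (simp add: distrib_left)
qed

text \<open>The regularity needed for vertex values: both first derivatives and one common mixed
  second derivative.\<close>
definition weak_mixed :: "plane \<Rightarrow> plane \<Rightarrow> (plane \<Rightarrow> real) \<Rightarrow> (plane \<Rightarrow> real) \<Rightarrow> (plane \<Rightarrow> real) \<Rightarrow> (plane \<Rightarrow> real) \<Rightarrow> bool" where
  "weak_mixed a b w w1 w2 w12 \<longleftrightarrow> weak_partial a b 1 w w1 \<and> weak_partial a b 2 w w2 \<and>
     weak_partial a b 2 w1 w12 \<and> weak_partial a b 1 w2 w12"

text \<open>The value at the point with the coordinates \<open>s\<close> and \<open>t\<close>,
  taken as a trace in direction 2 of a trace in direction 1.\<close>
definition vertex_value :: "plane \<Rightarrow> plane \<Rightarrow> (plane \<Rightarrow> real) \<Rightarrow> (plane \<Rightarrow> real) \<Rightarrow> (plane \<Rightarrow> real) \<Rightarrow> (plane \<Rightarrow> real) \<Rightarrow> real \<Rightarrow> real \<Rightarrow> real" where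
  "vertex_value a b w w1 w2 w12 s t = weak_trace (a $ 2) (b $ 2)
     (\<lambda>p. line_trace a b 1 w w1 p s) (\<lambda>p. line_trace a b 1 w2 w12 p s) t"

text \<open>Slopes and average of the bilinear interpolant at the vertices, in terms of means over
  the element. Up to first moments of the mixed derivative the slopes are the means of the first
  derivatives, and this is what makes the divergence of the interpolant accurate.\<close>
lemma vertex_value_element:
  assumes m: "weak_mixed a b w w1 w2 w12"
    and lr: "\<And>k. a $ k \<le> l $ k" "\<And>k. l $ k < r $ k" "\<And>k. r $ k \<le> b $ k"
  defines "V \<equiv> vertex_value a b w w1 w2 w12"
  defines "c \<equiv> center l r"
  shows "(r $ 2 - l $ 2) / 2 * (V (r $ 1) (r $ 2) + V (r $ 1) (l $ 2) - V (l $ 1) (r $ 2) - V (l $ 1) (l $ 2)) =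
      area l r * (mean l r w1 + mean l r (\<lambda>x. (x $ 2 - c 2) * w12 x))"
    and "(r $ 1 - l $ 1) / 2 * (V (r $ 1) (r $ 2) - V (r $ 1) (l $ 2) + V (l $ 1) (r $ 2) - V (l $ 1) (l $ 2)) =
      area l r * (mean l r w2 + mean l r (\<lambda>x. (x $ 1 - c 1) * w12 x))"
    and "(V (r $ 1) (r $ 2) + V (r $ 1) (l $ 2) + V (l $ 1) (r $ 2) + V (l $ 1) (l $ 2)) / 4 =
      mean l r w + mean l r (\<lambda>x. (x $ 1 - c 1) * w1 x) + mean l r (\<lambda>x. (x $ 2 - c 2) * w2 x)
      + mean l r (\<lambda>x. (x $ 1 - c 1) * (x $ 2 - c 2) * w12 x)"
proof -
  let ?K = "box l r" and ?h1 = "r $ 1 - l $ 1" and ?h2 = "r $ 2 - l $ 2"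
  have wp: "weak_partial a b 1 w w1" "weak_partial a b (co 1) w w2"
    "weak_partial a b (co 1) w1 w12" "weak_partial a b 1 w2 w12"
    using m by (simp_all add: weak_mixed_def)
  have ab: "a $ k < b $ k" for k using lr(1-3)[of k] by linarith
  have A: "0 < area l r" by (rule area_pos[OF lr(2)])
  have L2: "w \<in> L2 ?K" "w1 \<in> L2 ?K" "w2 \<in> L2 ?K" "w12 \<in> L2 ?K"
    using wp[THEN weak_partial_subbox, OF lr(1,3)] by (auto dest: weak_partial_L2)
  define one where "one = (\<lambda>s. indicator {l $ 2<..<r $ 2} s * 1 :: real)"
  define lin where "lin = (\<lambda>s. indicator {l $ 2<..<r $ 2} s * (s - c 2))"
  define T where "T p s = line_trace a b 1 w w1 p s" for p s
  define S where "S p s = line_trace a b 1 w2 w12 p s" for p s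
  have pairs: "weak_pair (a $ 2) (b $ 2) (\<lambda>p. T p s) (\<lambda>p. S p s)" for s
    using weak_pair_line_trace[OF wp] ab by (simp add: T_def S_def)
  have zero: "T (\<lambda>s. 0) s = 0" for s
    by (simp add: T_def line_trace_def weak_trace_def pairing_def)
  have S1: "S one s = V s (r $ 2) - V s (l $ 2)" for s
    using trace_by_parts[OF pairs[of s] lr(1) lr(2) lr(3) smooth_const[of 1]]
    by (simp add: one_def V_def vertex_value_def T_def[symmetric] S_def[symmetric] deriv_const_function zero)
  have c2: "r $ 2 - c 2 = ?h2 / 2" "l $ 2 - c 2 = - (?h2 / 2)" by (simp_all add: c_def center_def field_simps)
  have S2: "S lin s + T one s = ?h2 / 2 * (V s (r $ 2) + V s (l $ 2))" for s
  proof -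
    have "S lin s + T one s = (r $ 2 - c 2) * V s (r $ 2) - (l $ 2 - c 2) * V s (l $ 2)"
      using trace_by_parts[OF pairs[of s] lr(1) lr(2) lr(3) smooth_affine_function[of "c 2"]]
      by (simp add: one_def lin_def V_def vertex_value_def T_def[symmetric] S_def[symmetric] deriv_affine_function)
    then show ?thesis unfolding c2 by (simp only: distrib_left mult_minus_left diff_minus_eq_add)
  qed
  have int: "integrable (lebesgue_on ?K) (\<lambda>x. P (x $ 1) * R (x $ 2) * v x)"
    if "v \<in> L2 ?K" "smooth P" "smooth R" for P R v
    using pairing_integrable[of v l r 1 P R] that test_limit_smooth by simp
  have LINT: "(LINT x|lebesgue_on ?K. v x) = area l r * mean l r v" for v using A by (simp add: mean_def)
  note lt = line_trace_by_parts[OF _ lr, where i = 1, unfolded co_simps]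
  have T1: "T one (r $ 1) - T one (l $ 1) = area l r * mean l r w1"
    using lt[OF wp(1) smooth_const[of 1] smooth_const[of 1]]
    by (simp add: T_def one_def deriv_const_function LINT)
  have T2: "(r $ 1 - c 1) * T one (r $ 1) - (l $ 1 - c 1) * T one (l $ 1) =
      area l r * mean l r (\<lambda>x. (x $ 1 - c 1) * w1 x) + area l r * mean l r w"
  proof -
    have "(LINT x|lebesgue_on ?K. (x $ 1 - c 1) * 1 * w1 x + 1 * 1 * w x) =
        (r $ 1 - c 1) * T one (r $ 1) - (l $ 1 - c 1) * T one (l $ 1)"
      using lt[OF wp(1) smooth_affine_function[of "c 1"] smooth_const[of 1]]
      by (simp only: T_def one_def deriv_affine_function)
    then show ?thesis
      using Bochner_Integration.integral_add[OF int[OF L2(2) smooth_affine_function[of "c 1"] smooth_const[of 1]]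
        int[OF L2(1) smooth_const[of 1] smooth_const[of 1]]] by (simp add: LINT)
  qed
  have S3: "(r $ 1 - c 1) * S one (r $ 1) - (l $ 1 - c 1) * S one (l $ 1) =
      area l r * mean l r (\<lambda>x. (x $ 1 - c 1) * w12 x) + area l r * mean l r w2"
  proof -
    have "(LINT x|lebesgue_on ?K. (x $ 1 - c 1) * 1 * w12 x + 1 * 1 * w2 x) =
        (r $ 1 - c 1) * S one (r $ 1) - (l $ 1 - c 1) * S one (l $ 1)"
      using lt[OF wp(4) smooth_affine_function[of "c 1"] smooth_const[of 1]]
      by (simp only: S_def one_def deriv_affine_function)
    then show ?thesis
      using Bochner_Integration.integral_add[OF int[OF L2(4) smooth_affine_function[of "c 1"] smooth_const[of 1]]
        int[OF L2(3) smooth_const[of 1] smooth_const[of 1]]] by (simp add: LINT)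
  qed
  have S4: "S lin (r $ 1) - S lin (l $ 1) = area l r * mean l r (\<lambda>x. (x $ 2 - c 2) * w12 x)"
    using lt[OF wp(4) smooth_const[of 1] smooth_affine_function[of "c 2"]]
    by (simp add: S_def lin_def deriv_const_function LINT)
  have S5: "(r $ 1 - c 1) * S lin (r $ 1) - (l $ 1 - c 1) * S lin (l $ 1) =
      area l r * mean l r (\<lambda>x. (x $ 1 - c 1) * (x $ 2 - c 2) * w12 x) + area l r * mean l r (\<lambda>x. (x $ 2 - c 2) * w2 x)"
  proof -
    have "(LINT x|lebesgue_on ?K. (x $ 1 - c 1) * (x $ 2 - c 2) * w12 x + 1 * (x $ 2 - c 2) * w2 x) =
        (r $ 1 - c 1) * S lin (r $ 1) - (l $ 1 - c 1) * S lin (l $ 1)"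
      using lt[OF wp(4) smooth_affine_function[of "c 1"] smooth_affine_function[of "c 2"]]
      by (simp only: S_def lin_def deriv_affine_function)
    then show ?thesis
      using Bochner_Integration.integral_add[OF int[OF L2(4) smooth_affine_function[of "c 1"] smooth_affine_function[of "c 2"]]
        int[OF L2(3) smooth_const[of 1] smooth_affine_function[of "c 2"]]] by (simp add: LINT)
  qed
  have c1: "r $ 1 - c 1 = ?h1 / 2" "l $ 1 - c 1 = - (?h1 / 2)" by (simp_all add: c_def center_def field_simps)
  have alg: "h / 2 * (p + q - s - t) = h / 2 * (p + q) - h / 2 * (s + t)" for h p q s t :: real
    by (simp add: field_simps)
  show "?h2 / 2 * (V (r $ 1) (r $ 2) + V (r $ 1) (l $ 2) - V (l $ 1) (r $ 2) - V (l $ 1) (l $ 2)) =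
      area l r * (mean l r w1 + mean l r (\<lambda>x. (x $ 2 - c 2) * w12 x))"
    unfolding alg S2[symmetric] unfolding distrib_left using T1 S4 by linarith
  show "?h1 / 2 * (V (r $ 1) (r $ 2) - V (r $ 1) (l $ 2) + V (l $ 1) (r $ 2) - V (l $ 1) (l $ 2)) =
      area l r * (mean l r w2 + mean l r (\<lambda>x. (x $ 1 - c 1) * w12 x))"
  proof -
    have "h / 2 * (p - q + s - t) = h / 2 * (p - q) - (- (h / 2)) * (s - t)" for h p q s t :: real
      by (simp add: field_simps)
    then have "?h1 / 2 * (V (r $ 1) (r $ 2) - V (r $ 1) (l $ 2) + V (l $ 1) (r $ 2) - V (l $ 1) (l $ 2)) =
        (r $ 1 - c 1) * S one (r $ 1) - (l $ 1 - c 1) * S one (l $ 1)"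
      unfolding c1 S1 by blast
    then show ?thesis unfolding S3 distrib_left by linarith
  qed
  have "?h1 / 2 * (?h2 / 2 * (V (r $ 1) (r $ 2) + V (r $ 1) (l $ 2)) + ?h2 / 2 * (V (l $ 1) (r $ 2) + V (l $ 1) (l $ 2))) =
      area l r * (mean l r w + mean l r (\<lambda>x. (x $ 1 - c 1) * w1 x) + mean l r (\<lambda>x. (x $ 2 - c 2) * w2 x)
      + mean l r (\<lambda>x. (x $ 1 - c 1) * (x $ 2 - c 2) * w12 x))"
  proof -
    have "h / 2 * ((p + q) + (s + t)) = (h / 2 * p - (- (h / 2)) * s) + (h / 2 * q - (- (h / 2)) * t)" for h p q s t :: real
      by (simp add: field_simps)
    then have "?h1 / 2 * ((S lin (r $ 1) + T one (r $ 1)) + (S lin (l $ 1) + T one (l $ 1))) =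
        ((r $ 1 - c 1) * S lin (r $ 1) - (l $ 1 - c 1) * S lin (l $ 1)) +
        ((r $ 1 - c 1) * T one (r $ 1) - (l $ 1 - c 1) * T one (l $ 1))"
      unfolding c1 by blast
    then show ?thesis unfolding S2[symmetric] unfolding T2 S5 distrib_left[of "area l r"] by linarith
  qed
  moreover have "h / 2 * (k / 2 * x + k / 2 * y) = h * k * ((x + y) / 4)" for h k x y :: real
    by (simp add: field_simps)
  ultimately have "area l r * ((V (r $ 1) (r $ 2) + V (r $ 1) (l $ 2) + (V (l $ 1) (r $ 2) + V (l $ 1) (l $ 2))) / 4) =
      area l r * (mean l r w + mean l r (\<lambda>x. (x $ 1 - c 1) * w1 x) + mean l r (\<lambda>x. (x $ 2 - c 2) * w2 x)
      + mean l r (\<lambda>x. (x $ 1 - c 1) * (x $ 2 - c 2) * w12 x))"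
    by (simp only: area_def)
  then show "(V (r $ 1) (r $ 2) + V (r $ 1) (l $ 2) + V (l $ 1) (r $ 2) + V (l $ 1) (l $ 2)) / 4 =
      mean l r w + mean l r (\<lambda>x. (x $ 1 - c 1) * w1 x) + mean l r (\<lambda>x. (x $ 2 - c 2) * w2 x)
      + mean l r (\<lambda>x. (x $ 1 - c 1) * (x $ 2 - c 2) * w12 x)"
    using A by (simp add: add.assoc)
qed

section \<open>Rectangular grids\<close>

abbreviation lo :: "plane set \<Rightarrow> plane" where "lo K \<equiv> interval_lowerbound K"
abbreviation hi :: "plane set \<Rightarrow> plane" where "hi K \<equiv> interval_upperbound K"
abbreviation avg :: "plane set \<Rightarrow> (plane \<Rightarrow> real) \<Rightarrow> real" where "avg K \<equiv> mean (lo K) (hi K)"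
abbreviation strip :: "plane set \<Rightarrow> 2 \<Rightarrow> real \<Rightarrow> real" where "strip K \<equiv> strip_weight (lo K) (hi K)"
abbreviation mid :: "plane set \<Rightarrow> 2 \<Rightarrow> real" where "mid K \<equiv> center (lo K) (hi K)"
abbreviation upper_mid :: "plane set \<Rightarrow> 2 \<Rightarrow> plane" where "upper_mid K i \<equiv> emb i (hi K $ i) (mid K (co i))"

lemma AE_inside: "AE x in lebesgue_on U. x \<in> U" for U :: "plane set"
  by (rule AE_I2) simp

lemma cbox_bounds:
  fixes l :: plane assumes "\<And>k. l $ k \<le> r $ k"
  shows "lo (cbox l r) = l" "hi (cbox l r) = r"
proof -
  have "l \<bullet> b \<le> r \<bullet> b" if "b \<in> Basis" for b
    using that assms by (auto simp: Basis_vec_def inner_axis)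
  then show "lo (cbox l r) = l" "hi (cbox l r) = r" by (auto intro: interval_lowerbound interval_upperbound)
qed

lemma cbox_mem_iff:
  fixes x :: plane
  shows "x \<in> cbox l u \<longleftrightarrow> x $ i \<in> {l $ i..u $ i} \<and> x $ co i \<in> {l $ co i..u $ co i}"
proof -
  have "(\<forall>k. P k) \<longleftrightarrow> P i \<and> P (co i)" for P :: "2 \<Rightarrow> bool" by (metis index_cases)
  then show ?thesis by (simp add: mem_box_cart)
qed

locale grid =
  fixes a b :: plane and T :: "plane set set"
  assumes ab: "\<And>k. a $ k < b $ k" and grid: "rect_grid (box a b) T"
begin

lemma division: "T division_of cbox a b"
proof -
  have "box a b \<noteq> {}" using ab by (simp add: interval_ne_empty_cart)
  then show ?thesis using grid by (simp add: rect_grid_def closure_box)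
qed

lemma Union_T: "\<Union>T = cbox a b" by (rule division_ofD(6)[OF division])

lemma finite_T: "finite T" using division by blast

lemma element:
  assumes "K \<in> T"
  shows "K = cbox (lo K) (hi K)" "interior K = box (lo K) (hi K)" "lo K $ k < hi K $ k"
    "a $ k \<le> lo K $ k" "hi K $ k \<le> b $ k"
proof -
  obtain l r where K: "K = cbox l r" using division_ofD(4)[OF division assms] by blast
  have "interior K \<noteq> {}" using grid assms by (simp add: rect_grid_def)
  then have lr: "l $ j < r $ j" for j unfolding K interior_cbox interval_ne_empty_cart by blast
  have b: "lo K = l" "hi K = r" unfolding K by (simp_all add: cbox_bounds less_imp_le[OF lr])
  show "K = cbox (lo K) (hi K)" unfolding b by (rule K)
  show "interior K = box (lo K) (hi K)" unfolding b by (simp add: K interior_cbox)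
  show "lo K $ k < hi K $ k" unfolding b by (rule lr)
  have "K \<subseteq> cbox a b" using division_ofD(2)[OF division assms] .
  moreover have "l \<in> K" "r \<in> K" unfolding K using lr by (auto simp: mem_box_cart less_imp_le)
  ultimately have "l \<in> cbox a b" "r \<in> cbox a b" by blast+
  then show "a $ k \<le> lo K $ k" "hi K $ k \<le> b $ k" unfolding b by (simp_all add: mem_box_cart)
qed

lemma element_mem: "K \<in> T \<Longrightarrow> x \<in> K \<longleftrightarrow> x \<in> cbox (lo K) (hi K)"
  using element(1) by (rule arg_cong[where f = "\<lambda>S. x \<in> S"])

lemma element_closed: "K \<in> T \<Longrightarrow> closed K"
  by (subst element(1)) auto

lemma element_subset: "K \<in> T \<Longrightarrow> interior K \<subseteq> box a b"
  using element box_subset_box_cart_le[of a "lo K" "hi K" b] by simp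

lemma interiors_disjoint: "K \<in> T \<Longrightarrow> L \<in> T \<Longrightarrow> x \<in> interior K \<Longrightarrow> x \<in> interior L \<Longrightarrow> K = L"
  using division_ofD(5)[OF division] by blast

lemma emb_mem_box: "emb i s t \<in> box l r \<longleftrightarrow> s \<in> {l $ i<..<r $ i} \<and> t \<in> {l $ co i<..<r $ co i}"
  by (subst box_mem_iff[of _ l r i]) simp

lemma emb_mem_cbox: "emb i s t \<in> cbox l r \<longleftrightarrow> s \<in> {l $ i..r $ i} \<and> t \<in> {l $ co i..r $ co i}"
  by (subst cbox_mem_iff[of _ l r i]) simp

lemma element_eqI:
  assumes "K \<in> T" "L \<in> T" "s \<in> {lo K $ i<..<hi K $ i}" "s \<in> {lo L $ i<..<hi L $ i}"
    "t \<in> {lo K $ co i<..<hi K $ co i}" "t \<in> {lo L $ co i<..<hi L $ co i}"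
  shows "K = L"
  using interiors_disjoint[OF assms(1,2), of "emb i s t"] element(2)[OF assms(1)] element(2)[OF assms(2)] assms(3-6)
  by (simp add: emb_mem_box)

lemma element_eq_lo:
  assumes K: "K \<in> T" and L: "L \<in> T" and eq: "lo K $ i = lo L $ i" "lo K $ co i = lo L $ co i" "hi K $ co i = hi L $ co i"
  shows "K = L"
proof (rule element_eqI[OF K L, where i = i])
  show "(lo K $ i + min (hi K $ i) (hi L $ i)) / 2 \<in> {lo K $ i<..<hi K $ i}"
    "(lo K $ i + min (hi K $ i) (hi L $ i)) / 2 \<in> {lo L $ i<..<hi L $ i}"
    using element(3)[OF K, of i] element(3)[OF L, of i] eq by (auto simp: min_def)
  show "(lo K $ co i + hi K $ co i) / 2 \<in> {lo K $ co i<..<hi K $ co i}"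
    "(lo K $ co i + hi K $ co i) / 2 \<in> {lo L $ co i<..<hi L $ co i}"
    using element(3)[OF K, of "co i"] eq by auto
qed

lemma element_eq_hi:
  assumes K: "K \<in> T" and L: "L \<in> T" and eq: "hi K $ i = hi L $ i" "lo K $ co i = lo L $ co i" "hi K $ co i = hi L $ co i"
  shows "K = L"
proof (rule element_eqI[OF K L, where i = i])
  show "(max (lo K $ i) (lo L $ i) + hi K $ i) / 2 \<in> {lo K $ i<..<hi K $ i}"
    "(max (lo K $ i) (lo L $ i) + hi K $ i) / 2 \<in> {lo L $ i<..<hi L $ i}"
    using element(3)[OF K, of i] element(3)[OF L, of i] eq by (auto simp: max_def)
  show "(lo K $ co i + hi K $ co i) / 2 \<in> {lo K $ co i<..<hi K $ co i}"
    "(lo K $ co i + hi K $ co i) / 2 \<in> {lo L $ co i<..<hi L $ co i}"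
    using element(3)[OF K, of "co i"] eq by auto
qed

text \<open>Conformity enters here. An element containing the midpoint of the edge meets
  \<open>K\<close> in a face of both. As a face of \<open>K\<close> that contains an interior point
  of the edge, the intersection contains the whole edge; as a face of \<open>L\<close> it cannot
  end inside an edge of \<open>L\<close>.\<close>
lemma neighbour:
  assumes K: "K \<in> T" and t: "t \<in> {lo K $ i, hi K $ i}" "a $ i < t" "t < b $ i"
  obtains L where "L \<in> T" "L \<noteq> K" "t \<in> {lo L $ i, hi L $ i}"
    "lo L $ co i = lo K $ co i" "hi L $ co i = hi K $ co i"
proof -
  let ?j = "co i"
  define m where "m = emb i t ((lo K $ ?j + hi K $ ?j) / 2)"
  define p where "p = emb i t (lo K $ ?j)"
  define q where "q = emb i t (hi K $ ?j)"
  note K' = element[OF K]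
  have mid: "lo K $ ?j < (lo K $ ?j + hi K $ ?j) / 2" "(lo K $ ?j + hi K $ ?j) / 2 < hi K $ ?j"
    using K'(3)[of ?j] by simp_all
  have m_box: "m \<in> box a b"
    using t mid K'(4,5)[of ?j] by (simp add: m_def emb_mem_box)
  have m_K: "m \<in> K" "p \<in> K" "q \<in> K"
    unfolding element_mem[OF K] m_def p_def q_def using t(1) mid K'(3)[of i] K'(3)[of ?j] by (auto simp: emb_mem_cbox)
  have m_int: "m \<notin> interior K"
    using t(1) unfolding K'(2) m_def by (auto simp: emb_mem_box)
  \<comment> \<open>Otherwise \<open>K\<close> alone would cover a neighbourhood of \<open>m\<close>, which lies on its boundary.\<close>
  have "\<exists>L\<in>T - {K}. m \<in> L"
  proof (rule ccontr)
    assume "\<not> (\<exists>L\<in>T - {K}. m \<in> L)"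
    then have "m \<in> box a b - \<Union>(T - {K})" using m_box by blast
    moreover have "closed (\<Union>(T - {K}))"
      using finite_T element_closed by (intro closed_Union) auto
    then have "open (box a b - \<Union>(T - {K}))" by (intro open_Diff open_box)
    moreover have "box a b - \<Union>(T - {K}) \<subseteq> K"
    proof
      fix x assume x: "x \<in> box a b - \<Union>(T - {K})"
      then have "x \<in> \<Union>T" unfolding Union_T using box_subset_cbox[of a b] by blast
      then show "x \<in> K" using x by blast
    qed
    ultimately have "m \<in> interior K" by (meson interiorI)
    then show False using m_int by blast
  qed
  then obtain L where L: "L \<in> T" "L \<noteq> K" "m \<in> L" by blast
  note L' = element[OF L(1)]
  have face: "(K \<inter> L) face_of K" "(K \<inter> L) face_of L" using grid K L(1) by (auto simp: rect_grid_def)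
  have segm: "emb i t ((x + y) / 2) \<in> open_segment (emb i t x) (emb i t y)" if "x \<noteq> y" for x y
  proof -
    have "emb i t ((x + y) / 2) = (1 - 1/2) *\<^sub>R emb i t x + (1/2) *\<^sub>R emb i t y"
      by (simp add: vec_eq_iff emb_def field_simps)
    moreover have "emb i t x \<noteq> emb i t y" using that emb_nth(2)[of i t] by metis
    ultimately show ?thesis unfolding in_segment by (intro conjI exI[of _ "1/2"]) auto
  qed
  have pq: "p \<in> K \<inter> L" "q \<in> K \<inter> L"
    using face_ofD[OF face(1), of m p q] segm[of "lo K $ ?j" "hi K $ ?j"] m_K L(3) K'(3)[of ?j]
    by (auto simp: m_def p_def q_def)
  have tL: "lo L $ i \<le> t" "t \<le> hi L $ i" "lo L $ ?j \<le> lo K $ ?j" "hi K $ ?j \<le> hi L $ ?j"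
    using pq by (auto simp: element_mem[OF L(1)] p_def q_def emb_mem_cbox)
  \<comment> \<open>If \<open>L\<close> extended beyond an end point of the edge, that point would lie between two points of \<open>L\<close>,
    mirror images of each other, of which one is outside \<open>K\<close>.\<close>
  have stop: False if c: "emb i t c \<in> K \<inter> L" and v: "v \<noteq> c" "v \<in> {lo L $ ?j..hi L $ ?j}" "2 * c - v \<in> {lo L $ ?j..hi L $ ?j}"
    and out: "2 * c - v \<notin> {lo K $ ?j..hi K $ ?j}" for c v
  proof -
    have vL: "emb i t v \<in> L" "emb i t (2 * c - v) \<in> L" using v tL by (auto simp: element_mem[OF L(1)] emb_mem_cbox)
    have "emb i t c \<in> open_segment (emb i t (2 * c - v)) (emb i t v)" using segm[of "2 * c - v" v] v(1) by simp
    then have "emb i t (2 * c - v) \<in> K \<inter> L" using face_ofD[OF face(2) _ vL(2) vL(1) c] by blast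
    then show False using out by (auto simp: element_mem[OF K] emb_mem_cbox)
  qed
  have lo_eq: "lo L $ ?j = lo K $ ?j"
  proof (rule ccontr)
    assume "lo L $ ?j \<noteq> lo K $ ?j"
    then have "lo L $ ?j < lo K $ ?j" using tL by simp
    then show False
      using tL pq(1) K'(3)[of ?j] by (intro stop[of "lo K $ ?j" "min (hi K $ ?j) (2 * lo K $ ?j - lo L $ ?j)"]) (auto simp: p_def)
  qed
  have hi_eq: "hi L $ ?j = hi K $ ?j"
  proof (rule ccontr)
    assume "hi L $ ?j \<noteq> hi K $ ?j"
    then have "hi K $ ?j < hi L $ ?j" using tL by simp
    then show False
      using tL pq(2) K'(3)[of ?j] by (intro stop[of "hi K $ ?j" "max (lo K $ ?j) (2 * hi K $ ?j - hi L $ ?j)"]) (auto simp: q_def)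
  qed
  have "t \<in> {lo L $ i, hi L $ i}"
  proof (rule ccontr)
    assume "t \<notin> {lo L $ i, hi L $ i}"
    then have tL': "lo L $ i < t" "t < hi L $ i" using tL by auto
    have "\<exists>s. s \<in> {lo K $ i<..<hi K $ i} \<and> s \<in> {lo L $ i<..<hi L $ i}"
    proof (cases "t = lo K $ i")
      case True
      then show ?thesis using tL' K'(3)[of i]
        by (intro exI[of _ "(t + min (hi K $ i) (hi L $ i)) / 2"]) (auto simp: min_def)
    next
      case False
      then have "t = hi K $ i" using t by auto
      then show ?thesis using tL' K'(3)[of i]
        by (intro exI[of _ "(t + max (lo K $ i) (lo L $ i)) / 2"]) (auto simp: max_def)
    qed
    then obtain s where "s \<in> {lo K $ i<..<hi K $ i}" "s \<in> {lo L $ i<..<hi L $ i}" by blast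
    then have "K = L" using mid lo_eq hi_eq
      by (intro element_eqI[OF K L(1), of s i "(lo K $ ?j + hi K $ ?j) / 2"]) simp_all
    then show False using L(2) by simp
  qed
  then show ?thesis using that L lo_eq hi_eq by blast
qed

lemma right_neighbour:
  assumes K: "K \<in> T" and t: "hi K $ i < b $ i"
  obtains L where "L \<in> T" "lo L $ i = hi K $ i" "lo L $ co i = lo K $ co i" "hi L $ co i = hi K $ co i"
proof -
  have "a $ i < hi K $ i" using element(3,4)[OF K, of i] by linarith
  then obtain L where L: "L \<in> T" "L \<noteq> K" "hi K $ i \<in> {lo L $ i, hi L $ i}"
    "lo L $ co i = lo K $ co i" "hi L $ co i = hi K $ co i"
    using neighbour[OF K _ _ t] by blast
  have "hi K $ i \<noteq> hi L $ i" using element_eq_hi[OF K L(1)] L by metis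
  then show ?thesis using that L by auto
qed

lemma left_neighbour:
  assumes K: "K \<in> T" and t: "a $ i < lo K $ i"
  obtains L where "L \<in> T" "hi L $ i = lo K $ i" "lo L $ co i = lo K $ co i" "hi L $ co i = hi K $ co i"
proof -
  have "lo K $ i < b $ i" using element(3,5)[OF K, of i] by linarith
  then obtain L where L: "L \<in> T" "L \<noteq> K" "lo K $ i \<in> {lo L $ i, hi L $ i}"
    "lo L $ co i = lo K $ co i" "hi L $ co i = hi K $ co i"
    using neighbour[OF K _ t] by blast
  have "lo K $ i \<noteq> lo L $ i" using element_eq_lo[OF K L(1)] L by metis
  then show ?thesis using that L by auto
qed

text \<open>Taking the neighbour is a bijection from the elements not touching the right boundary
  to those not touching the left one, so that the sum telescopes.\<close>
lemma sum_over_edges_cancels: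
  fixes R S :: "plane set \<Rightarrow> real"
  assumes match: "\<And>K L. K \<in> T \<Longrightarrow> L \<in> T \<Longrightarrow> hi K $ i = lo L $ i \<Longrightarrow> lo K $ co i = lo L $ co i \<Longrightarrow>
      hi K $ co i = hi L $ co i \<Longrightarrow> a $ i < hi K $ i \<Longrightarrow> hi K $ i < b $ i \<Longrightarrow> R K = S L"
    and R0: "\<And>K. K \<in> T \<Longrightarrow> hi K $ i = b $ i \<Longrightarrow> R K = 0"
    and S0: "\<And>K. K \<in> T \<Longrightarrow> lo K $ i = a $ i \<Longrightarrow> S K = 0"
  shows "(\<Sum>K\<in>T. R K - S K) = 0"
proof -
  let ?A = "{K \<in> T. hi K $ i < b $ i}" and ?B = "{K \<in> T. a $ i < lo K $ i}"
  define rel where "rel K L \<longleftrightarrow> hi K $ i = lo L $ i \<and> lo K $ co i = lo L $ co i \<and> hi K $ co i = hi L $ co i" for K L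
  have right: "\<exists>L\<in>?B. rel K L" if "K \<in> ?A" for K
  proof -
    from that have K: "K \<in> T" "hi K $ i < b $ i" by auto
    obtain L where "L \<in> T" "lo L $ i = hi K $ i" "lo L $ co i = lo K $ co i" "hi L $ co i = hi K $ co i"
      using right_neighbour[OF K] by metis
    then show ?thesis using element(3,4)[OF K(1), of i] by (intro bexI[of _ L]) (auto simp: rel_def)
  qed
  have left: "\<exists>L\<in>?A. rel L K" if "K \<in> ?B" for K
  proof -
    from that have K: "K \<in> T" "a $ i < lo K $ i" by auto
    obtain L where "L \<in> T" "hi L $ i = lo K $ i" "lo L $ co i = lo K $ co i" "hi L $ co i = hi K $ co i"
      using left_neighbour[OF K] by metis
    then show ?thesis using element(3,5)[OF K(1), of i] by (intro bexI[of _ L]) (auto simp: rel_def)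
  qed
  have "\<forall>K\<in>?A. \<exists>L. L \<in> ?B \<and> rel K L" using right by blast
  from bchoice[OF this] obtain f where f: "\<And>K. K \<in> ?A \<Longrightarrow> f K \<in> ?B \<and> rel K (f K)" by blast
  have "\<forall>K\<in>?B. \<exists>L. L \<in> ?A \<and> rel L K" using left by blast
  from bchoice[OF this] obtain g where g: "\<And>K. K \<in> ?B \<Longrightarrow> g K \<in> ?A \<and> rel (g K) K" by blast
  have "(\<Sum>K\<in>?A. R K) = (\<Sum>K\<in>?B. S K)"
  proof (rule sum.reindex_bij_witness[where j = f and i = g])
    fix K assume K: "K \<in> ?A"
    have 1: "f K \<in> ?B" "rel K (f K)" using f[OF K] by auto
    have 2: "g (f K) \<in> ?A" "rel (g (f K)) (f K)" using g[OF 1(1)] by auto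
    show "g (f K) = K" using 1 2 K by (intro element_eq_hi[where i = i]) (auto simp: rel_def)
    show "f K \<in> ?B" by (rule 1)
    show "S (f K) = R K"
      using 1 K element(3,4)[of K i] by (intro match[symmetric]) (auto simp: rel_def)
  next
    fix K assume K: "K \<in> ?B"
    have 1: "g K \<in> ?A" "rel (g K) K" using g[OF K] by auto
    have 2: "f (g K) \<in> ?B" "rel (g K) (f (g K))" using f[OF 1(1)] by auto
    show "f (g K) = K" using 1 2 K by (intro element_eq_lo[where i = i]) (auto simp: rel_def)
    show "g K \<in> ?A" by (rule 1)
  qed
  moreover have "(\<Sum>K\<in>T. R K) = (\<Sum>K\<in>?A. R K)"
    using finite_T R0 element(5) by (intro sum.mono_neutral_right) (auto simp: less_le)
  moreover have "(\<Sum>K\<in>T. S K) = (\<Sum>K\<in>?B. S K)"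
    using finite_T S0 element(4) by (intro sum.mono_neutral_right) (auto simp: less_le)
  ultimately show ?thesis by (simp add: sum_subtractf)
qed

lemma AE_interior: "AE x in lebesgue_on (box a b). \<exists>K\<in>T. x \<in> interior K"
proof -
  have "negligible (\<Union>K\<in>T. cbox (lo K) (hi K) - box (lo K) (hi K))"
    using finite_T by (intro negligible_Union) (auto simp: negligible_frontier_interval)
  then have "AE x in lebesgue. x \<notin> (\<Union>K\<in>T. cbox (lo K) (hi K) - box (lo K) (hi K))"
    by (intro AE_not_in) (simp add: negligible_iff_null_sets)
  then have "AE x in lebesgue. x \<in> box a b \<longrightarrow> (\<exists>K\<in>T. x \<in> interior K)"
  proof eventually_elim
    case (elim x)
    show ?case
    proof
      assume "x \<in> box a b"
      then have "x \<in> \<Union>T" unfolding Union_T using box_subset_cbox[of a b] by blast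
      then obtain K where K: "K \<in> T" "x \<in> K" by blast
      then have "x \<in> interior K" using elim K element(2)[OF K(1)] element_mem[OF K(1)] by auto
      then show "\<exists>K\<in>T. x \<in> interior K" using K by blast
    qed
  qed
  then show ?thesis by (simp add: AE_restrict_space_iff)
qed

lemma sum_indicator_interior:
  fixes f :: "plane set \<Rightarrow> 'b::real_vector"
  assumes K: "K \<in> T" and x: "x \<in> interior K"
  shows "(\<Sum>L\<in>T. indicator (interior L) x *\<^sub>R f L) = f K"
proof -
  have "(\<Sum>L\<in>T. indicator (interior L) x *\<^sub>R f L) = (\<Sum>L\<in>{K}. indicator (interior L) x *\<^sub>R f L)"
    using finite_T K interiors_disjoint[OF K _ x] by (intro sum.mono_neutral_right) (auto simp: indicator_def)
  then show ?thesis using x by simp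
qed

lemma integral_elements:
  fixes F :: "plane \<Rightarrow> real"
  assumes F: "integrable (lebesgue_on (box a b)) F"
  shows "(LINT x|lebesgue_on (box a b). F x) = (\<Sum>K\<in>T. LINT x|lebesgue_on (interior K). F x)"
proof -
  have m: "indicat_real (interior K) \<in> borel_measurable (lebesgue_on (box a b))" for K
    by (rule borel_measurable_lebesgue_on) simp
  have int: "integrable (lebesgue_on (box a b)) (\<lambda>x. indicator (interior K) x *\<^sub>R F x)" for K
  proof (rule Bochner_Integration.integrable_bound[OF F])
    show "(\<lambda>x. indicator (interior K) x *\<^sub>R F x) \<in> borel_measurable (lebesgue_on (box a b))"
      using m borel_measurable_integrable[OF F] by (intro borel_measurable_scaleR)
    show "AE x in lebesgue_on (box a b). norm (indicator (interior K) x *\<^sub>R F x) \<le> norm (F x)"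
      by (rule AE_I2) (simp add: indicator_def)
  qed
  have "(LINT x|lebesgue_on (box a b). F x) = (LINT x|lebesgue_on (box a b). (\<Sum>K\<in>T. indicator (interior K) x *\<^sub>R F x))"
  proof (rule integral_cong_AE)
    show "AE x in lebesgue_on (box a b). F x = (\<Sum>K\<in>T. indicator (interior K) x *\<^sub>R F x)"
      using AE_interior
    proof eventually_elim
      case (elim x)
      then obtain K where "K \<in> T" "x \<in> interior K" by blast
      then show ?case using sum_indicator_interior[of K x "\<lambda>_. F x"] by simp
    qed
  qed (use F int in \<open>auto intro!: borel_measurable_sum borel_measurable_integrable\<close>)
  also have "\<dots> = (\<Sum>K\<in>T. LINT x|lebesgue_on (box a b). indicator (interior K) x *\<^sub>R F x)"
    by (rule Bochner_Integration.integral_sum[OF int])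
  also have "\<dots> = (\<Sum>K\<in>T. LINT x|lebesgue_on (interior K). F x)"
  proof (rule sum.cong[OF refl])
    fix K assume K: "K \<in> T"
    have "indicator (box a b) x *\<^sub>R (indicator (interior K) x *\<^sub>R F x) = indicator (interior K) x *\<^sub>R F x" for x
      using element_subset[OF K] by (auto simp: indicator_def)
    moreover have "(LINT x|lebesgue_on (box a b). indicator (interior K) x *\<^sub>R F x) =
        (LINT x|lebesgue. indicator (box a b) x *\<^sub>R (indicator (interior K) x *\<^sub>R F x))"
      by (rule integral_restrict_space) simp
    moreover have "(LINT x|lebesgue_on (interior K). F x) = (LINT x|lebesgue. indicator (interior K) x *\<^sub>R F x)"
      by (rule integral_restrict_space) simp
    ultimately show "(LINT x|lebesgue_on (box a b). indicator (interior K) x *\<^sub>R F x) = (LINT x|lebesgue_on (interior K). F x)"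
      by (simp only:)
  qed
  finally show ?thesis .
qed

lemma L2_norm_elements:
  assumes F: "F \<in> L2 (box a b)"
  shows "(L2_norm (box a b) F)\<^sup>2 = (\<Sum>K\<in>T. (L2_norm (interior K) F)\<^sup>2)"
  using integral_elements[OF L2_norm_integrable[OF F]] by (simp add: L2_norm_sq)

lemma L2_interior: "F \<in> L2 (box a b) \<Longrightarrow> K \<in> T \<Longrightarrow> F \<in> L2 (interior K)"
  using L2_subset[OF _ element_subset] by fastforce

lemma AE_elementsI:
  assumes "\<And>K. K \<in> T \<Longrightarrow> AE x in lebesgue_on (interior K). P x"
  shows "AE x in lebesgue_on (box a b). P x"
proof -
  have "AE x in lebesgue. \<forall>K\<in>T. x \<in> interior K \<longrightarrow> P x"
    using finite_T assms by (intro AE_finite_allI) (simp_all add: AE_restrict_space_iff)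
  moreover have "AE x in lebesgue. x \<in> box a b \<longrightarrow> (\<exists>K\<in>T. x \<in> interior K)"
    using AE_interior by (simp add: AE_restrict_space_iff)
  ultimately have "AE x in lebesgue. x \<in> box a b \<longrightarrow> P x" by eventually_elim blast
  then show ?thesis by (simp add: AE_restrict_space_iff)
qed

text \<open>Elementwise bounds with a common constant add up to a global one, as squared norms are
  additive over the elements.\<close>
lemma broken_norm_bound:
  fixes G1 G2 G3 :: "plane \<Rightarrow> 'c::euclidean_space"
  assumes F: "F \<in> L2 (box a b)" and G: "G1 \<in> L2 (box a b)" "G2 \<in> L2 (box a b)" "G3 \<in> L2 (box a b)"
    and le: "\<And>K. K \<in> T \<Longrightarrow> L2_norm (interior K) F \<le> c * (L2_norm (interior K) G1 + L2_norm (interior K) G2 + L2_norm (interior K) G3)"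
    and c: "0 \<le> c"
  shows "L2_norm (box a b) F \<le> 2 * c * (L2_norm (box a b) G1 + L2_norm (box a b) G2 + L2_norm (box a b) G3)"
proof -
  let ?n = "L2_norm (box a b)"
  have sq: "(c * (x + y + z))\<^sup>2 \<le> 3 * c\<^sup>2 * (x\<^sup>2 + y\<^sup>2 + z\<^sup>2)" for x y z :: real
  proof -
    have "(x + y + z)\<^sup>2 \<le> 3 * (x\<^sup>2 + y\<^sup>2 + z\<^sup>2)"
      using sum_squares_bound[of x y] sum_squares_bound[of y z] sum_squares_bound[of x z]
      by (simp add: power2_eq_square algebra_simps)
    then have "c\<^sup>2 * (x + y + z)\<^sup>2 \<le> c\<^sup>2 * (3 * (x\<^sup>2 + y\<^sup>2 + z\<^sup>2))" by (rule mult_left_mono) simp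
    then show ?thesis by (simp only: power_mult_distrib mult.assoc mult.left_commute)
  qed
  have "(?n F)\<^sup>2 = (\<Sum>K\<in>T. (L2_norm (interior K) F)\<^sup>2)" by (rule L2_norm_elements[OF F])
  also have "\<dots> \<le> (\<Sum>K\<in>T. 3 * c\<^sup>2 * ((L2_norm (interior K) G1)\<^sup>2 + (L2_norm (interior K) G2)\<^sup>2 + (L2_norm (interior K) G3)\<^sup>2))"
    by (rule sum_mono, rule order_trans[OF power_mono[OF le] sq]) (simp_all add: L2_norm_nonneg)
  also have "\<dots> = 3 * c\<^sup>2 * ((?n G1)\<^sup>2 + (?n G2)\<^sup>2 + (?n G3)\<^sup>2)"
    by (simp add: L2_norm_elements G sum.distrib sum_distrib_left[symmetric])
  also have "\<dots> \<le> (2 * c * (?n G1 + ?n G2 + ?n G3))\<^sup>2"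
  proof -
    have "(?n G1)\<^sup>2 + (?n G2)\<^sup>2 + (?n G3)\<^sup>2 \<le> (?n G1 + ?n G2 + ?n G3)\<^sup>2"
      using mult_nonneg_nonneg[OF L2_norm_nonneg L2_norm_nonneg, of "box a b" G1 "box a b" G2]
        mult_nonneg_nonneg[OF L2_norm_nonneg L2_norm_nonneg, of "box a b" G1 "box a b" G3]
        mult_nonneg_nonneg[OF L2_norm_nonneg L2_norm_nonneg, of "box a b" G2 "box a b" G3]
      by (simp add: power2_eq_square algebra_simps)
    then have "3 * c\<^sup>2 * ((?n G1)\<^sup>2 + (?n G2)\<^sup>2 + (?n G3)\<^sup>2) \<le> 4 * c\<^sup>2 * (?n G1 + ?n G2 + ?n G3)\<^sup>2"
      by (intro mult_mono) auto
    then show ?thesis by (simp add: power_mult_distrib)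
  qed
  finally show ?thesis
    by (rule power2_le_imp_le) (use c in \<open>simp add: L2_norm_nonneg\<close>)
qed

text \<open>Elements lying over a common point of the transverse axis have disjoint projections to
  direction \<open>i\<close>.\<close>
lemma row_lengths:
  assumes t: "t \<in> {a $ co i<..<b $ co i}"
  shows "(\<Sum>K\<in>T. indicator {lo K $ co i<..<hi K $ co i} t * (hi K $ i - lo K $ i)) \<le> b $ i - a $ i"
proof -
  let ?S = "{K \<in> T. t \<in> {lo K $ co i<..<hi K $ co i}}"
  let ?I = "\<lambda>K. {lo K $ i<..<hi K $ i}"
  have fin: "finite ?S" using finite_T by simp
  have "(\<Sum>K\<in>T. indicator {lo K $ co i<..<hi K $ co i} t * (hi K $ i - lo K $ i)) = (\<Sum>K\<in>?S. hi K $ i - lo K $ i)"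
    using finite_T by (intro sum.mono_neutral_cong_right) (auto simp: indicator_def)
  also have "\<dots> = (\<Sum>K\<in>?S. measure lborel (?I K))"
    using element(3) by (intro sum.cong refl) (simp add: less_imp_le)
  also have "\<dots> = measure lborel (\<Union>K\<in>?S. ?I K)"
  proof (rule measure_finite_Union[symmetric, OF fin])
    show "disjoint_family_on ?I ?S"
      unfolding disjoint_family_on_def using element_eqI[of _ _ _ i t] by blast
    show "emeasure lborel (?I K) \<noteq> \<infinity>" if "K \<in> ?S" for K using element(3)[of K i] that by (simp add: less_imp_le)
  qed auto
  also have "\<dots> \<le> measure lborel {a $ i..b $ i}"
  proof (rule measure_mono_fmeasurable)
    show "(\<Union>K\<in>?S. ?I K) \<subseteq> {a $ i..b $ i}" using element(4,5)[of _ i] by fastforce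
    show "(\<Union>K\<in>?S. ?I K) \<in> sets lborel" using fin by (intro sets.finite_UN) auto
    show "{a $ i..b $ i} \<in> fmeasurable lborel" using ab[of i] by (intro fmeasurableI) (auto simp: less_imp_le)
  qed
  also have "\<dots> = b $ i - a $ i" using ab[of i] by simp
  finally show ?thesis .
qed

lemma mesh_size_ge: "K \<in> T \<Longrightarrow> hi K $ i - lo K $ i \<le> mesh_size T"
proof -
  assume K: "K \<in> T"
  have "{hi K $ i - lo K $ i | K i. K \<in> T} = (\<lambda>(K, i). hi K $ i - lo K $ i) ` (T \<times> UNIV)" by auto
  then have "finite {hi K $ i - lo K $ i | K i. K \<in> T}" using finite_T by simp
  then show ?thesis unfolding mesh_size_def using K by (intro Max_ge) auto
qed

lemma T_nonempty: "T \<noteq> {}"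
proof
  assume "T = {}"
  then have "cbox a b = {}" using Union_T by simp
  moreover have "a \<in> cbox a b" using ab by (simp add: mem_box_cart less_imp_le)
  ultimately show False by simp
qed

lemma mesh_size_pos: "0 < mesh_size T"
  using T_nonempty mesh_size_ge[of _ 1] element(3)[of _ 1] by (metis diff_gt_0_iff_gt ex_in_conv less_le_trans)

end

section \<open>Weak derivatives and the weak divergence\<close>
lemma vec_integral_nth:
  fixes F :: "plane \<Rightarrow> real^'n"
  assumes "integrable M F" shows "(LINT x|M. F x) $ i = (LINT x|M. F x $ i)"
  using integral_bounded_linear[OF bounded_linear_vec_nth assms, of i] by simp

lemma L2_cong_AE:
  fixes D f :: "plane \<Rightarrow> 'b::euclidean_space"
  assumes D: "D \<in> L2 U" and U: "U \<in> sets lebesgue" and eq: "AE x in lebesgue_on U. f x = D x"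
  shows "f \<in> L2 U"
proof -
  have m: "(\<lambda>x. indicator U x *\<^sub>R D x) \<in> borel_measurable lebesgue"
    using L2_measurable[OF D] U by (simp add: borel_measurable_restrict_space_iff)
  have "AE x in lebesgue. x \<in> U \<longrightarrow> f x = D x" using eq U by (simp add: AE_restrict_space_iff)
  then have "AE x in lebesgue. indicator U x *\<^sub>R D x = indicator U x *\<^sub>R f x"
    by (rule AE_mp) (rule AE_I2, auto simp: indicator_def)
  from borel_measurable_AE[OF m this] have fm: "f \<in> borel_measurable (lebesgue_on U)"
    using U by (simp add: borel_measurable_restrict_space_iff)
  have "integrable (lebesgue_on U) (\<lambda>x. (norm (D x))\<^sup>2)" by (rule L2_norm_integrable[OF D])
  then have "integrable (lebesgue_on U) (\<lambda>x. (norm (f x))\<^sup>2)"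
    by (rule Bochner_Integration.integrable_cong_AE_imp) (use fm eq in auto)
  then show ?thesis using fm by (simp add: L2_def)
qed

text \<open>The scalar identity behind weak derivatives and weak divergences, one direction at a
  time.\<close>
definition weak_grad :: "plane set \<Rightarrow> 2 \<Rightarrow> (plane \<Rightarrow> real) \<Rightarrow> (plane \<Rightarrow> real) \<Rightarrow> bool" where
  "weak_grad U i w g \<longleftrightarrow> (\<forall>\<phi>\<in>test_functions U.
     (LINT x|lebesgue_on U. partial i \<phi> x * w x) = - (LINT x|lebesgue_on U. \<phi> x * g x))"

lemma weak_grad_weak_partial:
  assumes "weak_grad (box a b) i w g" "w \<in> L2 (box a b)" "g \<in> L2 (box a b)"
  shows "weak_partial a b i w g"
  unfolding weak_partial_def
proof (intro conjI assms allI impI)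
  fix q p assume "test1 (a $ i) (b $ i) q \<and> test1 (a $ co i) (b $ co i) p"
  then have q: "test1 (a $ i) (b $ i) q" and p: "test1 (a $ co i) (b $ co i) p" by auto
  show "pairing a b i w (deriv q) p = - pairing a b i g q p"
    using bspec[OF assms(1)[unfolded weak_grad_def] product_test_function'[OF q p]]
    by (simp only: pairing_def partial_product[OF test1_smooth[OF q] test1_smooth[OF p]])
qed

lemma weak_grad_smooth:
  assumes "\<forall>k. Ck k s" shows "weak_grad (box a b) i s (partial i s)"
  unfolding weak_grad_def
  using integration_by_parts_test[OF lmeasurable_box _ assms] by (simp add: mult.commute)

lemma weak_grad_subset:
  assumes "weak_grad U i w g" "W \<subseteq> U" "U \<in> sets lebesgue" "W \<in> sets lebesgue"
  shows "weak_grad W i w g"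
  unfolding weak_grad_def
proof
  fix \<phi> assume phi: "\<phi> \<in> test_functions W"
  have eq: "(LINT x|lebesgue_on W. F x) = (LINT x|lebesgue_on U. F x)" if "\<And>x. x \<notin> W \<Longrightarrow> F x = 0" for F :: "plane \<Rightarrow> real"
    using integral_lebesgue_on_UNIV[of W F] integral_lebesgue_on_UNIV[of U F] that assms by (metis subsetD)
  have "\<phi> \<in> test_functions U" using phi test_functions_mono[OF assms(2)] by blast
  then show "(LINT x|lebesgue_on W. partial i \<phi> x * w x) = - (LINT x|lebesgue_on W. \<phi> x * g x)"
    using assms(1) unfolding weak_grad_def
    by (subst (1 2) eq) (simp_all add: test_function_zero[OF phi] test_function_partial_zero[OF phi])
qed

lemma test_function_bounded_mult:
  fixes f :: "plane \<Rightarrow> 'b::euclidean_space"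
  assumes "\<phi> \<in> test_functions U" "f \<in> L2 W"
  shows "(\<lambda>x. \<phi> x *\<^sub>R f x) \<in> L2 W"
proof -
  obtain M where "\<And>x. \<bar>\<phi> x\<bar> \<le> M" using test_function_bounded[OF assms(1)] by blast
  then show ?thesis by (intro L2_bounded_scaleR[OF assms(2) test_function_measurable[OF assms(1)]])
qed

lemma test_function_integrable_mult:
  fixes f :: "plane \<Rightarrow> 'b::euclidean_space"
  assumes "\<phi> \<in> test_functions U" "f \<in> L2 W" "W \<in> lmeasurable"
  shows "integrable (lebesgue_on W) (\<lambda>x. \<phi> x *\<^sub>R f x)"
  by (rule L2_integrable[OF assms(3) test_function_bounded_mult[OF assms(1,2)]])

lemma weak_grad_cong_AE:
  assumes "weak_grad U i w g" "w \<in> L2 U" "w' \<in> L2 U" "AE x in lebesgue_on U. w x = w' x"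
  shows "weak_grad U i w' g"
  unfolding weak_grad_def
proof
  fix \<phi> assume phi: "\<phi> \<in> test_functions U"
  have "(LINT x|lebesgue_on U. partial i \<phi> x * w' x) = (LINT x|lebesgue_on U. partial i \<phi> x * w x)"
  proof (rule integral_cong_AE)
    have "(\<lambda>x. partial i \<phi> x) \<in> borel_measurable (lebesgue_on U)"
      by (rule test_function_measurable[OF partial_test_function[OF phi]])
    then show "(\<lambda>x. partial i \<phi> x * w' x) \<in> borel_measurable (lebesgue_on U)"
      "(\<lambda>x. partial i \<phi> x * w x) \<in> borel_measurable (lebesgue_on U)"
      using assms(2,3)[THEN L2_measurable] by (auto intro: borel_measurable_times)
  qed (use assms(4) in \<open>auto elim: eventually_mono\<close>)
  then show "(LINT x|lebesgue_on U. partial i \<phi> x * w' x) = - (LINT x|lebesgue_on U. \<phi> x * g x)"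
    using assms(1) phi by (simp add: weak_grad_def)
qed

lemma weak_grad_unique:
  assumes "weak_grad (box a b) i w g" "weak_grad (box a b) i w g'" "g \<in> L2 (box a b)" "g' \<in> L2 (box a b)"
  shows "AE x in lebesgue_on (box a b). g x = g' x"
proof -
  have "AE x in lebesgue_on (box a b). g x - g' x = 0"
  proof (rule fundamental_lemma[where i = 1])
    show "(\<lambda>x. g x - g' x) \<in> L2 (box a b)" by (intro L2_diff assms)
    fix q p assume q: "test1 (a $ 1) (b $ 1) q" and p: "test1 (a $ co 1) (b $ co 1) p"
    have phi: "(\<lambda>x. q (x $ 1) * p (x $ co 1)) \<in> test_functions (box a b)" by (rule product_test_function'[OF q p])
    have "pairing a b 1 g q p = pairing a b 1 g' q p"
      using bspec[OF assms(1)[unfolded weak_grad_def] phi] bspec[OF assms(2)[unfolded weak_grad_def] phi]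
      by (simp add: pairing_def)
    then show "pairing a b 1 (\<lambda>x. g x - g' x) q p = 0"
      using pairing_diff[OF assms(3,4) test_limit_smooth[OF test1_smooth[OF q]] test_limit_smooth[OF test1_smooth[OF p]]]
      by simp
  qed
  then show ?thesis by eventually_elim simp
qed

lemma matrix_vector_2: "(A *v v) $ i = A $ i $ 1 * v $ 1 + A $ i $ 2 * v $ 2" for A :: "real^2^2"
  by (simp add: matrix_vector_mult_def sum_2)

lemma has_weak_divI:
  fixes \<tau> :: "plane \<Rightarrow> real^2^2" and g :: "2 \<Rightarrow> 2 \<Rightarrow> plane \<Rightarrow> real"
  assumes U: "U \<in> lmeasurable" and tau: "\<tau> \<in> L2 U" and g: "\<And>i j. g i j \<in> L2 U"
    and grad: "\<And>i j. weak_grad U j (\<lambda>x. \<tau> x $ i $ j) (g i j)"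
  shows "has_weak_div U \<tau> (\<lambda>x. \<chi> i. g i 1 x + g i 2 x)"
  unfolding has_weak_div_def
proof
  fix \<phi> assume phi: "\<phi> \<in> test_functions U"
  define d where "d x = (\<chi> i. g i 1 x + g i 2 x)" for x
  have dL: "d \<in> L2 U" by (rule L2_vec2I) (simp add: d_def L2_add g)
  have int1: "integrable (lebesgue_on U) (\<lambda>x. partial j \<phi> x * \<tau> x $ i $ j)" for i j
    using test_function_integrable_mult[OF partial_test_function[OF phi] L2_nth_nth[OF tau] U] by simp
  have int2: "integrable (lebesgue_on U) (\<lambda>x. \<phi> x * g i j x)" for i j
    using test_function_integrable_mult[OF phi g U] by simp
  have vL: "(\<lambda>x. \<tau> x *v (\<chi> j. partial j \<phi> x)) \<in> L2 U"
  proof (rule L2_vec2I)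
    fix i
    have "(\<lambda>x. partial 1 \<phi> x *\<^sub>R \<tau> x $ i $ 1 + partial 2 \<phi> x *\<^sub>R \<tau> x $ i $ 2) \<in> L2 U"
      by (intro L2_add test_function_bounded_mult[OF partial_test_function[OF phi]] L2_nth_nth[OF tau])
    then show "(\<lambda>x. (\<tau> x *v (\<chi> j. partial j \<phi> x)) $ i) \<in> L2 U" by (simp add: matrix_vector_2 mult.commute)
  qed
  have "(LINT x|lebesgue_on U. \<tau> x *v (\<chi> j. partial j \<phi> x)) $ i = (- (LINT x|lebesgue_on U. \<phi> x *\<^sub>R d x)) $ i" for i
  proof -
    have "(LINT x|lebesgue_on U. \<tau> x *v (\<chi> j. partial j \<phi> x)) $ i =
        (LINT x|lebesgue_on U. partial 1 \<phi> x * \<tau> x $ i $ 1 + partial 2 \<phi> x * \<tau> x $ i $ 2)"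
      by (subst vec_integral_nth[OF L2_integrable[OF U vL]]) (simp add: matrix_vector_2 mult.commute)
    also have "\<dots> = - ((LINT x|lebesgue_on U. \<phi> x * g i 1 x) + (LINT x|lebesgue_on U. \<phi> x * g i 2 x))"
      using grad phi int1 by (simp add: weak_grad_def)
    also have "\<dots> = - (LINT x|lebesgue_on U. \<phi> x * g i 1 x + \<phi> x * g i 2 x)" using int2 by simp
    also have "\<dots> = (- (LINT x|lebesgue_on U. \<phi> x *\<^sub>R d x)) $ i"
      using vec_integral_nth[OF test_function_integrable_mult[OF phi dL U], of i]
      by (simp add: d_def distrib_left)
    finally show ?thesis .
  qed
  then show "(LINT x|lebesgue_on U. \<tau> x *v (\<chi> j. partial j \<phi> x)) = - (LINT x|lebesgue_on U. \<phi> x *\<^sub>R (\<chi> i. g i 1 x + g i 2 x))"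
    unfolding vec_eq_iff d_def by blast
qed

text \<open>Uniqueness makes the chosen weak divergence computable: it agrees almost everywhere
  with any explicit candidate.\<close>
lemma weak_div_unique:
  assumes d: "d \<in> L2 (box a b)" "has_weak_div (box a b) \<tau> d" and e: "e \<in> L2 (box a b)" "has_weak_div (box a b) \<tau> e"
  shows "AE x in lebesgue_on (box a b). d x = e x"
proof -
  have "AE x in lebesgue_on (box a b). d x $ k - e x $ k = 0" for k
  proof (rule fundamental_lemma[where i = 1])
    show "(\<lambda>x. d x $ k - e x $ k) \<in> L2 (box a b)" by (intro L2_diff L2_nth d e)
    fix q p assume q: "test1 (a $ 1) (b $ 1) q" and p: "test1 (a $ co 1) (b $ co 1) p"
    let ?\<phi> = "\<lambda>x::plane. q (x $ 1) * p (x $ co 1)"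
    have phi: "?\<phi> \<in> test_functions (box a b)" by (rule product_test_function'[OF q p])
    have c: "pairing a b 1 (\<lambda>x. f x $ k) q p = (LINT x|lebesgue_on (box a b). ?\<phi> x *\<^sub>R f x) $ k"
      if "f \<in> L2 (box a b)" for f :: "plane \<Rightarrow> real^2"
      using vec_integral_nth[OF test_function_integrable_mult[OF phi that lmeasurable_box], of k] by (simp add: pairing_def)
    have "(LINT x|lebesgue_on (box a b). ?\<phi> x *\<^sub>R d x) = (LINT x|lebesgue_on (box a b). ?\<phi> x *\<^sub>R e x)"
      using bspec[OF d(2)[unfolded has_weak_div_def] phi] bspec[OF e(2)[unfolded has_weak_div_def] phi] by simp
    then show "pairing a b 1 (\<lambda>x. d x $ k - e x $ k) q p = 0"
      using pairing_diff[OF L2_nth[OF d(1)] L2_nth[OF e(1)] test_limit_smooth[OF test1_smooth[OF q]]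
          test_limit_smooth[OF test1_smooth[OF p]]]
      by (simp add: c[OF d(1)] c[OF e(1)])
  qed
  then have "AE x in lebesgue_on (box a b). \<forall>k\<in>UNIV. d x $ k - e x $ k = 0" by (intro AE_finite_allI) auto
  then show ?thesis by eventually_elim (simp add: vec_eq_iff)
qed

lemma weak_div_eq:
  assumes d: "d \<in> L2 (box a b)" "has_weak_div (box a b) \<tau> d"
  shows "AE x in lebesgue_on (box a b). weak_div (box a b) \<tau> x = d x"
proof -
  have "weak_div (box a b) \<tau> \<in> L2 (box a b) \<and> has_weak_div (box a b) \<tau> (weak_div (box a b) \<tau>)"
    unfolding weak_div_def by (rule someI[of _ d]) (use d in blast)
  then show ?thesis using weak_div_unique d by blast
qed

text \<open>The elementwise divergence is determined by any square-integrable function that is the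
  weak divergence on every element.\<close>
lemma (in grid) div_h_eq:
  assumes D: "D \<in> L2 (box a b)" and div: "\<And>K. K \<in> T \<Longrightarrow> has_weak_div (interior K) \<tau> D"
  shows "AE x in lebesgue_on (box a b). div_h T \<tau> x = D x" "div_h T \<tau> \<in> L2 (box a b)"
proof -
  show *: "AE x in lebesgue_on (box a b). div_h T \<tau> x = D x"
  proof (rule AE_elementsI)
    fix K assume K: "K \<in> T"
    have "AE x in lebesgue_on (interior K). weak_div (interior K) \<tau> x = D x"
      using L2_interior[OF D K] div[OF K] unfolding element(2)[OF K] by (rule weak_div_eq)
    moreover have "AE x in lebesgue_on (interior K). x \<in> interior K"
      by (rule AE_I2) simp
    ultimately show "AE x in lebesgue_on (interior K). div_h T \<tau> x = D x"
      by eventually_elim (simp add: div_h_def sum_indicator_interior[OF K])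
  qed
  show "div_h T \<tau> \<in> L2 (box a b)" by (rule L2_cong_AE[OF D _ *]) simp
qed

section \<open>Functions in the second Sobolev space\<close>
lemma sobolev_weak_deriv:
  assumes f: "f \<in> sobolev m (U :: plane set)" and al: "fst \<alpha> + snd \<alpha> \<le> m"
  shows "weak_deriv U \<alpha> f \<in> L2 U" "has_weak_deriv U \<alpha> f (weak_deriv U \<alpha> f)"
    "L2_norm U (weak_deriv U \<alpha> f) \<le> sobolev_norm m U f"
proof -
  obtain g where "g \<in> L2 U \<and> has_weak_deriv U \<alpha> f g" using f al unfolding sobolev_def by blast
  then have "weak_deriv U \<alpha> f \<in> L2 U \<and> has_weak_deriv U \<alpha> f (weak_deriv U \<alpha> f)"
    unfolding weak_deriv_def by (rule someI[of "\<lambda>g. g \<in> L2 U \<and> has_weak_deriv U \<alpha> f g"])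
  then show "weak_deriv U \<alpha> f \<in> L2 U" "has_weak_deriv U \<alpha> f (weak_deriv U \<alpha> f)" by blast+
  have "finite {\<alpha>. fst \<alpha> + snd \<alpha> \<le> m}"
    by (rule finite_subset[of _ "{..m} \<times> {..m}"]) auto
  then have "(L2_norm U (weak_deriv U \<alpha> f))\<^sup>2 \<le> (\<Sum>\<beta> | fst \<beta> + snd \<beta> \<le> m. (L2_norm U (weak_deriv U \<beta> f))\<^sup>2)"
    using al by (intro member_le_sum) auto
  then show "L2_norm U (weak_deriv U \<alpha> f) \<le> sobolev_norm m U f"
    unfolding sobolev_norm_def by (rule real_le_rsqrt)
qed

definition unit_index :: "2 \<Rightarrow> nat \<times> nat" where
  "unit_index i = (if i = 1 then (1, 0) else (0, 1))"

lemma multi_partial_unit: "multi_partial (unit_index i) \<phi> = partial i \<phi>"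
  using exhaust_2[of i] by (auto simp: multi_partial_def unit_index_def)

lemma component_integral:
  fixes f :: "plane \<Rightarrow> 'b::euclidean_space"
  assumes phi: "\<phi> \<in> test_functions W" and f: "f \<in> L2 U" and U: "U \<in> lmeasurable" and h: "bounded_linear h"
  shows "h (LINT x|lebesgue_on U. \<phi> x *\<^sub>R f x) = (LINT x|lebesgue_on U. \<phi> x * (h (f x) :: real))"
  using integral_bounded_linear[OF h test_function_integrable_mult[OF phi f U]] linear_scale[OF bounded_linear.linear[OF h]]
  by simp

lemma has_weak_deriv_grad:
  fixes f g :: "plane \<Rightarrow> 'b::euclidean_space"
  assumes w: "has_weak_deriv U (unit_index i) f g" and f: "f \<in> L2 U" and g: "g \<in> L2 U"
    and U: "U \<in> lmeasurable" and h: "bounded_linear h"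
  shows "weak_grad U i (\<lambda>x. h (f x)) (\<lambda>x. h (g x))"
  unfolding weak_grad_def
proof
  fix \<phi> assume phi: "\<phi> \<in> test_functions U"
  have sgn: "(-1::real) ^ (fst (unit_index i) + snd (unit_index i)) = - 1" by (simp add: unit_index_def)
  have "(LINT x|lebesgue_on U. partial i \<phi> x *\<^sub>R f x) = - (LINT x|lebesgue_on U. \<phi> x *\<^sub>R g x)"
    using bspec[OF w[unfolded has_weak_deriv_def] phi] sgn by (simp only: multi_partial_unit scaleR_minus1_left)
  then have "h (LINT x|lebesgue_on U. partial i \<phi> x *\<^sub>R f x) = - h (LINT x|lebesgue_on U. \<phi> x *\<^sub>R g x)"
    using linear_neg[OF bounded_linear.linear[OF h]] by simp
  then show "(LINT x|lebesgue_on U. partial i \<phi> x * h (f x)) = - (LINT x|lebesgue_on U. \<phi> x * h (g x))"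
    using component_integral[OF partial_test_function[OF phi] f U h] component_integral[OF phi g U h] by simp
qed

text \<open>A second weak derivative of \<open>f\<close> is a first weak derivative of the first
  one. The test function \<open>\<partial>\<^sub>i \<phi>\<close> is admissible in the identity for
  \<open>g\<close>; with products as test functions the partial derivatives visibly commute.\<close>
lemma has_weak_deriv_second:
  fixes f g k :: "plane \<Rightarrow> 'b::euclidean_space"
  assumes f: "f \<in> L2 (box a b)" and g: "g \<in> L2 (box a b)" and k: "k \<in> L2 (box a b)"
    and wg: "has_weak_deriv (box a b) (unit_index j) f g"
    and wk: "has_weak_deriv (box a b) \<alpha> f k"
    and al: "\<alpha> = (fst (unit_index i) + fst (unit_index j), snd (unit_index i) + snd (unit_index j))"
    and h: "bounded_linear h"
  shows "weak_partial a b i (\<lambda>x. h (g x)) (\<lambda>x. h (k x))"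
  unfolding weak_partial_def
proof (intro conjI allI impI)
  show "(\<lambda>x. h (g x)) \<in> L2 (box a b)" "(\<lambda>x. h (k x)) \<in> L2 (box a b)"
    by (rule L2_linear[OF g h], rule L2_linear[OF k h])
  fix q p assume "test1 (a $ i) (b $ i) q \<and> test1 (a $ co i) (b $ co i) p"
  then have q: "test1 (a $ i) (b $ i) q" and p: "test1 (a $ co i) (b $ co i) p" by auto
  let ?\<phi> = "\<lambda>x::plane. q (x $ i) * p (x $ co i)" and ?\<psi> = "\<lambda>x::plane. deriv q (x $ i) * p (x $ co i)"
  have phi: "?\<phi> \<in> test_functions (box a b)" by (rule product_test_function'[OF q p])
  have psi: "?\<psi> \<in> test_functions (box a b)" by (rule product_test_function'[OF test1_deriv[OF q] p])
  have di: "partial i ?\<phi> = ?\<psi>" using partial_product[OF test1_smooth[OF q] test1_smooth[OF p]] by blast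
  have dc: "partial (co i) (\<lambda>x::plane. q (x $ i) * p (x $ co i)) = (\<lambda>x. q (x $ i) * deriv p (x $ co i))"
    if "smooth q" "smooth p" for q p
  proof
    fix x :: plane
    have eq: "(\<lambda>x::plane. q (x $ i) * p (x $ co i)) = (\<lambda>x. p (x $ co i) * q (x $ co (co i)))"
      by (rule ext) (simp only: co_co mult.commute)
    show "partial (co i) (\<lambda>x::plane. q (x $ i) * p (x $ co i)) x = q (x $ i) * deriv p (x $ co i)"
      unfolding eq partial_product[OF that(2) that(1), of "co i"] by simp
  qed
  have mp: "multi_partial \<alpha> ?\<phi> = partial j ?\<psi>"
  proof (cases "j = i")
    case True
    then show ?thesis unfolding al using exhaust_2[of i] di
      by (auto simp: unit_index_def multi_partial_def)
  next
    case False
    then have j: "j = co i" using index_cases[of j i] by blast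
    have 1: "partial (co i) ?\<psi> = (\<lambda>x. deriv q (x $ i) * deriv p (x $ co i))"
      by (rule dc[OF smooth_deriv[OF test1_smooth[OF q]] test1_smooth[OF p]])
    have 2: "partial (co i) ?\<phi> = (\<lambda>x. q (x $ i) * deriv p (x $ co i))"
      by (rule dc[OF test1_smooth[OF q] test1_smooth[OF p]])
    have 3: "partial i (\<lambda>x. q (x $ i) * deriv p (x $ co i)) = (\<lambda>x. deriv q (x $ i) * deriv p (x $ co i))"
      using partial_product[OF test1_smooth[OF q] smooth_deriv[OF test1_smooth[OF p]]] by blast
    show ?thesis unfolding al j using exhaust_2[of i] 1 2 3 di
      by (auto simp: unit_index_def multi_partial_def)
  qed
  have sgn: "(-1::real) ^ (fst \<alpha> + snd \<alpha>) = 1" unfolding al by (auto simp: unit_index_def)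
  have "(LINT x|lebesgue_on (box a b). partial j ?\<psi> x *\<^sub>R f x) = (LINT x|lebesgue_on (box a b). ?\<phi> x *\<^sub>R k x)"
    using bspec[OF wk[unfolded has_weak_deriv_def] phi] by (simp only: mp sgn scaleR_one)
  then have "h (LINT x|lebesgue_on (box a b). partial j ?\<psi> x *\<^sub>R f x) = (LINT x|lebesgue_on (box a b). ?\<phi> x * h (k x))"
    using component_integral[OF phi k lmeasurable_box h] by simp
  moreover have "h (LINT x|lebesgue_on (box a b). partial j ?\<psi> x *\<^sub>R f x) = - (LINT x|lebesgue_on (box a b). ?\<psi> x * h (g x))"
    using has_weak_deriv_grad[OF wg f g lmeasurable_box h] psi
      component_integral[OF partial_test_function[OF psi] f lmeasurable_box h]
    by (simp add: weak_grad_def)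
  ultimately show "pairing a b i (\<lambda>x. h (g x)) (deriv q) p = - pairing a b i (\<lambda>x. h (k x)) q p"
    by (simp add: pairing_def)
qed

definition D1 :: "plane set \<Rightarrow> 2 \<Rightarrow> (plane \<Rightarrow> 'b) \<Rightarrow> plane \<Rightarrow> 'b::euclidean_space" where
  "D1 U i f = weak_deriv U (unit_index i) f"

definition D2 :: "plane set \<Rightarrow> 2 \<Rightarrow> 2 \<Rightarrow> (plane \<Rightarrow> 'b) \<Rightarrow> plane \<Rightarrow> 'b::euclidean_space" where
  "D2 U i j f = weak_deriv U (fst (unit_index i) + fst (unit_index j), snd (unit_index i) + snd (unit_index j)) f"

text \<open>Both orders denote the same multi-index, so the mixed second derivative is a single
  function, as vertex values require.\<close>
lemma D2_commute: "D2 U i j f = D2 U j i f"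
  by (simp add: D2_def add.commute)

text \<open>What the error analysis uses of the space: first and second derivatives of every linear
  component, as weak partial derivatives, with norms bounded by the Sobolev norm.\<close>
lemma sobolev2:
  fixes f :: "plane \<Rightarrow> 'b::euclidean_space"
  assumes f: "f \<in> sobolev 2 (box a b)"
  shows "f \<in> L2 (box a b)" "D1 (box a b) i f \<in> L2 (box a b)" "D2 (box a b) i j f \<in> L2 (box a b)"
    "L2_norm (box a b) (D1 (box a b) i f) \<le> sobolev_norm 2 (box a b) f"
    "L2_norm (box a b) (D2 (box a b) i j f) \<le> sobolev_norm 2 (box a b) f"
    "bounded_linear h \<Longrightarrow> weak_grad (box a b) i (\<lambda>x. h (f x)) (\<lambda>x. h (D1 (box a b) i f x))"
    "bounded_linear h \<Longrightarrow> weak_partial a b i (\<lambda>x. h (f x)) (\<lambda>x. h (D1 (box a b) i f x))"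
    "bounded_linear h \<Longrightarrow> weak_partial a b i (\<lambda>x. h (D1 (box a b) j f x)) (\<lambda>x. h (D2 (box a b) i j f x))"
proof -
  have 1: "fst (unit_index i) + snd (unit_index i) \<le> 2" for i by (simp add: unit_index_def)
  have 2: "fst (fst (unit_index i) + fst (unit_index j), snd (unit_index i) + snd (unit_index j)) +
      snd (fst (unit_index i) + fst (unit_index j), snd (unit_index i) + snd (unit_index j)) \<le> 2" for i j
    by (simp add: unit_index_def)
  show fL: "f \<in> L2 (box a b)" using f by (simp add: sobolev_def)
  note s1 = sobolev_weak_deriv[OF f 1, folded D1_def] and s2 = sobolev_weak_deriv[OF f 2, folded D2_def]
  show "D1 (box a b) i f \<in> L2 (box a b)" "L2_norm (box a b) (D1 (box a b) i f) \<le> sobolev_norm 2 (box a b) f"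
    using s1 by blast+
  show "D2 (box a b) i j f \<in> L2 (box a b)" "L2_norm (box a b) (D2 (box a b) i j f) \<le> sobolev_norm 2 (box a b) f"
    using s2 by blast+
  assume h: "bounded_linear h"
  show g: "weak_grad (box a b) i (\<lambda>x. h (f x)) (\<lambda>x. h (D1 (box a b) i f x))"
    by (rule has_weak_deriv_grad[OF s1(2) fL s1(1) lmeasurable_box h])
  show "weak_partial a b i (\<lambda>x. h (f x)) (\<lambda>x. h (D1 (box a b) i f x))"
    by (rule weak_grad_weak_partial[OF g L2_linear[OF fL h] L2_linear[OF s1(1) h]])
  show "weak_partial a b i (\<lambda>x. h (D1 (box a b) j f x)) (\<lambda>x. h (D2 (box a b) i j f x))"
    by (rule has_weak_deriv_second[OF fL s1(1) s2(1) s1(2) s2(2) refl h])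
qed

section \<open>The discrete stress space\<close>
lemma AE_lebesgue_on_subset:
  assumes "AE x in lebesgue_on W. P x" "S \<subseteq> W" "S \<in> sets lebesgue" "W \<in> sets lebesgue"
  shows "AE x in lebesgue_on S. P x"
proof -
  have "AE x in lebesgue. x \<in> W \<longrightarrow> P x" using assms(1,4) by (simp add: AE_restrict_space_iff)
  then have "AE x in lebesgue. x \<in> S \<longrightarrow> P x" using assms(2) by (auto elim!: eventually_mono)
  then show ?thesis using assms(3) by (simp add: AE_restrict_space_iff)
qed

text \<open>Derivative of the \<open>i\<close>-th diagonal entry in direction \<open>i\<close>.\<close>
definition dslope :: "(plane \<Rightarrow> real^2^2) \<Rightarrow> 2 \<Rightarrow> real" where
  "dslope p i = p (axis i 1) $ i $ i - p 0 $ i $ i"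

text \<open>Derivative of the shear entry in direction \<open>k\<close>.\<close>
definition oslope :: "(plane \<Rightarrow> real^2^2) \<Rightarrow> 2 \<Rightarrow> real" where
  "oslope p k = p (axis k 1) $ 1 $ 2 - p 0 $ 1 $ 2"

lemma Sigma_poly_diag:
  assumes "p \<in> Sigma_poly" shows "p x $ i $ i = p y $ i $ i + dslope p i * (x $ i - y $ i)"
proof -
  obtain a0 a1 b0 b1 c0 c1 c2 where p: "\<And>x. p x $ 1 $ 1 = a0 + a1 * x $ 1 \<and> p x $ 2 $ 2 = b0 + b1 * x $ 2 \<and>
     p x $ 1 $ 2 = c0 + c1 * x $ 1 + c2 * x $ 2 \<and> p x $ 2 $ 1 = p x $ 1 $ 2"
    using assms unfolding Sigma_poly_def by blast
  show ?thesis using exhaust_2[of i] p by (auto simp: dslope_def axis_def algebra_simps)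
qed

lemma Sigma_poly_off:
  assumes "p \<in> Sigma_poly"
  shows "p x $ 1 $ 2 = p y $ 1 $ 2 + oslope p 1 * (x $ 1 - y $ 1) + oslope p 2 * (x $ 2 - y $ 2)"
    "p x $ 2 $ 1 = p x $ 1 $ 2"
proof -
  obtain a0 a1 b0 b1 c0 c1 c2 where p: "\<And>x. p x $ 1 $ 1 = a0 + a1 * x $ 1 \<and> p x $ 2 $ 2 = b0 + b1 * x $ 2 \<and>
     p x $ 1 $ 2 = c0 + c1 * x $ 1 + c2 * x $ 2 \<and> p x $ 2 $ 1 = p x $ 1 $ 2"
    using assms unfolding Sigma_poly_def by blast
  show "p x $ 1 $ 2 = p y $ 1 $ 2 + oslope p 1 * (x $ 1 - y $ 1) + oslope p 2 * (x $ 2 - y $ 2)"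
    "p x $ 2 $ 1 = p x $ 1 $ 2"
    using p by (auto simp: oslope_def axis_def algebra_simps)
qed

lemma Sigma_poly_off_index:
  assumes "p \<in> Sigma_poly"
  shows "p x $ i $ co i = p x $ 1 $ 2"
    "p x $ 1 $ 2 = p y $ 1 $ 2 + oslope p i * (x $ i - y $ i) + oslope p (co i) * (x $ co i - y $ co i)"
  using exhaust_2[of i] Sigma_poly_off(1)[OF assms, of x y] Sigma_poly_off(2)[OF assms, of x] by auto

lemma Sigma_polyI:
  assumes "\<And>x i. p x $ i $ i = d i + s i * (x $ i - m $ i)"
    and "\<And>x i. p x $ i $ co i = c + t 1 * (x $ 1 - m $ 1) + t 2 * (x $ 2 - m $ 2)"
  shows "p \<in> Sigma_poly" "dslope p i = s i" "oslope p i = t i"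
proof -
  show "p \<in> Sigma_poly"
    unfolding Sigma_poly_def
    by (rule CollectI, rule exI[of _ "d 1 - s 1 * m $ 1"], rule exI[of _ "s 1"], rule exI[of _ "d 2 - s 2 * m $ 2"],
        rule exI[of _ "s 2"], rule exI[of _ "c - t 1 * m $ 1 - t 2 * m $ 2"], rule exI[of _ "t 1"], rule exI[of _ "t 2"], rule allI)
      (simp only: assms(1) assms(2)[of _ 1, unfolded co_simps] assms(2)[of _ 2, unfolded co_simps], simp add: algebra_simps)
  show "dslope p i = s i" unfolding dslope_def assms(1) by (simp add: algebra_simps)
  show "oslope p i = t i" using exhaust_2[of i]
    unfolding oslope_def assms(2)[of _ 1, unfolded co_simps] by (auto simp: axis_def algebra_simps)
qed

lemma Sigma_poly_entry:
  assumes "p \<in> Sigma_poly"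
  shows "\<exists>c s t. (\<forall>x. p x $ i $ j = c + s * x $ 1 + t * x $ 2) \<and>
    (if j = 1 then s else t) = (if i = j then dslope p i else oslope p j)"
proof (cases "i = j")
  case True
  have "p x $ i $ j = p 0 $ i $ i + (if j = 1 then dslope p i else 0) * x $ 1 + (if j = 1 then 0 else dslope p i) * x $ 2" for x
    using Sigma_poly_diag[OF assms, of x i 0] True exhaust_2[of j] by auto
  moreover have "(if j = 1 then (if j = 1 then dslope p i else 0) else (if j = 1 then 0 else dslope p i)) =
      (if i = j then dslope p i else oslope p j)" using True by simp
  ultimately show ?thesis by blast
next
  case False
  then have "j = co i" using index_cases[of j i] by auto
  then have e: "p x $ i $ j = p 0 $ 1 $ 2 + oslope p 1 * x $ 1 + oslope p 2 * x $ 2" for x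
    using Sigma_poly_off(1)[OF assms, of x 0] Sigma_poly_off_index(1)[OF assms, of x i] by simp
  have o: "(if j = 1 then oslope p 1 else oslope p 2) = oslope p j" using exhaust_2[of j] by auto
  have "(\<forall>x. p x $ i $ j = p 0 $ 1 $ 2 + oslope p 1 * x $ 1 + oslope p 2 * x $ 2) \<and>
      (if j = 1 then oslope p 1 else oslope p 2) = (if i = j then dslope p i else oslope p j)"
    unfolding o using e False by simp
  then show ?thesis by blast
qed

lemma affine_Ck: "\<forall>k. Ck k (\<lambda>x::plane. c + s * x $ 1 + t * x $ 2)"
  by (intro allI Ck_add Ck_mult Ck_const Ck_coord[OF smooth_ident])

lemma partial_affine: "partial k (\<lambda>x::plane. c + s * x $ 1 + t * x $ 2) x = (if k = 1 then s else t)"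
proof -
  have "((\<lambda>x::plane. c + s * x $ 1 + t * x $ 2) has_derivative (\<lambda>h. s * h $ 1 + t * h $ 2)) (at x)"
    by (auto intro!: derivative_eq_intros bounded_linear_imp_has_derivative[OF bounded_linear_vec_nth])
  from partial_eq[OF this, of k] show ?thesis using exhaust_2[of k] by (auto simp: axis_def)
qed

context grid
begin

lemma face_cbox:
  assumes K: "K \<in> T" and t: "t \<in> {lo K $ i, hi K $ i}"
  shows "{x\<in>K. x $ i = t} = cbox (emb i t (lo K $ co i)) (emb i t (hi K $ co i))"
proof (rule set_eqI)
  fix x
  show "x \<in> {x\<in>K. x $ i = t} \<longleftrightarrow> x \<in> cbox (emb i t (lo K $ co i)) (emb i t (hi K $ co i))"
    using t element(3)[OF K, of i]
    by (auto simp: element_mem[OF K] cbox_mem_iff[of x _ _ i])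
qed

lemma edge_decode:
  assumes K: "K \<in> T" and e: "e \<in> edges i K"
  obtains t where "t \<in> {lo K $ i, hi K $ i}" "lo e = emb i t (lo K $ co i)" "hi e = emb i t (hi K $ co i)"
    "\<And>x. x \<in> e \<Longrightarrow> x $ i = t"
proof -
  obtain t where t: "t \<in> {lo K $ i, hi K $ i}" "e = {x\<in>K. x $ i = t}" using e by (auto simp: edges_def)
  have le: "emb i t (lo K $ co i) $ k \<le> emb i t (hi K $ co i) $ k" for k
    using index_cases[of k i] element(3)[OF K, of "co i"] by auto
  have "e = cbox (emb i t (lo K $ co i)) (emb i t (hi K $ co i))" unfolding t(2) by (rule face_cbox[OF K t(1)])
  then have "lo e = emb i t (lo K $ co i)" "hi e = emb i t (hi K $ co i)"
    using cbox_bounds[OF le] by simp_all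
  then show ?thesis using that t by blast
qed

lemma shared_edge:
  assumes K: "K \<in> T" "e \<in> edges i K" and L: "L \<in> T" "e \<in> edges i L"
  obtains t where "t \<in> {lo K $ i, hi K $ i}" "t \<in> {lo L $ i, hi L $ i}" "lo K $ co i = lo L $ co i"
    "hi K $ co i = hi L $ co i" "edge_midpoint e $ i = t" "edge_midpoint e $ co i = mid K (co i)"
    "\<And>x. x \<in> e \<Longrightarrow> x $ i = t"
proof -
  obtain t where t: "t \<in> {lo K $ i, hi K $ i}" "lo e = emb i t (lo K $ co i)" "hi e = emb i t (hi K $ co i)"
    "\<And>x. x \<in> e \<Longrightarrow> x $ i = t" using edge_decode[OF K] by blast
  obtain u where u: "u \<in> {lo L $ i, hi L $ i}" "lo e = emb i u (lo L $ co i)" "hi e = emb i u (hi L $ co i)"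
    using edge_decode[OF L] by blast
  have 1: "t = u" "lo K $ co i = lo L $ co i" "hi K $ co i = hi L $ co i"
    using t(2,3) u(2,3) emb_nth by metis+
  have m: "edge_midpoint e $ k = (lo e $ k + hi e $ k) / 2" for k
    by (simp add: edge_midpoint_def midpoint_def)
  have "edge_midpoint e $ i = (t + t) / 2" unfolding m t(2,3) emb_nth ..
  then have "edge_midpoint e $ i = t" by simp
  moreover have "edge_midpoint e $ co i = mid K (co i)" unfolding m t(2,3) emb_nth center_def ..
  ultimately show ?thesis using that t u 1 by blast
qed

lemma common_edge:
  assumes K: "K \<in> T" and L: "L \<in> T" and eq: "hi K $ i = lo L $ i" "lo K $ co i = lo L $ co i" "hi K $ co i = hi L $ co i"
    and t: "a $ i < hi K $ i" "hi K $ i < b $ i"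
  obtains e where "e \<in> interior_edges (box a b) T i" "e \<in> edges i K" "e \<in> edges i L"
    "upper_mid K i \<in> e"
    "edge_midpoint e = upper_mid K i"
proof -
  let ?t = "hi K $ i" and ?m = "mid K (co i)"
  define e where "e = {x\<in>K. x $ i = ?t}"
  have eK: "e \<in> edges i K" by (auto simp: e_def edges_def)
  have c: "e = cbox (emb i ?t (lo K $ co i)) (emb i ?t (hi K $ co i))"
    unfolding e_def by (rule face_cbox[OF K]) simp
  have "e = {x\<in>L. x $ i = lo L $ i}"
    using face_cbox[OF L, of "lo L $ i" i] c eq by simp
  then have eL: "e \<in> edges i L" by (auto simp: edges_def)
  have m: "lo K $ co i < ?m" "?m < hi K $ co i" using element(3)[OF K, of "co i"] by (simp_all add: center_def)
  have me: "emb i ?t ?m \<in> e" unfolding c using m by (simp add: emb_mem_cbox)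
  have "emb i ?t ?m \<in> box a b"
    using t m element(4,5)[OF K, of "co i"] by (simp add: emb_mem_box)
  then have "emb i ?t ?m \<notin> frontier (box a b)" unfolding frontier_def interior_open[OF open_box] by blast
  then have ie: "e \<in> interior_edges (box a b) T i" using me eK K by (auto simp: interior_edges_def)
  obtain u where u: "edge_midpoint e $ i = u" "edge_midpoint e $ co i = ?m" "\<And>x. x \<in> e \<Longrightarrow> x $ i = u"
    using shared_edge[OF K eK K eK] by metis
  have "u = ?t" using u(3)[OF me] by simp
  then have "edge_midpoint e = emb i ?t ?m" using u(1,2) emb_collapse[of i "edge_midpoint e"] by simp
  then show ?thesis using that ie eK eL me by blast
qed

text \<open>Elementwise polynomials of a discrete stress, with the continuity conditions read off
  at the midpoint of the edge between \<open>K\<close> and its upper neighbour \<open>L\<close> in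
  direction \<open>i\<close>. On such an edge the normal entry is constant, so that one point
  suffices for it as well.\<close>
definition sigma_rep :: "(plane \<Rightarrow> real^2^2) \<Rightarrow> (plane set \<Rightarrow> plane \<Rightarrow> real^2^2) \<Rightarrow> bool" where
  "sigma_rep \<tau> p \<longleftrightarrow> (\<forall>K\<in>T. p K \<in> Sigma_poly \<and> (AE x in lebesgue_on (interior K). \<tau> x = p K x)) \<and>
     (\<forall>i. \<forall>K\<in>T. \<forall>L\<in>T. hi K $ i = lo L $ i \<and> lo K $ co i = lo L $ co i \<and> hi K $ co i = hi L $ co i \<and>
        a $ i < hi K $ i \<and> hi K $ i < b $ i \<longrightarrow>
        p K (upper_mid K i) $ i $ i = p L (upper_mid K i) $ i $ i \<and>
        p K (upper_mid K i) $ 1 $ 2 = p L (upper_mid K i) $ 1 $ 2)"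

lemma Sigma_h_rep:
  assumes "\<tau> \<in> Sigma_h (box a b) T"
  obtains p where "sigma_rep \<tau> p"
proof -
  obtain p where p: "\<forall>K\<in>T. p K \<in> Sigma_poly \<and> (AE x in lebesgue_on K. \<tau> x = p K x)"
    "\<forall>i. \<forall>e\<in>interior_edges (box a b) T i. \<forall>K\<in>T. \<forall>L\<in>T. e \<in> edges i K \<and> e \<in> edges i L \<longrightarrow>
        (\<forall>x\<in>e. p K x $ i $ i = p L x $ i $ i) \<and>
        p K (edge_midpoint e) $ 1 $ 2 = p L (edge_midpoint e) $ 1 $ 2"
    using assms unfolding Sigma_h_def by blast
  have "AE x in lebesgue_on (interior K). \<tau> x = p K x" if K: "K \<in> T" for K
  proof (rule AE_lebesgue_on_subset[where W = K])
    show "AE x in lebesgue_on K. \<tau> x = p K x" using p(1) K by blast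
    show "interior K \<subseteq> K" by (rule interior_subset)
    show "K \<in> sets lebesgue" using element_closed[OF K] by simp
  qed simp
  moreover have "p K (upper_mid K i) $ i $ i = p L (upper_mid K i) $ i $ i \<and>
        p K (upper_mid K i) $ 1 $ 2 = p L (upper_mid K i) $ 1 $ 2"
    if K: "K \<in> T" and L: "L \<in> T" and eq: "hi K $ i = lo L $ i" "lo K $ co i = lo L $ co i" "hi K $ co i = hi L $ co i"
      and t: "a $ i < hi K $ i" "hi K $ i < b $ i" for i K L
  proof -
    obtain e where e: "e \<in> interior_edges (box a b) T i" "e \<in> edges i K" "e \<in> edges i L"
      "upper_mid K i \<in> e"
      "edge_midpoint e = upper_mid K i"
      using common_edge[OF K L eq t] by blast
    have "(\<forall>x\<in>e. p K x $ i $ i = p L x $ i $ i) \<and> p K (edge_midpoint e) $ 1 $ 2 = p L (edge_midpoint e) $ 1 $ 2"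
      using p(2) e(1,2,3) K L by blast
    then show ?thesis using e(4,5) by metis
  qed
  ultimately have "sigma_rep \<tau> p" using p(1) unfolding sigma_rep_def by blast
  then show ?thesis by (rule that)
qed

definition pw :: "(plane set \<Rightarrow> plane \<Rightarrow> 'b::real_vector) \<Rightarrow> plane \<Rightarrow> 'b" where
  "pw f x = (\<Sum>K\<in>T. indicator (interior K) x *\<^sub>R f K x)"

lemma pw_eq: "K \<in> T \<Longrightarrow> x \<in> interior K \<Longrightarrow> pw f x = f K x"
  unfolding pw_def by (rule sum_indicator_interior)

lemma pw_L2:
  fixes f :: "plane set \<Rightarrow> plane \<Rightarrow> 'b::euclidean_space"
  assumes "\<And>K. K \<in> T \<Longrightarrow> f K \<in> L2 (box a b)" shows "pw f \<in> L2 (box a b)"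
  unfolding pw_def
proof (rule L2_sum)
  fix K assume "K \<in> T"
  then show "(\<lambda>x. indicator (interior K) x *\<^sub>R f K x) \<in> L2 (box a b)"
    by (intro L2_bounded_scaleR[where B = 1] assms borel_measurable_lebesgue_on borel_measurable_indicator)
      (auto simp: indicator_def)
qed

lemma pw_const_L2: "pw (\<lambda>K x. c K :: 'b::euclidean_space) \<in> L2 (box a b)"
  by (intro pw_L2 L2_const) simp

lemma pw_const_V_h:
  fixes c :: "plane set \<Rightarrow> real^2"
  shows "pw (\<lambda>K x. c K) \<in> V_h (box a b) T"
proof -
  have "AE x in lebesgue_on K. pw (\<lambda>K x. c K) x = c K" if K: "K \<in> T" for K
  proof -
    have "negligible (cbox (lo K) (hi K) - box (lo K) (hi K))" by (rule negligible_frontier_interval)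
    then have "AE x in lebesgue. x \<notin> cbox (lo K) (hi K) - box (lo K) (hi K)"
      by (intro AE_not_in) (simp add: negligible_iff_null_sets)
    then have "AE x in lebesgue. x \<in> K \<longrightarrow> pw (\<lambda>K x. c K) x = c K"
    proof eventually_elim
      case (elim x)
      then show ?case using pw_eq[OF K, of x "\<lambda>K x. c K"] by (auto simp: element_mem[OF K] element(2)[OF K])
    qed
    then show ?thesis using element_closed[OF K] by (simp add: AE_restrict_space_iff)
  qed
  then show ?thesis using pw_const_L2[of c] unfolding V_h_def by blast
qed

text \<open>The divergence of a discrete stress is constant on each element.\<close>
definition rep_div :: "(plane set \<Rightarrow> plane \<Rightarrow> real^2^2) \<Rightarrow> plane \<Rightarrow> real^2" where
  "rep_div p = pw (\<lambda>K x. \<chi> i. dslope (p K) i + oslope (p K) (co i))"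

lemma has_weak_div_cong:
  assumes "has_weak_div U \<tau> d" "\<And>x. x \<in> U \<Longrightarrow> d x = d' x"
  shows "has_weak_div U \<tau> d'"
proof -
  have "(LINT x|lebesgue_on U. \<phi> x *\<^sub>R d x) = (LINT x|lebesgue_on U. \<phi> x *\<^sub>R d' x)" for \<phi> :: "plane \<Rightarrow> real"
    by (rule Bochner_Integration.integral_cong[OF refl]) (use assms(2) in simp)
  then show ?thesis using assms(1) by (simp add: has_weak_div_def)
qed

lemma rep_div_weak:
  assumes tau: "\<tau> \<in> L2 (box a b)" and rep: "sigma_rep \<tau> p" and K: "K \<in> T"
  shows "has_weak_div (interior K) \<tau> (rep_div p)"
proof -
  have p: "p K \<in> Sigma_poly" and eq: "AE x in lebesgue_on (interior K). \<tau> x = p K x"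
    using rep K by (auto simp: sigma_rep_def)
  have iK: "interior K = box (lo K) (hi K)" by (rule element(2)[OF K])
  define s where "s i j = (if i = j then dslope (p K) i else oslope (p K) j)" for i j :: 2
  have grad: "weak_grad (interior K) j (\<lambda>x. \<tau> x $ i $ j) (\<lambda>x. s i j)" for i j
  proof -
    obtain c u v where e: "\<And>x. p K x $ i $ j = c + u * x $ 1 + v * x $ 2" "(if j = 1 then u else v) = s i j"
      using Sigma_poly_entry[OF p, of i j] unfolding s_def by blast
    have "partial j (\<lambda>x::plane. c + u * x $ 1 + v * x $ 2) = (\<lambda>x. s i j)"
      by (rule ext) (simp only: partial_affine e(2))
    then have g: "weak_grad (interior K) j (\<lambda>x. c + u * x $ 1 + v * x $ 2) (\<lambda>x. s i j)"
      using weak_grad_smooth[OF affine_Ck[of c u v], of "lo K" "hi K" j] iK by simp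
    have "(\<lambda>x::plane. c + u * x $ 1 + v * x $ 2) \<in> L2 (interior K)"
      using affine_L2[of c u 0 v 0 "lo K" "hi K"] iK by simp
    then show ?thesis
      by (rule weak_grad_cong_AE[OF g _ L2_nth_nth[OF L2_interior[OF tau K]]])
         (use eq in \<open>auto elim!: eventually_mono simp: e(1)\<close>)
  qed
  have "has_weak_div (interior K) \<tau> (\<lambda>x. \<chi> i. s i 1 + s i 2)"
    using iK by (intro has_weak_divI L2_interior[OF tau K] grad) (auto simp: L2_const)
  moreover have "(\<chi> i. s i 1 + s i 2) = rep_div p x" if "x \<in> interior K" for x
  proof -
    have "s i 1 + s i 2 = dslope (p K) i + oslope (p K) (co i)" for i
      using exhaust_2[of i] by (auto simp: s_def)
    then show ?thesis unfolding rep_div_def pw_eq[OF K that] by (simp add: vec_eq_iff)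
  qed
  ultimately show ?thesis by (rule has_weak_div_cong)
qed

lemma rep_div_L2: "rep_div p \<in> L2 (box a b)" "rep_div p \<in> V_h (box a b) T"
  unfolding rep_div_def by (rule pw_const_L2, rule pw_const_V_h)

lemma div_h_rep:
  assumes "\<tau> \<in> L2 (box a b)" "sigma_rep \<tau> p"
  shows "AE x in lebesgue_on (box a b). div_h T \<tau> x = rep_div p x" "div_h T \<tau> \<in> L2 (box a b)"
  using div_h_eq[OF rep_div_L2(1) rep_div_weak[OF assms]] by blast+

section \<open>Summation by parts over the grid\<close>

text \<open>On each element the weight is affine in the direction of integration. Boundary terms of
  neighbours cancel where the weights match, and the trace of \<open>w\<close> vanishes on the
  outer sides. This is used twice: with a test function for \<open>w\<close> to show that diagonal
  parts are conforming, and with a displacement component to control the shear.\<close>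
lemma grid_summation_by_parts:
  assumes wp: "weak_partial a b i w g"
    and zero: "\<And>K. K \<in> T \<Longrightarrow> line_trace a b i w g (strip K i) (a $ i) = 0"
      "\<And>K. K \<in> T \<Longrightarrow> line_trace a b i w g (strip K i) (b $ i) = 0"
    and match: "\<And>K L. K \<in> T \<Longrightarrow> L \<in> T \<Longrightarrow> hi K $ i = lo L $ i \<Longrightarrow> lo K $ co i = lo L $ co i \<Longrightarrow>
      hi K $ co i = hi L $ co i \<Longrightarrow> a $ i < hi K $ i \<Longrightarrow> hi K $ i < b $ i \<Longrightarrow>
      c K + s K * hi K $ i = c L + s L * hi K $ i"
  shows "(\<Sum>K\<in>T. LINT x|lebesgue_on (interior K). (c K + s K * x $ i) * g x + s K * w x) = 0"
proof -
  let ?T = "\<lambda>K. line_trace a b i w g (strip K i)"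
  have "(LINT x|lebesgue_on (interior K). (c K + s K * x $ i) * g x + s K * w x) =
      (c K + s K * hi K $ i) * ?T K (hi K $ i) - (c K + s K * lo K $ i) * ?T K (lo K $ i)" if K: "K \<in> T" for K
  proof -
    have P: "smooth (\<lambda>t. c K + s K * t)"
      by (intro smooth_add smooth_mult smooth_const smooth_ident)
    have d: "deriv (\<lambda>t. c K + s K * t) = (\<lambda>t. s K)"
      by (rule ext, rule DERIV_imp_deriv) (auto intro!: derivative_eq_intros)
    show ?thesis
      using line_trace_by_parts[OF wp element(4)[OF K] element(3)[OF K] element(5)[OF K] P smooth_const[of 1]]
      by (simp add: d strip_weight_def element(2)[OF K])
  qed
  then have "(\<Sum>K\<in>T. LINT x|lebesgue_on (interior K). (c K + s K * x $ i) * g x + s K * w x) =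
    (\<Sum>K\<in>T. (c K + s K * hi K $ i) * ?T K (hi K $ i) - (c K + s K * lo K $ i) * ?T K (lo K $ i))"
    by (rule sum.cong[OF refl])
  also have "\<dots> = 0"
  proof (rule sum_over_edges_cancels[where i = i])
    fix K L assume *: "K \<in> T" "L \<in> T" "hi K $ i = lo L $ i" "lo K $ co i = lo L $ co i"
      "hi K $ co i = hi L $ co i" "a $ i < hi K $ i" "hi K $ i < b $ i"
    have "strip K i = strip L i" using *(4,5) by (simp add: strip_weight_def)
    then show "(c K + s K * hi K $ i) * ?T K (hi K $ i) = (c L + s L * lo L $ i) * ?T L (lo L $ i)"
      using match[OF *] *(3) by simp
  qed (use zero in simp_all)
  finally show ?thesis .
qed

end

lemma compact_box_gap:
  fixes S :: "plane set"
  assumes S: "compact S" "S \<subseteq> box a b" and ab: "a $ i < b $ i"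
  obtains c d where "a $ i < c" "c \<le> b $ i" "a $ i \<le> d" "d < b $ i" "\<And>x. x \<in> S \<Longrightarrow> c \<le> x $ i \<and> x $ i \<le> d"
proof (cases "S = {}")
  case True
  then show ?thesis using that[of "b $ i" "a $ i"] ab by auto
next
  case False
  have c: "continuous_on S (\<lambda>x. x $ i)" by (intro continuous_intros)
  obtain u where u: "u \<in> S" "\<And>x. x \<in> S \<Longrightarrow> u $ i \<le> x $ i" using continuous_attains_inf[OF S(1) False c] by blast
  obtain v where v: "v \<in> S" "\<And>x. x \<in> S \<Longrightarrow> x $ i \<le> v $ i" using continuous_attains_sup[OF S(1) False c] by blast
  show ?thesis using that[of "u $ i" "v $ i"] u v box_nthD[OF subsetD[OF S(2) u(1)], of i] box_nthD[OF subsetD[OF S(2) v(1)], of i]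
    by (auto simp: less_imp_le)
qed

lemma weak_partial_test_function:
  assumes phi: "\<phi> \<in> test_functions (box a b)"
  shows "weak_partial a b i \<phi> (partial i \<phi>)"
proof (rule weak_grad_weak_partial[OF weak_grad_smooth])
  show "\<forall>k. Ck k \<phi>" using phi by (simp add: test_functions_def)
qed (intro test_function_L2[OF phi] test_function_L2[OF partial_test_function[OF phi]] lmeasurable_box)+

text \<open>The function vanishes in a strip next to each outer side. Integration by parts over the
  strip with the weights \<open>1\<close> and \<open>t - s\<close> forces the traces at both ends
  of the strip to vanish.\<close>
lemma line_trace_test_function:
  assumes phi: "\<phi> \<in> test_functions (box a b)" and ab: "\<And>k. a $ k < b $ k"
    and lr: "a $ co i \<le> l $ co i" "l $ co i < r $ co i" "r $ co i \<le> b $ co i"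
  shows "line_trace a b i \<phi> (partial i \<phi>) (strip_weight l r i) (a $ i) = 0"
    "line_trace a b i \<phi> (partial i \<phi>) (strip_weight l r i) (b $ i) = 0"
proof -
  let ?S = "closure {x. \<phi> x \<noteq> 0}"
  let ?T = "line_trace a b i \<phi> (partial i \<phi>) (strip_weight l r i)"
  obtain c d where cd: "a $ i < c" "c \<le> b $ i" "a $ i \<le> d" "d < b $ i"
    "\<And>x. x \<in> ?S \<Longrightarrow> c \<le> x $ i \<and> x $ i \<le> d"
    using compact_box_gap[of ?S a b i] phi ab by (auto simp: test_functions_def)
  have zero: "\<phi> x = 0 \<and> partial i \<phi> x = 0" if "x $ i < c \<or> d < x $ i" for x
  proof -
    have "x \<notin> ?S" using cd(5)[of x] that by force
    then show ?thesis using partial_outside_support[of x \<phi> i] closure_subset[of "{x. \<phi> x \<noteq> 0}"] by blast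
  qed
  have step: "?T t = 0 \<and> ?T s = 0" if st: "a $ i \<le> s" "s < t" "t \<le> b $ i" "t \<le> c \<or> d \<le> s" for s t
  proof -
    let ?l = "emb i s (l $ co i)" and ?r = "emb i t (r $ co i)"
    have lr': "a $ k \<le> ?l $ k" "?l $ k < ?r $ k" "?r $ k \<le> b $ k" for k
      using index_cases[of k i] st lr by auto
    have sw: "(\<lambda>s. indicator {?l $ co i<..<?r $ co i} s * 1) = strip_weight l r i" by (simp add: strip_weight_def)
    note tr = line_trace_by_parts[OF weak_partial_test_function[OF phi, of i] lr']
    have 0: "\<phi> x = 0 \<and> partial i \<phi> x = 0" if "x \<in> box ?l ?r" for x
      using box_nthD[OF that, of i] st(4) by (intro zero) auto
    have int0: "(LINT x|lebesgue_on (box ?l ?r). F x) = 0" if "\<And>x. x \<in> box ?l ?r \<Longrightarrow> F x = 0" for F :: "plane \<Rightarrow> real"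
      using Bochner_Integration.integral_cong[of "lebesgue_on (box ?l ?r)" _ F "\<lambda>x. 0"] that by simp
    have 1: "1 * ?T (?r $ i) - 1 * ?T (?l $ i) = 0"
      using tr[OF smooth_const[of 1] smooth_const[of 1], unfolded sw, symmetric]
      by (rule trans) (rule int0, simp add: 0 deriv_const_function)
    have 2: "(?r $ i - s) * ?T (?r $ i) - (?l $ i - s) * ?T (?l $ i) = 0"
      using tr[OF smooth_affine_function[of s] smooth_const[of 1], unfolded sw, symmetric]
      by (rule trans) (rule int0, simp add: 0)
    show ?thesis using 1 2 st(2) by auto
  qed
  show "?T (a $ i) = 0" using step[of "a $ i" c] cd by auto
  show "?T (b $ i) = 0" using step[of d "b $ i"] cd by auto
qed

context grid
begin

definition diag_part :: "(plane \<Rightarrow> real^2^2) \<Rightarrow> plane \<Rightarrow> real^2^2" where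
  "diag_part \<tau> x = (\<chi> i j. if i = j then \<tau> x $ i $ i else 0)"

lemma diag_part_L2: "\<tau> \<in> L2 U \<Longrightarrow> diag_part \<tau> \<in> L2 U"
proof (rule L2_mat2I)
  fix i j assume "\<tau> \<in> L2 U"
  then show "(\<lambda>x. diag_part \<tau> x $ i $ j) \<in> L2 U"
    by (cases "i = j") (simp_all add: diag_part_def L2_nth_nth L2_zero)
qed

definition rep_diag_div :: "(plane set \<Rightarrow> plane \<Rightarrow> real^2^2) \<Rightarrow> plane \<Rightarrow> real^2" where
  "rep_diag_div p = pw (\<lambda>K x. \<chi> i. dslope (p K) i)"

text \<open>The diagonal entries are continuous in the direction in which they are differentiated,
  so the diagonal part of a discrete stress is an admissible test function of the exact problem.
  Only the shear entry is nonconforming.\<close>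
lemma diag_part_Hdiv:
  assumes tau: "\<tau> \<in> L2 (box a b)" and rep: "sigma_rep \<tau> p"
  shows "diag_part \<tau> \<in> Hdiv_sym (box a b)"
    "AE x in lebesgue_on (box a b). weak_div (box a b) (diag_part \<tau>) x = rep_diag_div p x"
proof -
  let ?\<Omega> = "box a b"
  define d where "d i = pw (\<lambda>K x. dslope (p K) i)" for i
  define g where "g i j = (if i = j then d i else (\<lambda>x. 0))" for i j :: 2
  have dL: "d i \<in> L2 ?\<Omega>" for i unfolding d_def by (rule pw_const_L2)
  have gL: "g i j \<in> L2 ?\<Omega>" for i j by (simp add: g_def dL L2_zero)
  have grad_ii: "weak_grad ?\<Omega> i (\<lambda>x. \<tau> x $ i $ i) (d i)" for i
    unfolding weak_grad_def
  proof
    fix \<phi> assume phi: "\<phi> \<in> test_functions ?\<Omega>"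
    define c where "c K = p K 0 $ i $ i" for K
    define s where "s K = dslope (p K) i" for K
    have pK: "p K x $ i $ i = c K + s K * x $ i" if "K \<in> T" for K x
      using Sigma_poly_diag[of "p K" x i 0] rep that by (simp add: sigma_rep_def c_def s_def)
    have "(\<Sum>K\<in>T. LINT x|lebesgue_on (interior K). (c K + s K * x $ i) * partial i \<phi> x + s K * \<phi> x) = 0"
    proof (rule grid_summation_by_parts[OF weak_partial_test_function[OF phi]])
      fix K assume K: "K \<in> T"
      show "line_trace a b i \<phi> (partial i \<phi>) (strip K i) (a $ i) = 0"
        "line_trace a b i \<phi> (partial i \<phi>) (strip K i) (b $ i) = 0"
        by (rule line_trace_test_function[OF phi ab element(4)[OF K] element(3)[OF K] element(5)[OF K]])+
    next
      fix K L assume *: "K \<in> T" "L \<in> T" "hi K $ i = lo L $ i" "lo K $ co i = lo L $ co i"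
        "hi K $ co i = hi L $ co i" "a $ i < hi K $ i" "hi K $ i < b $ i"
      let ?m = "upper_mid K i"
      have "p K ?m $ i $ i = p L ?m $ i $ i" using rep * unfolding sigma_rep_def by blast
      then show "c K + s K * hi K $ i = c L + s L * hi K $ i" using pK[OF *(1)] pK[OF *(2)] by simp
    qed
    moreover have "(LINT x|lebesgue_on ?\<Omega>. partial i \<phi> x * \<tau> x $ i $ i + \<phi> x * d i x) =
        (\<Sum>K\<in>T. LINT x|lebesgue_on (interior K). (c K + s K * x $ i) * partial i \<phi> x + s K * \<phi> x)"
    proof -
      have L: "(\<lambda>x. partial i \<phi> x *\<^sub>R \<tau> x $ i $ i + \<phi> x *\<^sub>R d i x) \<in> L2 ?\<Omega>"
        by (intro L2_add test_function_bounded_mult[OF partial_test_function[OF phi]]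
            test_function_bounded_mult[OF phi] L2_nth_nth tau dL)
      then have "integrable (lebesgue_on ?\<Omega>) (\<lambda>x. partial i \<phi> x * \<tau> x $ i $ i + \<phi> x * d i x)"
        using L2_integrable[OF lmeasurable_box L] by simp
      from integral_elements[OF this]
      have "(LINT x|lebesgue_on ?\<Omega>. partial i \<phi> x * \<tau> x $ i $ i + \<phi> x * d i x) =
          (\<Sum>K\<in>T. LINT x|lebesgue_on (interior K). partial i \<phi> x * \<tau> x $ i $ i + \<phi> x * d i x)" .
      also have "\<dots> = (\<Sum>K\<in>T. LINT x|lebesgue_on (interior K). (c K + s K * x $ i) * partial i \<phi> x + s K * \<phi> x)"
      proof (rule sum.cong[OF refl], rule integral_cong_AE)
        fix K assume K: "K \<in> T"
        show "(\<lambda>x. partial i \<phi> x * \<tau> x $ i $ i + \<phi> x * d i x) \<in> borel_measurable (lebesgue_on (interior K))"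
          using L2_measurable[OF L2_interior[OF L K]] by simp
        have "(\<lambda>x::plane. x $ i) \<in> borel_measurable (lebesgue_on (interior K))"
          using coordinate_measurable[of i 0] by simp
        then show "(\<lambda>x. (c K + s K * x $ i) * partial i \<phi> x + s K * \<phi> x) \<in> borel_measurable (lebesgue_on (interior K))"
          using test_function_measurable[OF phi] test_function_measurable[OF partial_test_function[OF phi]]
          by (intro borel_measurable_add borel_measurable_times) auto
        have "AE x in lebesgue_on (interior K). \<tau> x = p K x" using rep K by (simp add: sigma_rep_def)
        moreover have "AE x in lebesgue_on (interior K). x \<in> interior K" by (rule AE_I2) simp
        ultimately show "AE x in lebesgue_on (interior K). partial i \<phi> x * \<tau> x $ i $ i + \<phi> x * d i x =
            (c K + s K * x $ i) * partial i \<phi> x + s K * \<phi> x"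
          by eventually_elim (simp add: pK[OF K] d_def pw_eq[OF K] s_def)
      qed
      finally show ?thesis .
    qed
    moreover have "integrable (lebesgue_on ?\<Omega>) (\<lambda>x. partial i \<phi> x * \<tau> x $ i $ i)" "integrable (lebesgue_on ?\<Omega>) (\<lambda>x. \<phi> x * d i x)"
      using test_function_integrable_mult[OF partial_test_function[OF phi] L2_nth_nth[OF tau] lmeasurable_box]
        test_function_integrable_mult[OF phi dL lmeasurable_box] by simp_all
    ultimately show "(LINT x|lebesgue_on ?\<Omega>. partial i \<phi> x * \<tau> x $ i $ i) = - (LINT x|lebesgue_on ?\<Omega>. \<phi> x * d i x)"
      by simp
  qed
  have "weak_grad ?\<Omega> j (\<lambda>x. diag_part \<tau> x $ i $ j) (g i j)" for i j
    using grad_ii[of i] by (cases "i = j") (simp_all add: diag_part_def g_def weak_grad_def)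
  then have div: "has_weak_div ?\<Omega> (diag_part \<tau>) (\<lambda>x. \<chi> i. g i 1 x + g i 2 x)"
    by (intro has_weak_divI diag_part_L2 tau gL) simp
  have DL: "rep_diag_div p \<in> L2 ?\<Omega>" unfolding rep_diag_div_def by (rule pw_const_L2)
  have eq: "AE x in lebesgue_on ?\<Omega>. (\<chi> i. g i 1 x + g i 2 x) = rep_diag_div p x"
  proof (rule AE_elementsI, rule AE_I2)
    fix K x assume K: "K \<in> T" and "x \<in> space (lebesgue_on (interior K))"
    then have x: "x \<in> interior K" by simp
    have "g i 1 x + g i 2 x = dslope (p K) i" for i
      using exhaust_2[of i] by (auto simp: g_def d_def pw_eq[OF K x])
    then show "(\<chi> i. g i 1 x + g i 2 x) = rep_diag_div p x"
      unfolding rep_diag_div_def pw_eq[OF K x] by simp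
  qed
  have GL: "(\<lambda>x. \<chi> i. g i 1 x + g i 2 x) \<in> L2 ?\<Omega>" by (rule L2_vec2I) (simp add: L2_add gL)
  have "transpose (diag_part \<tau> x) = diag_part \<tau> x" for x
    by (simp add: transpose_def diag_part_def vec_eq_iff)
  then have "diag_part \<tau> \<in> L2_sym ?\<Omega>" using diag_part_L2[OF tau] by (simp add: L2_sym_def)
  then show "diag_part \<tau> \<in> Hdiv_sym ?\<Omega>" using div GL unfolding Hdiv_sym_def by blast
  have "AE x in lebesgue_on ?\<Omega>. weak_div ?\<Omega> (diag_part \<tau>) x = (\<chi> i. g i 1 x + g i 2 x)"
    by (rule weak_div_eq[OF GL div])
  then show "AE x in lebesgue_on ?\<Omega>. weak_div ?\<Omega> (diag_part \<tau>) x = rep_diag_div p x"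
    using eq by eventually_elim simp
qed

end

section \<open>Building discrete stresses from edge and vertex values\<close>

text \<open>The stress with values \<open>d\<close> and \<open>v\<close> at the centre
  \<open>c\<close> and slopes \<open>s\<close> and \<open>t\<close>.\<close>
definition affine_stress :: "(2 \<Rightarrow> real) \<Rightarrow> (2 \<Rightarrow> real) \<Rightarrow> (2 \<Rightarrow> real) \<Rightarrow> real \<Rightarrow> (2 \<Rightarrow> real) \<Rightarrow> plane \<Rightarrow> real^2^2" where
  "affine_stress c d s v t x = (\<chi> i j. if i = j then d i + s i * (x $ i - c i)
     else v + t 1 * (x $ 1 - c 1) + t 2 * (x $ 2 - c 2))"

lemma affine_stress_poly:
  "affine_stress c d s v t \<in> Sigma_poly" "dslope (affine_stress c d s v t) i = s i"
  "oslope (affine_stress c d s v t) i = t i"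
proof -
  have 1: "affine_stress c d s v t x $ i $ i = d i + s i * (x $ i - (\<chi> k. c k) $ i)"
    and 2: "affine_stress c d s v t x $ i $ co i = v + t 1 * (x $ 1 - (\<chi> k. c k) $ 1) + t 2 * (x $ 2 - (\<chi> k. c k) $ 2)" for x i
    by (simp_all add: affine_stress_def)
  show "affine_stress c d s v t \<in> Sigma_poly" "dslope (affine_stress c d s v t) i = s i"
    "oslope (affine_stress c d s v t) i = t i"
    by (rule Sigma_polyI[OF 1 2])+
qed

lemma Sigma_poly_L2:
  assumes "p \<in> Sigma_poly" shows "p \<in> L2 (box l r)"
proof (rule L2_mat2I)
  fix i j
  obtain c s t where "\<And>x. p x $ i $ j = c + s * x $ 1 + t * x $ 2"
    using Sigma_poly_entry[OF assms, of i j] by blast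
  then show "(\<lambda>x. p x $ i $ j) \<in> L2 (box l r)" using affine_L2[of c s 0 t 0 l r] by simp
qed

context grid
begin

text \<open>Interpolation of prescribed data: \<open>g K i t\<close> is the value of the
  \<open>i\<close>-th diagonal entry on the side of \<open>K\<close> at coordinate
  \<open>t\<close>. The shear entry has at the midpoint of each edge the average of the two vertex
  values \<open>V\<close>, because it is the least squares affine fit of the four vertex values.\<close>
definition value_stress :: "(plane set \<Rightarrow> 2 \<Rightarrow> real \<Rightarrow> real) \<Rightarrow> (real \<Rightarrow> real \<Rightarrow> real) \<Rightarrow> plane set \<Rightarrow> plane \<Rightarrow> real^2^2" where
  "value_stress g V K = affine_stress (mid K)
     (\<lambda>i. (g K i (hi K $ i) + g K i (lo K $ i)) / 2)
     (\<lambda>i. (g K i (hi K $ i) - g K i (lo K $ i)) / (hi K $ i - lo K $ i))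
     ((V (hi K $ 1) (hi K $ 2) + V (hi K $ 1) (lo K $ 2) + V (lo K $ 1) (hi K $ 2) + V (lo K $ 1) (lo K $ 2)) / 4)
     (\<lambda>i. (if i = 1 then V (hi K $ 1) (hi K $ 2) + V (hi K $ 1) (lo K $ 2) - V (lo K $ 1) (hi K $ 2) - V (lo K $ 1) (lo K $ 2)
        else V (hi K $ 1) (hi K $ 2) - V (hi K $ 1) (lo K $ 2) + V (lo K $ 1) (hi K $ 2) - V (lo K $ 1) (lo K $ 2))
        / (2 * (hi K $ i - lo K $ i)))"

lemma value_stress_diag:
  assumes K: "K \<in> T" and t: "t \<in> {lo K $ i, hi K $ i}" "x $ i = t"
  shows "value_stress g V K x $ i $ i = g K i t"
proof -
  have "hi K $ i - lo K $ i > 0" using element(3)[OF K, of i] by simp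
  then show ?thesis using t by (auto simp: value_stress_def affine_stress_def center_def field_simps)
qed

text \<open>The edge value depends only on the edge, not on the element, and this gives the
  continuity of the shear entry at edge midpoints.\<close>
lemma value_stress_midpoint:
  assumes K: "K \<in> T" and t: "t \<in> {lo K $ i, hi K $ i}" and x: "x $ i = t" "x $ co i = mid K (co i)"
  shows "value_stress g V K x $ 1 $ 2 =
    (if i = 1 then (V t (hi K $ 2) + V t (lo K $ 2)) / 2 else (V (hi K $ 1) t + V (lo K $ 1) t) / 2)"
proof -
  have alg: "s / 4 + d / (2 * h) * (h / 2) = (s + d) / 4" "s / 4 + d / (2 * h) * (- (h / 2)) = (s - d) / 4"
    if "h > 0" for s d h :: real using that by (simp_all add: field_simps)
  have h: "hi K $ i - lo K $ i > 0" using element(3)[OF K, of i] by simp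
  have c: "hi K $ i - mid K i = (hi K $ i - lo K $ i) / 2"
    "lo K $ i - mid K i = - ((hi K $ i - lo K $ i) / 2)" by (simp_all add: center_def field_simps)
  define S where "S = V (hi K $ 1) (hi K $ 2) + V (hi K $ 1) (lo K $ 2) + V (lo K $ 1) (hi K $ 2) + V (lo K $ 1) (lo K $ 2)"
  define D where "D = (if i = 1 then V (hi K $ 1) (hi K $ 2) + V (hi K $ 1) (lo K $ 2) - V (lo K $ 1) (hi K $ 2) - V (lo K $ 1) (lo K $ 2)
        else V (hi K $ 1) (hi K $ 2) - V (hi K $ 1) (lo K $ 2) + V (lo K $ 1) (hi K $ 2) - V (lo K $ 1) (lo K $ 2))"
  have val: "value_stress g V K x $ 1 $ 2 = S / 4 + D / (2 * (hi K $ i - lo K $ i)) * (x $ i - mid K i)"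
    using exhaust_2[of i] x(2) unfolding value_stress_def affine_stress_def S_def D_def by auto
  consider "t = hi K $ i" | "t = lo K $ i" using t by auto
  then show ?thesis
  proof cases
    case 1
    have "value_stress g V K x $ 1 $ 2 = (S + D) / 4"
      unfolding val x(1) 1 c(1) by (rule alg(1)[OF h])
    then show ?thesis using 1 exhaust_2[of i] by (auto simp: S_def D_def)
  next
    case 2
    have "value_stress g V K x $ 1 $ 2 = (S - D) / 4"
      unfolding val x(1) 2 c(2) by (rule alg(2)[OF h])
    then show ?thesis using 2 exhaust_2[of i] by (auto simp: S_def D_def)
  qed
qed

lemma AE_element_interior:
  assumes K: "K \<in> T" and P: "\<And>x. x \<in> interior K \<Longrightarrow> P x"
  shows "AE x in lebesgue_on K. P x"
proof -
  have "negligible (cbox (lo K) (hi K) - box (lo K) (hi K))" by (rule negligible_frontier_interval)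
  then have "AE x in lebesgue. x \<notin> cbox (lo K) (hi K) - box (lo K) (hi K)"
    by (intro AE_not_in) (simp add: negligible_iff_null_sets)
  then have "AE x in lebesgue. x \<in> K \<longrightarrow> P x"
    by eventually_elim (use P in \<open>auto simp: element_mem[OF K] element(2)[OF K]\<close>)
  then show ?thesis using element_closed[OF K] by (simp add: AE_restrict_space_iff)
qed

text \<open>The data for the diagonal entry may depend on the element only through its transverse
  extent; then both elements at an edge see the same value.\<close>
lemma value_stress_Sigma_h:
  assumes g: "\<And>K L i t. K \<in> T \<Longrightarrow> L \<in> T \<Longrightarrow> lo K $ co i = lo L $ co i \<Longrightarrow> hi K $ co i = hi L $ co i \<Longrightarrow> g K i t = g L i t"
  shows "pw (value_stress g V) \<in> Sigma_h (box a b) T" "sigma_rep (pw (value_stress g V)) (value_stress g V)"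
proof -
  let ?p = "value_stress g V" and ?\<Omega> = "box a b"
  have poly: "?p K \<in> Sigma_poly" for K unfolding value_stress_def by (rule affine_stress_poly)
  have L2: "pw ?p \<in> L2 ?\<Omega>" by (rule pw_L2[OF Sigma_poly_L2[OF poly]])
  have "AE x in lebesgue_on ?\<Omega>. transpose (pw ?p x) = pw ?p x"
  proof (rule AE_elementsI, rule AE_I2)
    fix K x assume K: "K \<in> T" and "x \<in> space (lebesgue_on (interior K))"
    then have "pw ?p x = ?p K x" by (simp add: pw_eq)
    moreover have "transpose (?p K x) = ?p K x"
      using Sigma_poly_off(2)[OF poly, of K x] by (simp add: transpose_def vec_eq_iff forall_2)
    ultimately show "transpose (pw ?p x) = pw ?p x" by simp
  qed
  then have sym: "pw ?p \<in> L2_sym ?\<Omega>" using L2 by (simp add: L2_sym_def)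
  have AE: "AE x in lebesgue_on K. pw ?p x = ?p K x" if "K \<in> T" for K
    using that by (rule AE_element_interior) (rule pw_eq[OF that])
  have cont: "(\<forall>x\<in>e. ?p K x $ i $ i = ?p L x $ i $ i) \<and> ?p K (edge_midpoint e) $ 1 $ 2 = ?p L (edge_midpoint e) $ 1 $ 2"
    if K: "K \<in> T" and L: "L \<in> T" and e: "e \<in> edges i K" "e \<in> edges i L" for i e K L
  proof -
    obtain t where t: "t \<in> {lo K $ i, hi K $ i}" "t \<in> {lo L $ i, hi L $ i}" "lo K $ co i = lo L $ co i"
      "hi K $ co i = hi L $ co i" "edge_midpoint e $ i = t" "edge_midpoint e $ co i = mid K (co i)"
      "\<And>x. x \<in> e \<Longrightarrow> x $ i = t" using shared_edge[OF K e(1) L e(2)] by blast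
    have m: "edge_midpoint e $ co i = mid L (co i)" using t(3,4,6) by (simp add: center_def)
    have "?p K x $ i $ i = ?p L x $ i $ i" if "x \<in> e" for x
      using value_stress_diag[OF K t(1) t(7)[OF that], of g V] value_stress_diag[OF L t(2) t(7)[OF that], of g V]
        g[OF K L t(3,4), of t] by simp
    moreover have "?p K (edge_midpoint e) $ 1 $ 2 = ?p L (edge_midpoint e) $ 1 $ 2"
      using value_stress_midpoint[OF K t(1,5,6), of g V] value_stress_midpoint[OF L t(2,5) m, of g V] t(3,4)
        exhaust_2[of i] by auto
    ultimately show ?thesis by blast
  qed
  show "pw ?p \<in> Sigma_h ?\<Omega> T" unfolding Sigma_h_def using sym poly AE cont by blast
  have "AE x in lebesgue_on (interior K). pw ?p x = ?p K x" if "K \<in> T" for K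
    by (rule AE_I2) (simp add: pw_eq[OF that])
  moreover have "?p K (upper_mid K i) $ i $ i = ?p L (upper_mid K i) $ i $ i \<and>
        ?p K (upper_mid K i) $ 1 $ 2 = ?p L (upper_mid K i) $ 1 $ 2"
    if K: "K \<in> T" and L: "L \<in> T" and eq: "hi K $ i = lo L $ i" "lo K $ co i = lo L $ co i" "hi K $ co i = hi L $ co i"
      and t: "a $ i < hi K $ i" "hi K $ i < b $ i" for i K L
  proof -
    obtain e where e: "e \<in> edges i K" "e \<in> edges i L"
      "upper_mid K i \<in> e"
      "edge_midpoint e = upper_mid K i"
      using common_edge[OF K L eq t] by blast
    show ?thesis using cont[OF K L e(1,2)] e(3,4) by metis
  qed
  ultimately show "sigma_rep (pw ?p) ?p" unfolding sigma_rep_def using poly by blast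
qed

lemma element_area: "K \<in> T \<Longrightarrow> area (lo K) (hi K) > 0"
  by (rule area_pos) (rule element(3))

section \<open>A bounded right inverse of the discrete divergence\<close>
lemma strip_weight_limit: "test_limit s t (strip_weight l r i)"
  unfolding strip_weight_def by (intro test_limit_mult test_limit_indicator test_limit_const)

text \<open>Cauchy--Schwarz on the strip of the domain that extends \<open>K\<close> in direction
  \<open>i\<close>.\<close>
lemma pairing_bound:
  assumes v: "v \<in> L2 (box a b)" and K: "K \<in> T" and q: "test_limit (a $ i) (b $ i) q" "\<And>t. \<bar>q t\<bar> \<le> 1"
  shows "(pairing a b i v q (strip K i))\<^sup>2 \<le> (b $ i - a $ i) * (hi K $ co i - lo K $ co i) *
    (LINT x|lebesgue_on (box a b). indicator {lo K $ co i<..<hi K $ co i} (x $ co i) * (v x)\<^sup>2)"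
proof -
  let ?\<Omega> = "box a b" and ?p = "strip K i" and ?J = "{lo K $ co i<..<hi K $ co i}"
  let ?l = "emb i (a $ i) (lo K $ co i)" and ?r = "emb i (b $ i) (hi K $ co i)"
  have lr: "a $ k \<le> ?l $ k" "?l $ k < ?r $ k" "?r $ k \<le> b $ k" for k
    using index_cases[of k i] ab[of i] element(3,4,5)[OF K, of "co i"] by auto
  have ind: "indicat_real ?J (x $ co i) = indicator (box ?l ?r) x" if "x \<in> ?\<Omega>" for x
    using box_nthD[OF that, of i] by (simp add: indicator_def box_mem_iff[of x _ _ i])
  define w where "w x = indicat_real ?J (x $ co i) * v x" for x
  define k where "k x = q (x $ i) * indicat_real ?J (x $ co i)" for x
  have Jm: "(\<lambda>x. indicat_real ?J (x $ co i)) \<in> borel_measurable (lebesgue_on ?\<Omega>)"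
    by (rule test_limit_measurable[OF test_limit_indicator])
  have wL: "w \<in> L2 ?\<Omega>" unfolding w_def by (rule L2_bounded_mult[OF v Jm, of 1]) (simp add: indicator_def)
  have kL: "k \<in> L2 ?\<Omega>"
  proof (rule L2_bounded[where B = 1])
    show "k \<in> borel_measurable (lebesgue_on ?\<Omega>)"
      unfolding k_def by (intro borel_measurable_times Jm test_limit_measurable q)
    show "norm (k x) \<le> 1" for x using q(2)[of "x $ i"] by (simp add: k_def indicator_def)
  qed simp
  have "pairing a b i v q ?p = L2_inner ?\<Omega> k w"
    unfolding pairing_def L2_inner_def
    by (rule Bochner_Integration.integral_cong) (auto simp: k_def w_def strip_weight_def indicator_def)
  then have "(pairing a b i v q ?p)\<^sup>2 \<le> (L2_norm ?\<Omega> k * L2_norm ?\<Omega> w)\<^sup>2"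
    using L2_Cauchy_Schwarz[OF kL wL] by (simp add: abs_le_square_iff[symmetric] abs_mult L2_norm_nonneg)
  also have "\<dots> = (L2_norm ?\<Omega> k)\<^sup>2 * (L2_norm ?\<Omega> w)\<^sup>2" by (rule power_mult_distrib)
  also have "\<dots> \<le> ((b $ i - a $ i) * (hi K $ co i - lo K $ co i)) * (L2_norm ?\<Omega> w)\<^sup>2"
  proof (rule mult_right_mono)
    have "(L2_norm ?\<Omega> k)\<^sup>2 \<le> (LINT x|lebesgue_on ?\<Omega>. indicat_real (box ?l ?r) x)"
      unfolding L2_norm_sq
    proof (rule integral_mono_AE)
      show "integrable (lebesgue_on ?\<Omega>) (\<lambda>x. (norm (k x))\<^sup>2)" by (rule L2_norm_integrable[OF kL])
      show "integrable (lebesgue_on ?\<Omega>) (indicat_real (box ?l ?r))"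
        by (rule L2_integrable[OF lmeasurable_box L2_bounded[where B = 1]]) (auto intro: borel_measurable_lebesgue_on)
      show "AE x in lebesgue_on ?\<Omega>. (norm (k x))\<^sup>2 \<le> indicat_real (box ?l ?r) x"
      proof (rule AE_I2)
        fix x assume "x \<in> space (lebesgue_on ?\<Omega>)"
        then have "x \<in> ?\<Omega>" by simp
        moreover have "(q (x $ i))\<^sup>2 \<le> 1" using q(2)[of "x $ i"] by (simp add: abs_square_le_1)
        ultimately show "(norm (k x))\<^sup>2 \<le> indicat_real (box ?l ?r) x"
          using ind[of x] by (cases "x $ co i \<in> ?J") (simp_all add: k_def)
      qed
    qed
    also have "\<dots> = (LINT x|lebesgue_on (box ?l ?r). indicat_real (box ?l ?r) x)"
      by (rule integral_subbox[OF box_subset_box_cart_le[OF lr(1,3)], symmetric]) simp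
    also have "\<dots> = (LINT x|lebesgue_on (box ?l ?r). 1)"
      by (rule Bochner_Integration.integral_cong) auto
    also have "\<dots> = area ?l ?r" using integral_const_box[of ?l ?r 1] lr(2) by (simp add: less_imp_le)
    also have "\<dots> = (b $ i - a $ i) * (hi K $ co i - lo K $ co i)" by (simp add: area_index[of _ _ i])
    finally show "(L2_norm ?\<Omega> k)\<^sup>2 \<le> (b $ i - a $ i) * (hi K $ co i - lo K $ co i)" .
  qed simp
  also have "(L2_norm ?\<Omega> w)\<^sup>2 = (LINT x|lebesgue_on ?\<Omega>. indicator ?J (x $ co i) * (v x)\<^sup>2)"
    unfolding L2_norm_sq by (rule Bochner_Integration.integral_cong) (auto simp: w_def indicator_def)
  finally show ?thesis .
qed

text \<open>The integral of \<open>v\<^sub>i\<close> over the part of the strip through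
  \<open>K\<close> up to coordinate \<open>t\<close>, divided by the width of the strip: the normal
  stress on an edge whose divergence reproduces the mean of \<open>v\<^sub>i\<close>.\<close>
definition flux :: "(plane \<Rightarrow> real^2) \<Rightarrow> plane set \<Rightarrow> 2 \<Rightarrow> real \<Rightarrow> real" where
  "flux v K i t = pairing a b i (\<lambda>x. v x $ i) (\<lambda>s. if s < t then 1 else 0) (strip K i)
     / (hi K $ co i - lo K $ co i)"

lemma flux_difference:
  assumes v: "v \<in> L2 (box a b)" and K: "K \<in> T"
  shows "flux v K i (hi K $ i) - flux v K i (lo K $ i) = (hi K $ i - lo K $ i) * avg K (\<lambda>x. v x $ i)"
proof -
  let ?p = "strip K i" and ?H = "\<lambda>t s. if s < t then 1 else 0 :: real"
  let ?L = "\<lambda>q. pairing a b i (\<lambda>x. v x $ i) q ?p"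
  let ?I = "\<lambda>s. indicat_real {lo K $ i<..<hi K $ i} s * 1"
  have lin: "weight_linear (a $ i) (b $ i) ?L"
    by (rule weight_linear_pairing[OF L2_nth[OF v] strip_weight_limit])
  have I: "test_limit (a $ i) (b $ i) ?I" by (intro test_limit_mult test_limit_indicator test_limit_const)
  note H = test_limit_less[of "a $ i" "b $ i"]
  have "?L (?H (hi K $ i)) = ?L (\<lambda>s. ?H (lo K $ i) s + ?I s)"
  proof (rule weight_linearD(3)[OF lin H test_limit_add[OF H I]])
    have "{t \<in> {a $ i<..<b $ i}. ?H (hi K $ i) t \<noteq> ?H (lo K $ i) t + ?I t} \<subseteq> {lo K $ i}"
      using element(3)[OF K, of i] by (auto simp: indicator_def)
    then show "finite {t \<in> {a $ i<..<b $ i}. ?H (hi K $ i) t \<noteq> ?H (lo K $ i) t + ?I t}" by (rule finite_subset) simp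
  qed
  also have "\<dots> = ?L (?H (lo K $ i)) + ?L ?I" by (rule weight_linearD(1)[OF lin H I])
  also have "?L ?I = (LINT x|lebesgue_on (box (lo K) (hi K)). v x $ i)"
    unfolding strip_weight_def using pairing_element[OF element(4)[OF K] element(5)[OF K], of i _ "\<lambda>s. 1" "\<lambda>s. 1"] by simp
  also have "\<dots> = area (lo K) (hi K) * avg K (\<lambda>x. v x $ i)"
    using element_area[OF K] by (simp add: mean_def)
  finally have "?L (?H (hi K $ i)) - ?L (?H (lo K $ i)) =
      (hi K $ i - lo K $ i) * (hi K $ co i - lo K $ co i) * avg K (\<lambda>x. v x $ i)"
    by (simp add: area_index[of _ _ i])
  then show ?thesis unfolding flux_def diff_divide_distrib[symmetric]
    using element(3)[OF K, of "co i"] by simp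
qed

lemma mean_pw_const:
  assumes K: "K \<in> T" and "\<And>x. x \<in> interior K \<Longrightarrow> w x = c" shows "avg K w = c"
proof -
  have "(LINT x|lebesgue_on (box (lo K) (hi K)). w x) = (LINT x|lebesgue_on (box (lo K) (hi K)). c)"
    by (rule Bochner_Integration.integral_cong) (use assms element(2)[OF K] in auto)
  also have "\<dots> = c * area (lo K) (hi K)" by (rule integral_const_box) (use element(3)[OF K] in \<open>simp add: less_imp_le\<close>)
  finally show ?thesis using element_area[OF K] by (simp add: mean_def)
qed

text \<open>With zero shear the two equations of the divergence decouple. In each direction the
  normal stress is obtained by integration of \<open>v\<^sub>i\<close> along the strip through the
  element. The bound has no dependence on the shape of the elements: each diagonal entry is bounded
  on \<open>K\<close> by the norm of \<open>v\<^sub>i\<close> on its strip, and over a point of the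
  transverse axis the lengths of the elements add up to at most the length of the domain.\<close>
lemma right_inverse:
  fixes c :: "plane set \<Rightarrow> real^2"
  defines "v \<equiv> pw (\<lambda>K x. c K)"
  obtains \<rho> where "\<rho> \<in> Sigma_h (box a b) T" "AE x in lebesgue_on (box a b). div_h T \<rho> x = v x"
    "L2_norm (box a b) \<rho> \<le> ((b $ 1 - a $ 1) + (b $ 2 - a $ 2)) * L2_norm (box a b) v"
proof -
  let ?\<Omega> = "box a b" and ?p = "value_stress (flux v) (\<lambda>s t. 0)"
  define \<rho> where "\<rho> = pw ?p"
  have vL: "v \<in> L2 ?\<Omega>" unfolding v_def by (rule pw_const_L2)
  have match: "flux v K i t = flux v L i t" if "lo K $ co i = lo L $ co i" "hi K $ co i = hi L $ co i" for K L i t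
    using that by (simp add: flux_def strip_weight_def)
  have S: "\<rho> \<in> Sigma_h ?\<Omega> T" "sigma_rep \<rho> ?p"
    unfolding \<rho>_def by (rule value_stress_Sigma_h, rule match, assumption+)+
  have \<rho>L: "\<rho> \<in> L2 ?\<Omega>" using S(1) by (simp add: Sigma_h_def L2_sym_def)
  have poly: "?p K \<in> Sigma_poly" for K unfolding value_stress_def by (rule affine_stress_poly)
  have slopes: "dslope (?p K) i + oslope (?p K) (co i) = c K $ i" if K: "K \<in> T" for K i
  proof -
    have "avg K (\<lambda>x. v x $ i) = c K $ i"
      by (rule mean_pw_const[OF K]) (simp add: v_def pw_eq[OF K])
    then show ?thesis
      using flux_difference[OF vL K, of i] element(3)[OF K, of i] by (simp add: value_stress_def affine_stress_poly)
  qed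
  have "rep_div ?p x = v x" if "K \<in> T" "x \<in> interior K" for K x
  proof -
    have "v x = c K" unfolding v_def by (rule pw_eq[OF that])
    then show ?thesis unfolding rep_div_def pw_eq[OF that] using slopes[OF that(1)] by (simp add: vec_eq_iff)
  qed
  then have "AE x in lebesgue_on ?\<Omega>. rep_div ?p x = v x"
    by (intro AE_elementsI AE_I2) simp
  then have div: "AE x in lebesgue_on ?\<Omega>. div_h T \<rho> x = v x"
    using div_h_rep(1)[OF \<rho>L S(2)] by eventually_elim simp
  have ii: "L2_norm ?\<Omega> (\<lambda>x. \<rho> x $ i $ i) \<le> (b $ i - a $ i) * L2_norm ?\<Omega> (\<lambda>x. v x $ i)" for i
  proof -
    let ?B = "b $ i - a $ i" and ?J = "\<lambda>K. {lo K $ co i<..<hi K $ co i}"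
    let ?S = "\<lambda>K. LINT x|lebesgue_on ?\<Omega>. indicator (?J K) (x $ co i) * (v x $ i)\<^sup>2"
    have B: "?B > 0" using ab[of i] by simp
    have intJ: "integrable (lebesgue_on ?\<Omega>) (\<lambda>x. indicator (?J K) (x $ co i) * (v x $ i)\<^sup>2)" for K
    proof (rule Bochner_Integration.integrable_bound)
      show "integrable (lebesgue_on ?\<Omega>) (\<lambda>x. (v x $ i)\<^sup>2)" using L2_norm_integrable[OF L2_nth[OF vL, of i]] by simp
      show "(\<lambda>x. indicator (?J K) (x $ co i) * (v x $ i)\<^sup>2) \<in> borel_measurable (lebesgue_on ?\<Omega>)"
        using L2_measurable[OF L2_nth[OF vL, of i]]
        by (intro borel_measurable_times borel_measurable_power test_limit_measurable[OF test_limit_indicator])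
    qed (auto simp: indicator_def intro!: AE_I2)
    have el: "(L2_norm (interior K) (\<lambda>x. \<rho> x $ i $ i))\<^sup>2 \<le> ?B * (hi K $ i - lo K $ i) * ?S K" if K: "K \<in> T" for K
    proof -
      let ?h = "hi K $ i - lo K $ i" and ?H = "hi K $ co i - lo K $ co i"
      have h: "?h > 0" "?H > 0" using element(3)[OF K] by simp_all
      have fl: "(flux v K i t)\<^sup>2 \<le> ?B * ?S K / ?H" for t
      proof -
        have "(pairing a b i (\<lambda>x. v x $ i) (\<lambda>s. if s < t then 1 else 0) (strip K i))\<^sup>2 \<le> ?B * ?H * ?S K"
          by (rule pairing_bound[OF L2_nth[OF vL] K test_limit_less]) simp
        then have "(flux v K i t)\<^sup>2 \<le> ?B * ?H * ?S K / ?H\<^sup>2"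
          unfolding flux_def power_divide by (rule divide_right_mono) simp
        then show ?thesis using h by (simp add: power2_eq_square)
      qed
      \<comment> \<open>Inside the element the entry is a convex combination of its two side values.\<close>
      define m where "m = max \<bar>flux v K i (hi K $ i)\<bar> \<bar>flux v K i (lo K $ i)\<bar>"
      have m: "m\<^sup>2 \<le> ?B * ?S K / ?H" using fl[of "hi K $ i"] fl[of "lo K $ i"] by (simp add: m_def max_def)
      have bound: "\<bar>\<rho> x $ i $ i\<bar> \<le> m" if x: "x \<in> interior K" for x
      proof -
        let ?F = "flux v K i (hi K $ i)" and ?G = "flux v K i (lo K $ i)"
        define y where "y = (x $ i - lo K $ i) / ?h"
        have xi: "lo K $ i < x $ i" "x $ i < hi K $ i" using box_nthD[of x "lo K" "hi K" i] x element(2)[OF K] by auto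
        have y: "0 \<le> y" "y \<le> 1" using xi h by (simp_all add: y_def)
        have "\<rho> x $ i $ i = (?F + ?G) / 2 + (?F - ?G) / ?h * (x $ i - mid K i)"
          unfolding \<rho>_def pw_eq[OF K x] by (simp add: value_stress_def affine_stress_def)
        also have "x $ i - mid K i = ?h * (y - 1 / 2)"
          using h by (simp add: y_def center_def field_simps)
        also have "(?F + ?G) / 2 + (?F - ?G) / ?h * (?h * (y - 1 / 2)) = y * ?F + (1 - y) * ?G"
          using h by (simp add: field_simps)
        finally have "\<bar>\<rho> x $ i $ i\<bar> \<le> y * \<bar>?F\<bar> + (1 - y) * \<bar>?G\<bar>"
          using abs_triangle_ineq[of "y * ?F" "(1 - y) * ?G"] y by (simp add: abs_mult)
        also have "\<dots> \<le> y * m + (1 - y) * m"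
          using y by (intro add_mono mult_left_mono) (auto simp: m_def)
        finally show ?thesis by (simp add: algebra_simps)
      qed
      have m0: "0 \<le> m" by (simp add: m_def)
      have iK: "interior K = box (lo K) (hi K)" by (rule element(2)[OF K])
      have "L2_norm (interior K) (\<lambda>x. \<rho> x $ i $ i) \<le> L2_norm (interior K) (\<lambda>x. m)"
        using bound m0 iK
        by (intro L2_norm_mono L2_measurable[OF L2_interior[OF L2_nth_nth[OF \<rho>L] K]] L2_const AE_I2) auto
      also have "\<dots> = m * sqrt (area (lo K) (hi K))"
        unfolding iK using m0 element(3)[OF K] by (subst L2_norm_const) (auto simp: less_imp_le)
      finally have "(L2_norm (interior K) (\<lambda>x. \<rho> x $ i $ i))\<^sup>2 \<le> (m * sqrt (area (lo K) (hi K)))\<^sup>2"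
        by (rule power_mono) (rule L2_norm_nonneg)
      also have "\<dots> = m\<^sup>2 * (?h * ?H)"
        using element_area[OF K] by (simp add: power_mult_distrib area_index[of _ _ i])
      also have "\<dots> \<le> (?B * ?S K / ?H) * (?h * ?H)" using h by (intro mult_right_mono m) simp
      also have "\<dots> = ?B * ?h * ?S K" using h by simp
      finally show ?thesis .
    qed
    have "(L2_norm ?\<Omega> (\<lambda>x. \<rho> x $ i $ i))\<^sup>2 \<le> (\<Sum>K\<in>T. ?B * (hi K $ i - lo K $ i) * ?S K)"
      unfolding L2_norm_elements[OF L2_nth_nth[OF \<rho>L]] by (rule sum_mono) (rule el)
    also have "\<dots> = ?B * (LINT x|lebesgue_on ?\<Omega>. (\<Sum>K\<in>T. (hi K $ i - lo K $ i) * (indicator (?J K) (x $ co i) * (v x $ i)\<^sup>2)))"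
      using intJ by (simp add: sum_distrib_left mult.assoc)
    also have "\<dots> \<le> ?B * (LINT x|lebesgue_on ?\<Omega>. ?B * (v x $ i)\<^sup>2)"
    proof (rule mult_left_mono[OF integral_mono_AE])
      show "integrable (lebesgue_on ?\<Omega>) (\<lambda>x. \<Sum>K\<in>T. (hi K $ i - lo K $ i) * (indicator (?J K) (x $ co i) * (v x $ i)\<^sup>2))"
        using intJ by (intro Bochner_Integration.integrable_sum integrable_mult_right)
      show "integrable (lebesgue_on ?\<Omega>) (\<lambda>x. ?B * (v x $ i)\<^sup>2)"
        using L2_norm_integrable[OF L2_nth[OF vL, of i]] by simp
      show "AE x in lebesgue_on ?\<Omega>. (\<Sum>K\<in>T. (hi K $ i - lo K $ i) * (indicator (?J K) (x $ co i) * (v x $ i)\<^sup>2)) \<le> ?B * (v x $ i)\<^sup>2"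
      proof (rule AE_I2)
        fix x assume "x \<in> space (lebesgue_on ?\<Omega>)"
        then have "x $ co i \<in> {a $ co i<..<b $ co i}" using box_nthD[of x a b "co i"] by simp
        from mult_right_mono[OF row_lengths[OF this] zero_le_power2[of "v x $ i"]]
        show "(\<Sum>K\<in>T. (hi K $ i - lo K $ i) * (indicator (?J K) (x $ co i) * (v x $ i)\<^sup>2)) \<le> ?B * (v x $ i)\<^sup>2"
          unfolding sum_distrib_right by (simp add: mult_ac)
      qed
    qed (use B in simp)
    also have "\<dots> = (?B * L2_norm ?\<Omega> (\<lambda>x. v x $ i))\<^sup>2"
      by (simp add: power_mult_distrib L2_norm_sq power2_eq_square[of ?B])
    finally show ?thesis by (rule power2_le_imp_le) (use B in \<open>simp add: L2_norm_nonneg\<close>)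
  qed
  have ij: "L2_norm ?\<Omega> (\<lambda>x. \<rho> x $ i $ j) \<le> 0" if "i \<noteq> j" for i j
  proof -
    have "AE x in lebesgue_on ?\<Omega>. \<rho> x $ i $ j = 0"
      using that by (intro AE_elementsI AE_I2) (simp add: \<rho>_def pw_eq value_stress_def affine_stress_def)
    then have "L2_norm ?\<Omega> (\<lambda>x. \<rho> x $ i $ j) = L2_norm ?\<Omega> (\<lambda>x. 0 :: real)"
      by (rule L2_norm_cong_AE) (use L2_measurable[OF L2_nth_nth[OF \<rho>L]] in simp_all)
    then show ?thesis by (simp add: L2_norm_def)
  qed
  have row: "L2_norm ?\<Omega> (\<lambda>x. \<rho> x $ i) \<le> (b $ i - a $ i) * L2_norm ?\<Omega> v" for i
  proof -
    have "L2_norm ?\<Omega> (\<lambda>x. \<rho> x $ i) \<le> (if i = 1 then (b $ i - a $ i) * L2_norm ?\<Omega> (\<lambda>x. v x $ i) else 0) +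
        (if i = 2 then (b $ i - a $ i) * L2_norm ?\<Omega> (\<lambda>x. v x $ i) else 0)"
      by (rule L2_norm_vec_le[OF L2_nth[OF \<rho>L], of i "\<lambda>j. if i = j then (b $ i - a $ i) * L2_norm ?\<Omega> (\<lambda>x. v x $ i) else 0"])
        (use ii[of i] ij in auto)
    then have "L2_norm ?\<Omega> (\<lambda>x. \<rho> x $ i) \<le> (b $ i - a $ i) * L2_norm ?\<Omega> (\<lambda>x. v x $ i)"
      using exhaust_2[of i] by auto
    also have "\<dots> \<le> (b $ i - a $ i) * L2_norm ?\<Omega> v"
      using ab[of i] by (intro mult_left_mono L2_norm_nth_le vL) simp
    finally show ?thesis .
  qed
  have "L2_norm ?\<Omega> \<rho> \<le> (b $ 1 - a $ 1) * L2_norm ?\<Omega> v + (b $ 2 - a $ 2) * L2_norm ?\<Omega> v"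
    by (rule L2_norm_vec_le[OF \<rho>L row])
  then show ?thesis using that S(1) div by (simp add: distrib_right)
qed

end

section \<open>Projection and interpolation errors\<close>
lemma mean_add:
  assumes "v \<in> L2 (box l r)" "w \<in> L2 (box l r)"
  shows "mean l r (\<lambda>x. v x + w x) = mean l r v + mean l r w"
  using L2_integrable[OF lmeasurable_box assms(1)] L2_integrable[OF lmeasurable_box assms(2)]
  by (simp add: mean_def add_divide_distrib)

lemma mean_cong_AE:
  assumes "v \<in> L2 (box l r)" "w \<in> L2 (box l r)" "AE x in lebesgue_on (box l r). v x = w x"
  shows "mean l r v = mean l r w"
proof -
  have "(LINT x|lebesgue_on (box l r). v x) = (LINT x|lebesgue_on (box l r). w x)"
    by (rule integral_cong_AE) (use assms assms(1,2)[THEN L2_measurable] in auto)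
  then show ?thesis by (simp add: mean_def)
qed

lemma weak_partial_add:
  assumes "weak_partial a b i v g" "weak_partial a b i w k"
  shows "weak_partial a b i (\<lambda>x. v x + w x) (\<lambda>x. g x + k x)"
proof -
  have L2: "v \<in> L2 (box a b)" "g \<in> L2 (box a b)" "w \<in> L2 (box a b)" "k \<in> L2 (box a b)"
    using assms by (simp_all add: weak_partial_def)
  have "pairing a b i (\<lambda>x. v x + w x) (deriv q) p = - pairing a b i (\<lambda>x. g x + k x) q p"
    if q: "test1 (a $ i) (b $ i) q" and p: "test1 (a $ co i) (b $ co i) p" for q p
  proof -
    have t: "test_limit (a $ i) (b $ i) q" "test_limit (a $ i) (b $ i) (deriv q)" "test_limit (a $ co i) (b $ co i) p"
      using test_limit_smooth test1_smooth[OF q] test1_smooth[OF p] smooth_deriv by blast+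
    show ?thesis
      using assms q p unfolding weak_partial_def
      by (simp add: pairing_add[OF L2(1,3) t(2,3)] pairing_add[OF L2(2,4) t(1,3)])
  qed
  then show ?thesis by (simp add: weak_partial_def L2_add L2)
qed

lemma bounded_linear_entry: "bounded_linear (\<lambda>A :: real^2^2. A $ i $ j)"
  by (rule bounded_linear_compose[OF bounded_linear_vec_nth bounded_linear_vec_nth])

context grid
begin

abbreviation "hh \<equiv> mesh_size T"

lemma Poincare_element:
  assumes "weak_partial a b 1 w g1" "weak_partial a b 2 w g2" and K: "K \<in> T"
  shows "L2_norm (interior K) (\<lambda>x. w x - avg K w) \<le> hh * (L2_norm (interior K) g1 + L2_norm (interior K) g2)"
proof -
  note sub = weak_partial_subbox[OF _ element(4)[OF K] element(5)[OF K]]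
  have "L2_norm (interior K) (\<lambda>x. w x - avg K w) \<le>
      (hi K $ 1 - lo K $ 1) * L2_norm (interior K) g1 + (hi K $ 2 - lo K $ 2) * L2_norm (interior K) g2"
    using Poincare_inequality[where i = 1, OF sub[OF assms(1)], of g2] sub[OF assms(2)] element(2,3)[OF K] by simp
  also have "\<dots> \<le> hh * L2_norm (interior K) g1 + hh * L2_norm (interior K) g2"
    by (intro add_mono mult_right_mono mesh_size_ge K L2_norm_nonneg)
  finally show ?thesis by (simp add: distrib_left)
qed

text \<open>Orthogonal projection to piecewise constants.\<close>
definition proj :: "(plane \<Rightarrow> real) \<Rightarrow> plane \<Rightarrow> real" where
  "proj w = pw (\<lambda>K x. avg K w)"

lemma proj_L2: "proj w \<in> L2 (box a b)"
  unfolding proj_def by (rule pw_const_L2)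

lemma L2_norm_element_cong:
  assumes "\<And>x. x \<in> interior K \<Longrightarrow> f x = g x"
  shows "L2_norm (interior K) f = L2_norm (interior K) g"
  unfolding L2_norm_def by (intro arg_cong[where f = sqrt] Bochner_Integration.integral_cong) (use assms in auto)

lemma L2_norm_zero [simp]: "L2_norm U (\<lambda>x. 0) = 0"
  by (simp add: L2_norm_def)

lemma proj_error:
  assumes wp: "weak_partial a b 1 w g1" "weak_partial a b 2 w g2"
  shows "L2_norm (box a b) (\<lambda>x. w x - proj w x) \<le> 2 * hh * (L2_norm (box a b) g1 + L2_norm (box a b) g2)"
proof -
  have L2: "w \<in> L2 (box a b)" "g1 \<in> L2 (box a b)" "g2 \<in> L2 (box a b)" using wp by (auto simp: weak_partial_def)
  have "L2_norm (box a b) (\<lambda>x. w x - proj w x) \<le>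
      2 * hh * (L2_norm (box a b) g1 + L2_norm (box a b) g2 + L2_norm (box a b) (\<lambda>x. 0 :: real))"
  proof (rule broken_norm_bound)
    fix K assume K: "K \<in> T"
    have "L2_norm (interior K) (\<lambda>x. w x - proj w x) = L2_norm (interior K) (\<lambda>x. w x - avg K w)"
      by (rule L2_norm_element_cong) (simp add: proj_def pw_eq[OF K])
    then show "L2_norm (interior K) (\<lambda>x. w x - proj w x) \<le> hh *
        (L2_norm (interior K) g1 + L2_norm (interior K) g2 + L2_norm (interior K) (\<lambda>x. 0 :: real))"
      using Poincare_element[OF wp K] by simp
  qed (use L2 mesh_size_pos proj_L2 in \<open>simp_all add: L2_diff L2_zero less_imp_le\<close>)
  then show ?thesis by simp
qed

definition proj_vec :: "(plane \<Rightarrow> real^2) \<Rightarrow> plane \<Rightarrow> real^2" where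
  "proj_vec v = pw (\<lambda>K x. \<chi> i. avg K (\<lambda>x. v x $ i))"

lemma proj_vec_L2: "proj_vec v \<in> L2 (box a b)" "proj_vec v \<in> V_h (box a b) T"
  unfolding proj_vec_def by (rule pw_const_L2, rule pw_const_V_h)

lemma pw_nth: "pw (\<lambda>K x. \<chi> i. c K i) x $ i = pw (\<lambda>K x. c K i) x" for c :: "plane set \<Rightarrow> 2 \<Rightarrow> real"
  by (simp add: pw_def)

lemma proj_vec_nth: "proj_vec v x $ i = proj (\<lambda>x. v x $ i) x"
  unfolding proj_vec_def proj_def by (rule pw_nth)

lemma proj_vec_error:
  assumes v: "v \<in> L2 (box a b)"
    and wp: "\<And>i k. weak_partial a b k (\<lambda>x. v x $ i) (g k i)" and N: "\<And>i k. L2_norm (box a b) (g k i) \<le> N"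
  shows "L2_norm (box a b) (\<lambda>x. v x - proj_vec v x) \<le> 8 * hh * N"
proof -
  have "L2_norm (box a b) (\<lambda>x. (v x - proj_vec v x) $ i) \<le> 4 * hh * N" for i
  proof -
    have "L2_norm (box a b) (\<lambda>x. v x $ i - proj (\<lambda>x. v x $ i) x) \<le> 2 * hh * (L2_norm (box a b) (g 1 i) + L2_norm (box a b) (g 2 i))"
      by (rule proj_error[OF wp wp])
    also have "\<dots> \<le> 2 * hh * (N + N)" using mesh_size_pos by (intro mult_left_mono add_mono N) simp
    finally show ?thesis by (simp add: proj_vec_nth)
  qed
  then have "L2_norm (box a b) (\<lambda>x. v x - proj_vec v x) \<le> 4 * hh * N + 4 * hh * N"
    by (intro L2_norm_vec_le L2_diff v proj_vec_L2)
  also have "\<dots> = 8 * hh * N" by (simp only: distrib_right[symmetric]) simp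
  finally show ?thesis .
qed

text \<open>A length that bounds every element side. It turns bounds by \<open>h\<^sup>2\<close>
  into bounds by \<open>h\<close>.\<close>
definition width :: real where "width = (b $ 1 - a $ 1) + (b $ 2 - a $ 2)"

lemma width_ge: "K \<in> T \<Longrightarrow> hi K $ i - lo K $ i \<le> width"
  using element(4,5)[of K i] ab[of 1] ab[of 2] exhaust_2[of i] by (force simp: width_def)

lemma width_pos: "0 < width" using ab[of 1] ab[of 2] by (simp add: width_def)

lemma mean_coordinate_bound:
  assumes g: "g \<in> L2 (box a b)" and K: "K \<in> T"
  shows "\<bar>avg K (\<lambda>x. (x $ k - mid K k) * g x)\<bar> * sqrt (area (lo K) (hi K)) \<le>
    (hi K $ k - lo K $ k) / 2 * L2_norm (interior K) g"
  using mean_diff_bound[OF _ element(3)[OF K] coordinate_measurable center_bound] L2_interior[OF g K]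
  by (simp add: element(2)[OF K])

lemma mean_bound:
  assumes g: "g \<in> L2 (box a b)" and K: "K \<in> T"
  shows "\<bar>avg K g\<bar> * sqrt (area (lo K) (hi K)) \<le> L2_norm (interior K) g"
  using mean_diff_bound[of g "lo K" "hi K" "\<lambda>x. 1" 1, OF _ element(3)[OF K]] L2_interior[OF g K]
  by (simp add: element(2)[OF K])

text \<open>A diagonal entry is interpolated by its averages over the two sides orthogonal to the
  direction of differentiation. The slope is then exactly the mean of the derivative, so this entry
  commutes with the divergence.\<close>
lemma diag_interpolation_element:
  assumes wp: "weak_partial a b i w g" "weak_partial a b (co i) w g'" and K: "K \<in> T"
  defines "F \<equiv> \<lambda>t. line_trace a b i w g (strip K i) t / (hi K $ co i - lo K $ co i)"
  defines "s \<equiv> (F (hi K $ i) - F (lo K $ i)) / (hi K $ i - lo K $ i)"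
  shows "s = avg K g"
    and "L2_norm (interior K) (\<lambda>x. w x - ((F (hi K $ i) + F (lo K $ i)) / 2 + s * (x $ i - mid K i))) \<le>
      2 * hh * (L2_norm (interior K) g + L2_norm (interior K) g')"
proof -
  let ?l = "lo K" and ?r = "hi K"
  let ?h = "?r $ i - ?l $ i" and ?H = "?r $ co i - ?l $ co i" and ?A = "area ?l ?r"
  let ?m = "mean ?l ?r (\<lambda>x. (x $ i - center ?l ?r i) * g x)" and ?n = "L2_norm (interior K)"
  have iK: "interior K = box ?l ?r" by (rule element(2)[OF K])
  have h: "?h > 0" "?H > 0" using element(3)[OF K] by simp_all
  have L2: "w \<in> L2 (box a b)" "g \<in> L2 (box a b)" "g' \<in> L2 (box a b)" using wp by (auto simp: weak_partial_def)
  note tr = line_trace_element[OF wp(1) element(4)[OF K] element(3)[OF K] element(5)[OF K]]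
  have "s = (?A * mean ?l ?r g) / (?H * ?h)"
    unfolding s_def F_def tr(1)[symmetric] by (simp add: diff_divide_distrib)
  then show s: "s = mean ?l ?r g" using h by (simp add: area_index[of _ _ i])
  have d: "(F (?r $ i) + F (?l $ i)) / 2 = mean ?l ?r w + ?m"
  proof -
    have "x = y" if "e / 2 * (p + q) = e * f * y" "x = (p / f + q / f) / 2" "e > 0" "f > 0" for x y e f p q :: real
    proof -
      have "e * (p + q) = e * (2 * f * y)" using that(1) by (simp add: mult_ac)
      then have "p + q = 2 * f * y" using that(3) by simp
      then show ?thesis using that(4) by (simp add: that(2) add_divide_distrib[symmetric])
    qed
    from this[OF tr(2)[unfolded area_index[of ?l ?r i]] _ h] show ?thesis unfolding F_def by blast
  qed
  have "(\<lambda>x. w x - ((F (?r $ i) + F (?l $ i)) / 2 + s * (x $ i - center ?l ?r i))) =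
      (\<lambda>x. w x - (mean ?l ?r w + ?m + (if i = 1 then s else 0) * (x $ 1 - center ?l ?r 1) + (if i = 2 then s else 0) * (x $ 2 - center ?l ?r 2)))"
    unfolding d using exhaust_2[of i] by auto
  then have "?n (\<lambda>x. w x - ((F (?r $ i) + F (?l $ i)) / 2 + s * (x $ i - center ?l ?r i))) \<le>
      ?n (\<lambda>x. w x - mean ?l ?r w) + \<bar>?m\<bar> * sqrt ?A +
      (?r $ 1 - ?l $ 1) / 2 * (\<bar>if i = 1 then s else 0\<bar> * sqrt ?A) + (?r $ 2 - ?l $ 2) / 2 * (\<bar>if i = 2 then s else 0\<bar> * sqrt ?A)"
    using affine_error[OF _ element(3)[OF K], of w "mean ?l ?r w + ?m" "if i = 1 then s else 0" "if i = 2 then s else 0"]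
      L2_interior[OF L2(1) K] by (simp add: iK)
  also have "\<dots> = ?n (\<lambda>x. w x - mean ?l ?r w) + \<bar>?m\<bar> * sqrt ?A + ?h / 2 * (\<bar>s\<bar> * sqrt ?A)"
    using exhaust_2[of i] by auto
  also have "\<dots> \<le> hh * (?n g + ?n g') + ?h / 2 * ?n g + ?h / 2 * ?n g"
  proof (intro add_mono)
    show "?n (\<lambda>x. w x - mean ?l ?r w) \<le> hh * (?n g + ?n g')"
    proof (cases "i = 1")
      case True
      then show ?thesis using Poincare_element[OF _ _ K, of w g g'] wp by simp
    next
      case False
      then have "i = 2" using exhaust_2[of i] by auto
      then show ?thesis using Poincare_element[OF _ _ K, of w g' g] wp by (simp add: add.commute)
    qed
    show "\<bar>?m\<bar> * sqrt ?A \<le> ?h / 2 * ?n g" by (rule mean_coordinate_bound[OF L2(2) K])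
    show "?h / 2 * (\<bar>s\<bar> * sqrt ?A) \<le> ?h / 2 * ?n g"
      unfolding s using h by (intro mult_left_mono mean_bound[OF L2(2) K]) simp
  qed
  also have "\<dots> \<le> hh * (?n g + ?n g') + hh / 2 * ?n g + hh / 2 * ?n g"
    using mesh_size_ge[OF K, of i] by (intro add_mono order_refl mult_right_mono L2_norm_nonneg) simp_all
  also have "\<dots> \<le> 2 * hh * (?n g + ?n g')"
    using mult_nonneg_nonneg[OF less_imp_le[OF mesh_size_pos] L2_norm_nonneg, of "interior K" g'] by (simp add: algebra_simps)
  finally show "?n (\<lambda>x. w x - ((F (?r $ i) + F (?l $ i)) / 2 + s * (x $ i - center ?l ?r i))) \<le> 2 * hh * (?n g + ?n g')" .
qed

text \<open>The shear entry is interpolated at the vertices. Its slopes are the means of the first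
  derivatives up to first moments of the mixed derivative.\<close>
lemma off_interpolation_element:
  assumes m: "weak_mixed a b w w1 w2 w12" and K: "K \<in> T"
  defines "V \<equiv> vertex_value a b w w1 w2 w12"
  defines "c \<equiv> (V (hi K $ 1) (hi K $ 2) + V (hi K $ 1) (lo K $ 2) + V (lo K $ 1) (hi K $ 2) + V (lo K $ 1) (lo K $ 2)) / 4"
    and "s \<equiv> (V (hi K $ 1) (hi K $ 2) + V (hi K $ 1) (lo K $ 2) - V (lo K $ 1) (hi K $ 2) - V (lo K $ 1) (lo K $ 2)) / (2 * (hi K $ 1 - lo K $ 1))"
    and "t \<equiv> (V (hi K $ 1) (hi K $ 2) - V (hi K $ 1) (lo K $ 2) + V (lo K $ 1) (hi K $ 2) - V (lo K $ 1) (lo K $ 2)) / (2 * (hi K $ 2 - lo K $ 2))"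
  shows "s = avg K w1 + avg K (\<lambda>x. (x $ 2 - mid K 2) * w12 x)"
    and "t = avg K w2 + avg K (\<lambda>x. (x $ 1 - mid K 1) * w12 x)"
    and "L2_norm (interior K) (\<lambda>x. w x - (c + s * (x $ 1 - mid K 1) + t * (x $ 2 - mid K 2))) \<le>
      2 * hh * (1 + width) * (L2_norm (interior K) w1 + L2_norm (interior K) w2 + L2_norm (interior K) w12)"
proof -
  let ?l = "lo K" and ?r = "hi K"
  let ?h1 = "?r $ 1 - ?l $ 1" and ?h2 = "?r $ 2 - ?l $ 2" and ?A = "area ?l ?r"
  let ?c1 = "center ?l ?r 1" and ?c2 = "center ?l ?r 2" and ?n = "L2_norm (interior K)" and ?M = "mean ?l ?r"
  have iK: "interior K = box ?l ?r" by (rule element(2)[OF K])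
  have h: "?h1 > 0" "?h2 > 0" using element(3)[OF K] by simp_all
  have L2: "w \<in> L2 (box a b)" "w1 \<in> L2 (box a b)" "w2 \<in> L2 (box a b)" "w12 \<in> L2 (box a b)"
    using m by (auto simp: weak_mixed_def weak_partial_def)
  note vv = vertex_value_element[OF m element(4)[OF K] element(3)[OF K] element(5)[OF K], folded V_def]
  have alg: "p / (2 * e) = y" if "f / 2 * p = e * f * y" "e > 0" "f > 0" for p e f y :: real
    using that by (simp add: field_simps)
  have alg': "p / (2 * f) = y" if "e / 2 * p = e * f * y" "e > 0" "f > 0" for p e f y :: real
    using that by (simp add: field_simps)
  show s: "s = ?M w1 + ?M (\<lambda>x. (x $ 2 - ?c2) * w12 x)"
    unfolding s_def by (rule alg[OF vv(1)[unfolded area_def] h])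
  show t: "t = ?M w2 + ?M (\<lambda>x. (x $ 1 - ?c1) * w12 x)"
    unfolding t_def by (rule alg'[OF vv(2)[unfolded area_def] h])
  define m1 where "m1 = ?M (\<lambda>x. (x $ 1 - ?c1) * w1 x)"
  define m2 where "m2 = ?M (\<lambda>x. (x $ 2 - ?c2) * w2 x)"
  define m12 where "m12 = ?M (\<lambda>x. (x $ 1 - ?c1) * (x $ 2 - ?c2) * w12 x)"
  define n1 where "n1 = ?M (\<lambda>x. (x $ 1 - ?c1) * w12 x)"
  define n2 where "n2 = ?M (\<lambda>x. (x $ 2 - ?c2) * w12 x)"
  have c: "c = ?M w + m1 + m2 + m12" unfolding c_def m1_def m2_def m12_def by (rule vv(3))
  let ?q = "sqrt ?A"
  have q: "0 \<le> ?q" using element_area[OF K] by simp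
  have b1: "\<bar>m1\<bar> * ?q \<le> ?h1 / 2 * ?n w1" unfolding m1_def by (rule mean_coordinate_bound[OF L2(2) K])
  have b2: "\<bar>m2\<bar> * ?q \<le> ?h2 / 2 * ?n w2" unfolding m2_def by (rule mean_coordinate_bound[OF L2(3) K])
  have b3: "\<bar>n1\<bar> * ?q \<le> ?h1 / 2 * ?n w12" unfolding n1_def by (rule mean_coordinate_bound[OF L2(4) K])
  have b4: "\<bar>n2\<bar> * ?q \<le> ?h2 / 2 * ?n w12" unfolding n2_def by (rule mean_coordinate_bound[OF L2(4) K])
  have b5: "\<bar>m12\<bar> * ?q \<le> ?h1 / 2 * (?h2 / 2) * ?n w12"
    unfolding m12_def iK
  proof (rule mean_diff_bound[OF _ element(3)[OF K]])
    show "w12 \<in> L2 (box ?l ?r)" using L2_interior[OF L2(4) K] by (simp add: iK)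
    show "(\<lambda>x. (x $ 1 - ?c1) * (x $ 2 - ?c2)) \<in> borel_measurable (lebesgue_on (box ?l ?r))"
      by (intro borel_measurable_times coordinate_measurable)
    show "\<bar>(x $ 1 - ?c1) * (x $ 2 - ?c2)\<bar> \<le> ?h1 / 2 * (?h2 / 2)" if "x \<in> box ?l ?r" for x
      unfolding abs_mult using h by (intro mult_mono center_bound[OF that]) auto
  qed
  have M1: "\<bar>?M w1\<bar> * ?q \<le> ?n w1" and M2: "\<bar>?M w2\<bar> * ?q \<le> ?n w2"
    by (rule mean_bound[OF L2(2) K], rule mean_bound[OF L2(3) K])
  have tri: "\<bar>x + y\<bar> * ?q \<le> \<bar>x\<bar> * ?q + \<bar>y\<bar> * ?q" for x y
    using mult_right_mono[OF abs_triangle_ineq[of x y] q] by (simp add: distrib_right)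
  have cq: "\<bar>c - ?M w\<bar> * ?q \<le> ?h1 / 2 * ?n w1 + ?h2 / 2 * ?n w2 + ?h1 / 2 * (?h2 / 2) * ?n w12"
  proof -
    have "c - ?M w = (m1 + m2) + m12" by (simp add: c)
    then show ?thesis using tri[of "m1 + m2" m12] tri[of m1 m2] b1 b2 b5 by simp
  qed
  have sq: "\<bar>s\<bar> * ?q \<le> ?n w1 + ?h2 / 2 * ?n w12" using tri[of "?M w1" n2] M1 b4 by (simp add: s n2_def)
  have tq: "\<bar>t\<bar> * ?q \<le> ?n w2 + ?h1 / 2 * ?n w12" using tri[of "?M w2" n1] M2 b3 by (simp add: t n1_def)
  have "?n (\<lambda>x. w x - (c + s * (x $ 1 - ?c1) + t * (x $ 2 - ?c2))) \<le>
      ?n (\<lambda>x. w x - ?M w) + \<bar>c - ?M w\<bar> * ?q + ?h1 / 2 * (\<bar>s\<bar> * ?q) + ?h2 / 2 * (\<bar>t\<bar> * ?q)"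
    using affine_error[OF _ element(3)[OF K], of w c s t] L2_interior[OF L2(1) K] by (simp add: iK)
  also have "\<dots> \<le> hh * (?n w1 + ?n w2) + (?h1 / 2 * ?n w1 + ?h2 / 2 * ?n w2 + ?h1 / 2 * (?h2 / 2) * ?n w12)
      + ?h1 / 2 * (?n w1 + ?h2 / 2 * ?n w12) + ?h2 / 2 * (?n w2 + ?h1 / 2 * ?n w12)"
    using m Poincare_element[OF _ _ K, of w w1 w2] cq h
    by (intro add_mono mult_left_mono sq tq) (auto simp: weak_mixed_def)
  also have "\<dots> = hh * (?n w1 + ?n w2) + ?h1 * ?n w1 + ?h2 * ?n w2 + 3 / 4 * (?h1 * ?h2 * ?n w12)"
    by (simp add: field_simps)
  also have "\<dots> \<le> hh * (?n w1 + ?n w2) + hh * ?n w1 + hh * ?n w2 + 1 * (hh * width * ?n w12)"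
    using h mesh_size_pos width_pos
    by (intro add_mono order_refl mult_mono mesh_size_ge[OF K] width_ge[OF K])
       (auto intro!: mult_nonneg_nonneg simp: L2_norm_nonneg less_imp_le)
  also have "\<dots> \<le> 2 * hh * (1 + width) * (?n w1 + ?n w2 + ?n w12)"
  proof -
    have "hh * (x + y) + hh * x + hh * y + 1 * (hh * width * z) \<le> 2 * hh * (1 + width) * (x + y + z)"
      if "0 \<le> x" "0 \<le> y" "0 \<le> z" for x y z
    proof -
      have "0 \<le> hh * width * x" "0 \<le> hh * width * y" "0 \<le> hh * width * z" "0 \<le> hh * z"
        using that mesh_size_pos width_pos by (simp_all add: less_imp_le)
      then show ?thesis by (simp add: algebra_simps)
    qed
    then show ?thesis by (simp add: L2_norm_nonneg)
  qed
  finally show "?n (\<lambda>x. w x - (c + s * (x $ 1 - ?c1) + t * (x $ 2 - ?c2))) \<le> 2 * hh * (1 + width) * (?n w1 + ?n w2 + ?n w12)" .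
qed

definition sobolev_div :: "(plane \<Rightarrow> real^2^2) \<Rightarrow> plane \<Rightarrow> real^2" where
  "sobolev_div \<sigma> x = (\<chi> i. D1 (box a b) 1 \<sigma> x $ i $ 1 + D1 (box a b) 2 \<sigma> x $ i $ 2)"

lemma sobolev_div_L2:
  assumes "\<sigma> \<in> sobolev 2 (box a b)" shows "sobolev_div \<sigma> \<in> L2 (box a b)"
  by (rule L2_vec2I) (simp add: sobolev_div_def L2_add L2_nth_nth sobolev2(2)[OF assms])

lemma sobolev_div_error:
  assumes s: "\<sigma> \<in> sobolev 2 (box a b)"
  shows "L2_norm (box a b) (\<lambda>x. sobolev_div \<sigma> x - proj_vec (sobolev_div \<sigma>) x) \<le> 16 * hh * sobolev_norm 2 (box a b) \<sigma>"
proof -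
  let ?\<Omega> = "box a b" and ?N = "sobolev_norm 2 (box a b) \<sigma>"
  have "L2_norm ?\<Omega> (\<lambda>x. sobolev_div \<sigma> x - proj_vec (sobolev_div \<sigma>) x) \<le> 8 * hh * (2 * ?N)"
  proof (rule proj_vec_error[OF sobolev_div_L2[OF s]])
    fix i k
    show "weak_partial a b k (\<lambda>x. sobolev_div \<sigma> x $ i) (\<lambda>x. D2 ?\<Omega> k 1 \<sigma> x $ i $ 1 + D2 ?\<Omega> k 2 \<sigma> x $ i $ 2)"
      unfolding sobolev_div_def vec_lambda_beta
      by (intro weak_partial_add sobolev2(8)[OF s bounded_linear_entry])
    have "L2_norm ?\<Omega> (\<lambda>x. D2 ?\<Omega> k j \<sigma> x $ i $ j) \<le> ?N" for j
      using L2_norm_nth_nth_le[OF sobolev2(3)[OF s, of k j], of i j] sobolev2(5)[OF s, of k j] by linarith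
    from this[of 1] this[of 2]
    show "L2_norm ?\<Omega> (\<lambda>x. D2 ?\<Omega> k 1 \<sigma> x $ i $ 1 + D2 ?\<Omega> k 2 \<sigma> x $ i $ 2) \<le> 2 * ?N"
      using L2_norm_triangle[OF L2_nth_nth[OF sobolev2(3)[OF s, of k 1], of i 1] L2_nth_nth[OF sobolev2(3)[OF s, of k 2], of i 2]]
      by linarith
  qed
  then show ?thesis by simp
qed

lemma sobolev_div_weak:
  assumes s: "\<sigma> \<in> sobolev 2 (box a b)"
  shows "has_weak_div (box a b) \<sigma> (sobolev_div \<sigma>)" "K \<in> T \<Longrightarrow> has_weak_div (interior K) \<sigma> (sobolev_div \<sigma>)"
proof -
  have *: "has_weak_div U \<sigma> (sobolev_div \<sigma>)" if U: "U \<in> lmeasurable" "U \<subseteq> box a b" for U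
    unfolding sobolev_div_def
  proof (rule has_weak_divI[OF U(1), where g = "\<lambda>i j x. D1 (box a b) j \<sigma> x $ i $ j"])
    have L: "f \<in> L2 U" if "f \<in> L2 (box a b)" for f :: "plane \<Rightarrow> 'c::euclidean_space"
      using L2_subset[OF that U(2)] U(1) by (simp add: fmeasurableD)
    show "\<sigma> \<in> L2 U" by (rule L[OF sobolev2(1)[OF s]])
    show "(\<lambda>x. D1 (box a b) j \<sigma> x $ i $ j) \<in> L2 U" for i j by (rule L[OF L2_nth_nth[OF sobolev2(2)[OF s]]])
    show "weak_grad U j (\<lambda>x. \<sigma> x $ i $ j) (\<lambda>x. D1 (box a b) j \<sigma> x $ i $ j)" for i j
      using weak_grad_subset[OF sobolev2(6)[OF s bounded_linear_entry] U(2)] U(1) by (simp add: fmeasurableD)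
  qed
  show "has_weak_div (box a b) \<sigma> (sobolev_div \<sigma>)" by (rule *) auto
  show "K \<in> T \<Longrightarrow> has_weak_div (interior K) \<sigma> (sobolev_div \<sigma>)"
    using element_subset by (intro *) (auto simp: element(2))
qed

text \<open>The interpolant takes side averages of the diagonal entries and vertex values of the
  shear entry. The discrepancy of the divergences is a first moment of the mixed second derivative
  of the shear entry, hence of first order; it is corrected later by the right inverse.\<close>
lemma interpolation:
  assumes s: "\<sigma> \<in> sobolev 2 (box a b)" and sym: "\<sigma> \<in> L2_sym (box a b)"
  obtains \<pi> where "\<pi> \<in> Sigma_h (box a b) T"
    "L2_norm (box a b) (\<lambda>x. \<sigma> x - \<pi> x) \<le> 48 * (1 + width) * hh * sobolev_norm 2 (box a b) \<sigma>"
    "L2_norm (box a b) (\<lambda>x. proj_vec (sobolev_div \<sigma>) x - div_h T \<pi> x) \<le> 4 * hh * sobolev_norm 2 (box a b) \<sigma>"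
proof -
  let ?\<Omega> = "box a b" and ?N = "sobolev_norm 2 (box a b) \<sigma>"
  define d where "d i j k x = D1 ?\<Omega> k \<sigma> x $ i $ j" for i j k x
  define w12 where "w12 x = D2 ?\<Omega> 1 2 \<sigma> x $ 1 $ 2" for x
  have sL: "\<sigma> \<in> L2 ?\<Omega>" by (rule sobolev2(1)[OF s])
  have dL: "d i j k \<in> L2 ?\<Omega>" for i j k unfolding d_def by (rule L2_nth_nth[OF sobolev2(2)[OF s]])
  have wL: "w12 \<in> L2 ?\<Omega>" unfolding w12_def by (rule L2_nth_nth[OF sobolev2(3)[OF s]])
  have wp: "weak_partial a b k (\<lambda>x. \<sigma> x $ i $ j) (d i j k)" for i j k
    unfolding d_def by (rule sobolev2(7)[OF s bounded_linear_entry])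
  have d_eq: "d i j k = (\<lambda>x. D1 ?\<Omega> k \<sigma> x $ i $ j)" for i j k by (rule ext) (rule d_def)
  have w_eq: "w12 = (\<lambda>x. D2 ?\<Omega> 1 2 \<sigma> x $ 1 $ 2)" by (rule ext) (rule w12_def)
  have "weak_partial a b 1 (d 1 2 2) w12"
    unfolding d_eq w_eq by (rule sobolev2(8)[OF s bounded_linear_entry])
  moreover have "weak_partial a b 2 (d 1 2 1) w12"
    unfolding d_eq w_eq D2_commute[of ?\<Omega> 1 2] by (rule sobolev2(8)[OF s bounded_linear_entry])
  ultimately have mixed: "weak_mixed a b (\<lambda>x. \<sigma> x $ 1 $ 2) (d 1 2 1) (d 1 2 2) w12"
    unfolding weak_mixed_def using wp by blast
  have dN: "L2_norm ?\<Omega> (d i j k) \<le> ?N" for i j k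
    using L2_norm_nth_nth_le[OF sobolev2(2)[OF s, of k], of i j] sobolev2(4)[OF s, of k] unfolding d_def by linarith
  have wN: "L2_norm ?\<Omega> w12 \<le> ?N"
    using L2_norm_nth_nth_le[OF sobolev2(3)[OF s, of 1 2], of 1 2] sobolev2(5)[OF s, of 1 2] unfolding w12_def by linarith
  have N0: "0 \<le> ?N" using wN L2_norm_nonneg[of ?\<Omega> w12] by linarith
  have sym_AE: "AE x in lebesgue_on ?\<Omega>. \<sigma> x $ 1 $ 2 = \<sigma> x $ 2 $ 1"
    using sym unfolding L2_sym_def by (auto elim!: eventually_mono simp: transpose_def vec_eq_iff)
  have d_sym: "AE x in lebesgue_on ?\<Omega>. d 2 1 k x = d 1 2 k x" for k
  proof (rule weak_grad_unique[OF _ _ dL dL])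
    show "weak_grad ?\<Omega> k (\<lambda>x. \<sigma> x $ 2 $ 1) (d 2 1 k)" unfolding d_def by (rule sobolev2(6)[OF s bounded_linear_entry])
    have "weak_grad ?\<Omega> k (\<lambda>x. \<sigma> x $ 1 $ 2) (d 1 2 k)" unfolding d_def by (rule sobolev2(6)[OF s bounded_linear_entry])
    then show "weak_grad ?\<Omega> k (\<lambda>x. \<sigma> x $ 2 $ 1) (d 1 2 k)"
      by (rule weak_grad_cong_AE[OF _ L2_nth_nth[OF sL] L2_nth_nth[OF sL] sym_AE])
  qed
  define g where "g K i t = line_trace a b i (\<lambda>x. \<sigma> x $ i $ i) (d i i i) (strip K i) t / (hi K $ co i - lo K $ co i)" for K i t
  define V where "V = vertex_value a b (\<lambda>x. \<sigma> x $ 1 $ 2) (d 1 2 1) (d 1 2 2) w12"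
  define p where "p = value_stress g V"
  define \<pi> where "\<pi> = pw p"
  have S: "\<pi> \<in> Sigma_h ?\<Omega> T" "sigma_rep \<pi> p"
    unfolding \<pi>_def p_def by (rule value_stress_Sigma_h, simp add: g_def strip_weight_def)+
  have pL: "\<pi> \<in> L2 ?\<Omega>" using S(1) by (simp add: Sigma_h_def L2_sym_def)
  have eL: "(\<lambda>x. \<sigma> x $ i $ j - \<pi> x $ i $ j) \<in> L2 ?\<Omega>" for i j by (intro L2_diff L2_nth_nth sL pL)
  let ?C = "2 * (2 * hh * (1 + width)) * (3 * ?N)"
  have c0: "0 \<le> 2 * hh * (1 + width)" using mesh_size_pos width_pos by simp
  have norm3: "2 * (2 * hh * (1 + width)) * (L2_norm ?\<Omega> G1 + L2_norm ?\<Omega> G2 + L2_norm ?\<Omega> G3) \<le> ?C"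
    if "L2_norm ?\<Omega> G1 \<le> ?N" "L2_norm ?\<Omega> G2 \<le> ?N" "L2_norm ?\<Omega> G3 \<le> ?N" for G1 G2 G3 :: "plane \<Rightarrow> real"
    using that c0 by (intro mult_left_mono) auto
  have diag: "L2_norm ?\<Omega> (\<lambda>x. \<sigma> x $ i $ i - \<pi> x $ i $ i) \<le> ?C" for i
  proof (rule order_trans[OF broken_norm_bound[OF eL dL dL L2_zero _ c0] norm3[OF dN dN]])
    fix K assume K: "K \<in> T"
    have "L2_norm (interior K) (\<lambda>x. \<sigma> x $ i $ i - \<pi> x $ i $ i) = L2_norm (interior K) (\<lambda>x. \<sigma> x $ i $ i -
        ((g K i (hi K $ i) + g K i (lo K $ i)) / 2 + (g K i (hi K $ i) - g K i (lo K $ i)) / (hi K $ i - lo K $ i) * (x $ i - mid K i)))"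
      by (rule L2_norm_element_cong) (simp add: \<pi>_def pw_eq[OF K] p_def value_stress_def affine_stress_def)
    also have "\<dots> \<le> 2 * hh * (L2_norm (interior K) (d i i i) + L2_norm (interior K) (d i i (co i)))"
      unfolding g_def by (rule diag_interpolation_element(2)[OF wp wp K])
    also have "\<dots> \<le> 2 * hh * (1 + width) * (L2_norm (interior K) (d i i i) + L2_norm (interior K) (d i i (co i)))"
      using mesh_size_pos width_pos by (intro mult_right_mono) (simp_all add: L2_norm_nonneg)
    finally show "L2_norm (interior K) (\<lambda>x. \<sigma> x $ i $ i - \<pi> x $ i $ i) \<le> 2 * hh * (1 + width) *
        (L2_norm (interior K) (d i i i) + L2_norm (interior K) (d i i (co i)) + L2_norm (interior K) (\<lambda>x. 0 :: real))" by simp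
  qed (use N0 in simp)
  have off: "L2_norm ?\<Omega> (\<lambda>x. \<sigma> x $ 1 $ 2 - \<pi> x $ 1 $ 2) \<le> ?C"
  proof (rule order_trans[OF broken_norm_bound[OF eL dL dL wL _ c0] norm3[OF dN dN wN]])
    fix K assume K: "K \<in> T"
    note oi = off_interpolation_element(3)[OF mixed K, folded V_def]
    show "L2_norm (interior K) (\<lambda>x. \<sigma> x $ 1 $ 2 - \<pi> x $ 1 $ 2) \<le> 2 * hh * (1 + width) *
        (L2_norm (interior K) (d 1 2 1) + L2_norm (interior K) (d 1 2 2) + L2_norm (interior K) w12)"
      by (rule order_trans[OF eq_refl[OF L2_norm_element_cong] oi])
         (simp add: \<pi>_def pw_eq[OF K] p_def value_stress_def affine_stress_def)
  qed
  have off': "L2_norm ?\<Omega> (\<lambda>x. \<sigma> x $ 2 $ 1 - \<pi> x $ 2 $ 1) \<le> ?C"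
  proof -
    have "AE x in lebesgue_on ?\<Omega>. \<pi> x $ 1 $ 2 = \<pi> x $ 2 $ 1"
      using S(1) unfolding Sigma_h_def L2_sym_def by (auto elim!: eventually_mono simp: transpose_def vec_eq_iff)
    then have "AE x in lebesgue_on ?\<Omega>. \<sigma> x $ 2 $ 1 - \<pi> x $ 2 $ 1 = \<sigma> x $ 1 $ 2 - \<pi> x $ 1 $ 2"
      using sym_AE by eventually_elim simp
    then have "L2_norm ?\<Omega> (\<lambda>x. \<sigma> x $ 2 $ 1 - \<pi> x $ 2 $ 1) = L2_norm ?\<Omega> (\<lambda>x. \<sigma> x $ 1 $ 2 - \<pi> x $ 1 $ 2)"
      by (rule L2_norm_cong_AE[OF _ L2_measurable[OF eL] L2_measurable[OF eL]])
    then show ?thesis using off by simp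
  qed
  have entries: "L2_norm ?\<Omega> (\<lambda>x. \<sigma> x $ i $ j - \<pi> x $ i $ j) \<le> ?C" for i j
    using diag[of 1] diag[of 2] off off' exhaust_2[of i] exhaust_2[of j] by auto
  have "L2_norm ?\<Omega> (\<lambda>x. \<sigma> x - \<pi> x) \<le> (?C + ?C) + (?C + ?C)"
  proof (rule L2_norm_vec_le[OF L2_diff[OF sL pL]])
    show "L2_norm ?\<Omega> (\<lambda>x. (\<sigma> x - \<pi> x) $ i) \<le> ?C + ?C" for i
      by (rule L2_norm_vec_le[OF L2_nth[OF L2_diff[OF sL pL]]]) (use entries in simp)
  qed
  also have "(?C + ?C) + (?C + ?C) = 48 * (1 + width) * hh * ?N" by algebra
  finally have 1: "L2_norm ?\<Omega> (\<lambda>x. \<sigma> x - \<pi> x) \<le> 48 * (1 + width) * hh * ?N" .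
  have divdiff: "L2_norm ?\<Omega> (\<lambda>x. proj_vec (sobolev_div \<sigma>) x $ i - rep_div p x $ i) \<le> 2 * hh * ?N" for i
  proof -
    have "L2_norm ?\<Omega> (\<lambda>x. proj_vec (sobolev_div \<sigma>) x $ i - rep_div p x $ i) \<le>
        2 * hh * (L2_norm ?\<Omega> w12 + L2_norm ?\<Omega> (\<lambda>x. 0 :: real) + L2_norm ?\<Omega> (\<lambda>x. 0 :: real))"
    proof (rule broken_norm_bound)
      fix K assume K: "K \<in> T"
      let ?M = "avg K" and ?m = "\<lambda>k. avg K (\<lambda>x. (x $ k - mid K k) * w12 x)"
      have L2K: "d i j k \<in> L2 (box (lo K) (hi K))" for i j k using L2_interior[OF dL K] element(2)[OF K] by simp
      have sl: "dslope (p K) i = ?M (d i i i)"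
        using diag_interpolation_element(1)[OF wp wp K, of i i]
        by (simp add: p_def value_stress_def affine_stress_poly g_def)
      have os: "oslope (p K) (co i) = ?M (d 1 2 (co i)) + ?m i"
        using off_interpolation_element(1,2)[OF mixed K, folded V_def] exhaust_2[of i]
        by (auto simp: p_def value_stress_def affine_stress_poly)
      have "?M (d i (co i) (co i)) = ?M (d 1 2 (co i))"
      proof (cases "i = 1")
        case False
        then have i: "i = 2" using exhaust_2[of i] by auto
        have "AE x in lebesgue_on (box (lo K) (hi K)). d 2 1 1 x = d 1 2 1 x"
          unfolding element(2)[OF K, symmetric]
          by (rule AE_lebesgue_on_subset[OF d_sym[of 1] element_subset[OF K]]) (simp_all add: element(2)[OF K])
        then show ?thesis unfolding i co_simps by (rule mean_cong_AE[OF L2K L2K])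
      qed simp
      moreover have "?M (\<lambda>x. sobolev_div \<sigma> x $ i) = ?M (d i i i) + ?M (d i (co i) (co i))"
      proof -
        have "(\<lambda>x. sobolev_div \<sigma> x $ i) = (\<lambda>x. d i i i x + d i (co i) (co i) x)"
          using exhaust_2[of i] by (auto simp: sobolev_div_def d_def)
        then show ?thesis using mean_add[OF L2K L2K] by simp
      qed
      ultimately have diff: "proj_vec (sobolev_div \<sigma>) x $ i - rep_div p x $ i = - ?m i" if "x \<in> interior K" for x
        unfolding rep_div_def proj_vec_def pw_eq[OF K that] by (simp add: sl os)
      have "L2_norm (interior K) (\<lambda>x. proj_vec (sobolev_div \<sigma>) x $ i - rep_div p x $ i) = L2_norm (interior K) (\<lambda>x. - ?m i)"
        by (rule L2_norm_element_cong) (rule diff)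
      also have "\<dots> = \<bar>?m i\<bar> * sqrt (area (lo K) (hi K))"
        unfolding element(2)[OF K] using element(3)[OF K] by (subst L2_norm_const) (simp_all add: less_imp_le)
      also have "\<dots> \<le> (hi K $ i - lo K $ i) / 2 * L2_norm (interior K) w12" by (rule mean_coordinate_bound[OF wL K])
      also have "\<dots> \<le> hh * L2_norm (interior K) w12"
        using mesh_size_ge[OF K, of i] mesh_size_pos by (intro mult_right_mono L2_norm_nonneg) simp
      finally show "L2_norm (interior K) (\<lambda>x. proj_vec (sobolev_div \<sigma>) x $ i - rep_div p x $ i) \<le>
          hh * (L2_norm (interior K) w12 + L2_norm (interior K) (\<lambda>x. 0 :: real) + L2_norm (interior K) (\<lambda>x. 0 :: real))" by simp
    qed (use mesh_size_pos in \<open>simp_all add: L2_diff L2_nth proj_vec_L2 rep_div_L2 wL L2_zero less_imp_le\<close>)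
    also have "\<dots> \<le> 2 * hh * ?N" using wN mesh_size_pos by simp
    finally show ?thesis .
  qed
  have dhL: "div_h T \<pi> \<in> L2 ?\<Omega>" by (rule div_h_rep(2)[OF pL S(2)])
  have "L2_norm ?\<Omega> (\<lambda>x. proj_vec (sobolev_div \<sigma>) x - div_h T \<pi> x) = L2_norm ?\<Omega> (\<lambda>x. proj_vec (sobolev_div \<sigma>) x - rep_div p x)"
    by (rule L2_norm_cong_AE)
       (use div_h_rep(1)[OF pL S(2)] in \<open>auto intro!: L2_measurable L2_diff proj_vec_L2 rep_div_L2 dhL elim!: eventually_mono\<close>)
  also have "\<dots> \<le> 2 * hh * ?N + 2 * hh * ?N"
    by (rule L2_norm_vec_le[OF L2_diff[OF proj_vec_L2(1) rep_div_L2(1)]]) (use divdiff in simp)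
  finally have 2: "L2_norm ?\<Omega> (\<lambda>x. proj_vec (sobolev_div \<sigma>) x - div_h T \<pi> x) \<le> 4 * hh * ?N" by simp
  show ?thesis by (rule that[OF S(1) 1 2])
qed

end

section \<open>The quadratic bubble\<close>

text \<open>Half of the quadratic that vanishes on the two sides orthogonal to direction
  \<open>k\<close>; its derivative is the signed distance to the centre line. It converts first
  moments into integrals of derivatives without boundary terms.\<close>
definition bubble :: "plane \<Rightarrow> plane \<Rightarrow> 2 \<Rightarrow> plane \<Rightarrow> real" where
  "bubble l r k x = ((x $ k - center l r k)\<^sup>2 - ((r $ k - l $ k) / 2)\<^sup>2) / 2"

lemma bubble_by_parts:
  assumes wp: "weak_partial l r k w g" and lr: "\<And>k. l $ k < r $ k"
  shows "mean l r (\<lambda>x. bubble l r k x * g x) + mean l r (\<lambda>x. (x $ k - center l r k) * w x) = 0"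
proof -
  let ?m = "center l r k" and ?e = "(r $ k - l $ k) / 2"
  define P where "P t = ((t - ?m) * (t - ?m) - ?e * ?e) * (1 / 2)" for t
  have P: "smooth P" unfolding P_def by (intro smooth_mult smooth_diff smooth_ident smooth_const)
  have dP: "deriv P = (\<lambda>t. t - ?m)"
    unfolding P_def by (rule ext, rule DERIV_imp_deriv) (auto intro!: derivative_eq_intros)
  have Pb: "P (x $ k) = bubble l r k x" for x :: plane by (simp add: P_def bubble_def power2_eq_square)
  have ends: "r $ k - ?m = ?e" "l $ k - ?m = - ?e" by (simp_all add: center_def field_simps)
  have P0: "P (r $ k) = 0" "P (l $ k) = 0" unfolding P_def ends by simp_all
  have L2: "w \<in> L2 (box l r)" "g \<in> L2 (box l r)" using wp by (auto simp: weak_partial_def)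
  have int: "integrable (lebesgue_on (box l r)) (\<lambda>x. P (x $ k) * 1 * g x)"
    "integrable (lebesgue_on (box l r)) (\<lambda>x. deriv P (x $ k) * 1 * w x)"
    by (intro pairing_integrable[where p = "\<lambda>t. 1"] L2 test_limit_smooth P smooth_deriv smooth_const)+
  have "(LINT x|lebesgue_on (box l r). P (x $ k) * 1 * g x + deriv P (x $ k) * 1 * w x) = 0"
    using line_trace_by_parts[OF wp order_refl lr order_refl P smooth_const[of 1]] by (simp only: P0)
  then have "(LINT x|lebesgue_on (box l r). P (x $ k) * 1 * g x) + (LINT x|lebesgue_on (box l r). deriv P (x $ k) * 1 * w x) = 0"
    using Bochner_Integration.integral_add[OF int] by linarith
  then show ?thesis by (simp add: mean_def dP Pb add_divide_distrib[symmetric])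
qed

lemma bubble_bound: "x \<in> box l r \<Longrightarrow> \<bar>bubble l r k x\<bar> \<le> (r $ k - l $ k)\<^sup>2 / 8"
proof -
  assume "x \<in> box l r"
  from center_bound[OF this, of k]
  have sq: "(x $ k - center l r k)\<^sup>2 \<le> ((r $ k - l $ k) / 2)\<^sup>2" by (rule abs_le_square_iff[THEN iffD1, OF order_trans[OF _ abs_ge_self]])
  have "\<bar>(X - e) / 2\<bar> \<le> H / 8" if "X \<le> e" "0 \<le> X" "e = H / 4" for X e H :: real
    by (rule abs_leI) (use that in \<open>simp_all add: field_simps\<close>)
  from this[OF sq zero_le_power2] show ?thesis unfolding bubble_def by (simp only: power_divide) simp
qed

lemma weak_partial_affine: "weak_partial l r k (\<lambda>x. c + s * x $ 1 + t * x $ 2) (\<lambda>x. if k = 1 then s else t)"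
proof -
  have "weak_grad (box l r) k (\<lambda>x. c + s * x $ 1 + t * x $ 2) (\<lambda>x. if k = 1 then s else t)"
    using weak_grad_smooth[OF affine_Ck[of c s t], of l r k] by (simp add: partial_affine[abs_def])
  then show ?thesis
    by (rule weak_grad_weak_partial) (use affine_L2[of c s 0 t 0 l r] in \<open>simp_all add: L2_const\<close>)
qed

lemma weak_partial_coordinate: "weak_partial l r k (\<lambda>x. x $ k - c) (\<lambda>x. 1)"
  using weak_partial_affine[of l r k "- c" "if k = 1 then 1 else 0" "if k = 1 then 0 else 1"] exhaust_2[of k] by auto

lemma bubble_measurable: "bubble l r k \<in> borel_measurable (lebesgue_on (box l r))"
  unfolding bubble_def[abs_def]
  by (rule continuous_measurable_lebesgue_on) (intro continuous_intros, simp)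

text \<open>Apply the integration by parts formula to the coordinate itself: \<open>(x -
  m)\<^sup>2\<close> is \<open>2 bubble + h\<^sup>2/4\<close>, so that \<open>3 bubble +
  h\<^sup>2/4\<close> has mean zero.\<close>
lemma mean_bubble:
  assumes lr: "\<And>k. l $ k < r $ k" shows "mean l r (bubble l r k) = - ((r $ k - l $ k)\<^sup>2 / 12)"
proof -
  let ?m = "center l r k" and ?h = "r $ k - l $ k"
  have A: "area l r > 0" by (rule area_pos[OF lr])
  have eq: "bubble l r k x + ((x $ k - ?m) * (x $ k - ?m)) = 3 * bubble l r k x + ?h\<^sup>2 / 4" for x :: plane
    by (simp add: bubble_def power2_eq_square field_simps)
  have bL: "bubble l r k \<in> L2 (box l r)"
    by (rule L2_bounded[OF lmeasurable_box bubble_measurable, where B = "?h\<^sup>2 / 8"]) (simp only: real_norm_def bubble_bound)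
  have qL: "(\<lambda>x. (x $ k - ?m) * (x $ k - ?m)) \<in> L2 (box l r)"
    by (rule L2_bounded_mult[OF weak_partial_L2(1)[OF weak_partial_coordinate] coordinate_measurable center_bound])
  have "0 = mean l r (\<lambda>x. bubble l r k x + (x $ k - ?m) * (x $ k - ?m))"
    using bubble_by_parts[OF weak_partial_coordinate lr, of k ?m] mean_add[OF bL qL] by simp
  also have "\<dots> = mean l r (\<lambda>x. 3 * bubble l r k x + ?h\<^sup>2 / 4)" unfolding eq ..
  also have "\<dots> = mean l r (\<lambda>x. 3 * bubble l r k x) + mean l r (\<lambda>x. ?h\<^sup>2 / 4)"
    by (rule mean_add) (use L2_scaleR[OF bL, of 3] in \<open>simp_all add: L2_const\<close>)
  also have "mean l r (\<lambda>x. 3 * bubble l r k x) = 3 * mean l r (bubble l r k)" by (simp add: mean_def)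
  also have "mean l r (\<lambda>x. ?h\<^sup>2 / 4) = ?h\<^sup>2 / 4"
    using A unfolding mean_def by (subst integral_const_box) (simp_all add: lr less_imp_le)
  finally show ?thesis by simp
qed

text \<open>Inverse estimate. The first moment of a function with constant derivative in direction
  \<open>k\<close> is \<open>h\<^sup>2/12\<close> times the slope, while the norm of the
  constant given by the moment is at most \<open>h/2\<close> times the norm of the function.\<close>
lemma slope_bound:
  assumes wp: "weak_partial l r k w (\<lambda>x. s)" and lr: "\<And>k. l $ k < r $ k"
  shows "\<bar>s\<bar> * (r $ k - l $ k) * sqrt (area l r) \<le> 6 * L2_norm (box l r) w"
proof -
  let ?m = "center l r k" and ?h = "r $ k - l $ k" and ?q = "sqrt (area l r)"
  have h: "?h > 0" using lr by simp
  have "mean l r (\<lambda>x. bubble l r k x * s) = mean l r (bubble l r k) * s" by (simp add: mean_def)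
  then have M: "mean l r (\<lambda>x. (x $ k - ?m) * w x) = ?h\<^sup>2 / 12 * s"
    using bubble_by_parts[OF wp lr] mean_bubble[of l r k, OF lr] by simp
  have "\<bar>?h\<^sup>2 / 12 * s\<bar> * ?q \<le> ?h / 2 * L2_norm (box l r) w"
    unfolding M[symmetric] by (rule mean_diff_bound[OF weak_partial_L2(1)[OF wp] lr coordinate_measurable center_bound])
  moreover have "\<bar>?h\<^sup>2 / 12 * s\<bar> * ?q = ?h / 12 * (\<bar>s\<bar> * ?h * ?q)"
    using h by (simp add: abs_mult power2_eq_square mult_ac)
  moreover have "?h / 2 * L2_norm (box l r) w = ?h / 12 * (6 * L2_norm (box l r) w)" by simp
  ultimately have "?h / 12 * (\<bar>s\<bar> * ?h * ?q) \<le> ?h / 12 * (6 * L2_norm (box l r) w)" by (simp only:)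
  moreover have "?h / 12 > 0" using h by simp
  ultimately show ?thesis by (simp only: mult_le_cancel_left_pos)
qed

text \<open>The first moment of \<open>g\<close> only sees the variation of \<open>g\<close>.\<close>
lemma first_moment_bound:
  assumes wp: "weak_partial l r k g D" and lr: "\<And>k. l $ k < r $ k"
  shows "\<bar>mean l r (\<lambda>x. (x $ k - center l r k) * g x)\<bar> * sqrt (area l r) \<le> (r $ k - l $ k)\<^sup>2 / 8 * L2_norm (box l r) D"
proof -
  have "\<bar>mean l r (\<lambda>x. (x $ k - center l r k) * g x)\<bar> = \<bar>mean l r (\<lambda>x. bubble l r k x * D x)\<bar>"
    using bubble_by_parts[OF wp lr] by linarith
  then show ?thesis
    using mean_diff_bound[OF weak_partial_L2(2)[OF wp] lr bubble_measurable bubble_bound] by simp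
qed

section \<open>The consistency error\<close>

text \<open>On each element the shear entry is its restriction to the centre line in direction
  \<open>i\<close> plus a part linear in the transverse coordinate. The first part is affine in
  direction \<open>i\<close> and matches at edge midpoints, so it sums to zero by parts. The second
  part only meets the first moment of \<open>g\<close>: the inverse estimate for its slope and the
  second-order bound for the moment leave one power of \<open>h\<close>.\<close>
lemma (in grid) off_diagonal_consistency:
  assumes tau: "\<tau> \<in> L2 (box a b)" and rep: "sigma_rep \<tau> p"
    and wp: "weak_partial a b i w g" "weak_partial a b (co i) g D"
    and zero: "\<And>K. K \<in> T \<Longrightarrow> line_trace a b i w g (strip K i) (a $ i) = 0"
      "\<And>K. K \<in> T \<Longrightarrow> line_trace a b i w g (strip K i) (b $ i) = 0"
  shows "\<bar>LINT x|lebesgue_on (box a b). \<tau> x $ 1 $ 2 * g x + pw (\<lambda>K x. oslope (p K) i) x * w x\<bar> \<le>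
    hh * (L2_norm (box a b) (\<lambda>x. \<tau> x $ 1 $ 2) * L2_norm (box a b) D)"
proof -
  let ?\<Omega> = "box a b" and ?o = "pw (\<lambda>K x. oslope (p K) i)" and ?t = "\<lambda>x. \<tau> x $ 1 $ 2"
  let ?m = "\<lambda>K. mid K (co i)"
  define s where "s K = oslope (p K) i" for K
  define c where "c K = p K (emb i 0 (?m K)) $ 1 $ 2" for K
  define e where "e K = (LINT x|lebesgue_on (interior K). oslope (p K) (co i) * ((x $ co i - ?m K) * g x))" for K
  have poly: "p K \<in> Sigma_poly" if "K \<in> T" for K using rep that by (simp add: sigma_rep_def)
  have L2: "w \<in> L2 ?\<Omega>" "g \<in> L2 ?\<Omega>" "D \<in> L2 ?\<Omega>" using wp by (auto simp: weak_partial_def)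
  have tL: "?t \<in> L2 ?\<Omega>" by (rule L2_nth_nth[OF tau])
  have pK: "p K x $ 1 $ 2 = c K + s K * x $ i + oslope (p K) (co i) * (x $ co i - ?m K)" if "K \<in> T" for K x
    using Sigma_poly_off_index(2)[OF poly[OF that], of x "emb i 0 (?m K)" i] by (simp add: c_def s_def)
  have int: "integrable (lebesgue_on ?\<Omega>) (\<lambda>x. ?t x * g x + ?o x * w x)"
    using L2_inner_integrable[OF tL L2(2)] L2_inner_integrable[OF pw_const_L2 L2(1), of "\<lambda>K. oslope (p K) i"]
    by (simp add: integrable_add)
  have gK: "(\<lambda>x. (x $ co i - ?m K) * g x) \<in> L2 (interior K)" if K: "K \<in> T" for K
  proof -
    have "(\<lambda>x. (x $ co i - mid K (co i)) * g x) \<in> L2 (box (lo K) (hi K))"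
      by (rule L2_bounded_mult[OF _ coordinate_measurable center_bound]) (use L2_interior[OF L2(2) K] element(2)[OF K] in simp)
    then show ?thesis using element(2)[OF K] by simp
  qed
  have split: "(LINT x|lebesgue_on (interior K). ?t x * g x + ?o x * w x) =
      (LINT x|lebesgue_on (interior K). (c K + s K * x $ i) * g x + s K * w x) + e K" if K: "K \<in> T" for K
  proof -
    have tK: "AE x in lebesgue_on (interior K). \<tau> x = p K x" using rep K by (simp add: sigma_rep_def)
    note inK = AE_inside[of "interior K"]
    have L2K: "w \<in> L2 (interior K)" "g \<in> L2 (interior K)" "?t \<in> L2 (interior K)" "?o \<in> L2 (interior K)"
      by (intro L2_interior[OF _ K] L2 tL pw_const_L2)+
    have K_lm: "interior K \<in> lmeasurable" unfolding element(2)[OF K] by (rule lmeasurable_box)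
    have i1: "integrable (lebesgue_on (interior K)) (\<lambda>x. ?t x * g x + ?o x * w x)"
      using L2_inner_integrable[OF L2K(3,2)] L2_inner_integrable[OF L2K(4,1)] by simp
    have i2: "integrable (lebesgue_on (interior K)) (\<lambda>x. oslope (p K) (co i) * ((x $ co i - ?m K) * g x))"
      using L2_integrable[OF K_lm gK[OF K]] by simp
    have eq: "AE x in lebesgue_on (interior K). ?t x * g x + ?o x * w x - oslope (p K) (co i) * ((x $ co i - ?m K) * g x) =
        (c K + s K * x $ i) * g x + s K * w x"
      using tK inK by eventually_elim (simp add: pK[OF K] pw_eq[OF K] s_def[symmetric] algebra_simps)
    have "(\<lambda>x::plane. x $ i) \<in> borel_measurable (lebesgue_on (interior K))"
      using coordinate_measurable[of i 0] by simp
    then have m: "(\<lambda>x. (c K + s K * x $ i) * g x + s K * w x) \<in> borel_measurable (lebesgue_on (interior K))"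
      using L2_measurable[OF L2K(1)] L2_measurable[OF L2K(2)]
      by (intro borel_measurable_add borel_measurable_times) auto
    have "(LINT x|lebesgue_on (interior K). (c K + s K * x $ i) * g x + s K * w x) =
        (LINT x|lebesgue_on (interior K). ?t x * g x + ?o x * w x - oslope (p K) (co i) * ((x $ co i - ?m K) * g x))"
      by (rule integral_cong_AE[OF m borel_measurable_integrable[OF Bochner_Integration.integrable_diff[OF i1 i2]]])
         (use eq in \<open>auto elim!: eventually_mono\<close>)
    also have "\<dots> = (LINT x|lebesgue_on (interior K). ?t x * g x + ?o x * w x) - e K"
      unfolding e_def by (rule Bochner_Integration.integral_diff[OF i1 i2])
    finally show ?thesis by simp
  qed
  have e_bound: "\<bar>e K\<bar> \<le> hh * (\<bar>L2_norm (interior K) ?t\<bar> * \<bar>L2_norm (interior K) D\<bar>)" if K: "K \<in> T" for K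
  proof -
    let ?l = "lo K" and ?r = "hi K" and ?q = "sqrt (area (lo K) (hi K))" and ?h = "hi K $ co i - lo K $ co i"
    let ?M = "avg K (\<lambda>x. (x $ co i - ?m K) * g x)"
    let ?nt = "L2_norm (interior K) ?t" and ?nD = "L2_norm (interior K) D"
    have iK: "interior K = box ?l ?r" by (rule element(2)[OF K])
    have h: "?h > 0" using element(3)[OF K] by simp
    have q: "?q > 0" "?q * ?q = area ?l ?r" using element_area[OF K] by auto
    have "e K = oslope (p K) (co i) * ((?q * ?q) * ?M)"
      unfolding q(2) using element_area[OF K] by (simp add: e_def mean_def iK)
    then have "\<bar>e K\<bar> = \<bar>oslope (p K) (co i)\<bar> * ((?q * ?q) * \<bar>?M\<bar>)"
      by (simp only: abs_mult abs_of_pos[OF q(1)])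
    then have eK: "\<bar>e K\<bar> = (\<bar>oslope (p K) (co i)\<bar> * ?q) * (\<bar>?M\<bar> * ?q)"
      by (simp only: mult_ac)
    have "weak_partial ?l ?r (co i) (\<lambda>x. p K x $ 1 $ 2) (\<lambda>x. oslope (p K) (co i))"
    proof -
      obtain c' s' t' where e': "\<And>x. p K x $ 1 $ 2 = c' + s' * x $ 1 + t' * x $ 2"
          "s' = oslope (p K) 1" "t' = oslope (p K) 2"
        using Sigma_poly_off(1)[OF poly[OF K], of _ 0] by (metis diff_zero zero_index)
      show ?thesis using weak_partial_affine[of ?l ?r "co i" c' s' t'] exhaust_2[of i] by (auto simp: e')
    qed
    from slope_bound[OF this element(3)[OF K]]
    have 1: "\<bar>oslope (p K) (co i)\<bar> * ?h * ?q \<le> 6 * L2_norm (interior K) (\<lambda>x. p K x $ 1 $ 2)" by (simp add: iK)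
    have "L2_norm (interior K) (\<lambda>x. p K x $ 1 $ 2) = ?nt"
    proof (rule L2_norm_cong_AE)
      show "AE x in lebesgue_on (interior K). p K x $ 1 $ 2 = \<tau> x $ 1 $ 2"
        using rep K by (auto simp: sigma_rep_def elim!: eventually_mono)
      show "(\<lambda>x. p K x $ 1 $ 2) \<in> borel_measurable (lebesgue_on (interior K))"
        unfolding iK by (intro L2_measurable L2_nth_nth Sigma_poly_L2 poly K)
      show "?t \<in> borel_measurable (lebesgue_on (interior K))" by (intro L2_measurable L2_interior tL K)
    qed
    with 1 have 1: "\<bar>oslope (p K) (co i)\<bar> * ?h * ?q \<le> 6 * ?nt" by simp
    have 2: "\<bar>?M\<bar> * ?q \<le> ?h\<^sup>2 / 8 * ?nD"
      unfolding iK by (rule first_moment_bound[OF weak_partial_subbox[OF wp(2) element(4)[OF K] element(5)[OF K]] element(3)[OF K]])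
    have "\<bar>e K\<bar> \<le> (\<bar>oslope (p K) (co i)\<bar> * ?q) * (?h\<^sup>2 / 8 * ?nD)"
      unfolding eK using 2 q(1) by (intro mult_left_mono) auto
    also have "\<dots> = (\<bar>oslope (p K) (co i)\<bar> * ?h * ?q) * (?h / 8 * ?nD)" by (simp add: power2_eq_square)
    also have "\<dots> \<le> (6 * ?nt) * (?h / 8 * ?nD)"
      using h by (intro mult_right_mono[OF 1] mult_nonneg_nonneg L2_norm_nonneg) simp
    also have "\<dots> = 3 / 4 * ?h * (?nt * ?nD)" by simp
    also have "\<dots> \<le> hh * (?nt * ?nD)"
    proof (intro mult_right_mono mult_nonneg_nonneg L2_norm_nonneg)
      have "3 / 4 * ?h \<le> ?h" using h by (simp add: field_simps)
      then show "3 / 4 * ?h \<le> hh" using mesh_size_ge[OF K, of "co i"] by (rule order_trans)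
    qed
    finally show ?thesis by (simp add: L2_norm_nonneg)
  qed
  have "(\<Sum>K\<in>T. LINT x|lebesgue_on (interior K). (c K + s K * x $ i) * g x + s K * w x) = 0"
  proof (rule grid_summation_by_parts[OF wp(1) zero])
    fix K L assume *: "K \<in> T" "L \<in> T" "hi K $ i = lo L $ i" "lo K $ co i = lo L $ co i"
      "hi K $ co i = hi L $ co i" "a $ i < hi K $ i" "hi K $ i < b $ i"
    let ?x = "emb i (hi K $ i) (?m K)"
    have "p K ?x $ 1 $ 2 = p L ?x $ 1 $ 2" using rep * unfolding sigma_rep_def by blast
    moreover have "?m L = ?m K" using *(4,5) by (simp add: center_def)
    ultimately show "c K + s K * hi K $ i = c L + s L * hi K $ i" using pK[OF *(1), of ?x] pK[OF *(2), of ?x] by simp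
  qed
  then have "(LINT x|lebesgue_on ?\<Omega>. ?t x * g x + ?o x * w x) = (\<Sum>K\<in>T. e K)"
    unfolding integral_elements[OF int] by (simp add: split sum.distrib)
  also have "\<bar>\<Sum>K\<in>T. e K\<bar> \<le> (\<Sum>K\<in>T. hh * (\<bar>L2_norm (interior K) ?t\<bar> * \<bar>L2_norm (interior K) D\<bar>))"
    by (rule order_trans[OF sum_abs sum_mono[OF e_bound]])
  also have "\<dots> = hh * (\<Sum>K\<in>T. \<bar>L2_norm (interior K) ?t\<bar> * \<bar>L2_norm (interior K) D\<bar>)"
    by (simp add: sum_distrib_left)
  also have "\<dots> \<le> hh * (L2_set (\<lambda>K. L2_norm (interior K) ?t) T * L2_set (\<lambda>K. L2_norm (interior K) D) T)"
    using mesh_size_pos by (intro mult_left_mono L2_set_mult_ineq) simp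
  also have "L2_set (\<lambda>K. L2_norm (interior K) ?t) T = L2_norm ?\<Omega> ?t"
    unfolding L2_set_def L2_norm_elements[OF tL, symmetric] by (simp add: L2_norm_nonneg)
  also have "L2_set (\<lambda>K. L2_norm (interior K) D) T = L2_norm ?\<Omega> D"
    unfolding L2_set_def L2_norm_elements[OF L2(3), symmetric] by (simp add: L2_norm_nonneg)
  finally show ?thesis .
qed

section \<open>Strain and boundary values of the displacement\<close>

text \<open>The exact problem is tested with a pure shear field whose entry has product form. The
  factors need not vanish at the boundary, since there is no boundary condition on stresses; the
  boundary condition on the displacement is encoded in this freedom.\<close>
lemma exact_off_diagonal_equation:
  assumes ex: "exact_solution (box a b) A f \<sigma> u" and AL: "A \<sigma> \<in> L2 (box a b)" and P: "smooth P" and R: "smooth R"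
  shows "pairing a b i (\<lambda>x. A \<sigma> x $ 1 $ 2 + A \<sigma> x $ 2 $ 1) P R + pairing a b i (\<lambda>x. u x $ i) P (deriv R)
    + pairing a b i (\<lambda>x. u x $ co i) (deriv P) R = 0"
proof -
  let ?\<Omega> = "box a b"
  define \<psi> where "\<psi> = (\<lambda>x::plane. P (x $ i) * R (x $ co i))"
  define \<tau> :: "plane \<Rightarrow> real^2^2" where "\<tau> x = (\<chi> r c. if r = c then 0 else \<psi> x)" for x
  define g where "g r c = (if r = c then (\<lambda>x. 0) else partial c \<psi>)" for r c
  define d where "d = (\<lambda>x. \<chi> r. g r 1 x + g r 2 x)"
  have uL: "u \<in> L2 ?\<Omega>" using ex by (simp add: exact_solution_def)
  note tl = test_limit_smooth[OF P] test_limit_smooth[OF R] test_limit_smooth[OF smooth_deriv[OF P]]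
    test_limit_smooth[OF smooth_deriv[OF R]]
  have one: "(\<lambda>x. 1 :: real) \<in> L2 ?\<Omega>" by (simp add: L2_const)
  have p1: "partial i \<psi> = (\<lambda>x. deriv P (x $ i) * R (x $ co i))"
    unfolding \<psi>_def using partial_product[OF P R, of i] by blast
  have p2: "partial (co i) \<psi> = (\<lambda>x. P (x $ i) * deriv R (x $ co i))"
  proof -
    have "\<psi> = (\<lambda>x. R (x $ co i) * P (x $ co (co i)))" unfolding \<psi>_def co_co by (rule ext) (rule mult.commute)
    then show ?thesis using partial_product[OF R P, of "co i"] by (auto simp: mult.commute)
  qed
  have psiL: "\<psi> \<in> L2 ?\<Omega>" using pairing_weight_L2[OF one tl(1,2)] by (simp add: \<psi>_def)
  have "partial i \<psi> \<in> L2 ?\<Omega>" "partial (co i) \<psi> \<in> L2 ?\<Omega>"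
    unfolding p1 p2 using pairing_weight_L2[OF one tl(3,2)] pairing_weight_L2[OF one tl(1,4)] by simp_all
  then have dpL: "partial c \<psi> \<in> L2 ?\<Omega>" for c using index_cases[of c i] by auto
  have Ck: "\<forall>k. Ck k \<psi>" unfolding \<psi>_def by (intro allI Ck_mult Ck_coord P R)
  have gL: "g r c \<in> L2 ?\<Omega>" for r c by (simp add: g_def dpL L2_zero)
  have tL: "\<tau> \<in> L2 ?\<Omega>"
  proof (rule L2_mat2I)
    show "(\<lambda>x. \<tau> x $ r $ c) \<in> L2 ?\<Omega>" for r c by (cases "r = c") (simp_all add: \<tau>_def psiL L2_zero)
  qed
  have "weak_grad ?\<Omega> c (\<lambda>x. \<tau> x $ r $ c) (g r c)" for r c
    using weak_grad_smooth[OF Ck, of a b c] by (cases "r = c") (simp_all add: \<tau>_def g_def weak_grad_def)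
  then have div: "has_weak_div ?\<Omega> \<tau> d" unfolding d_def by (intro has_weak_divI lmeasurable_box tL gL)
  have dL: "d \<in> L2 ?\<Omega>" unfolding d_def by (rule L2_vec2I) (simp add: L2_add gL)
  have "transpose (\<tau> x) = \<tau> x" for x by (simp add: transpose_def \<tau>_def vec_eq_iff)
  then have H: "\<tau> \<in> Hdiv_sym ?\<Omega>" using tL dL div unfolding Hdiv_sym_def L2_sym_def by auto
  have wd: "AE x in lebesgue_on ?\<Omega>. weak_div ?\<Omega> \<tau> x = d x" by (rule weak_div_eq[OF dL div])
  have "L2_inner ?\<Omega> (weak_div ?\<Omega> \<tau>) u = L2_inner ?\<Omega> d u"
    by (rule L2_inner_cong_AE[OF wd L2_cong_AE[OF dL _ wd] dL uL]) simp
  then have eq: "L2_inner ?\<Omega> (A \<sigma>) \<tau> + L2_inner ?\<Omega> d u = 0" using ex H unfolding exact_solution_def by auto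
  have "A \<sigma> x \<bullet> \<tau> x = P (x $ i) * R (x $ co i) * (A \<sigma> x $ 1 $ 2 + A \<sigma> x $ 2 $ 1)" for x
    by (simp add: inner_vec_def UNIV_2 \<tau>_def \<psi>_def distrib_left mult.commute)
  then have 1: "L2_inner ?\<Omega> (A \<sigma>) \<tau> = pairing a b i (\<lambda>x. A \<sigma> x $ 1 $ 2 + A \<sigma> x $ 2 $ 1) P R"
    by (simp add: L2_inner_def pairing_def)
  have "d x \<bullet> u x = P (x $ i) * deriv R (x $ co i) * u x $ i + deriv P (x $ i) * R (x $ co i) * u x $ co i" for x
  proof -
    have "d x \<bullet> u x = partial 2 \<psi> x * u x $ 1 + partial 1 \<psi> x * u x $ 2"
      by (simp add: inner_vec_def UNIV_2 d_def g_def)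
    also have "\<dots> = partial (co i) \<psi> x * u x $ i + partial i \<psi> x * u x $ co i"
      using exhaust_2[of i] by auto
    finally show ?thesis unfolding p1 p2 .
  qed
  then have 2: "L2_inner ?\<Omega> d u = pairing a b i (\<lambda>x. u x $ i) P (deriv R) + pairing a b i (\<lambda>x. u x $ co i) (deriv P) R"
    unfolding L2_inner_def pairing_def
    using pairing_integrable[where i = i, OF L2_nth[OF uL, of i] tl(1,4)]
      pairing_integrable[where i = i, OF L2_nth[OF uL, of "co i"] tl(3,2)] by simp
  show ?thesis using eq unfolding 1 2 by simp
qed

lemma test_limit_integral_zero:
  assumes h: "h \<in> L2 (box a b)" and p: "test_limit (a $ k) (b $ k) p"
    and zero: "\<And>R. test1 (a $ k) (b $ k) R \<Longrightarrow> (LINT x|lebesgue_on (box a b). R (x $ k) * h x) = 0"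
  shows "(LINT x|lebesgue_on (box a b). p (x $ k) * h x) = 0"
proof -
  obtain Q M where Q: "\<And>n. test1 (a $ k) (b $ k) (Q n)" "\<And>n t. \<bar>Q n t\<bar> \<le> M"
      "\<And>t. t \<in> {a $ k<..<b $ k} \<Longrightarrow> (\<lambda>n. Q n t) \<longlonglongrightarrow> p t"
    using p unfolding test_limit_def by metis
  have "(\<lambda>n. LINT x|lebesgue_on (box a b). Q n (x $ k) * h x) \<longlonglongrightarrow> (LINT x|lebesgue_on (box a b). p (x $ k) * h x)"
    by (rule bounded_dominated_convergence[OF L2_integrable[OF lmeasurable_box h] test1_measurable[OF Q(1)] Q(2) Q(3)[OF box_nthD]])
  then have "(\<lambda>n. 0) \<longlonglongrightarrow> (LINT x|lebesgue_on (box a b). p (x $ k) * h x)" by (simp add: zero[OF Q(1)])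
  then show ?thesis using LIMSEQ_unique[OF _ tendsto_const] by blast
qed

context grid
begin

text \<open>The off-diagonal part of the constitutive equation, from shear fields of compact
  support.\<close>
lemma symmetric_gradient:
  assumes ex: "exact_solution (box a b) A f \<sigma> u" and AL: "A \<sigma> \<in> L2 (box a b)" and u: "u \<in> sobolev 2 (box a b)"
  shows "AE x in lebesgue_on (box a b). A \<sigma> x $ 1 $ 2 + A \<sigma> x $ 2 $ 1 =
    D1 (box a b) (co i) u x $ i + D1 (box a b) i u x $ co i"
proof -
  let ?\<Omega> = "box a b" and ?S = "\<lambda>x. A \<sigma> x $ 1 $ 2 + A \<sigma> x $ 2 $ 1"
  let ?g = "D1 ?\<Omega>"
  have wp: "weak_partial a b k (\<lambda>x. u x $ j) (\<lambda>x. ?g k u x $ j)" for k j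
    by (rule sobolev2(7)[OF u bounded_linear_vec_nth])
  have SL: "?S \<in> L2 ?\<Omega>" by (intro L2_add L2_nth_nth AL)
  have gL: "(\<lambda>x. ?g k u x $ j) \<in> L2 ?\<Omega>" for k j by (rule weak_partial_L2(2)[OF wp])
  have "AE x in lebesgue_on ?\<Omega>. ?S x - (?g (co i) u x $ i + ?g i u x $ co i) = 0"
  proof (rule fundamental_lemma[where i = i])
    show "(\<lambda>x. ?S x - (?g (co i) u x $ i + ?g i u x $ co i)) \<in> L2 ?\<Omega>" by (intro L2_diff L2_add SL gL)
    fix q p assume q: "test1 (a $ i) (b $ i) q" and p: "test1 (a $ co i) (b $ co i) p"
    note tl = test_limit_smooth[OF test1_smooth[OF q], of "a $ i" "b $ i"] test_limit_smooth[OF test1_smooth[OF p], of "a $ co i" "b $ co i"]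
    have "pairing a b i (\<lambda>x. ?S x - (?g (co i) u x $ i + ?g i u x $ co i)) q p =
        pairing a b i ?S q p - (pairing a b i (\<lambda>x. ?g (co i) u x $ i) q p + pairing a b i (\<lambda>x. ?g i u x $ co i) q p)"
      by (simp add: pairing_diff[OF SL L2_add[OF gL gL] tl] pairing_add[OF gL gL tl])
    moreover have "pairing a b i (\<lambda>x. u x $ co i) (deriv q) p = - pairing a b i (\<lambda>x. ?g i u x $ co i) q p"
      using wp[of i "co i"] q p unfolding weak_partial_def by blast
    moreover have "pairing a b i (\<lambda>x. u x $ i) q (deriv p) = - pairing a b i (\<lambda>x. ?g (co i) u x $ i) q p"
      using wp[of "co i" i] q p unfolding weak_partial_def by (simp add: pairing_swap)
    ultimately show "pairing a b i (\<lambda>x. ?S x - (?g (co i) u x $ i + ?g i u x $ co i)) q p = 0"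
      using exact_off_diagonal_equation[OF ex AL test1_smooth[OF q] test1_smooth[OF p], of i] by linarith
  qed
  then show ?thesis by eventually_elim simp
qed

text \<open>The natural boundary condition. Shear fields that vanish near the two sides parallel to
  direction \<open>i\<close>, but not near the other two, give the identity \<open>P(b) T(b) = P(a)
  T(a)\<close> for every smooth \<open>P\<close>, where \<open>T\<close> is the trace of the
  displacement component tangential to the sides orthogonal to direction \<open>i\<close>. The
  choices \<open>P = 1\<close> and \<open>P = t - a\<close> give \<open>T = 0\<close> at both ends.\<close>
lemma displacement_boundary_trace:
  assumes ex: "exact_solution (box a b) A f \<sigma> u" and AL: "A \<sigma> \<in> L2 (box a b)" and u: "u \<in> sobolev 2 (box a b)"
    and p: "test_limit (a $ co i) (b $ co i) p"
  shows "line_trace a b i (\<lambda>x. u x $ co i) (\<lambda>x. D1 (box a b) i u x $ co i) p (a $ i) = 0"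
    "line_trace a b i (\<lambda>x. u x $ co i) (\<lambda>x. D1 (box a b) i u x $ co i) p (b $ i) = 0"
proof -
  let ?\<Omega> = "box a b" and ?S = "\<lambda>x. A \<sigma> x $ 1 $ 2 + A \<sigma> x $ 2 $ 1"
  let ?w = "\<lambda>x. u x $ co i" and ?g = "\<lambda>x. D1 ?\<Omega> i u x $ co i" and ?k = "\<lambda>x. D1 ?\<Omega> (co i) u x $ i"
  let ?T = "line_trace a b i ?w ?g p"
  have wp: "weak_partial a b k (\<lambda>x. u x $ j) (\<lambda>x. D1 ?\<Omega> k u x $ j)" for k j
    by (rule sobolev2(7)[OF u bounded_linear_vec_nth])
  have SL: "?S \<in> L2 ?\<Omega>" by (intro L2_add L2_nth_nth AL)
  have gL: "(\<lambda>x. D1 ?\<Omega> k u x $ j) \<in> L2 ?\<Omega>" "(\<lambda>x. u x $ j) \<in> L2 ?\<Omega>" for k j by (rule weak_partial_L2[OF wp])+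
  have zero: "pairing a b i ?g P R + pairing a b i ?w (deriv P) R = 0"
    if P: "smooth P" and R: "test1 (a $ co i) (b $ co i) R" for P R
  proof -
    note tl = test_limit_smooth[OF P, of "a $ i" "b $ i"] test_limit_smooth[OF test1_smooth[OF R], of "a $ co i" "b $ co i"]
    have 1: "pairing a b i (\<lambda>x. u x $ i) P (deriv R) = - pairing a b i ?k P R"
    proof -
      have RI: "(deriv R has_integral R t) {a $ co i..t}" if "a $ co i \<le> t" for t
      proof -
        have "(deriv R has_integral R t - R (a $ co i)) {a $ co i..t}"
          by (rule fundamental_theorem_of_calculus[OF that])
             (use smooth_has_deriv[OF test1_smooth[OF R]] in
              \<open>auto simp: has_real_derivative_iff_has_vector_derivative[symmetric] intro: has_field_derivative_at_within\<close>)
        then show ?thesis using test1_zero_outside[OF R, of "a $ co i"] by simp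
      qed
      have "(deriv R has_integral 0) {a $ co i..b $ co i}"
        using RI[of "b $ co i"] test1_zero_outside[OF R, of "b $ co i"] ab[of "co i"] by simp
      then have "pairing a b (co i) (\<lambda>x. u x $ i) (deriv R) P = - pairing a b (co i) ?k R P"
        using RI tl(1) by (intro weak_partial_extended[OF wp ab]) (auto intro: test_limit_smooth smooth_deriv test1_smooth[OF R])
      then show ?thesis by (simp only: pairing_swap)
    qed
    have "pairing a b i ?S P R = pairing a b i (\<lambda>x. ?k x + ?g x) P R"
      unfolding pairing_def
    proof (rule integral_cong_AE)
      show "AE x in lebesgue_on ?\<Omega>. P (x $ i) * R (x $ co i) * ?S x = P (x $ i) * R (x $ co i) * (?k x + ?g x)"
        using symmetric_gradient[OF ex AL u, of i] by eventually_elim simp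
    qed (intro borel_measurable_integrable pairing_integrable SL L2_add gL tl)+
    also have "\<dots> = pairing a b i ?k P R + pairing a b i ?g P R" by (rule pairing_add[OF gL(1) gL(1) tl])
    finally show ?thesis using exact_off_diagonal_equation[OF ex AL P test1_smooth[OF R], of i] 1 by linarith
  qed
  have zero': "pairing a b i ?g P p + pairing a b i ?w (deriv P) p = 0" if P: "smooth P" for P
  proof -
    note tP = test_limit_smooth[OF P, of "a $ i" "b $ i"] test_limit_smooth[OF smooth_deriv[OF P], of "a $ i" "b $ i"]
    define h where "h x = P (x $ i) * ?g x + deriv P (x $ i) * ?w x" for x
    have hL: "h \<in> L2 ?\<Omega>"
      using L2_add[OF pairing_weight_L2[OF gL(1)[of i "co i"] tP(1) test_limit_const[of _ _ 1]]
          pairing_weight_L2[OF gL(2)[of "co i"] tP(2) test_limit_const[of _ _ 1]]]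
      by (simp add: h_def[abs_def])
    have sum: "pairing a b i ?g P R + pairing a b i ?w (deriv P) R = (LINT x|lebesgue_on ?\<Omega>. R (x $ co i) * h x)"
      if "test_limit (a $ co i) (b $ co i) R" for R
      unfolding pairing_def h_def
      using pairing_integrable[OF gL(1) tP(1) that, of i "co i"] pairing_integrable[OF gL(2) tP(2) that, of "co i"]
      by (subst Bochner_Integration.integral_add[symmetric]) (simp_all add: algebra_simps)
    have "(LINT x|lebesgue_on ?\<Omega>. p (x $ co i) * h x) = 0"
    proof (rule test_limit_integral_zero[OF hL p])
      fix R assume R: "test1 (a $ co i) (b $ co i) R"
      show "(LINT x|lebesgue_on ?\<Omega>. R (x $ co i) * h x) = 0"
        using zero[OF P R] sum[OF test_limit_smooth[OF test1_smooth[OF R]]] by simp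
    qed
    then show ?thesis using sum[OF p] by simp
  qed
  have tr: "P (b $ i) * ?T (b $ i) - P (a $ i) * ?T (a $ i) = 0" if P: "smooth P" for P
  proof -
    let ?I = "indicat_real {a $ i<..<b $ i}"
    have "pairing a b i v (\<lambda>s. ?I s * Q s) p = pairing a b i v Q p" for v Q
      unfolding pairing_def by (rule Bochner_Integration.integral_cong) (use box_nthD[of _ a b i] in auto)
    then show ?thesis
      using trace_by_parts[OF weak_pair_pairing[OF wp[of i "co i"] ab p] order_refl ab[of i] order_refl P] zero'[OF P]
      by (simp add: line_trace_def)
  qed
  have 1: "?T (b $ i) - ?T (a $ i) = 0" using tr[OF smooth_const[of 1]] by simp
  have 2: "(b $ i - a $ i) * ?T (b $ i) = 0" using tr[OF smooth_affine_function[of "a $ i"]] by simp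
  show "?T (b $ i) = 0" using 2 ab[of i] by simp
  then show "?T (a $ i) = 0" using 1 by simp
qed

text \<open>The error committed by testing the exact equation with a nonconforming stress. The
  diagonal part contributes nothing, as it is conforming; in the shear part the symmetric gradient
  replaces the stress, and the two summands belong to the two directions.\<close>
lemma consistency:
  assumes ex: "exact_solution (box a b) A f \<sigma> u" and AL: "A \<sigma> \<in> L2 (box a b)" and u: "u \<in> sobolev 2 (box a b)"
    and tau: "\<tau> \<in> Sigma_h (box a b) T"
  shows "\<bar>L2_inner (box a b) (A \<sigma>) \<tau> + L2_inner (box a b) (div_h T \<tau>) u\<bar> \<le>
    2 * hh * sobolev_norm 2 (box a b) u * L2_norm (box a b) \<tau>"
proof -
  let ?\<Omega> = "box a b" and ?N = "sobolev_norm 2 (box a b) u" and ?t = "\<lambda>x. \<tau> x $ 1 $ 2"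
  obtain p where rep: "sigma_rep \<tau> p" using Sigma_h_rep[OF tau] .
  have tL: "\<tau> \<in> L2 ?\<Omega>" and ts: "AE x in lebesgue_on ?\<Omega>. transpose (\<tau> x) = \<tau> x"
    using tau by (auto simp: Sigma_h_def L2_sym_def)
  have uL: "u \<in> L2 ?\<Omega>" by (rule sobolev2(1)[OF u])
  define os where "os i = pw (\<lambda>K x. oslope (p K) i)" for i
  define g where "g i x = D1 ?\<Omega> i u x $ co i" for i x
  define E where "E i = (LINT x|lebesgue_on ?\<Omega>. ?t x * g i x + os i x * u x $ co i)" for i
  have gL: "g i \<in> L2 ?\<Omega>" for i unfolding g_def by (rule L2_nth[OF sobolev2(2)[OF u]])
  have oL: "os i \<in> L2 ?\<Omega>" for i unfolding os_def by (rule pw_const_L2)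
  have E_bound: "\<bar>E i\<bar> \<le> hh * ?N * L2_norm ?\<Omega> \<tau>" for i
  proof -
    let ?D = "\<lambda>x. D2 ?\<Omega> (co i) i u x $ co i"
    have "\<bar>E i\<bar> \<le> hh * (L2_norm ?\<Omega> ?t * L2_norm ?\<Omega> ?D)"
      unfolding E_def g_def os_def
      by (rule off_diagonal_consistency[OF tL rep sobolev2(7)[OF u bounded_linear_vec_nth] sobolev2(8)[OF u bounded_linear_vec_nth]
            displacement_boundary_trace(1)[OF ex AL u strip_weight_limit] displacement_boundary_trace(2)[OF ex AL u strip_weight_limit]])
    also have "\<dots> \<le> hh * (L2_norm ?\<Omega> \<tau> * ?N)"
    proof -
      have "L2_norm ?\<Omega> ?D \<le> ?N"
        using L2_norm_nth_le[OF sobolev2(3)[OF u, of "co i" i], of "co i"] sobolev2(5)[OF u, of "co i" i] by linarith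
      then show ?thesis using mesh_size_pos
        by (intro mult_left_mono mult_mono L2_norm_nth_nth_le tL L2_norm_nonneg) auto
    qed
    finally show ?thesis by (simp add: mult_ac)
  qed
  have rL: "rep_diag_div p \<in> L2 ?\<Omega>" unfolding rep_diag_div_def by (rule pw_const_L2)
  have exact: "L2_inner ?\<Omega> (A \<sigma>) (diag_part \<tau>) + L2_inner ?\<Omega> (rep_diag_div p) u = 0"
  proof -
    note d = diag_part_Hdiv[OF tL rep]
    have "L2_inner ?\<Omega> (weak_div ?\<Omega> (diag_part \<tau>)) u = L2_inner ?\<Omega> (rep_diag_div p) u"
      by (rule L2_inner_cong_AE[OF d(2) L2_cong_AE[OF rL _ d(2)] rL uL]) simp
    then show ?thesis using ex d(1) unfolding exact_solution_def by auto
  qed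
  have dhL: "div_h T \<tau> \<in> L2 ?\<Omega>" by (rule div_h_rep(2)[OF tL rep])
  have i1: "integrable (lebesgue_on ?\<Omega>) (\<lambda>x. A \<sigma> x \<bullet> \<tau> x)" "integrable (lebesgue_on ?\<Omega>) (\<lambda>x. A \<sigma> x \<bullet> diag_part \<tau> x)"
    "integrable (lebesgue_on ?\<Omega>) (\<lambda>x. div_h T \<tau> x \<bullet> u x)" "integrable (lebesgue_on ?\<Omega>) (\<lambda>x. rep_diag_div p x \<bullet> u x)"
    by (intro L2_inner_integrable AL tL diag_part_L2 dhL uL rL)+
  have i2: "integrable (lebesgue_on ?\<Omega>) (\<lambda>x. ?t x * g i x + os i x * u x $ co i)" for i
    using L2_inner_integrable[OF L2_nth_nth[OF tL] gL, of 1 2 i] L2_inner_integrable[OF oL L2_nth[OF uL], of i "co i"] by simp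
  let ?F = "\<lambda>x. (A \<sigma> x \<bullet> \<tau> x + div_h T \<tau> x \<bullet> u x) - (A \<sigma> x \<bullet> diag_part \<tau> x + rep_diag_div p x \<bullet> u x)"
  have "AE x in lebesgue_on ?\<Omega>. ?F x = (?t x * g 1 x + os 1 x * u x $ co 1) + (?t x * g 2 x + os 2 x * u x $ co 2)"
  proof (rule AE_elementsI)
    fix K assume K: "K \<in> T"
    have sub: "AE x in lebesgue_on (interior K). Q x" if "AE x in lebesgue_on ?\<Omega>. Q x" for Q
      by (rule AE_lebesgue_on_subset[OF that element_subset[OF K]]) (simp_all add: element(2)[OF K])
    note inK = AE_inside[of "interior K"]
    show "AE x in lebesgue_on (interior K). ?F x = (?t x * g 1 x + os 1 x * u x $ co 1) + (?t x * g 2 x + os 2 x * u x $ co 2)"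
      using sub[OF ts] sub[OF div_h_rep(1)[OF tL rep]] sub[OF symmetric_gradient[OF ex AL u, of 1]] inK
    proof eventually_elim
      case (elim x)
      have t: "\<tau> x $ 2 $ 1 = \<tau> x $ 1 $ 2" using arg_cong[OF elim(1), of "\<lambda>B. B $ 1 $ 2"] by (simp only: transpose_def vec_lambda_beta)
      have S: "A \<sigma> x $ 1 $ 2 + A \<sigma> x $ 2 $ 1 = g 2 x + g 1 x" using elim(3) by (simp only: g_def co_simps)
      have "div_h T \<tau> x \<bullet> u x - rep_diag_div p x \<bullet> u x = os 1 x * u x $ 2 + os 2 x * u x $ 1"
        unfolding elim(2) rep_div_def rep_diag_div_def os_def pw_eq[OF K elim(4)]
        by (simp add: inner_vec_def UNIV_2 algebra_simps)
      moreover have "A \<sigma> x \<bullet> \<tau> x - A \<sigma> x \<bullet> diag_part \<tau> x = ?t x * (A \<sigma> x $ 1 $ 2 + A \<sigma> x $ 2 $ 1)"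
        by (simp add: inner_vec_def UNIV_2 diag_part_def t algebra_simps)
      ultimately show ?case unfolding S by (simp add: algebra_simps)
    qed
  qed
  then have "(LINT x|lebesgue_on ?\<Omega>. ?F x) =
      (LINT x|lebesgue_on ?\<Omega>. (?t x * g 1 x + os 1 x * u x $ co 1) + (?t x * g 2 x + os 2 x * u x $ co 2))"
    by (intro integral_cong_AE borel_measurable_integrable Bochner_Integration.integrable_add
        Bochner_Integration.integrable_diff i1 i2)
  then have "L2_inner ?\<Omega> (A \<sigma>) \<tau> + L2_inner ?\<Omega> (div_h T \<tau>) u = E 1 + E 2"
    using exact Bochner_Integration.integral_add[OF i2[of 1] i2[of 2]] i1 unfolding L2_inner_def E_def by simp
  then show ?thesis using E_bound[of 1] E_bound[of 2] by (simp add: mult_ac)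
qed

end

section \<open>Linear structure of the discrete problem\<close>
lemma has_weak_div_diff:
  assumes U: "U \<in> lmeasurable" and d: "\<tau> \<in> L2 U" "d \<in> L2 U" "has_weak_div U \<tau> d"
    and e: "\<tau>' \<in> L2 U" "e \<in> L2 U" "has_weak_div U \<tau>' e"
  shows "has_weak_div U (\<lambda>x. \<tau> x - \<tau>' x) (\<lambda>x. d x - e x)"
  unfolding has_weak_div_def
proof
  fix \<phi> assume phi: "\<phi> \<in> test_functions U"
  let ?G = "\<lambda>x. \<chi> j. partial j \<phi> x"
  have int: "integrable (lebesgue_on U) (\<lambda>x. \<rho> x *v ?G x)" if "\<rho> \<in> L2 U" for \<rho> :: "plane \<Rightarrow> real^2^2"
  proof (rule L2_integrable[OF U L2_vec2I])
    fix i
    have "(\<lambda>x. partial 1 \<phi> x *\<^sub>R \<rho> x $ i $ 1 + partial 2 \<phi> x *\<^sub>R \<rho> x $ i $ 2) \<in> L2 U"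
      by (intro L2_add test_function_bounded_mult[OF partial_test_function[OF phi]] L2_nth_nth[OF that])
    then show "(\<lambda>x. (\<rho> x *v ?G x) $ i) \<in> L2 U" by (simp add: matrix_vector_2 mult.commute)
  qed
  have "(LINT x|lebesgue_on U. (\<tau> x - \<tau>' x) *v ?G x) = (LINT x|lebesgue_on U. \<tau> x *v ?G x - \<tau>' x *v ?G x)"
    by (simp only: matrix_vector_mult_diff_rdistrib)
  also have "\<dots> = (LINT x|lebesgue_on U. \<tau> x *v ?G x) - (LINT x|lebesgue_on U. \<tau>' x *v ?G x)"
    by (rule Bochner_Integration.integral_diff[OF int[OF d(1)] int[OF e(1)]])
  also have "\<dots> = - (LINT x|lebesgue_on U. \<phi> x *\<^sub>R d x) - - (LINT x|lebesgue_on U. \<phi> x *\<^sub>R e x)"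
    using bspec[OF d(3)[unfolded has_weak_div_def] phi] bspec[OF e(3)[unfolded has_weak_div_def] phi] by simp
  also have "\<dots> = - ((LINT x|lebesgue_on U. \<phi> x *\<^sub>R d x) - (LINT x|lebesgue_on U. \<phi> x *\<^sub>R e x))" by simp
  also have "(LINT x|lebesgue_on U. \<phi> x *\<^sub>R d x) - (LINT x|lebesgue_on U. \<phi> x *\<^sub>R e x) =
      (LINT x|lebesgue_on U. \<phi> x *\<^sub>R d x - \<phi> x *\<^sub>R e x)"
    by (rule Bochner_Integration.integral_diff[symmetric])
       (rule test_function_integrable_mult[OF phi d(2) U], rule test_function_integrable_mult[OF phi e(2) U])
  also have "\<dots> = (LINT x|lebesgue_on U. \<phi> x *\<^sub>R (d x - e x))" by (simp only: scaleR_diff_right)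
  finally show "(LINT x|lebesgue_on U. (\<tau> x - \<tau>' x) *v ?G x) = - (LINT x|lebesgue_on U. \<phi> x *\<^sub>R (d x - e x))" .
qed

lemma L2_sym_diff:
  assumes "\<sigma> \<in> L2_sym U" "\<tau> \<in> L2_sym U" shows "(\<lambda>x. \<sigma> x - \<tau> x) \<in> L2_sym U"
proof -
  have "AE x in lebesgue_on U. transpose (\<sigma> x) = \<sigma> x" "AE x in lebesgue_on U. transpose (\<tau> x) = \<tau> x"
    using assms by (auto simp: L2_sym_def)
  then have "AE x in lebesgue_on U. transpose (\<sigma> x - \<tau> x) = \<sigma> x - \<tau> x"
    by eventually_elim (simp add: transpose_def vec_eq_iff)
  then show ?thesis using assms by (simp add: L2_sym_def L2_diff)
qed

lemma Sigma_poly_diff: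
  assumes p: "p \<in> Sigma_poly" and q: "q \<in> Sigma_poly"
  shows "(\<lambda>x. p x - q x) \<in> Sigma_poly"
proof (rule Sigma_polyI(1))
  show "(p x - q x) $ i $ i = (p 0 $ i $ i - q 0 $ i $ i) + (dslope p i - dslope q i) * (x $ i - 0 $ i)" for x i
    using Sigma_poly_diag[OF p, of x i 0] Sigma_poly_diag[OF q, of x i 0] by (simp add: algebra_simps)
  show "(p x - q x) $ i $ co i = (p 0 $ 1 $ 2 - q 0 $ 1 $ 2) + (oslope p 1 - oslope q 1) * (x $ 1 - 0 $ 1)
      + (oslope p 2 - oslope q 2) * (x $ 2 - 0 $ 2)" for x i
    using Sigma_poly_off(1)[OF p, of x 0] Sigma_poly_off(1)[OF q, of x 0]
    by (simp add: Sigma_poly_off_index(1)[OF p] Sigma_poly_off_index(1)[OF q] algebra_simps)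
qed

lemma Sigma_h_L2: "\<tau> \<in> Sigma_h U T \<Longrightarrow> \<tau> \<in> L2_sym U" "\<tau> \<in> Sigma_h U T \<Longrightarrow> \<tau> \<in> L2 U"
  by (simp_all add: Sigma_h_def L2_sym_def)

lemma Sigma_h_diff:
  assumes s: "\<sigma> \<in> Sigma_h U T" and t: "\<tau> \<in> Sigma_h U T"
  shows "(\<lambda>x. \<sigma> x - \<tau> x) \<in> Sigma_h U T"
proof -
  obtain p where p: "\<forall>K\<in>T. p K \<in> Sigma_poly \<and> (AE x in lebesgue_on K. \<sigma> x = p K x)"
    "\<forall>i. \<forall>e\<in>interior_edges U T i. \<forall>K\<in>T. \<forall>L\<in>T. e \<in> edges i K \<and> e \<in> edges i L \<longrightarrow>
        (\<forall>x\<in>e. p K x $ i $ i = p L x $ i $ i) \<and> p K (edge_midpoint e) $ 1 $ 2 = p L (edge_midpoint e) $ 1 $ 2"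
    using s unfolding Sigma_h_def by blast
  obtain q where q: "\<forall>K\<in>T. q K \<in> Sigma_poly \<and> (AE x in lebesgue_on K. \<tau> x = q K x)"
    "\<forall>i. \<forall>e\<in>interior_edges U T i. \<forall>K\<in>T. \<forall>L\<in>T. e \<in> edges i K \<and> e \<in> edges i L \<longrightarrow>
        (\<forall>x\<in>e. q K x $ i $ i = q L x $ i $ i) \<and> q K (edge_midpoint e) $ 1 $ 2 = q L (edge_midpoint e) $ 1 $ 2"
    using t unfolding Sigma_h_def by blast
  define r where "r K x = p K x - q K x" for K x
  have "r K \<in> Sigma_poly \<and> (AE x in lebesgue_on K. \<sigma> x - \<tau> x = r K x)" if K: "K \<in> T" for K
  proof
    show "r K \<in> Sigma_poly" using Sigma_poly_diff[of "p K" "q K"] p(1) q(1) K by (simp add: r_def[abs_def])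
    have "AE x in lebesgue_on K. \<sigma> x = p K x" "AE x in lebesgue_on K. \<tau> x = q K x" using p(1) q(1) K by blast+
    then show "AE x in lebesgue_on K. \<sigma> x - \<tau> x = r K x" by eventually_elim (simp add: r_def)
  qed
  moreover have "(\<forall>x\<in>e. r K x $ i $ i = r L x $ i $ i) \<and> r K (edge_midpoint e) $ 1 $ 2 = r L (edge_midpoint e) $ 1 $ 2"
    if "e \<in> interior_edges U T i" "K \<in> T" "L \<in> T" "e \<in> edges i K" "e \<in> edges i L" for i e K L
  proof -
    have "(\<forall>x\<in>e. p K x $ i $ i = p L x $ i $ i) \<and> p K (edge_midpoint e) $ 1 $ 2 = p L (edge_midpoint e) $ 1 $ 2"
      "(\<forall>x\<in>e. q K x $ i $ i = q L x $ i $ i) \<and> q K (edge_midpoint e) $ 1 $ 2 = q L (edge_midpoint e) $ 1 $ 2"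
      using p(2) q(2) that by blast+
    then show ?thesis by (simp add: r_def)
  qed
  ultimately show ?thesis
    using L2_sym_diff[OF Sigma_h_L2(1)[OF s] Sigma_h_L2(1)[OF t]] unfolding Sigma_h_def by blast
qed

text \<open>Linearity of \<open>A\<close> holds almost everywhere only, so it is used through inner
  products.\<close>
lemma compliance_diff:
  assumes A: "compliance U A" and U: "U \<in> sets lebesgue" and s: "\<sigma> \<in> L2_sym U" and t: "\<tau> \<in> L2_sym U" and k: "k \<in> L2 U"
  shows "L2_inner U (A (\<lambda>x. \<sigma> x - \<tau> x)) k = L2_inner U (A \<sigma>) k - L2_inner U (A \<tau>) k"
proof -
  have sym: "A \<rho> \<in> L2 U" if "\<rho> \<in> L2_sym U" for \<rho>
    using A that unfolding compliance_def by (auto simp: L2_sym_def)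
  have "AE x in lebesgue_on U. A (\<lambda>y. 1 *\<^sub>R \<sigma> y + (- 1) *\<^sub>R \<tau> y) x = 1 *\<^sub>R A \<sigma> x + (- 1) *\<^sub>R A \<tau> x"
    using A s t unfolding compliance_def by blast
  then have AE: "AE x in lebesgue_on U. A (\<lambda>x. \<sigma> x - \<tau> x) x = A \<sigma> x - A \<tau> x" by simp
  have "L2_inner U (A (\<lambda>x. \<sigma> x - \<tau> x)) k = L2_inner U (\<lambda>x. A \<sigma> x - A \<tau> x) k"
    by (rule L2_inner_cong_AE[OF AE sym[OF L2_sym_diff[OF s t]] L2_diff[OF sym[OF s] sym[OF t]] k])
  then show ?thesis using L2_inner_diff_left[OF sym[OF s] sym[OF t] k] by simp
qed

lemma V_h_diff:
  assumes "v \<in> V_h U T" "w \<in> V_h U T" shows "(\<lambda>x. v x - w x) \<in> V_h U T"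
proof -
  have "\<exists>c. AE x in lebesgue_on K. v x - w x = c" if K: "K \<in> T" for K
  proof -
    obtain c d where "AE x in lebesgue_on K. v x = c" "AE x in lebesgue_on K. w x = d"
      using assms K unfolding V_h_def by blast
    then have "AE x in lebesgue_on K. v x - w x = c - d" by eventually_elim simp
    then show ?thesis by blast
  qed
  then show ?thesis using assms by (auto simp: V_h_def L2_diff)
qed

context grid
begin

lemma V_h_interior:
  assumes "v \<in> V_h (box a b) T"
  obtains c where "\<And>K. K \<in> T \<Longrightarrow> AE x in lebesgue_on (interior K). v x = c K"
proof -
  have "\<exists>c. AE x in lebesgue_on (interior K). v x = c" if K: "K \<in> T" for K
  proof -
    obtain c where "AE x in lebesgue_on K. v x = c" using assms K unfolding V_h_def by blast
    then have "AE x in lebesgue_on (interior K). v x = c"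
      by (rule AE_lebesgue_on_subset[OF _ interior_subset]) (use element_closed[OF K] in simp_all)
    then show ?thesis by blast
  qed
  then have "\<exists>c. \<forall>K\<in>T. AE x in lebesgue_on (interior K). v x = c K" by (intro bchoice) blast
  then show ?thesis using that by blast
qed

lemma proj_vec_orthogonal:
  assumes s: "s \<in> L2 (box a b)" and v: "v \<in> V_h (box a b) T"
  shows "L2_inner (box a b) (\<lambda>x. s x - proj_vec s x) v = 0"
proof -
  let ?\<Omega> = "box a b" and ?F = "\<lambda>x. (s x - proj_vec s x) \<bullet> v x"
  have vL: "v \<in> L2 ?\<Omega>" using v by (simp add: V_h_def)
  have dL: "(\<lambda>x. s x - proj_vec s x) \<in> L2 ?\<Omega>" by (intro L2_diff s proj_vec_L2)
  obtain c where c: "\<And>K. K \<in> T \<Longrightarrow> AE x in lebesgue_on (interior K). v x = c K" using V_h_interior[OF v] by blast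
  have "(LINT x|lebesgue_on (interior K). ?F x) = 0" if K: "K \<in> T" for K
  proof -
    define m :: "real^2" where "m = (\<chi> i. avg K (\<lambda>x. s x $ i))"
    have K_lm: "interior K \<in> lmeasurable" unfolding element(2)[OF K] by (rule lmeasurable_box)
    have sm: "(\<lambda>x. s x - m) \<in> L2 (interior K)" by (intro L2_diff L2_interior[OF s K] L2_const K_lm)
    have int: "integrable (lebesgue_on (interior K)) (\<lambda>x. s x - m)" by (rule L2_integrable[OF K_lm sm])
    note inK = AE_inside[of "interior K"]
    have "AE x in lebesgue_on (interior K). ?F x = (s x - m) \<bullet> c K"
      using c[OF K] inK by eventually_elim (simp add: proj_vec_def pw_eq[OF K] m_def)
    then have "(LINT x|lebesgue_on (interior K). ?F x) = (LINT x|lebesgue_on (interior K). (s x - m) \<bullet> c K)"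
      by (intro integral_cong_AE borel_measurable_integrable L2_inner_integrable L2_interior[OF _ K] dL vL sm L2_const K_lm)
    also have "\<dots> = (LINT x|lebesgue_on (interior K). s x - m) \<bullet> c K" using int by (intro integral_inner_left) simp
    also have "(LINT x|lebesgue_on (interior K). s x - m) = 0"
    proof -
      have "(LINT x|lebesgue_on (interior K). s x $ i - m $ i) = 0" for i
      proof -
        have i1: "integrable (lebesgue_on (interior K)) (\<lambda>x. s x $ i)"
          by (rule L2_integrable[OF K_lm L2_nth[OF L2_interior[OF s K]]])
        have i2: "integrable (lebesgue_on (interior K)) (\<lambda>x. m $ i)" by (rule L2_integrable[OF K_lm L2_const[OF K_lm]])
        have "(LINT x|lebesgue_on (interior K). m $ i) = m $ i * area (lo K) (hi K)"
          unfolding element(2)[OF K] by (rule integral_const_box) (use element(3)[OF K] in \<open>simp add: less_imp_le\<close>)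
        also have "\<dots> = (LINT x|lebesgue_on (interior K). s x $ i)"
          using element_area[OF K] by (simp add: m_def mean_def element(2)[OF K])
        finally show ?thesis unfolding Bochner_Integration.integral_diff[OF i1 i2] by simp
      qed
      then show ?thesis using vec_integral_nth[OF int] by (simp add: vec_eq_iff)
    qed
    finally show ?thesis by simp
  qed
  then show ?thesis unfolding L2_inner_def integral_elements[OF L2_inner_integrable[OF dL vL]] by simp
qed

lemma Sigma_h_broken_div:
  assumes "\<tau> \<in> Sigma_h (box a b) T"
  obtains c where "\<And>K. K \<in> T \<Longrightarrow> has_weak_div (interior K) \<tau> (pw (\<lambda>K x. c K))"
proof -
  obtain p where p: "sigma_rep \<tau> p" using Sigma_h_rep[OF assms] .
  show ?thesis
    by (rule that[of "\<lambda>K. \<chi> i. dslope (p K) i + oslope (p K) (co i)"])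
       (rule rep_div_weak[OF Sigma_h_L2(2)[OF assms] p, unfolded rep_div_def])
qed

lemma div_h_diff:
  assumes s: "\<sigma> \<in> L2 (box a b)" "d \<in> L2 (box a b)" "\<And>K. K \<in> T \<Longrightarrow> has_weak_div (interior K) \<sigma> d"
    and t: "\<tau> \<in> L2 (box a b)" "e \<in> L2 (box a b)" "\<And>K. K \<in> T \<Longrightarrow> has_weak_div (interior K) \<tau> e"
  shows "AE x in lebesgue_on (box a b). div_h T (\<lambda>x. \<sigma> x - \<tau> x) x = d x - e x"
    "div_h T (\<lambda>x. \<sigma> x - \<tau> x) \<in> L2 (box a b)"
    "K \<in> T \<Longrightarrow> has_weak_div (interior K) (\<lambda>x. \<sigma> x - \<tau> x) (\<lambda>x. d x - e x)"
proof -
  have *: "has_weak_div (interior K) (\<lambda>x. \<sigma> x - \<tau> x) (\<lambda>x. d x - e x)" if K: "K \<in> T" for K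
    by (rule has_weak_div_diff[OF _ L2_interior[OF s(1) K] L2_interior[OF s(2) K] s(3)[OF K]
          L2_interior[OF t(1) K] L2_interior[OF t(2) K] t(3)[OF K]]) (simp add: element(2)[OF K])
  then show "K \<in> T \<Longrightarrow> has_weak_div (interior K) (\<lambda>x. \<sigma> x - \<tau> x) (\<lambda>x. d x - e x)" .
  show "AE x in lebesgue_on (box a b). div_h T (\<lambda>x. \<sigma> x - \<tau> x) x = d x - e x"
    "div_h T (\<lambda>x. \<sigma> x - \<tau> x) \<in> L2 (box a b)"
    using div_h_eq[OF L2_diff[OF s(2) t(2)] *] by blast+
qed

section \<open>The error estimate\<close>

text \<open>The discrete equilibrium equation determines the divergence: it is the projection of
  the exact one.\<close>
lemma discrete_divergence:
  assumes ex: "exact_solution (box a b) A f \<sigma> u" and s: "\<sigma> \<in> sobolev 2 (box a b)"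
    and fem: "fem_solution (box a b) T A f \<sigma>h uh"
    and div: "\<And>K. K \<in> T \<Longrightarrow> has_weak_div (interior K) \<sigma>h (pw (\<lambda>K x. c K))"
  shows "L2_norm (box a b) (\<lambda>x. proj_vec (sobolev_div \<sigma>) x - pw (\<lambda>K x. c K) x) = 0"
proof -
  let ?\<Omega> = "box a b" and ?s = "sobolev_div \<sigma>" and ?d = "pw (\<lambda>K x. c K)"
  let ?v = "\<lambda>x. proj_vec ?s x - ?d x"
  have sL: "?s \<in> L2 ?\<Omega>" by (rule sobolev_div_L2[OF s])
  have vV: "?v \<in> V_h ?\<Omega> T" by (intro V_h_diff proj_vec_L2 pw_const_V_h)
  then have vL: "?v \<in> L2 ?\<Omega>" by (simp add: V_h_def)
  note dh = div_h_eq[OF pw_const_L2 div]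
  have wd: "AE x in lebesgue_on ?\<Omega>. weak_div ?\<Omega> \<sigma> x = ?s x" by (rule weak_div_eq[OF sL sobolev_div_weak(1)[OF s]])
  have "L2_inner ?\<Omega> ?d ?v = L2_inner ?\<Omega> (div_h T \<sigma>h) ?v"
    by (rule L2_inner_cong_AE[OF _ pw_const_L2 dh(2) vL]) (use dh(1) in \<open>auto elim!: eventually_mono\<close>)
  also have "\<dots> = L2_inner ?\<Omega> (weak_div ?\<Omega> \<sigma>) ?v"
    using fem ex vV vL unfolding fem_solution_def exact_solution_def by auto
  also have "\<dots> = L2_inner ?\<Omega> ?s ?v"
    by (rule L2_inner_cong_AE[OF wd L2_cong_AE[OF sL _ wd] sL vL]) simp
  also have "\<dots> = L2_inner ?\<Omega> (proj_vec ?s) ?v"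
    using proj_vec_orthogonal[OF sL vV] L2_inner_diff_left[OF sL proj_vec_L2(1) vL, of ?s] by simp
  finally have "L2_inner ?\<Omega> ?v ?v = 0"
    unfolding L2_inner_diff_left[OF proj_vec_L2(1) pw_const_L2 vL] by simp
  then show ?thesis by (simp add: L2_inner_self)
qed

text \<open>Let \<open>\<rho>\<close> repair the divergence of the interpolant
  \<open>\<pi>\<close>. Then \<open>\<tau> = \<sigma>h - \<pi> - \<rho>\<close> is divergence free,
  and coercivity together with the two variational equations bounds it by the interpolation error
  and the consistency error. The displacement follows by duality: the right inverse of
  \<open>proj_vec u - uh\<close> is a test stress for which both equations give the error.\<close>
lemma error_estimate:
  assumes A: "compliance (box a b) A"
    and M: "0 \<le> M" "\<And>\<tau>. \<tau> \<in> L2_sym (box a b) \<Longrightarrow> L2_norm (box a b) (A \<tau>) \<le> M * L2_norm (box a b) \<tau>"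
    and \<gamma>: "0 < \<gamma>" "\<And>\<tau>. \<tau> \<in> L2_sym (box a b) \<Longrightarrow> \<gamma> * (L2_norm (box a b) \<tau>)\<^sup>2 \<le> L2_inner (box a b) (A \<tau>) \<tau>"
    and ex: "exact_solution (box a b) A f \<sigma> u" and s: "\<sigma> \<in> sobolev 2 (box a b)" and u: "u \<in> sobolev 2 (box a b)"
    and fem: "fem_solution (box a b) T A f \<sigma>h uh"
  defines "X \<equiv> hh * (sobolev_norm 2 (box a b) u + sobolev_norm 2 (box a b) \<sigma>)"
    and "C \<equiv> 52 * (1 + width) + (2 + M * (52 * (1 + width))) / \<gamma>"
  shows "L2_norm (box a b) (\<lambda>x. \<sigma> x - \<sigma>h x) \<le> C * X"
    and "L2_norm (box a b) (div_h T (\<lambda>x. \<sigma> x - \<sigma>h x)) \<le> 16 * X"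
    and "L2_norm (box a b) (\<lambda>x. u x - uh x) \<le> (8 + width * (2 + M * C)) * X"
proof -
  let ?\<Omega> = "box a b" and ?n = "L2_norm (box a b)" and ?s = "sobolev_div \<sigma>"
  let ?Nu = "sobolev_norm 2 (box a b) u" and ?Ns = "sobolev_norm 2 (box a b) \<sigma>"
  define \<alpha> where "\<alpha> = 52 * (1 + width)"
  have N0: "0 \<le> ?Nu" "0 \<le> ?Ns" by (simp_all add: sobolev_norm_def sum_nonneg)
  have h0: "0 < hh" "0 < width" by (rule mesh_size_pos, rule width_pos)
  have X: "hh * ?Nu \<le> X" "hh * ?Ns \<le> X" "0 \<le> X" unfolding X_def using N0 h0 by (simp_all add: mult_left_mono)
  have \<alpha>0: "0 \<le> \<alpha>" using h0 by (simp add: \<alpha>_def)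
  have C: "C = \<alpha> + (2 + M * \<alpha>) / \<gamma>" by (simp add: C_def \<alpha>_def)
  have C0: "0 \<le> C" unfolding C using \<alpha>0 M(1) \<gamma>(1) by simp
  have AL: "A \<rho> \<in> L2 ?\<Omega>" if "\<rho> \<in> L2_sym ?\<Omega>" for \<rho> using A that unfolding compliance_def by (auto simp: L2_sym_def)
  have \<Omega>: "?\<Omega> \<in> sets lebesgue" by simp
  have sS: "\<sigma> \<in> L2_sym ?\<Omega>" using ex by (simp add: exact_solution_def Hdiv_sym_def)
  have sL: "\<sigma> \<in> L2 ?\<Omega>" and uL: "u \<in> L2 ?\<Omega>" by (rule sobolev2(1)[OF s], rule sobolev2(1)[OF u])
  have fh: "\<sigma>h \<in> Sigma_h ?\<Omega> T" "uh \<in> V_h ?\<Omega> T" using fem by (simp_all add: fem_solution_def)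
  have hS: "\<sigma>h \<in> L2_sym ?\<Omega>" and hL: "\<sigma>h \<in> L2 ?\<Omega>" by (rule Sigma_h_L2[OF fh(1)])+
  have uhL: "uh \<in> L2 ?\<Omega>" using fh(2) by (simp add: V_h_def)
  have discrete: "L2_inner ?\<Omega> (A \<sigma>h) \<tau> + L2_inner ?\<Omega> (div_h T \<tau>) uh = 0" if "\<tau> \<in> Sigma_h ?\<Omega> T" for \<tau>
    using fem that by (simp add: fem_solution_def)
  note cons = consistency[OF ex AL[OF sS] u]
  obtain ch where ch: "\<And>K. K \<in> T \<Longrightarrow> has_weak_div (interior K) \<sigma>h (pw (\<lambda>K x. ch K))"
    using Sigma_h_broken_div[OF fh(1)] by blast
  note zero = discrete_divergence[OF ex s fem ch]
  have sdL: "?s \<in> L2 ?\<Omega>" by (rule sobolev_div_L2[OF s])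
  obtain \<pi> where \<pi>: "\<pi> \<in> Sigma_h ?\<Omega> T" "?n (\<lambda>x. \<sigma> x - \<pi> x) \<le> 48 * (1 + width) * hh * ?Ns"
    "?n (\<lambda>x. proj_vec ?s x - div_h T \<pi> x) \<le> 4 * hh * ?Ns"
    using interpolation[OF s sS] by blast
  obtain cp where cp: "\<And>K. K \<in> T \<Longrightarrow> has_weak_div (interior K) \<pi> (pw (\<lambda>K x. cp K))"
    using Sigma_h_broken_div[OF \<pi>(1)] by blast
  note dhp = div_h_eq[OF pw_const_L2 cp]
  have pw_diff: "pw (\<lambda>K x. c K - d K) = (\<lambda>x. pw (\<lambda>K x. c K) x - pw (\<lambda>K x. d K) x)" for c d :: "plane set \<Rightarrow> real^2"
    by (rule ext) (simp add: pw_def scaleR_diff_right sum_subtractf)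
  obtain \<rho> where \<rho>: "\<rho> \<in> Sigma_h ?\<Omega> T" "AE x in lebesgue_on ?\<Omega>. div_h T \<rho> x = pw (\<lambda>K x. ch K - cp K) x"
    "?n \<rho> \<le> width * ?n (pw (\<lambda>K x. ch K - cp K))"
    using right_inverse[of "\<lambda>K. ch K - cp K"] unfolding width_def by blast
  obtain cr where cr: "\<And>K. K \<in> T \<Longrightarrow> has_weak_div (interior K) \<rho> (pw (\<lambda>K x. cr K))"
    using Sigma_h_broken_div[OF \<rho>(1)] by blast
  have dhr: "AE x in lebesgue_on ?\<Omega>. div_h T \<rho> x = pw (\<lambda>K x. cr K) x" by (rule div_h_eq(1)[OF pw_const_L2 cr])
  have \<pi>L: "\<pi> \<in> L2 ?\<Omega>" and \<rho>L: "\<rho> \<in> L2 ?\<Omega>" by (rule Sigma_h_L2(2)[OF \<pi>(1)], rule Sigma_h_L2(2)[OF \<rho>(1)])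

  \<comment> \<open>The corrected interpolant has the divergence of the discrete stress.\<close>
  define e where "e x = \<sigma> x - \<pi> x - \<rho> x" for x
  define \<tau> where "\<tau> x = \<sigma>h x - \<pi> x - \<rho> x" for x
  have \<tau>S: "\<tau> \<in> Sigma_h ?\<Omega> T" unfolding \<tau>_def[abs_def] by (intro Sigma_h_diff fh \<pi>(1) \<rho>(1))
  have eS: "e \<in> L2_sym ?\<Omega>" unfolding e_def[abs_def]
    by (intro L2_sym_diff sS Sigma_h_L2(1)[OF \<pi>(1)] Sigma_h_L2(1)[OF \<rho>(1)])
  have \<tau>L: "\<tau> \<in> L2 ?\<Omega>" and eL: "e \<in> L2 ?\<Omega>" using Sigma_h_L2(2)[OF \<tau>S] eS by (simp_all add: L2_sym_def)
  have d\<tau>: "AE x in lebesgue_on ?\<Omega>. div_h T \<tau> x = 0"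
  proof -
    note d1 = div_h_diff[OF hL pw_const_L2 ch \<pi>L pw_const_L2 cp]
    have d2: "AE x in lebesgue_on ?\<Omega>. div_h T \<tau> x = pw (\<lambda>K x. ch K) x - pw (\<lambda>K x. cp K) x - pw (\<lambda>K x. cr K) x"
      unfolding \<tau>_def[abs_def]
      by (rule div_h_diff(1)[OF L2_diff[OF hL \<pi>L] L2_diff[OF pw_const_L2 pw_const_L2] d1(3) \<rho>L pw_const_L2 cr])
    show ?thesis using d2 \<rho>(2) dhr by eventually_elim (simp add: pw_diff)
  qed
  have d0: "L2_inner ?\<Omega> (div_h T \<tau>) w = 0" if "w \<in> L2 ?\<Omega>" for w
  proof -
    have "L2_inner ?\<Omega> (div_h T \<tau>) w = L2_inner ?\<Omega> (\<lambda>x. 0) w"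
      by (rule L2_inner_cong_AE[OF d\<tau> L2_cong_AE[OF L2_zero \<Omega> d\<tau>] L2_zero that])
    then show ?thesis by (simp add: L2_inner_def)
  qed
  have e_le: "?n e \<le> \<alpha> * X"
  proof -
    have "?n (pw (\<lambda>K x. ch K - cp K)) \<le> ?n (\<lambda>x. proj_vec ?s x - pw (\<lambda>K x. cp K) x) + ?n (\<lambda>x. proj_vec ?s x - pw (\<lambda>K x. ch K) x)"
    proof -
      have "pw (\<lambda>K x. ch K - cp K) = (\<lambda>x. (proj_vec ?s x - pw (\<lambda>K x. cp K) x) - (proj_vec ?s x - pw (\<lambda>K x. ch K) x))"
        unfolding pw_diff by auto
      then show ?thesis
        using L2_norm_diff_triangle[OF L2_diff[OF proj_vec_L2(1) pw_const_L2] L2_diff[OF proj_vec_L2(1) pw_const_L2], of ?s cp ?s ch] by simp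
    qed
    also have "\<dots> = ?n (\<lambda>x. proj_vec ?s x - pw (\<lambda>K x. cp K) x)" using zero by simp
    also have "\<dots> = ?n (\<lambda>x. proj_vec ?s x - div_h T \<pi> x)"
      by (rule L2_norm_cong_AE)
         (use dhp(1) in \<open>auto intro!: L2_measurable L2_diff proj_vec_L2 pw_const_L2 dhp(2) elim!: eventually_mono\<close>)
    finally have "?n (pw (\<lambda>K x. ch K - cp K)) \<le> 4 * hh * ?Ns" using \<pi>(3) by linarith
    then have "width * ?n (pw (\<lambda>K x. ch K - cp K)) \<le> width * (4 * hh * ?Ns)" using h0 by (intro mult_left_mono) auto
    then have \<rho>n: "?n \<rho> \<le> width * (4 * hh * ?Ns)" using \<rho>(3) by linarith
    have "?n e \<le> ?n (\<lambda>x. \<sigma> x - \<pi> x) + ?n \<rho>"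
      unfolding e_def[abs_def] by (rule L2_norm_diff_triangle[OF L2_diff[OF sL \<pi>L] \<rho>L])
    also have "\<dots> \<le> 48 * (1 + width) * hh * ?Ns + width * (4 * hh * ?Ns)" using \<pi>(2) \<rho>n by (rule add_mono)
    also have "\<dots> \<le> \<alpha> * (hh * ?Ns)"
    proof -
      have "0 \<le> hh * ?Ns" using h0 N0 by simp
      then show ?thesis by (simp add: \<alpha>_def algebra_simps)
    qed
    also have "\<dots> \<le> \<alpha> * X" by (rule mult_left_mono[OF X(2) \<alpha>0])
    finally show ?thesis .
  qed
  have absorb: "t \<le> B / c" if "c * t\<^sup>2 \<le> B * t" "0 \<le> t" "0 < c" "0 \<le> B" for t B c :: real
  proof (cases "t = 0")
    case False
    then have "c * t \<le> B" using that by (simp add: power2_eq_square)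
    then show ?thesis using that(3) by (simp add: field_simps)
  qed (use that in simp)
  have \<tau>_le: "?n \<tau> \<le> ((2 + M * \<alpha>) * X) / \<gamma>"
  proof (rule absorb[OF _ L2_norm_nonneg \<gamma>(1)])
    define w where "w x = \<pi> x + \<rho> x" for x
    have "(\<lambda>x. \<sigma> x - e x) = w" by (auto simp: e_def w_def)
    then have wS: "w \<in> L2_sym ?\<Omega>" using L2_sym_diff[OF sS eS] by simp
    have e': "e = (\<lambda>x. \<sigma> x - w x)" and \<tau>': "\<tau> = (\<lambda>x. \<sigma>h x - w x)" by (auto simp: e_def \<tau>_def w_def)
    have "L2_inner ?\<Omega> (A \<tau>) \<tau> = L2_inner ?\<Omega> (A \<sigma>h) \<tau> - L2_inner ?\<Omega> (A w) \<tau>"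
      using compliance_diff[OF A \<Omega> hS wS \<tau>L] \<tau>' by simp
    also have "L2_inner ?\<Omega> (A \<sigma>h) \<tau> = 0" using discrete[OF \<tau>S] d0[OF uhL] by simp
    also have "L2_inner ?\<Omega> (A w) \<tau> = L2_inner ?\<Omega> (A \<sigma>) \<tau> - L2_inner ?\<Omega> (A e) \<tau>"
      using compliance_diff[OF A \<Omega> sS wS \<tau>L] e' by simp
    finally have eq: "L2_inner ?\<Omega> (A \<tau>) \<tau> = L2_inner ?\<Omega> (A e) \<tau> - L2_inner ?\<Omega> (A \<sigma>) \<tau>" by simp
    have 1: "\<bar>L2_inner ?\<Omega> (A \<sigma>) \<tau>\<bar> \<le> 2 * (hh * ?Nu) * ?n \<tau>" using cons[OF \<tau>S] d0[OF uL] by (simp add: mult_ac)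
    have "\<bar>L2_inner ?\<Omega> (A e) \<tau>\<bar> \<le> ?n (A e) * ?n \<tau>" by (rule L2_Cauchy_Schwarz[OF AL[OF eS] \<tau>L])
    also have "\<dots> \<le> M * (\<alpha> * X) * ?n \<tau>"
      using M(2)[OF eS] mult_left_mono[OF e_le M(1)] by (intro mult_right_mono L2_norm_nonneg) linarith
    finally have 2: "\<bar>L2_inner ?\<Omega> (A e) \<tau>\<bar> \<le> M * (\<alpha> * X) * ?n \<tau>" .
    have "2 * (hh * ?Nu) * ?n \<tau> \<le> 2 * X * ?n \<tau>" using X(1) by (intro mult_right_mono L2_norm_nonneg) simp
    then have "L2_inner ?\<Omega> (A \<tau>) \<tau> \<le> M * (\<alpha> * X) * ?n \<tau> + 2 * X * ?n \<tau>" using eq 1 2 by linarith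
    also have "\<dots> = ((2 + M * \<alpha>) * X) * ?n \<tau>" by algebra
    finally show "\<gamma> * (?n \<tau>)\<^sup>2 \<le> ((2 + M * \<alpha>) * X) * ?n \<tau>"
      using \<gamma>(2)[OF Sigma_h_L2(1)[OF \<tau>S]] by linarith
    show "0 \<le> (2 + M * \<alpha>) * X" using M(1) \<alpha>0 X(3) by simp
  qed
  have "?n (\<lambda>x. \<sigma> x - \<sigma>h x) \<le> ?n e + ?n \<tau>"
  proof -
    have "(\<lambda>x. \<sigma> x - \<sigma>h x) = (\<lambda>x. e x - \<tau> x)" by (auto simp: e_def \<tau>_def)
    then show ?thesis using L2_norm_diff_triangle[OF eL \<tau>L] by simp
  qed
  also have "\<dots> \<le> \<alpha> * X + ((2 + M * \<alpha>) * X) / \<gamma>" by (rule add_mono[OF e_le \<tau>_le])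
  also have "\<dots> = C * X" by (simp add: C distrib_right)
  finally show est: "?n (\<lambda>x. \<sigma> x - \<sigma>h x) \<le> C * X" .

  show "?n (div_h T (\<lambda>x. \<sigma> x - \<sigma>h x)) \<le> 16 * X"
  proof -
    note d = div_h_diff[OF sL sdL sobolev_div_weak(2)[OF s] hL pw_const_L2 ch]
    have "?n (div_h T (\<lambda>x. \<sigma> x - \<sigma>h x)) = ?n (\<lambda>x. ?s x - pw (\<lambda>K x. ch K) x)"
      by (rule L2_norm_cong_AE[OF d(1) L2_measurable[OF d(2)] L2_measurable[OF L2_diff[OF sdL pw_const_L2]]])
    also have "\<dots> \<le> ?n (\<lambda>x. ?s x - proj_vec ?s x) + ?n (\<lambda>x. proj_vec ?s x - pw (\<lambda>K x. ch K) x)"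
      using L2_norm_triangle[OF L2_diff[OF sdL proj_vec_L2(1)] L2_diff[OF proj_vec_L2(1) pw_const_L2], of ?s ?s ch] by simp
    also have "\<dots> \<le> 16 * (hh * ?Ns)" using sobolev_div_error[OF s] zero by simp
    also have "\<dots> \<le> 16 * X" using X(2) by simp
    finally show ?thesis .
  qed

  obtain cu where cu: "\<And>K. K \<in> T \<Longrightarrow> AE x in lebesgue_on (interior K). uh x = cu K" using V_h_interior[OF fh(2)] by blast
  define k :: "plane set \<Rightarrow> real^2" where "k K = (\<chi> i. avg K (\<lambda>x. u x $ i)) - cu K" for K
  let ?w = "pw (\<lambda>K x. k K)"
  have wV: "?w \<in> V_h ?\<Omega> T" and wL: "?w \<in> L2 ?\<Omega>" by (rule pw_const_V_h, rule pw_const_L2)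
  have w_eq: "AE x in lebesgue_on ?\<Omega>. ?w x = proj_vec u x - uh x"
  proof (rule AE_elementsI)
    fix K assume K: "K \<in> T"
    note inK = AE_inside[of "interior K"]
    show "AE x in lebesgue_on (interior K). ?w x = proj_vec u x - uh x"
      using cu[OF K] inK by eventually_elim (simp add: proj_vec_def pw_eq[OF K] k_def)
  qed
  \<comment> \<open>Duality: \<open>\<rho>'\<close> turns the squared norm of \<open>?w\<close> into the two variational equations.\<close>
  obtain \<rho>' where \<rho>': "\<rho>' \<in> Sigma_h ?\<Omega> T" "AE x in lebesgue_on ?\<Omega>. div_h T \<rho>' x = ?w x" "?n \<rho>' \<le> width * ?n ?w"
    using right_inverse[of k] unfolding width_def by blast
  have \<rho>'L: "\<rho>' \<in> L2 ?\<Omega>" by (rule Sigma_h_L2(2)[OF \<rho>'(1)])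
  have w_le: "?n ?w \<le> (width * (2 + M * C) * X) / 1"
  proof (rule absorb[OF _ L2_norm_nonneg zero_less_one])
    have "(?n ?w)\<^sup>2 = L2_inner ?\<Omega> ?w ?w" by (rule L2_inner_self[symmetric])
    also have "\<dots> = L2_inner ?\<Omega> (\<lambda>x. proj_vec u x - uh x) ?w"
      by (rule L2_inner_cong_AE[OF w_eq wL L2_diff[OF proj_vec_L2(1) uhL] wL])
    also have "\<dots> = L2_inner ?\<Omega> u ?w - L2_inner ?\<Omega> uh ?w"
      using proj_vec_orthogonal[OF uL wV]
      unfolding L2_inner_diff_left[OF proj_vec_L2(1) uhL wL] L2_inner_diff_left[OF uL proj_vec_L2(1) wL] by simp
    also have "\<dots> = L2_inner ?\<Omega> (div_h T \<rho>') u - L2_inner ?\<Omega> (div_h T \<rho>') uh"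
      using L2_inner_cong_AE[OF \<rho>'(2) L2_cong_AE[OF wL \<Omega> \<rho>'(2)] wL uL] L2_inner_cong_AE[OF \<rho>'(2) L2_cong_AE[OF wL \<Omega> \<rho>'(2)] wL uhL]
      by (simp only: L2_inner_commute[of _ u] L2_inner_commute[of _ uh])
    finally have eq: "(?n ?w)\<^sup>2 = L2_inner ?\<Omega> (div_h T \<rho>') u - L2_inner ?\<Omega> (div_h T \<rho>') uh" .
    have E: "\<bar>L2_inner ?\<Omega> (A \<sigma>) \<rho>' + L2_inner ?\<Omega> (div_h T \<rho>') u\<bar> \<le> 2 * (hh * ?Nu) * ?n \<rho>'"
      using cons[OF \<rho>'(1)] by (simp add: mult_ac)
    have "\<bar>L2_inner ?\<Omega> (A (\<lambda>x. \<sigma> x - \<sigma>h x)) \<rho>'\<bar> \<le> ?n (A (\<lambda>x. \<sigma> x - \<sigma>h x)) * ?n \<rho>'"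
      by (rule L2_Cauchy_Schwarz[OF AL[OF L2_sym_diff[OF sS hS]] \<rho>'L])
    also have "\<dots> \<le> M * (C * X) * ?n \<rho>'"
      using M(2)[OF L2_sym_diff[OF sS hS]] mult_left_mono[OF est M(1)] by (intro mult_right_mono L2_norm_nonneg) linarith
    finally have "\<bar>L2_inner ?\<Omega> (A \<sigma>) \<rho>' - L2_inner ?\<Omega> (A \<sigma>h) \<rho>'\<bar> \<le> M * (C * X) * ?n \<rho>'"
      unfolding compliance_diff[OF A \<Omega> sS hS \<rho>'L] .
    moreover have "2 * (hh * ?Nu) * ?n \<rho>' \<le> 2 * X * ?n \<rho>'" using X(1) by (intro mult_right_mono L2_norm_nonneg) simp
    ultimately have "(?n ?w)\<^sup>2 \<le> 2 * X * ?n \<rho>' + M * (C * X) * ?n \<rho>'"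
      using eq E discrete[OF \<rho>'(1)] by linarith
    also have "\<dots> = (2 + M * C) * X * ?n \<rho>'" by algebra
    also have "\<dots> \<le> (2 + M * C) * X * (width * ?n ?w)"
      using M(1) C0 X(3) by (intro mult_left_mono[OF \<rho>'(3)]) simp
    also have "\<dots> = width * (2 + M * C) * X * ?n ?w" by algebra
    finally show "1 * (?n ?w)\<^sup>2 \<le> width * (2 + M * C) * X * ?n ?w" by simp
    show "0 \<le> width * (2 + M * C) * X" using M(1) C0 X(3) h0 by simp
  qed
  have "?n (\<lambda>x. u x - uh x) \<le> ?n (\<lambda>x. u x - proj_vec u x) + ?n (\<lambda>x. proj_vec u x - uh x)"
    using L2_norm_triangle[OF L2_diff[OF uL proj_vec_L2(1)] L2_diff[OF proj_vec_L2(1) uhL], of u u] by simp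
  also have "?n (\<lambda>x. proj_vec u x - uh x) = ?n ?w"
    by (rule L2_norm_cong_AE[symmetric, OF w_eq L2_measurable[OF wL] L2_measurable[OF L2_diff[OF proj_vec_L2(1) uhL]]])
  also have "?n (\<lambda>x. u x - proj_vec u x) + ?n ?w \<le> 8 * X + width * (2 + M * C) * X"
  proof (rule add_mono)
    have "?n (\<lambda>x. u x - proj_vec u x) \<le> 8 * hh * ?Nu"
    proof (rule proj_vec_error[OF uL])
      fix i k
      show "weak_partial a b k (\<lambda>x. u x $ i) (\<lambda>x. D1 ?\<Omega> k u x $ i)" by (rule sobolev2(7)[OF u bounded_linear_vec_nth])
      show "?n (\<lambda>x. D1 ?\<Omega> k u x $ i) \<le> ?Nu"
        using L2_norm_nth_le[OF sobolev2(2)[OF u, of k], of i] sobolev2(4)[OF u, of k] by linarith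
    qed
    then show "?n (\<lambda>x. u x - proj_vec u x) \<le> 8 * X" using X(1) by simp
    show "?n ?w \<le> width * (2 + M * C) * X" using w_le by simp
  qed
  also have "\<dots> = (8 + width * (2 + M * C)) * X" by (simp only: distrib_right)
  finally show "?n (\<lambda>x. u x - uh x) \<le> (8 + width * (2 + M * C)) * X" .
qed

end

theorem theorem4p3:
  fixes a b :: "real^2" and \<Omega> :: "(real^2) set"
    and A :: "(real^2 \<Rightarrow> real^2^2) \<Rightarrow> (real^2 \<Rightarrow> real^2^2)"
    and grids :: "(real^2) set set set"
  assumes "\<forall>i. a $ i < b $ i" and "\<Omega> = box a b"
    and "compliance \<Omega> A"
    and "\<forall>T\<in>grids. rect_grid \<Omega> T"
  shows "\<exists>C>0. \<forall>T\<in>grids. \<forall>f\<in>L2 \<Omega>. \<forall>\<sigma> u \<sigma>h uh.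
    exact_solution \<Omega> A f \<sigma> u \<and> \<sigma> \<in> sobolev 2 \<Omega> \<and> u \<in> sobolev 2 \<Omega> \<and>
    fem_solution \<Omega> T A f \<sigma>h uh \<longrightarrow>
      L2_norm \<Omega> (\<lambda>x. \<sigma> x - \<sigma>h x)
        \<le> C * mesh_size T * (sobolev_norm 2 \<Omega> u + sobolev_norm 2 \<Omega> \<sigma>) \<and>
      L2_norm \<Omega> (div_h T (\<lambda>x. \<sigma> x - \<sigma>h x))
        \<le> C * mesh_size T * (sobolev_norm 2 \<Omega> u + sobolev_norm 2 \<Omega> \<sigma>) \<and>
      L2_norm \<Omega> (\<lambda>x. u x - uh x)
        \<le> C * mesh_size T * (sobolev_norm 2 \<Omega> u + sobolev_norm 2 \<Omega> \<sigma>)"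
proof -
  note \<Omega> = assms(2)
  obtain M0 where M0: "\<And>\<tau>. \<tau> \<in> L2_sym \<Omega> \<Longrightarrow> L2_norm \<Omega> (A \<tau>) \<le> M0 * L2_norm \<Omega> \<tau>"
    using assms(3) unfolding compliance_def by blast
  \<comment> \<open>The bound in the definition of a compliance tensor need not be nonnegative.\<close>
  define M where "M = \<bar>M0\<bar>"
  have M: "0 \<le> M" "L2_norm \<Omega> (A \<tau>) \<le> M * L2_norm \<Omega> \<tau>" if "\<tau> \<in> L2_sym \<Omega>" for \<tau>
    using M0[OF that] mult_right_mono[OF abs_ge_self[of M0] L2_norm_nonneg[of \<Omega> \<tau>]] by (auto simp: M_def)
  obtain \<gamma> where \<gamma>: "0 < \<gamma>" "\<And>\<tau>. \<tau> \<in> L2_sym \<Omega> \<Longrightarrow> \<gamma> * (L2_norm \<Omega> \<tau>)\<^sup>2 \<le> L2_inner \<Omega> (A \<tau>) \<tau>"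
    using assms(3) unfolding compliance_def by blast
  define W where "W = (b $ 1 - a $ 1) + (b $ 2 - a $ 2)"
  define D where "D = 52 * (1 + W) + (2 + M * (52 * (1 + W))) / \<gamma>"
  define C where "C = D + 16 + (8 + W * (2 + M * D))"
  have M0': "0 \<le> M" by (simp add: M_def)
  have W0: "0 < W" using assms(1) by (simp add: W_def add_pos_pos)
  have D0: "0 \<le> D" unfolding D_def using W0 M0' \<gamma>(1) by simp
  have E0: "0 \<le> W * (2 + M * D)" using W0 M0' D0 by simp
  have C: "0 < C" "D \<le> C" "16 \<le> C" "8 + W * (2 + M * D) \<le> C" using D0 E0 by (simp_all add: C_def)
  show ?thesis
  proof (intro exI[of _ C] conjI C(1) ballI allI impI)
    fix T f \<sigma> u \<sigma>h uh
    assume T: "T \<in> grids" and *: "exact_solution \<Omega> A f \<sigma> u \<and> \<sigma> \<in> sobolev 2 \<Omega> \<and> u \<in> sobolev 2 \<Omega> \<and> fem_solution \<Omega> T A f \<sigma>h uh"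
    interpret grid a b T
      by unfold_locales (use assms(1,2,4) T in auto)
    let ?X = "mesh_size T * (sobolev_norm 2 \<Omega> u + sobolev_norm 2 \<Omega> \<sigma>)"
    have X0: "0 \<le> ?X" using mesh_size_pos by (simp add: sobolev_norm_def sum_nonneg)
    have mono: "y \<le> C * mesh_size T * (sobolev_norm 2 \<Omega> u + sobolev_norm 2 \<Omega> \<sigma>)" if "y \<le> c * ?X" "c \<le> C" for y c
      using order_trans[OF that(1) mult_right_mono[OF that(2) X0]] by (simp only: mult.assoc)
    have "exact_solution (box a b) A f \<sigma> u" "\<sigma> \<in> sobolev 2 (box a b)" "u \<in> sobolev 2 (box a b)"
      "fem_solution (box a b) T A f \<sigma>h uh" using * \<Omega> by simp_all
    note est = error_estimate[OF assms(3)[unfolded \<Omega>] M0' M(2)[unfolded \<Omega>] \<gamma>(1) \<gamma>(2)[unfolded \<Omega>] this,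
        folded \<Omega>, unfolded width_def, folded W_def, folded D_def]
    show "L2_norm \<Omega> (\<lambda>x. \<sigma> x - \<sigma>h x) \<le> C * mesh_size T * (sobolev_norm 2 \<Omega> u + sobolev_norm 2 \<Omega> \<sigma>)"
      "L2_norm \<Omega> (div_h T (\<lambda>x. \<sigma> x - \<sigma>h x)) \<le> C * mesh_size T * (sobolev_norm 2 \<Omega> u + sobolev_norm 2 \<Omega> \<sigma>)"
      "L2_norm \<Omega> (\<lambda>x. u x - uh x) \<le> C * mesh_size T * (sobolev_norm 2 \<Omega> u + sobolev_norm 2 \<Omega> \<sigma>)"
      using est C(2-4) by (auto intro: mono)
  qed
qed

end
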